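(* Let $f\in[H^{1,1}_{;,0}(Q)]'$ and $\lambda\in[H^{1/2}_{,0}(\Sigma)]'$. Then the generalized variational formulation of the Neumann problem $\Box u=f$ in $Q$, $\gamma_N^iu=\lambda$ on $\Sigma$, $u=\partial_tu=0$ on $\Omega\times\{0\}$, namely: find $u\in\mathcal H_{;0,}(Q)$ such that $$\widetilde f_u(v)=\langle f,v\rangle_Q+\langle\lambda,\gamma_\Sigma^iv\rangle_\Sigma\qquad\text{for all }v\in H^{1,1}_{;,0}(Q),$$ has a unique solution $u\in\mathcal H_{;0,}(Q)$, and $$\|\gamma_\Sigma^iu\|_{\mathcal H_{0,}(\Sigma)}\le\|u\|_{\mathcal H(Q)}\le\frac{1}{\sqrt2}\sqrt{2+T^2}\,\Big[\|f\|_{[H^{1,1}_{;,0}(Q)]'}+\|\lambda\|_{[H^{1/2}_{,0}(\Sigma)]'}\Big].$$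
   Context: Let $n\in\{1,2,3\}$, $\Omega\subset\mathbb R^n$ a bounded interval ($n=1$) or bounded Lipschitz domain ($n=2,3$), $\Gamma=\partial\Omega$, $0<T<\infty$, $Q=\Omega\times(0,T)$, $\Sigma=\Gamma\times[0,T]$, $Q_-=\Omega\times(-T,T)$, $\Box=\partial_{tt}-\Delta_x$. Pairings $\langle\cdot,\cdot\rangle_Q,\langle\cdot,\cdot\rangle_{Q_-},\langle\cdot,\cdot\rangle_\Sigma$ extend the $L^2$ inner products; $X'$ is the dual of $X$ with dual norm. $H^{1,1}_{;0,}(Q)$ (resp. $H^{1,1}_{;,0}(Q)$) is the set of $v\in L^2(0,T;H^1(\Omega))\cap H^1(0,T;L^2(\Omega))$ with $v(\cdot,0)=0$ (resp. $v(\cdot,T)=0$), norm $(\|\partial_tv\|_{L^2(Q)}^2+\|\nabla_xv\|_{L^2(Q)}^2)^{1/2}$; $H^{1,1}_{0;,0}(Q)$ is the subspace of $H^{1,1}_{;,0}(Q)$ with zero trace on $\Sigma$. For $u\in L^2(Q)$, $\widetilde u$ is the extension by zero to $Q_-$, and $\Box\widetilde u$ is a distribution on $Q_-$. $\mathcal E:H^{1,1}_{0;,0}(Q)\to H^1_0(Q_-)$ is a fixed continuous injective extension operator (with $(\mathcal Ev)_{|Q}=v$). $\mathcal H(Q)=\{u=\widetilde u_{|Q}:\widetilde u\in L^2(Q_-),\ \widetilde u=0\text{ on }\Omega\times(-T,0),\ \Box\widetilde u\in[H^1_0(Q_-)]'\}$, norm $\|u\|_{\mathcal H(Q)}=(\|u\|_{L^2(Q)}^2+\|\Box\widetilde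 u\|_{[H^1_0(Q_-)]'}^2)^{1/2}$, where $\|\Box\widetilde u\|_{[H^1_0(Q_-)]'}=\sup_{0\ne v\in H^{1,1}_{0;,0}(Q)}|\langle\Box\widetilde u,\mathcal Ev\rangle_{Q_-}|/\|v\|_{H^{1,1}_{0;,0}(Q)}$. $\mathcal H_{;0,}(Q)$ is the closure of $H^{1,1}_{;0,}(Q)$ in $\mathcal H(Q)$. $\gamma_\Sigma^i$ is the continuous extension of $u\mapsto u_{|\Sigma}$ from the interior. $H^{1/2}_{,0}(\Sigma)=L^2(0,T;H^{1/2}(\Gamma))\cap[H^1_{,0}(0,T;L^2(\Gamma)),L^2(0,T;L^2(\Gamma))]_{1/2}$ ($H^1_{,0}$: zero value at $t=T$) is the trace space of $H^{1,1}_{;,0}(Q)$, and $\|\lambda\|_{[H^{1/2}_{,0}(\Sigma)]'}=\sup_{0\ne v\in H^{1,1}_{;,0}(Q)}|\langle\lambda,\gamma_\Sigma^iv\rangle_\Sigma|/\|v\|_{H^{1,1}_{;,0}(Q)}$. $\mathcal H_{0,}(\Sigma)=\gamma_\Sigma^i(\mathcal H_{;0,}(Q))$ with $\|v\|_{\mathcal H_{0,}(\Sigma)}=\inf\{\|V\|_{\mathcal H(Q)}:V\in\mathcal H_{;0,}(Q),\gamma_\Sigma^iV=v\}$. For $u\in\mathcal H_{;0,}(Q)$, $\widetilde f_u\in[H^{1,1}_{;,0}(Q)]'$ denotes the (Hahn–Banach) extension of $f_u(v)=\langle\Box\widetilde u,\mathcal Ev\rangle_{Q_-}$, $v\in H^{1,1}_{0;,0}(Q)$,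 with $\|\widetilde f_u\|_{[H^{1,1}_{;,0}(Q)]'}=\|\Box\widetilde u\|_{[H^1_0(Q_-)]'}$; it is given for $u\in H^{1,1}_{;0,}(Q)$ by $\widetilde f_u(v)=-\langle\partial_tu,\partial_tv\rangle_{L^2(Q)}+\langle\nabla_xu,\nabla_xv\rangle_{L^2(Q)}$, and for general $u\in\mathcal H_{;0,}(Q)$ by $\widetilde f_u(v)=\lim_m\widetilde f_{u_m}(v)$, $u_m\in H^{1,1}_{;0,}(Q)$, $u_m\to u$ in $\mathcal H(Q)$.
   Formalization: The norm identity for the extension f̃_u, which contradicts its explicit formula, is dropped; f̃_u is taken as a bounded extension of f_u that is the limit of the explicit formula along some (not every) sequence u_m → u in H(Q). *)

theory Defs
  imports "HOL-Analysis.Analysis"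
begin

text \<open>
  Space-time points are pairs \<open>(x, t)\<close>.  Elements of function spaces on an open set \<open>U\<close> are
  represented by total real functions, identified when they agree almost everywhere on \<open>U\<close>;
  values outside \<open>U\<close> are irrelevant.
\<close>

section \<open>Domains\<close>

text \<open>Near every boundary point the domain is the strict subgraph, in some direction \<open>e\<close>, of a
  Lipschitz function on the hyperplane orthogonal to \<open>e\<close>.\<close>

definition bounded_lipschitz_domain :: "'a::euclidean_space set \<Rightarrow> bool" where
  "bounded_lipschitz_domain \<Omega> \<longleftrightarrow>
     open \<Omega> \<and> connected \<Omega> \<and> bounded \<Omega> \<and> \<Omega> \<noteq> {} \<and>
     (\<forall>x\<in>frontier \<Omega>. \<exists>e V \<phi> L. norm e = 1 \<and> open V \<and> x \<in> V \<and>
        L-lipschitz_on {y. y \<bullet> e = 0} (\<phi> :: 'a \<Rightarrow> real) \<and>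
        \<Omega> \<inter> V = {y \<in> V. y \<bullet> e < \<phi> (y - (y \<bullet> e) *\<^sub>R e)})"

definition admissible_domain :: "'a::euclidean_space set \<Rightarrow> bool" where
  "admissible_domain \<Omega> \<longleftrightarrow>
     (DIM('a) = 1 \<and> \<Omega> \<noteq> {} \<and> (\<exists>a b. \<Omega> = box a b)) \<or>
     (DIM('a) \<in> {2, 3} \<and> bounded_lipschitz_domain \<Omega>)"

definition Q :: "'a set \<Rightarrow> real \<Rightarrow> ('a \<times> real) set" where
  "Q \<Omega> T = \<Omega> \<times> {0<..<T}"

definition Qminus :: "'a set \<Rightarrow> real \<Rightarrow> ('a \<times> real) set" where
  "Qminus \<Omega> T = \<Omega> \<times> {-T<..<T}"


section \<open>Square-integrable functions and weak derivatives\<close>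

abbreviation leb :: "'b::euclidean_space set \<Rightarrow> 'b measure" where
  "leb U \<equiv> restrict_space lborel U"

definition L2 :: "'b measure \<Rightarrow> ('b \<Rightarrow> real) \<Rightarrow> bool" where
  "L2 M u \<longleftrightarrow> u \<in> borel_measurable M \<and> integrable M (\<lambda>z. (u z)\<^sup>2)"

definition L2norm :: "'b measure \<Rightarrow> ('b \<Rightarrow> real) \<Rightarrow> real" where
  "L2norm M u = sqrt (\<integral>z. (u z)\<^sup>2 \<partial>M)"

definition pd :: "'b::euclidean_space \<Rightarrow> ('b \<Rightarrow> real) \<Rightarrow> 'b \<Rightarrow> real" where
  "pd b f = (\<lambda>z. frechet_derivative f (at z) b)"

primrec diff_times :: "nat \<Rightarrow> ('b::euclidean_space \<Rightarrow> real) \<Rightarrow> bool" where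
  "diff_times 0 f \<longleftrightarrow> continuous_on UNIV f"
| "diff_times (Suc k) f \<longleftrightarrow> (\<forall>z. f differentiable (at z)) \<and> (\<forall>b\<in>Basis. diff_times k (pd b f))"

definition smooth :: "('b::euclidean_space \<Rightarrow> real) \<Rightarrow> bool" where
  "smooth f \<longleftrightarrow> (\<forall>k. diff_times k f)"

definition test_fun :: "'b::euclidean_space set \<Rightarrow> ('b \<Rightarrow> real) \<Rightarrow> bool" where
  "test_fun U \<phi> \<longleftrightarrow> smooth \<phi> \<and> (\<exists>K. compact K \<and> K \<subseteq> U \<and> (\<forall>z. z \<notin> K \<longrightarrow> \<phi> z = 0))"

definition is_wderiv ::
    "'b::euclidean_space set \<Rightarrow> 'b \<Rightarrow> ('b \<Rightarrow> real) \<Rightarrow> ('b \<Rightarrow> real) \<Rightarrow> bool" where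
  "is_wderiv U b u g \<longleftrightarrow> L2 (leb U) g \<and>
     (\<forall>\<phi>. test_fun U \<phi> \<longrightarrow> (\<integral>z. u z * pd b \<phi> z \<partial>leb U) = - (\<integral>z. g z * \<phi> z \<partial>leb U))"

definition wderiv :: "'b::euclidean_space set \<Rightarrow> 'b \<Rightarrow> ('b \<Rightarrow> real) \<Rightarrow> 'b \<Rightarrow> real" where
  "wderiv U b u = (SOME g. is_wderiv U b u g)"

definition H1 :: "'b::euclidean_space set \<Rightarrow> ('b \<Rightarrow> real) set" where
  "H1 U = {u. L2 (leb U) u \<and> (\<forall>b\<in>Basis. \<exists>g. is_wderiv U b u g)}"

definition H1norm :: "'b::euclidean_space set \<Rightarrow> ('b \<Rightarrow> real) \<Rightarrow> real" where
  "H1norm U u = sqrt ((L2norm (leb U) u)\<^sup>2 + (\<Sum>b\<in>Basis. (L2norm (leb U) (wderiv U b u))\<^sup>2))"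

definition H10 :: "'b::euclidean_space set \<Rightarrow> ('b \<Rightarrow> real) set" where
  "H10 U = {w \<in> H1 U. \<exists>\<phi>. (\<forall>m. test_fun U (\<phi> m)) \<and>
              (\<lambda>m. H1norm U (\<lambda>z. \<phi> m z - w z)) \<longlonglongrightarrow> 0}"


section \<open>Bounded linear functionals\<close>

definition dual :: "('b \<Rightarrow> real) set \<Rightarrow> (('b \<Rightarrow> real) \<Rightarrow> real) \<Rightarrow> (('b \<Rightarrow> real) \<Rightarrow> real) set" where
  "dual S nrm = {f. (\<forall>v\<in>S. \<forall>w\<in>S. \<forall>a b. f (\<lambda>z. a * v z + b * w z) = a * f v + b * f w) \<and>
                    (\<exists>C. \<forall>v\<in>S. \<bar>f v\<bar> \<le> C * nrm v)}"

text \<open>The element \<open>v = 0\<close> contributes \<open>0 / 0 = 0\<close> to the supremum, which is therefore the one over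
  \<open>v \<noteq> 0\<close>.\<close>

definition dual_norm ::
    "('b \<Rightarrow> real) set \<Rightarrow> (('b \<Rightarrow> real) \<Rightarrow> real) \<Rightarrow> (('b \<Rightarrow> real) \<Rightarrow> real) \<Rightarrow> real" where
  "dual_norm S nrm f = Sup {\<bar>f v\<bar> / nrm v | v. v \<in> S}"


section \<open>Anisotropic Sobolev spaces on the space-time cylinder\<close>

text \<open>\<open>L\<^sup>2(0,T;H\<^sup>1(\<Omega>)) \<inter> H\<^sup>1(0,T;L\<^sup>2(\<Omega>))\<close> consists of the \<open>L\<^sup>2(Q)\<close> functions all of whose first-order
  weak derivatives on \<open>Q\<close> are in \<open>L\<^sup>2(Q)\<close>.\<close>

definition H11 :: "'a::euclidean_space set \<Rightarrow> real \<Rightarrow> ('a \<times> real \<Rightarrow> real) set" where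
  "H11 \<Omega> T = H1 (Q \<Omega> T)"

abbreviation dt :: "'a::euclidean_space set \<Rightarrow> real \<Rightarrow> ('a \<times> real \<Rightarrow> real) \<Rightarrow> 'a \<times> real \<Rightarrow> real" where
  "dt \<Omega> T \<equiv> wderiv (Q \<Omega> T) (0, 1)"

abbreviation dx ::
    "'a::euclidean_space set \<Rightarrow> real \<Rightarrow> 'a \<Rightarrow> ('a \<times> real \<Rightarrow> real) \<Rightarrow> 'a \<times> real \<Rightarrow> real" where
  "dx \<Omega> T b \<equiv> wderiv (Q \<Omega> T) (b, 0)"

definition norm11 :: "'a::euclidean_space set \<Rightarrow> real \<Rightarrow> ('a \<times> real \<Rightarrow> real) \<Rightarrow> real" where
  "norm11 \<Omega> T v = sqrt ((L2norm (leb (Q \<Omega> T)) (dt \<Omega> T v))\<^sup>2 +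
                        (\<Sum>b\<in>Basis. (L2norm (leb (Q \<Omega> T)) (dx \<Omega> T b v))\<^sup>2))"

text \<open>\<open>v(\<cdot>,s) = 0\<close>, read through the representative of \<open>v\<close> in \<open>C([0,T];L\<^sup>2(\<Omega>))\<close>.\<close>

definition vanishes_at ::
    "'a::euclidean_space set \<Rightarrow> real \<Rightarrow> real \<Rightarrow> ('a \<times> real \<Rightarrow> real) \<Rightarrow> bool" where
  "vanishes_at \<Omega> T s v \<longleftrightarrow>
     (\<exists>V. (AE z in leb (Q \<Omega> T). V z = v z) \<and>
          (\<forall>t\<in>{0..T}. L2 (leb \<Omega>) (\<lambda>x. V (x, t))) \<and>
          (\<forall>t\<in>{0..T}. ((\<lambda>r. L2norm (leb \<Omega>) (\<lambda>x. V (x, r) - V (x, t))) \<longlongrightarrow> 0) (at t within {0..T})) \<and>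
          (AE x in leb \<Omega>. V (x, s) = 0))"

text \<open>\<open>H\<^sup>1\<^sup>,\<^sup>1\<close> with zero initial condition, and with zero terminal condition.\<close>

definition H11_init :: "'a::euclidean_space set \<Rightarrow> real \<Rightarrow> ('a \<times> real \<Rightarrow> real) set" where
  "H11_init \<Omega> T = {v \<in> H11 \<Omega> T. vanishes_at \<Omega> T 0 v}"

definition H11_term :: "'a::euclidean_space set \<Rightarrow> real \<Rightarrow> ('a \<times> real \<Rightarrow> real) set" where
  "H11_term \<Omega> T = {v \<in> H11 \<Omega> T. vanishes_at \<Omega> T T v}"


section \<open>Surface measure and the lateral trace\<close>

definition hausdorff_outer :: "nat \<Rightarrow> 'a::euclidean_space set \<Rightarrow> ennreal" where
  "hausdorff_outer k A =
     (SUP \<delta>\<in>{0::real<..}.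
        INF U\<in>{U :: nat \<Rightarrow> 'a set. A \<subseteq> (\<Union>i. U i) \<and> (\<forall>i. bounded (U i) \<and> diameter (U i) \<le> \<delta>)}.
          \<Sum>i. if U i = {} then 0
               else ennreal (unit_ball_vol (real k) * (diameter (U i) / 2) ^ k))"

text \<open>The \<open>(n-1)\<close>-dimensional Hausdorff measure (normalised as surface area; counting measure if
  \<open>n = 1\<close>), concentrated on \<open>\<Gamma> = \<partial>\<Omega>\<close>.\<close>

definition surface_measure :: "'a::euclidean_space set \<Rightarrow> 'a measure" where
  "surface_measure \<Omega> =
     measure_of UNIV (sets borel) (\<lambda>A. hausdorff_outer (DIM('a) - 1) (A \<inter> frontier \<Omega>))"

definition Sigma_measure :: "'a::euclidean_space set \<Rightarrow> real \<Rightarrow> ('a \<times> real) measure" where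
  "Sigma_measure \<Omega> T = surface_measure \<Omega> \<Otimes>\<^sub>M leb {0..T}"

text \<open>The continuous extension to \<open>H\<^sup>1\<^sup>,\<^sup>1(Q)\<close> of the pointwise restriction of smooth functions to \<open>\<Sigma>\<close>.
  The trace is an element of \<open>L\<^sup>2(\<Sigma>)\<close>, that is, the set of all its representatives.\<close>

definition lateral_trace ::
    "'a::euclidean_space set \<Rightarrow> real \<Rightarrow> ('a \<times> real \<Rightarrow> real) \<Rightarrow> ('a \<times> real \<Rightarrow> real) set" where
  "lateral_trace \<Omega> T v = {g. L2 (Sigma_measure \<Omega> T) g \<and>
     (\<exists>\<phi>. (\<forall>m. smooth (\<phi> m) \<and> L2 (Sigma_measure \<Omega> T) (\<phi> m)) \<and>
          (\<lambda>m. H1norm (Q \<Omega> T) (\<lambda>z. \<phi> m z - v z)) \<longlonglongrightarrow> 0 \<and>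
          (\<lambda>m. L2norm (Sigma_measure \<Omega> T) (\<lambda>z. \<phi> m z - g z)) \<longlonglongrightarrow> 0)}"

text \<open>The subspace of functions in \<open>H11_term\<close> with zero trace on \<open>\<Sigma>\<close>.\<close>

definition H11_zero_term :: "'a::euclidean_space set \<Rightarrow> real \<Rightarrow> ('a \<times> real \<Rightarrow> real) set" where
  "H11_zero_term \<Omega> T = {v \<in> H11_term \<Omega> T. (\<lambda>_. 0) \<in> lateral_trace \<Omega> T v}"

text \<open>\<open>H\<^sup>1\<^sup>/\<^sup>2(\<Sigma>)\<close> with zero terminal value is the trace space \<open>lateral_trace ` H11_term\<close>.  A function \<open>\<lambda>\<close> on it
  is linear iff \<open>v \<mapsto> \<lambda> (lateral_trace v)\<close> is linear on \<open>H11_term\<close>, and its dual norm is the supremum of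
  \<open>\<bar>\<lambda> (lateral_trace v)\<bar> / \<parallel>v\<parallel>\<close> over \<open>H11_term\<close>.\<close>

definition trace_dual ::
    "'a::euclidean_space set \<Rightarrow> real \<Rightarrow> (('a \<times> real \<Rightarrow> real) set \<Rightarrow> real) set" where
  "trace_dual \<Omega> T = {l. (\<lambda>v. l (lateral_trace \<Omega> T v)) \<in> dual (H11_term \<Omega> T) (norm11 \<Omega> T)}"

definition trace_dual_norm ::
    "'a::euclidean_space set \<Rightarrow> real \<Rightarrow> (('a \<times> real \<Rightarrow> real) set \<Rightarrow> real) \<Rightarrow> real" where
  "trace_dual_norm \<Omega> T l = dual_norm (H11_term \<Omega> T) (norm11 \<Omega> T) (\<lambda>v. l (lateral_trace \<Omega> T v))"


section \<open>The wave operator and the space \<open>\<H>(Q)\<close>\<close>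

definition Box :: "('a::euclidean_space \<times> real \<Rightarrow> real) \<Rightarrow> 'a \<times> real \<Rightarrow> real" where
  "Box \<phi> = (\<lambda>z. pd (0, 1) (pd (0, 1) \<phi>) z - (\<Sum>b\<in>Basis. pd (b, 0) (pd (b, 0) \<phi>) z))"

definition ext0 :: "'a set \<Rightarrow> real \<Rightarrow> ('a \<times> real \<Rightarrow> real) \<Rightarrow> 'a \<times> real \<Rightarrow> real" where
  "ext0 \<Omega> T u = (\<lambda>z. if z \<in> Q \<Omega> T then u z else 0)"

text \<open>The distribution \<open>\<box>\<close> of the zero extension of \<open>u\<close>, on \<open>Q\<^sub>-\<close>.\<close>

definition box_dist ::
    "'a::euclidean_space set \<Rightarrow> real \<Rightarrow> ('a \<times> real \<Rightarrow> real) \<Rightarrow> ('a \<times> real \<Rightarrow> real) \<Rightarrow> real" where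
  "box_dist \<Omega> T u \<phi> = (\<integral>z. ext0 \<Omega> T u z * Box \<phi> z \<partial>leb (Qminus \<Omega> T))"

definition HQ :: "'a::euclidean_space set \<Rightarrow> real \<Rightarrow> ('a \<times> real \<Rightarrow> real) set" where
  "HQ \<Omega> T = {u. L2 (leb (Q \<Omega> T)) u \<and>
     (\<exists>C. \<forall>\<phi>. test_fun (Qminus \<Omega> T) \<phi> \<longrightarrow> \<bar>box_dist \<Omega> T u \<phi>\<bar> \<le> C * H1norm (Qminus \<Omega> T) \<phi>)}"

text \<open>The continuous extension of \<open>box_dist \<Omega> T u\<close> from test functions to \<open>H\<^sup>1\<^sub>0(Q\<^sub>-)\<close>, for \<open>u\<close> in \<open>HQ\<close>.\<close>

definition box_pair ::
    "'a::euclidean_space set \<Rightarrow> real \<Rightarrow> ('a \<times> real \<Rightarrow> real) \<Rightarrow> ('a \<times> real \<Rightarrow> real) \<Rightarrow> real" where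
  "box_pair \<Omega> T u w = (THE l. \<forall>\<phi>. (\<forall>m. test_fun (Qminus \<Omega> T) (\<phi> m)) \<and>
      (\<lambda>m. H1norm (Qminus \<Omega> T) (\<lambda>z. \<phi> m z - w z)) \<longlonglongrightarrow> 0 \<longrightarrow>
      (\<lambda>m. box_dist \<Omega> T u (\<phi> m)) \<longlonglongrightarrow> l)"

definition extension_operator ::
    "'a::euclidean_space set \<Rightarrow> real \<Rightarrow> (('a \<times> real \<Rightarrow> real) \<Rightarrow> 'a \<times> real \<Rightarrow> real) \<Rightarrow> bool" where
  "extension_operator \<Omega> T E \<longleftrightarrow>
     (\<forall>v\<in>H11_zero_term \<Omega> T. E v \<in> H10 (Qminus \<Omega> T)) \<and>
     (\<forall>v\<in>H11_zero_term \<Omega> T. \<forall>w\<in>H11_zero_term \<Omega> T. \<forall>a b.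
        AE z in leb (Qminus \<Omega> T). E (\<lambda>y. a * v y + b * w y) z = a * E v z + b * E w z) \<and>
     (\<exists>C. \<forall>v\<in>H11_zero_term \<Omega> T. H1norm (Qminus \<Omega> T) (E v) \<le> C * norm11 \<Omega> T v) \<and>
     (\<forall>v\<in>H11_zero_term \<Omega> T. \<forall>w\<in>H11_zero_term \<Omega> T.
        (AE z in leb (Qminus \<Omega> T). E v z = E w z) \<longrightarrow> (AE z in leb (Q \<Omega> T). v z = w z)) \<and>
     (\<forall>v\<in>H11_zero_term \<Omega> T. AE z in leb (Q \<Omega> T). E v z = v z)"

text \<open>In the rest of the theory \<open>E\<close> is the fixed extension operator.\<close>

definition box_norm ::
    "'a::euclidean_space set \<Rightarrow> real \<Rightarrow> (('a \<times> real \<Rightarrow> real) \<Rightarrow> 'a \<times> real \<Rightarrow> real) \<Rightarrow>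
     ('a \<times> real \<Rightarrow> real) \<Rightarrow> real" where
  "box_norm \<Omega> T E u = dual_norm (H11_zero_term \<Omega> T) (norm11 \<Omega> T) (\<lambda>v. box_pair \<Omega> T u (E v))"

definition HQ_norm ::
    "'a::euclidean_space set \<Rightarrow> real \<Rightarrow> (('a \<times> real \<Rightarrow> real) \<Rightarrow> 'a \<times> real \<Rightarrow> real) \<Rightarrow>
     ('a \<times> real \<Rightarrow> real) \<Rightarrow> real" where
  "HQ_norm \<Omega> T E u = sqrt ((L2norm (leb (Q \<Omega> T)) u)\<^sup>2 + (box_norm \<Omega> T E u)\<^sup>2)"

definition approximates ::
    "'a::euclidean_space set \<Rightarrow> real \<Rightarrow> (('a \<times> real \<Rightarrow> real) \<Rightarrow> 'a \<times> real \<Rightarrow> real) \<Rightarrow>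
     (nat \<Rightarrow> 'a \<times> real \<Rightarrow> real) \<Rightarrow> ('a \<times> real \<Rightarrow> real) \<Rightarrow> bool" where
  "approximates \<Omega> T E U u \<longleftrightarrow> (\<forall>m. U m \<in> H11_init \<Omega> T) \<and>
     (\<lambda>m. HQ_norm \<Omega> T E (\<lambda>z. U m z - u z)) \<longlonglongrightarrow> 0"

text \<open>The closure of \<open>H11_init\<close> in \<open>HQ\<close>.\<close>

definition HQ_init ::
    "'a::euclidean_space set \<Rightarrow> real \<Rightarrow> (('a \<times> real \<Rightarrow> real) \<Rightarrow> 'a \<times> real \<Rightarrow> real) \<Rightarrow>
     ('a \<times> real \<Rightarrow> real) set" where
  "HQ_init \<Omega> T E = {u \<in> HQ \<Omega> T. \<exists>U. approximates \<Omega> T E U u}"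


section \<open>The trace on \<open>\<H>\<close>\<close>

text \<open>The continuous extension of \<open>lateral_trace\<close> from \<open>H11_init\<close> to its closure \<open>HQ_init\<close>.  Its values lie in
  the completion of \<open>lateral_trace ` H11_init\<close> in the quotient norm induced by \<open>HQ_norm\<close>; a point of this
  completion is represented by the set of all sequences of traces converging to it.  Thus
  \<open>trace_ext V = trace_ext u\<close> iff \<open>V - u\<close> is a limit in \<open>HQ\<close> of functions in \<open>H11_init\<close> with zero
  trace, and \<open>u\<close> in \<open>H11_init\<close> has the constant sequence \<open>lateral_trace u\<close> in \<open>trace_ext u\<close>.\<close>

definition trace_ext ::
    "'a::euclidean_space set \<Rightarrow> real \<Rightarrow> (('a \<times> real \<Rightarrow> real) \<Rightarrow> 'a \<times> real \<Rightarrow> real) \<Rightarrow>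
     ('a \<times> real \<Rightarrow> real) \<Rightarrow> (nat \<Rightarrow> ('a \<times> real \<Rightarrow> real) set) set" where
  "trace_ext \<Omega> T E u = {(\<lambda>m. lateral_trace \<Omega> T (U m)) | U. approximates \<Omega> T E U u}"

definition HSigma_norm ::
    "'a::euclidean_space set \<Rightarrow> real \<Rightarrow> (('a \<times> real \<Rightarrow> real) \<Rightarrow> 'a \<times> real \<Rightarrow> real) \<Rightarrow>
     (nat \<Rightarrow> ('a \<times> real \<Rightarrow> real) set) set \<Rightarrow> real" where
  "HSigma_norm \<Omega> T E g = Inf {HQ_norm \<Omega> T E V | V. V \<in> HQ_init \<Omega> T E \<and> trace_ext \<Omega> T E V = g}"


section \<open>The functional of the generalized formulation\<close>

definition wave_form ::
    "'a::euclidean_space set \<Rightarrow> real \<Rightarrow> ('a \<times> real \<Rightarrow> real) \<Rightarrow> ('a \<times> real \<Rightarrow> real) \<Rightarrow> real" where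
  "wave_form \<Omega> T u v =
     - (\<integral>z. dt \<Omega> T u z * dt \<Omega> T v z \<partial>leb (Q \<Omega> T))
     + (\<Sum>b\<in>Basis. \<integral>z. dx \<Omega> T b u z * dx \<Omega> T b v z \<partial>leb (Q \<Omega> T))"

text \<open>\<open>F\<close> is the extension, to a bounded functional on \<open>H11_term\<close>, of
  \<open>v \<mapsto> \<langle>\<box>u, E v\<rangle>\<close>, obtained as the limit of \<open>wave_form \<Omega> T (U m)\<close> for some \<open>U m\<close> in \<open>H11_init\<close> with
  \<open>U m \<rightarrow> u\<close> in \<open>HQ\<close>.  Stated as a relation because the limit need not exist for every
  approximating sequence.\<close>

definition is_ftilde ::
    "'a::euclidean_space set \<Rightarrow> real \<Rightarrow> (('a \<times> real \<Rightarrow> real) \<Rightarrow> 'a \<times> real \<Rightarrow> real) \<Rightarrow>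
     ('a \<times> real \<Rightarrow> real) \<Rightarrow> (('a \<times> real \<Rightarrow> real) \<Rightarrow> real) \<Rightarrow> bool" where
  "is_ftilde \<Omega> T E u F \<longleftrightarrow>
     F \<in> dual (H11_term \<Omega> T) (norm11 \<Omega> T) \<and>
     (\<forall>v\<in>H11_zero_term \<Omega> T. F v = box_pair \<Omega> T u (E v)) \<and>
     (\<exists>U. approximates \<Omega> T E U u \<and>
          (\<forall>v\<in>H11_term \<Omega> T. (\<lambda>m. wave_form \<Omega> T (U m) v) \<longlonglongrightarrow> F v))"

definition solves_neumann ::
    "'a::euclidean_space set \<Rightarrow> real \<Rightarrow> (('a \<times> real \<Rightarrow> real) \<Rightarrow> 'a \<times> real \<Rightarrow> real) \<Rightarrow>
     (('a \<times> real \<Rightarrow> real) \<Rightarrow> real) \<Rightarrow> (('a \<times> real \<Rightarrow> real) set \<Rightarrow> real) \<Rightarrow> ('a \<times> real \<Rightarrow> real) \<Rightarrow> bool" where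
  "solves_neumann \<Omega> T E f l u \<longleftrightarrow> u \<in> HQ_init \<Omega> T E \<and>
     (\<exists>F. is_ftilde \<Omega> T E u F \<and> (\<forall>v\<in>H11_term \<Omega> T. F v = f v + l (lateral_trace \<Omega> T v)))"

end

theory Submission
  imports Defs
begin

text \<open>
  Write \<open>a(w,v)\<close> for \<open>wave_form\<close>.  For \<open>w\<close> with \<open>w(0) = 0\<close> the function \<open>v(t) = \<integral>\<^sub>t\<^sup>T \<psi>(s) w(s) ds\<close>, with a suitable
  decreasing weight \<open>\<psi>\<close>, vanishes at \<open>t = T\<close> and satisfies
  \<open>\<parallel>w\<parallel>\<^sup>2 + \<parallel>v\<parallel>\<^sup>2 \<le> sqrt 2 T a(w,v)\<close>, where \<open>w\<close> is measured in \<open>L\<^sup>2(Q)\<close> and \<open>v\<close> in the energy norm; hence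
  \<open>\<parallel>w\<parallel> \<le> T / sqrt 2 \<parallel>a(w,\<cdot>)\<parallel>\<close> in the dual norm.  The same estimate after time reversal shows that only \<open>v = 0\<close> satisfies
  \<open>a(w,v) = 0\<close> for all \<open>w\<close>, so the functionals \<open>a(w,\<cdot>)\<close> are dense in the dual of the Hilbert space of test functions.
  Approximating \<open>f + \<lambda>\<close> by functionals \<open>a(u\<^sub>m,\<cdot>)\<close>, the estimate makes \<open>u\<^sub>m\<close> Cauchy in \<open>L\<^sup>2(Q)\<close>; its limit is the solution
  and inherits the bound.  Weak derivatives interact with initial and terminal values only through the identities
  \<open>w = \<integral>\<^sub>0\<^sup>t \<partial>\<^sub>t w\<close> and \<open>v = - \<integral>\<^sub>t\<^sup>T \<partial>\<^sub>t v\<close>, which characterize them.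
\<close>

section \<open>Square-integrable functions\<close>

text \<open>The weight has to decrease: with a constant weight the time part of
  \<open>a(w,v)\<close> is only half the squared norm of \<open>w(T)\<close>, which controls nothing
  in the interior. A decreasing weight produces the norm of \<open>w\<close> over Q, but it also
  enters the spatial part, where its reciprocal has to increase. One Riccati equation serves both
  with a common rate \<alpha>; it has a positive solution on [0,T] exactly when \<alpha> T <
  \<pi>/2, and the value \<alpha> T = sqrt 2 behind the constant T / sqrt 2 lies below this
  threshold. The solution then has L2 norm at most T / sqrt 2 times, and distributional norm at most
  once, the norm of the data; sqrt (T^2/2 + 1) is the constant of the theorem. The second obstacle
  is that the norm of \<open>HQ\<close> tests the wave operator only with functions of zero lateral
  trace. Convergence in \<open>HQ\<close> does not by itself control the functionals on functions
  with nonzero trace, so uniqueness is not read off from the estimate but rests on exact solvability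
  of the adjoint problem.\<close>

lemma discriminant_le:
  fixes a b c :: real
  assumes nn: "\<And>s. 0 \<le> a + 2 * s * b + s\<^sup>2 * c" and c: "0 \<le> c"
  shows "b\<^sup>2 \<le> a * c"
\<comment> \<open>The degenerate case does occur, since the forms involved are only semidefinite: an
  affine function of s takes the value -1 unless b = 0. Otherwise the quadratic is evaluated at its
  minimizer s = -b/c.\<close>
proof (cases "c = 0")
  case True
  have "b = 0"
  proof (rule ccontr)
    assume "b \<noteq> 0"
    then have "a + 2 * (-(a+1)/(2*b)) * b = -1" by (simp add: field_simps)
    with nn[of "-(a+1)/(2*b)"] True show False by simp
  qed
  then show ?thesis using True by simp
next
  case False
  then have "a + 2 * (-b/c) * b + (-b/c)\<^sup>2 * c = a - b\<^sup>2/c"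
    by (simp add: power2_eq_square field_simps)
  with nn[of "-b/c"] have "b\<^sup>2/c \<le> a" by simp
  then show ?thesis using False c by (simp add: field_simps)
qed

lemma L2_measurable: "L2 M u \<Longrightarrow> u \<in> borel_measurable M"
  and L2_square_integrable: "L2 M u \<Longrightarrow> integrable M (\<lambda>z. (u z)\<^sup>2)"
  by (auto simp: L2_def)

lemma L2_mult_integrable:
  assumes u: "L2 M u" and v: "L2 M v"
  shows "integrable M (\<lambda>z. u z * v z)"
proof (rule Bochner_Integration.integrable_bound)
  show "integrable M (\<lambda>z. (u z)\<^sup>2 + (v z)\<^sup>2)"
    using u v by (auto simp: L2_def)
  show "(\<lambda>z. u z * v z) \<in> borel_measurable M"
    using u v by (auto simp: L2_def)
  have "\<bar>a * b\<bar> \<le> a\<^sup>2 + b\<^sup>2" for a b :: real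
    using sum_squares_bound[of "\<bar>a\<bar>" "\<bar>b\<bar>"] mult_nonneg_nonneg[of "\<bar>a\<bar>" "\<bar>b\<bar>"]
    unfolding abs_mult power2_abs by linarith
  then show "AE z in M. norm (u z * v z) \<le> norm ((u z)\<^sup>2 + (v z)\<^sup>2)"
    by (auto simp: abs_mult)
qed

lemma L2_cmult: "L2 M u \<Longrightarrow> L2 M (\<lambda>z. a * u z)"
  by (auto simp: L2_def power_mult_distrib)

lemma L2_add:
  assumes u: "L2 M u" and v: "L2 M v"
  shows "L2 M (\<lambda>z. u z + v z)"
proof -
  have "(\<lambda>z. (u z + v z)\<^sup>2) = (\<lambda>z. (u z)\<^sup>2 + (v z)\<^sup>2 + 2 * (u z * v z))"
    by (auto simp: power2_eq_square algebra_simps)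
  then show ?thesis using u v L2_mult_integrable[OF u v] by (auto simp: L2_def)
qed

lemma L2_lincomb: "L2 M u \<Longrightarrow> L2 M v \<Longrightarrow> L2 M (\<lambda>z. a * u z + b * v z)"
  by (intro L2_add L2_cmult)

lemma L2_diff: "L2 M u \<Longrightarrow> L2 M v \<Longrightarrow> L2 M (\<lambda>z. u z - v z)"
  using L2_lincomb[of M u v 1 "-1"] by simp

lemma L2_minus: "L2 M u \<Longrightarrow> L2 M (\<lambda>z. - u z)"
  using L2_cmult[of M u "-1"] by simp

lemma L2_zero [simp]: "L2 M (\<lambda>z. 0)"
  by (auto simp: L2_def)

lemma L2_AE_cong:
  assumes "L2 M u" "AE z in M. u z = v z" "v \<in> borel_measurable M"
  shows "L2 M v"
  unfolding L2_def
proof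
  show "integrable M (\<lambda>z. (v z)\<^sup>2)"
  proof (subst integrable_cong_AE)
    show "AE z in M. (v z)\<^sup>2 = (u z)\<^sup>2" using assms(2) by auto
  qed (use assms in \<open>auto simp: L2_def\<close>)
qed (rule assms)

lemma L2_bounded_mult:
  assumes "L2 M u" "b \<in> borel_measurable M" "\<And>z. z \<in> space M \<Longrightarrow> \<bar>b z\<bar> \<le> C"
  shows "L2 M (\<lambda>z. b z * u z)"
  unfolding L2_def
proof
  show "(\<lambda>z. b z * u z) \<in> borel_measurable M" using assms by (auto simp: L2_def)
  show "integrable M (\<lambda>z. (b z * u z)\<^sup>2)"
  proof (rule Bochner_Integration.integrable_bound)
    show "integrable M (\<lambda>z. C\<^sup>2 * (u z)\<^sup>2)" using assms by (auto simp: L2_def)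
    show "(\<lambda>z. (b z * u z)\<^sup>2) \<in> borel_measurable M" using assms by (auto simp: L2_def)
    have "(b z)\<^sup>2 \<le> C\<^sup>2" if "z \<in> space M" for z
      using assms(3)[OF that] by (metis abs_ge_zero power2_abs power_mono)
    then show "AE z in M. norm ((b z * u z)\<^sup>2) \<le> norm (C\<^sup>2 * (u z)\<^sup>2)"
      by (auto simp: power_mult_distrib mult_right_mono)
  qed
qed

lemma L2norm_nonneg [simp]: "0 \<le> L2norm M u"
  by (simp add: L2norm_def)

lemma L2norm_power2: "(L2norm M u)\<^sup>2 = (\<integral>z. (u z)\<^sup>2 \<partial>M)"
  by (simp add: L2norm_def)

lemma L2norm_cong_AE:
  assumes "AE z in M. u z = v z" "u \<in> borel_measurable M" "v \<in> borel_measurable M"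
  shows "L2norm M u = L2norm M v"
  unfolding L2norm_def using assms by (intro arg_cong[where f=sqrt] integral_cong_AE) auto

lemma L2norm_minus: "L2norm M (\<lambda>z. u z - v z) = L2norm M (\<lambda>z. v z - u z)"
  by (simp add: L2norm_def power2_commute)

lemma L2_integral_square_lincomb:
  assumes u: "L2 M u" and v: "L2 M v"
  shows "(\<integral>z. (u z + s * v z)\<^sup>2 \<partial>M) = (\<integral>z. (u z)\<^sup>2 \<partial>M) + 2 * s * (\<integral>z. u z * v z \<partial>M) + s\<^sup>2 * (\<integral>z. (v z)\<^sup>2 \<partial>M)"
proof -
  have "(\<integral>z. (u z + s * v z)\<^sup>2 \<partial>M) = (\<integral>z. (u z)\<^sup>2 + (2 * s) * (u z * v z) + s\<^sup>2 * (v z)\<^sup>2 \<partial>M)"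
    by (intro Bochner_Integration.integral_cong) (auto simp: power2_eq_square algebra_simps)
  also have "\<dots> = (\<integral>z. (u z)\<^sup>2 \<partial>M) + (2 * s) * (\<integral>z. u z * v z \<partial>M) + s\<^sup>2 * (\<integral>z. (v z)\<^sup>2 \<partial>M)"
    using L2_mult_integrable[OF u v] L2_square_integrable[OF u] L2_square_integrable[OF v]
    by (subst Bochner_Integration.integral_add; simp)+
  finally show ?thesis .
qed

lemma L2_integral_lincomb_mult:
  assumes "L2 M p" "L2 M q" "L2 M r"
  shows "(\<integral>z. (a * p z + c * q z) * r z \<partial>M) = a * (\<integral>z. p z * r z \<partial>M) + c * (\<integral>z. q z * r z \<partial>M)"
proof -
  have "(\<integral>z. (a * p z + c * q z) * r z \<partial>M) = (\<integral>z. a * (p z * r z) + c * (q z * r z) \<partial>M)"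
    by (intro Bochner_Integration.integral_cong) (auto simp: algebra_simps)
  then show ?thesis using L2_mult_integrable[OF assms(1,3)] L2_mult_integrable[OF assms(2,3)] by simp
qed

lemma L2_Cauchy_Schwarz:
  assumes u: "L2 M u" and v: "L2 M v"
  shows "\<bar>\<integral>z. u z * v z \<partial>M\<bar> \<le> L2norm M u * L2norm M v"
proof -
  have "(\<integral>z. u z * v z \<partial>M)\<^sup>2 \<le> (\<integral>z. (u z)\<^sup>2 \<partial>M) * (\<integral>z. (v z)\<^sup>2 \<partial>M)"
  proof (rule discriminant_le)
    show "0 \<le> (\<integral>z. (u z)\<^sup>2 \<partial>M) + 2 * s * (\<integral>z. u z * v z \<partial>M) + s\<^sup>2 * (\<integral>z. (v z)\<^sup>2 \<partial>M)" for s
      unfolding L2_integral_square_lincomb[OF u v, symmetric] by simp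
  qed simp
  then have "sqrt ((\<integral>z. u z * v z \<partial>M)\<^sup>2) \<le> sqrt ((\<integral>z. (u z)\<^sup>2 \<partial>M) * (\<integral>z. (v z)\<^sup>2 \<partial>M))"
    by (rule real_sqrt_le_mono)
  then show ?thesis by (simp add: L2norm_def real_sqrt_mult)
qed

lemma L2norm_triangle:
  assumes u: "L2 M u" and v: "L2 M v"
  shows "L2norm M (\<lambda>z. u z + v z) \<le> L2norm M u + L2norm M v"
proof (rule power2_le_imp_le)
  have "(L2norm M (\<lambda>z. u z + v z))\<^sup>2 = (L2norm M u)\<^sup>2 + 2 * (\<integral>z. u z * v z \<partial>M) + (L2norm M v)\<^sup>2"
    using L2_integral_square_lincomb[OF u v, of 1] by (simp add: L2norm_power2)
  also have "\<dots> \<le> (L2norm M u + L2norm M v)\<^sup>2"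
    using L2_Cauchy_Schwarz[OF u v] by (simp add: power2_eq_square algebra_simps)
  finally show "(L2norm M (\<lambda>z. u z + v z))\<^sup>2 \<le> (L2norm M u + L2norm M v)\<^sup>2" .
qed simp

lemma L2norm_le_diff:
  assumes u: "L2 M u" and v: "L2 M v"
  shows "\<bar>L2norm M u - L2norm M v\<bar> \<le> L2norm M (\<lambda>z. u z - v z)"
  using L2norm_triangle[OF L2_diff[OF u v] v] L2norm_triangle[OF L2_diff[OF v u] u]
  by (simp add: L2norm_minus[of M v u])

lemma L2norm_zero_iff:
  assumes "L2 M u"
  shows "L2norm M u = 0 \<longleftrightarrow> (AE z in M. u z = 0)"
proof -
  have "L2norm M u = 0 \<longleftrightarrow> (\<integral>z. (u z)\<^sup>2 \<partial>M) = 0" by (simp add: L2norm_def)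
  also have "\<dots> \<longleftrightarrow> (AE z in M. (u z)\<^sup>2 = 0)"
    using assms by (intro integral_nonneg_eq_0_iff_AE) (auto simp: L2_def)
  finally show ?thesis by simp
qed

lemma L2_tendsto_integral_mult:
  assumes s: "\<And>n. L2 M (s n)" and u: "L2 M u" and v: "L2 M v"
    and lim: "(\<lambda>n. L2norm M (\<lambda>z. s n z - u z)) \<longlonglongrightarrow> 0"
  shows "(\<lambda>n. \<integral>z. s n z * v z \<partial>M) \<longlonglongrightarrow> (\<integral>z. u z * v z \<partial>M)"
proof (rule Lim_null_comparison[THEN LIM_zero_cancel])
  show "(\<lambda>n. L2norm M (\<lambda>z. s n z - u z) * L2norm M v) \<longlonglongrightarrow> 0"
    using lim by (rule tendsto_mult_left_zero)
  have "(\<integral>z. s n z * v z \<partial>M) - (\<integral>z. u z * v z \<partial>M) = (\<integral>z. (s n z - u z) * v z \<partial>M)" for n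
    using L2_mult_integrable[OF s v] L2_mult_integrable[OF u v] by (simp add: left_diff_distrib)
  then show "\<forall>\<^sub>F n in sequentially. norm ((\<integral>z. s n z * v z \<partial>M) - (\<integral>z. u z * v z \<partial>M))
      \<le> L2norm M (\<lambda>z. s n z - u z) * L2norm M v"
    using L2_Cauchy_Schwarz[OF L2_diff[OF s u] v] by simp
qed

lemma L2norm_tendsto:
  assumes s: "\<And>n. L2 M (s n)" and u: "L2 M u"
    and lim: "(\<lambda>n. L2norm M (\<lambda>z. s n z - u z)) \<longlonglongrightarrow> 0"
  shows "(\<lambda>n. L2norm M (s n)) \<longlonglongrightarrow> L2norm M u"
proof (rule Lim_null_comparison[THEN LIM_zero_cancel])
  show "\<forall>\<^sub>F n in sequentially. norm (L2norm M (s n) - L2norm M u) \<le> L2norm M (\<lambda>z. s n z - u z)"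
    using L2norm_le_diff[OF s u] by simp
qed (rule lim)

lemma L2_imp_integrable:
  assumes "finite_measure M" "L2 M u"
  shows "integrable M u"
proof -
  interpret finite_measure M by fact
  have "L2 M (\<lambda>z. 1)" by (auto simp: L2_def)
  from L2_mult_integrable[OF assms(2) this] show ?thesis by simp
qed

lemma L2norm_abs: "L2norm M (\<lambda>z. \<bar>u z\<bar>) = L2norm M u"
  by (simp add: L2norm_def)

lemma L2_integral_abs_le:
  assumes "finite_measure M" "L2 M u"
  shows "(\<integral>z. \<bar>u z\<bar> \<partial>M) \<le> sqrt (measure M (space M)) * L2norm M u"
proof -
  interpret finite_measure M by fact
  have 1: "L2 M (\<lambda>z. 1)" by (auto simp: L2_def)
  have 2: "L2 M (\<lambda>z. \<bar>u z\<bar>)" using assms by (auto simp: L2_def)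
  show ?thesis using L2_Cauchy_Schwarz[OF 1 2] L2norm_abs[of M u] by (simp add: L2norm_def)
qed

text \<open>Riesz-Fischer. Along a subsequence with increments below (1/2)^k the increments are
  summable almost everywhere, because on a finite measure space their L1 norms are controlled by
  their L2 norms; the pointwise limit is then shown to be the L2 limit of the whole
  sequence.\<close>

lemma L2_complete:
  fixes s :: "nat \<Rightarrow> 'b \<Rightarrow> real"
  assumes fin: "finite_measure M" and s: "\<And>n. L2 M (s n)"
    and Cauchy: "\<And>e. 0 < e \<Longrightarrow> \<exists>N. \<forall>m\<ge>N. \<forall>n\<ge>N. L2norm M (\<lambda>z. s m z - s n z) < e"
  shows "\<exists>u. L2 M u \<and> (\<lambda>n. L2norm M (\<lambda>z. s n z - u z)) \<longlonglongrightarrow> 0"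
proof -
  interpret finite_measure M by fact
  have [measurable]: "s n \<in> borel_measurable M" for n using s by (simp add: L2_def)
  have "\<exists>N. \<forall>k. (\<forall>m\<ge>N k. \<forall>n\<ge>N k. L2norm M (\<lambda>z. s m z - s n z) < (1/2)^k) \<and> N k < N (Suc k)"
  proof (rule dependent_nat_choice)
    show "\<exists>x. \<forall>m\<ge>x. \<forall>n\<ge>x. L2norm M (\<lambda>z. s m z - s n z) < (1/2)^0" using Cauchy[of 1] by simp
    fix x n
    obtain N where "\<forall>m\<ge>N. \<forall>k\<ge>N. L2norm M (\<lambda>z. s m z - s k z) < (1/2)^Suc n"
      using Cauchy[of "(1/2)^Suc n"] by auto
    then show "\<exists>y. (\<forall>m\<ge>y. \<forall>k\<ge>y. L2norm M (\<lambda>z. s m z - s k z) < (1/2)^Suc n) \<and> x < y"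
      by (intro exI[of _ "max N (Suc x)"]) auto
  qed
  then obtain N where N: "\<And>k m n. m \<ge> N k \<Longrightarrow> n \<ge> N k \<Longrightarrow> L2norm M (\<lambda>z. s m z - s n z) < (1/2)^k"
    and Nmono: "\<And>k. N k < N (Suc k)" by blast
  have Nstrict: "strict_mono N" using Nmono by (simp add: strict_mono_Suc_iff)
  define d where "d k z = \<bar>s (N (Suc k)) z - s (N k) z\<bar>" for k z
  have dL2: "L2 M (d k)" for k
    using L2_diff[OF s s, of "N (Suc k)" "N k"] by (auto simp: d_def[abs_def] L2_def)
  define K where "K = sqrt (measure M (space M))"
  have dint: "(\<integral>z. d k z \<partial>M) \<le> K * (1/2)^k" for k
  proof -
    have "(\<integral>z. d k z \<partial>M) \<le> K * L2norm M (\<lambda>z. s (N (Suc k)) z - s (N k) z)"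
      unfolding d_def K_def by (rule L2_integral_abs_le[OF fin L2_diff[OF s s]])
    also have "\<dots> \<le> K * (1/2)^k"
      using N[of k "N (Suc k)" "N k"] Nmono[of k] by (intro mult_left_mono) (auto simp: K_def)
    finally show ?thesis .
  qed
  have dinteg: "integrable M (d k)" for k by (rule L2_imp_integrable[OF fin dL2])
  have "(\<integral>\<^sup>+z. (\<Sum>k. ennreal (d k z)) \<partial>M) = (\<Sum>k. \<integral>\<^sup>+z. ennreal (d k z) \<partial>M)"
    using dinteg by (intro nn_integral_suminf) auto
  also have "\<dots> = (\<Sum>k. ennreal (\<integral>z. d k z \<partial>M))"
    using dinteg by (intro suminf_cong nn_integral_eq_integral dinteg) (simp add: d_def)
  also have "\<dots> \<le> (\<Sum>k. ennreal (K * (1/2)^k))"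
    using dint by (intro suminf_le) (auto intro: ennreal_leI)
  also have "\<dots> = ennreal (\<Sum>k. K * (1/2)^k)"
    by (intro suminf_ennreal2) (auto simp: K_def intro!: summable_mult summable_geometric)
  finally have "(\<integral>\<^sup>+z. (\<Sum>k. ennreal (d k z)) \<partial>M) \<noteq> \<infinity>" by (auto simp: top_unique)
  then have "AE z in M. (\<Sum>k. ennreal (d k z)) \<noteq> \<infinity>"
    using dinteg by (intro nn_integral_PInf_AE) auto
  then have conv: "AE z in M. convergent (\<lambda>k. s (N k) z)"
  proof eventually_elim
    case (elim z)
    then have "summable (\<lambda>k. d k z)"
      by (intro summable_suminf_not_top) (auto simp: d_def)
    then have "summable (\<lambda>k. s (N (Suc k)) z - s (N k) z)"
      unfolding d_def by (rule summable_rabs_cancel)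
    then have "summable (\<lambda>k. s (N (Suc k)) z - s (N k) z)" .
    then have "convergent (\<lambda>n. \<Sum>k<n. s (N (Suc k)) z - s (N k) z)"
      by (simp add: summable_iff_convergent)
    then have "convergent (\<lambda>n. s (N n) z - s (N 0) z)"
      by (simp add: sum_lessThan_telescope[of "\<lambda>k. s (N k) z"])
    from convergent_add[OF this convergent_const[of "s (N 0) z"]] show ?case by simp
  qed
  define u where "u z = lim (\<lambda>k. s (N k) z)" for z
  have [measurable]: "u \<in> borel_measurable M" unfolding u_def by measurable
  have lim: "AE z in M. (\<lambda>k. s (N k) z) \<longlonglongrightarrow> u z"
    using conv unfolding u_def by eventually_elim (simp add: convergent_LIMSEQ_iff)
  \<comment> \<open>Fatou's lemma in the index j of the subsequence: from \<open>N k\<close> on,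
    every \<open>s n\<close> is within (1/2)^k of all later members, hence of the limit.\<close>
  have est: "(\<integral>\<^sup>+z. ennreal ((s n z - u z)\<^sup>2) \<partial>M) \<le> ennreal (((1/2)^k)\<^sup>2)" if "n \<ge> N k" for n k
  proof -
    have "(\<integral>\<^sup>+z. ennreal ((s n z - u z)\<^sup>2) \<partial>M)
        = (\<integral>\<^sup>+z. liminf (\<lambda>j. ennreal ((s n z - s (N j) z)\<^sup>2)) \<partial>M)"
    proof (rule nn_integral_cong_AE)
      show "AE z in M. ennreal ((s n z - u z)\<^sup>2) = liminf (\<lambda>j. ennreal ((s n z - s (N j) z)\<^sup>2))"
        using lim
      proof eventually_elim
        case (elim z)
        then have "(\<lambda>j. ennreal ((s n z - s (N j) z)\<^sup>2)) \<longlonglongrightarrow> ennreal ((s n z - u z)\<^sup>2)"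
          by (intro tendsto_ennrealI tendsto_intros)
        then show ?case by (intro lim_imp_Liminf[symmetric]) auto
      qed
    qed
    also have "\<dots> \<le> liminf (\<lambda>j. \<integral>\<^sup>+z. ennreal ((s n z - s (N j) z)\<^sup>2) \<partial>M)"
      by (rule nn_integral_liminf) auto
    also have "\<dots> \<le> liminf (\<lambda>j. ennreal (((1/2)^k)\<^sup>2))"
    proof (rule Liminf_mono, rule eventually_sequentiallyI[of k])
      fix j assume "k \<le> j"
      then have "N k \<le> N j" using Nstrict by (simp add: strict_mono_less_eq)
      have "(\<integral>\<^sup>+z. ennreal ((s n z - s (N j) z)\<^sup>2) \<partial>M) = ennreal ((L2norm M (\<lambda>z. s n z - s (N j) z))\<^sup>2)"
        unfolding L2norm_power2 using L2_diff[OF s s]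
        by (intro nn_integral_eq_integral) (auto simp: L2_def)
      also have "\<dots> \<le> ennreal (((1/2)^k)\<^sup>2)"
        using N[OF that \<open>N k \<le> N j\<close>] by (intro ennreal_leI power_mono) auto
      finally show "(\<integral>\<^sup>+z. ennreal ((s n z - s (N j) z)\<^sup>2) \<partial>M) \<le> ennreal (((1/2)^k)\<^sup>2)" .
    qed
    finally show ?thesis by (simp add: Liminf_const)
  qed
  have diffL2: "L2 M (\<lambda>z. s n z - u z)" if "n \<ge> N k" for n k
    unfolding L2_def
  proof
    show "integrable M (\<lambda>z. (s n z - u z)\<^sup>2)"
      using le_less_trans[OF est[OF that]] by (intro integrableI_nonneg) auto
  qed simp
  have uL2: "L2 M u"
    using L2_diff[OF s diffL2[of 0 "N 0"], of "N 0"] by simp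
  have est': "L2norm M (\<lambda>z. s n z - u z) \<le> (1/2)^k" if "n \<ge> N k" for n k
  proof -
    have "(\<integral>\<^sup>+z. ennreal ((s n z - u z)\<^sup>2) \<partial>M) = ennreal ((L2norm M (\<lambda>z. s n z - u z))\<^sup>2)"
      unfolding L2norm_power2 using diffL2[OF that]
      by (intro nn_integral_eq_integral) (auto simp: L2_def)
    with est[OF that] have "(L2norm M (\<lambda>z. s n z - u z))\<^sup>2 \<le> ((1/2)^k)\<^sup>2" by simp
    then show ?thesis by (rule power2_le_imp_le) simp
  qed
  have "(\<lambda>n. L2norm M (\<lambda>z. s n z - u z)) \<longlonglongrightarrow> 0"
  proof (rule LIMSEQ_I)
    fix r :: real assume "0 < r"
    then obtain k where k: "(1/2)^k < r" using real_arch_pow_inv[of r "1/2"] by auto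
    show "\<exists>no. \<forall>n\<ge>no. norm (L2norm M (\<lambda>z. s n z - u z) - 0) < r"
      using est'[of k] k by (intro exI[of _ "N k"]) (auto intro: le_less_trans)
  qed
  with uL2 show ?thesis by blast
qed

section \<open>Smooth functions\<close>

lemma differentiable_has_frechet:
  "f differentiable (at z) \<Longrightarrow> (f has_derivative frechet_derivative f (at z)) (at z)"
  by (simp add: frechet_derivative_works)

lemma pd_eqI: "(f has_derivative f') (at z) \<Longrightarrow> pd b f z = f' b"
  unfolding pd_def using frechet_derivative_at by metis

lemma frechet_derivative_eq_sum_pd:
  fixes f :: "'b::euclidean_space \<Rightarrow> real"
  assumes "f differentiable (at z)"
  shows "frechet_derivative f (at z) h = (\<Sum>b\<in>Basis. (h \<bullet> b) * pd b f z)"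
proof -
  have lin: "linear (frechet_derivative f (at z))"
    using linear_frechet_derivative[OF assms] .
  have "frechet_derivative f (at z) h = frechet_derivative f (at z) (\<Sum>b\<in>Basis. (h \<bullet> b) *\<^sub>R b)"
    by (simp add: euclidean_representation)
  also have "\<dots> = (\<Sum>b\<in>Basis. (h \<bullet> b) * pd b f z)"
    by (simp add: linear_sum[OF lin] linear_cmul[OF lin] pd_def)
  finally show ?thesis .
qed

lemma diff_times_SucD: "diff_times (Suc k) f \<Longrightarrow> diff_times k f"
proof (induction k arbitrary: f)
  case 0
  then show ?case by (auto intro!: continuous_at_imp_continuous_on differentiable_imp_continuous_within)
next
  case (Suc k)
  then show ?case by (metis diff_times.simps(2))
qed

lemma diff_times_const [simp]: "diff_times k (\<lambda>z::'b::euclidean_space. c)"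
proof (induction k arbitrary: c)
  case (Suc k)
  have "pd b (\<lambda>z::'b. c) = (\<lambda>z. 0)" for b by (rule ext, rule pd_eqI) (auto intro!: derivative_eq_intros)
  with Suc show ?case by simp
qed simp

lemma pd_lincomb:
  assumes "f differentiable (at z)" "g differentiable (at z)"
  shows "pd d (\<lambda>z. a * f z + b * g z) z = a * pd d f z + b * pd d g z"
  unfolding pd_def[of d f] pd_def[of d g]
  by (rule pd_eqI) (intro derivative_intros differentiable_has_frechet assms)

lemma pd_mult:
  assumes "f differentiable (at z)" "g differentiable (at z)"
  shows "pd d (\<lambda>z. f z * g z) z = f z * pd d g z + pd d f z * g z"
  unfolding pd_def[of d f] pd_def[of d g]
  by (rule pd_eqI) (intro derivative_intros differentiable_has_frechet assms)

lemma pd_affine: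
  fixes f :: "'c::euclidean_space \<Rightarrow> real"
  assumes "f differentiable (at (p + l z))" "bounded_linear l"
  shows "pd d (\<lambda>z. f (p + l z)) z = (\<Sum>c\<in>Basis. (l d \<bullet> c) * pd c f (p + l z))"
proof -
  have "((\<lambda>z. p + l z) has_derivative l) (at z)"
    using bounded_linear_imp_has_derivative[OF assms(2)] by (auto intro!: derivative_eq_intros)
  from diff_chain_at[OF this differentiable_has_frechet[OF assms(1)]]
  have "((\<lambda>z. f (p + l z)) has_derivative (\<lambda>h. frechet_derivative f (at (p + l z)) (l h))) (at z)"
    by (simp add: o_def)
  from pd_eqI[OF this] show ?thesis by (simp add: frechet_derivative_eq_sum_pd[OF assms(1)])
qed

lemma diff_times_lincomb:
  "diff_times k f \<Longrightarrow> diff_times k g \<Longrightarrow> diff_times k (\<lambda>z. a * f z + b * g z)"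
proof (induction k arbitrary: f g)
  case (Suc k)
  then have "pd d (\<lambda>z. a * f z + b * g z) = (\<lambda>z. a * pd d f z + b * pd d g z)" for d
    by (intro ext pd_lincomb) auto
  with Suc show ?case by (auto intro!: derivative_intros)
qed (auto intro!: continuous_intros)

lemma diff_times_add: "diff_times k f \<Longrightarrow> diff_times k g \<Longrightarrow> diff_times k (\<lambda>z. f z + g z)"
  using diff_times_lincomb[of k f g 1 1] by simp

lemma diff_times_cmult: "diff_times k f \<Longrightarrow> diff_times k (\<lambda>z. a * f z)"
  using diff_times_lincomb[of k f f a 0] by simp

lemma diff_times_sum:
  "finite I \<Longrightarrow> (\<And>i. i \<in> I \<Longrightarrow> diff_times k (f i)) \<Longrightarrow> diff_times k (\<lambda>z. \<Sum>i\<in>I. f i z)"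
  by (induction I rule: finite_induct) (auto intro!: diff_times_add)

lemma diff_times_mult:
  "diff_times k f \<Longrightarrow> diff_times k g \<Longrightarrow> diff_times k (\<lambda>z. f z * g z)"
proof (induction k arbitrary: f g)
  case (Suc k)
  then have "pd d (\<lambda>z. f z * g z) = (\<lambda>z. f z * pd d g z + pd d f z * g z)" for d
    by (intro ext pd_mult) simp_all
  moreover have "diff_times k f" "diff_times k g" using Suc.prems[THEN diff_times_SucD] by - assumption+
  ultimately show ?case using Suc by (auto intro!: derivative_intros diff_times_add)
qed (auto intro!: continuous_intros)

lemma diff_times_prod:
  "finite I \<Longrightarrow> (\<And>i. i \<in> I \<Longrightarrow> diff_times k (f i)) \<Longrightarrow> diff_times k (\<lambda>z. \<Prod>i\<in>I. f i z)"
  by (induction I rule: finite_induct) (auto intro!: diff_times_mult)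

lemma diff_times_affine:
  fixes f :: "'c::euclidean_space \<Rightarrow> real"
  assumes l: "bounded_linear l"
  shows "diff_times k f \<Longrightarrow> diff_times k (\<lambda>z. f (p + l z))"
proof (induction k arbitrary: f)
  case 0
  have "continuous_on UNIV (\<lambda>z. p + l z)"
    by (intro continuous_intros bounded_linear.continuous_on[OF l])
  from continuous_on_compose2[OF _ this] 0 show ?case by auto
next
  case (Suc k)
  have "pd d (\<lambda>z. f (p + l z)) = (\<lambda>z. \<Sum>c\<in>Basis. (l d \<bullet> c) * pd c f (p + l z))" for d
    using Suc.prems by (intro ext pd_affine l) auto
  moreover have "(\<lambda>z. f (p + l z)) differentiable (at z)" for z
  proof -
    have "((\<lambda>z. p + l z) has_derivative l) (at z)"
      using bounded_linear_imp_has_derivative[OF l] by (auto intro!: derivative_eq_intros)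
    from diff_chain_at[OF this differentiable_has_frechet[of f]] Suc.prems
    show ?thesis by (auto simp: o_def differentiable_def)
  qed
  ultimately show ?case using Suc by (auto intro!: diff_times_sum diff_times_cmult)
qed

lemma smooth_differentiable: "smooth f \<Longrightarrow> f differentiable (at z)"
  unfolding smooth_def using diff_times.simps(2) by metis

lemma smooth_continuous: "smooth f \<Longrightarrow> continuous_on S f"
  unfolding smooth_def using diff_times.simps(1) continuous_on_subset by blast

lemma smooth_pd: "smooth f \<Longrightarrow> b \<in> Basis \<Longrightarrow> smooth (pd b f)"
  unfolding smooth_def using diff_times.simps(2) by metis

lemma smooth_const [simp]: "smooth (\<lambda>z. c)"
  by (simp add: smooth_def)

lemma smooth_lincomb: "smooth f \<Longrightarrow> smooth g \<Longrightarrow> smooth (\<lambda>z. a * f z + b * g z)"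
  by (simp add: smooth_def diff_times_lincomb)

lemma smooth_mult: "smooth f \<Longrightarrow> smooth g \<Longrightarrow> smooth (\<lambda>z. f z * g z)"
  by (simp add: smooth_def diff_times_mult)

lemma smooth_prod:
  "finite I \<Longrightarrow> (\<And>i. i \<in> I \<Longrightarrow> smooth (f i)) \<Longrightarrow> smooth (\<lambda>z. \<Prod>i\<in>I. f i z)"
  by (simp add: smooth_def diff_times_prod)

lemma smooth_affine:
  fixes f :: "'c::euclidean_space \<Rightarrow> real"
  shows "bounded_linear l \<Longrightarrow> smooth f \<Longrightarrow> smooth (\<lambda>z. f (p + l z))"
  by (simp add: smooth_def diff_times_affine)

lemma smooth_comp_linear:
  fixes f :: "'c::euclidean_space \<Rightarrow> real"
  shows "bounded_linear l \<Longrightarrow> smooth f \<Longrightarrow> smooth (\<lambda>z. f (l z))"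
  using smooth_affine[of l f 0] by simp

lemma smooth_real_deriv:
  fixes f f' :: "real \<Rightarrow> real"
  assumes "\<And>t. (f has_real_derivative f' t) (at t)" "smooth f'"
  shows "smooth f"
  unfolding smooth_def
proof
  have pd: "pd b f = (\<lambda>t. b * f' t)" for b
    using pd_eqI[OF assms(1)[unfolded has_field_derivative_def]] by (auto simp: mult.commute)
  have diff: "f differentiable (at t)" for t
    using assms(1) real_differentiable_def by blast
  fix k show "diff_times k f"
  proof (cases k)
    case 0
    then show ?thesis using diff
      by (auto intro!: continuous_at_imp_continuous_on differentiable_imp_continuous_within)
  next
    case (Suc j)
    then show ?thesis using diff pd assms(2) by (auto simp: smooth_def intro!: diff_times_cmult)
  qed
qed

lemma smooth_id: "smooth (\<lambda>t::real. t)"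
  by (rule smooth_real_deriv[where f'="\<lambda>t. 1"]) (auto intro!: derivative_eq_intros)

lemma smooth_real_polynomial:
  assumes "real_polynomial_function (p :: real \<Rightarrow> real)"
  shows "smooth p"
  using assms
proof (induction rule: real_polynomial_function.induct)
  case (linear f)
  then show ?case using smooth_comp_linear[OF linear smooth_id] by simp
next
  case (add f g)
  then show ?case using smooth_lincomb[of f g 1 1] by simp
qed (auto intro: smooth_mult)

section \<open>Smooth cut-offs in time and bumps on boxes\<close>

text \<open>For c = 0 this is the standard smooth function exp (-1/t), continued by 0. The extra
  powers of 1/t make the family closed under differentiation up to linear combinations, so that
  smoothness follows by one induction over all c.\<close>

definition flat :: "nat \<Rightarrow> real \<Rightarrow> real" where
  "flat c t = (if t \<le> 0 then 0 else (1/t)^c * exp (- (1/t)))"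

lemma flat_tendsto_0: "(flat c \<longlongrightarrow> 0) (at_right 0)"
proof -
  have "((\<lambda>y. y ^ c * exp (- y)) \<longlongrightarrow> 0) (at_top :: real filter)"
    using tendsto_power_div_exp_0[of c] by (simp only: exp_minus divide_inverse)
  from filterlim_compose[OF this filterlim_inverse_at_top_right]
  have "((\<lambda>t::real. (1/t) ^ c * exp (- (1/t))) \<longlongrightarrow> 0) (at_right 0)"
    by (simp only: divide_inverse mult_1_left)
  then show ?thesis
    by (rule Lim_transform_eventually) (simp add: eventually_at_filter flat_def)
qed

lemma flat_has_derivative:
  "(flat c has_real_derivative (- real c * flat (Suc c) t + flat (Suc (Suc c)) t)) (at t)"
proof -
  consider "t < 0" | "t = 0" | "t > 0" by linarith
  then show ?thesis
  proof cases
    case 1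
    have "((\<lambda>t. 0) has_real_derivative 0) (at t)" by simp
    then have "(flat c has_real_derivative 0) (at t)"
      by (rule has_field_derivative_transform_within_open[where S="{..<0}"])
        (use 1 in \<open>auto simp: flat_def\<close>)
    with 1 show ?thesis by (simp add: flat_def)
  next
    case 2
    have "((\<lambda>h. (flat c (0 + h) - flat c 0) / h) \<longlongrightarrow> 0) (at 0)"
    proof (rule filterlim_split_at)
      show "((\<lambda>h. (flat c (0 + h) - flat c 0) / h) \<longlongrightarrow> 0) (at_left 0)"
        by (rule Lim_transform_eventually[OF tendsto_const])
          (simp add: eventually_at_filter flat_def)
      \<comment> \<open>For h > 0 the difference quotient of \<open>flat c\<close> at 0 is
        \<open>flat (Suc c) h\<close>.\<close>
      show "((\<lambda>h. (flat c (0 + h) - flat c 0) / h) \<longlongrightarrow> 0) (at_right 0)"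
        by (rule Lim_transform_eventually[OF flat_tendsto_0[of "Suc c"]])
          (simp add: eventually_at_filter flat_def)
    qed
    with 2 show ?thesis by (simp add: DERIV_def flat_def)
  next
    case 3
    have inv: "((\<lambda>t. inverse t) has_real_derivative - (inverse t * inverse t)) (at t)"
      using 3 by (auto intro!: derivative_eq_intros simp: power2_eq_square)
    have e: "((\<lambda>t. exp (- inverse t)) has_real_derivative (inverse t * inverse t) * exp (- inverse t)) (at t)"
      using DERIV_chain2[OF DERIV_exp DERIV_minus[OF inv]] by (simp add: mult.commute)
    have "((\<lambda>t. inverse t ^ c * exp (- inverse t)) has_real_derivative
        - real c * (inverse t ^ Suc c * exp (- inverse t)) + inverse t ^ Suc (Suc c) * exp (- inverse t)) (at t)"
    proof (cases c)
      case 0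
      then show ?thesis using e by simp
    next
      case (Suc d)
      show ?thesis
        using DERIV_mult[OF DERIV_power[OF inv, of c] e] Suc by (simp add: algebra_simps)
    qed
    then have "((\<lambda>t. inverse t ^ c * exp (- inverse t)) has_real_derivative
        (- real c * flat (Suc c) t + flat (Suc (Suc c)) t)) (at t)"
      using 3 by (simp add: flat_def divide_inverse)
    then show ?thesis
      by (rule has_field_derivative_transform_within_open[where S="{0<..}"])
        (use 3 in \<open>auto simp: flat_def divide_inverse\<close>)
  qed
qed

lemma smooth_flat: "smooth (flat c)"
  unfolding smooth_def
proof
  fix k show "diff_times k (flat c)"
  proof (induction k arbitrary: c)
    case 0
    show ?case using flat_has_derivative[THEN DERIV_isCont]
      by (simp add: continuous_at_imp_continuous_on)
  next
    case (Suc k)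
    have "pd b (flat c) = (\<lambda>t. (b * - real c) * flat (Suc c) t + b * flat (Suc (Suc c)) t)" for b
      using pd_eqI[OF flat_has_derivative[of c, unfolded has_field_derivative_def]]
      by (auto simp: algebra_simps)
    moreover have "diff_times k (\<lambda>t. (b * - real c) * flat (Suc c) t + b * flat (Suc (Suc c)) t)" for b
      by (intro diff_times_lincomb Suc.IH)
    ultimately have "diff_times k (pd b (flat c))" for b by metis
    moreover have "flat c differentiable (at t)" for t
      using flat_has_derivative[of c t] real_differentiable_def by blast
    ultimately show ?case by simp
  qed
qed

lemma flat_0_bounds: "0 \<le> flat 0 t" "flat 0 t \<le> 1" "t \<le> 0 \<Longrightarrow> flat 0 t = 0"
  by (auto simp: flat_def)

lemma flat_0_pos: "0 < t \<Longrightarrow> 0 < flat 0 t"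
  by (simp add: flat_def)

text \<open>The argument tends to infinity, where exp (-1/x) tends to 1. The shift is 0 for cut-offs
  that vanish only outside the open interval and 1 for those that must vanish near its end points as
  well.\<close>

lemma flat_0_tendsto:
  assumes t: "0 < t"
  shows "(\<lambda>m. flat 0 (real m * t - c)) \<longlonglongrightarrow> 1"
proof -
  have "filterlim (\<lambda>m. real m * t) at_top sequentially"
    by (rule filterlim_at_top_mult_tendsto_pos[OF tendsto_const[of t] t filterlim_real_sequentially])
  then have *: "filterlim (\<lambda>m. - c + real m * t) at_top sequentially"
    by (rule filterlim_tendsto_add_at_top[OF tendsto_const])
  have "(\<lambda>m. inverse (- c + real m * t)) \<longlonglongrightarrow> 0"
    by (rule filterlim_compose[OF tendsto_inverse_0_at_top[OF filterlim_ident] *])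
  then have "(\<lambda>m. exp (- inverse (- c + real m * t))) \<longlonglongrightarrow> exp (- 0)"
    by (intro tendsto_exp tendsto_minus)
  then have lim: "(\<lambda>m. exp (- inverse (- c + real m * t))) \<longlonglongrightarrow> 1" by simp
  have "\<forall>\<^sub>F m in sequentially. 0 < - c + real m * t"
    using * unfolding filterlim_at_top_dense by blast
  then have "\<forall>\<^sub>F m in sequentially. exp (- inverse (- c + real m * t)) = flat 0 (real m * t - c)"
    by eventually_elim (simp add: flat_def divide_inverse)
  with lim show ?thesis by (rule Lim_transform_eventually)
qed

lemma smooth_flat_affine: "smooth (\<lambda>t::real. flat c (p + q * t))"
  using smooth_affine[OF bounded_linear_mult_right smooth_flat] .

definition cutoff :: "real \<Rightarrow> real \<Rightarrow> nat \<Rightarrow> real \<Rightarrow> real" where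
  "cutoff a b m t = flat 0 (real m * (t - a)) * flat 0 (real m * (b - t))"

lemma smooth_cutoff: "smooth (cutoff a b m)"
proof -
  have "smooth (\<lambda>t. flat 0 (- real m * a + real m * t) * flat 0 (real m * b + (- real m) * t))"
    by (intro smooth_mult smooth_flat_affine)
  then show ?thesis by (simp add: cutoff_def[abs_def] algebra_simps)
qed

lemma cutoff_bounds: "0 \<le> cutoff a b m t" "cutoff a b m t \<le> 1"
  by (auto simp: cutoff_def flat_0_bounds mult_le_one)

lemma cutoff_eq_0: "t \<notin> {a<..<b} \<Longrightarrow> cutoff a b m t = 0"
  by (auto simp: cutoff_def flat_0_bounds mult_nonneg_nonpos)

lemma cutoff_tendsto: "(\<lambda>m. cutoff a b m t) \<longlonglongrightarrow> indicator {a<..<b} t"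
proof (cases "t \<in> {a<..<b}")
  case True
  then have "(\<lambda>m. flat 0 (real m * (t - a)) * flat 0 (real m * (b - t))) \<longlonglongrightarrow> 1 * 1"
    using flat_0_tendsto[of "t - a" 0] flat_0_tendsto[of "b - t" 0] by (intro tendsto_mult) auto
  with True show ?thesis by (simp add: cutoff_def)
qed (simp add: cutoff_eq_0)

text \<open>These products suffice as test functions throughout: they converge to indicators of
  boxes, which generate the Borel sets, and they factor into a spatial and a temporal part, which
  makes their time antiderivatives explicit.\<close>

definition bump :: "'b::euclidean_space \<Rightarrow> 'b \<Rightarrow> nat \<Rightarrow> 'b \<Rightarrow> real" where
  "bump a b m z = (\<Prod>i\<in>Basis. cutoff (a \<bullet> i) (b \<bullet> i) m (z \<bullet> i))"

lemma smooth_bump: "smooth (bump a b m)"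
proof -
  have "smooth (\<lambda>z. \<Prod>i\<in>Basis. cutoff (a \<bullet> i) (b \<bullet> i) m (z \<bullet> i))"
    by (intro smooth_prod smooth_comp_linear[OF bounded_linear_inner_left smooth_cutoff]) auto
  then show ?thesis by (simp add: bump_def[abs_def])
qed

lemma bump_bounds: "0 \<le> bump a b m z" "bump a b m z \<le> 1"
  by (auto simp: bump_def cutoff_bounds intro!: prod_nonneg prod_le_1)

lemma bump_eq_0: "z \<notin> box a b \<Longrightarrow> bump a b m z = 0"
  by (auto simp: bump_def mem_box intro!: cutoff_eq_0)

lemma bump_tendsto: "(\<lambda>m. bump a b m z) \<longlonglongrightarrow> indicator (box a b) z"
proof -
  have "(\<lambda>m. bump a b m z) \<longlonglongrightarrow> (\<Prod>i\<in>Basis. indicator {a \<bullet> i<..<b \<bullet> i} (z \<bullet> i))"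
    unfolding bump_def by (intro tendsto_prod cutoff_tendsto)
  moreover have "(\<Prod>i\<in>Basis. indicator {a \<bullet> i<..<b \<bullet> i} (z \<bullet> i)) = (indicator (box a b) z :: real)"
    by (auto simp: indicator_def mem_box intro: prod.neutral)
  ultimately show ?thesis by simp
qed

lemma test_fun_bump: "cbox a b \<subseteq> U \<Longrightarrow> test_fun U (bump a b m)"
  unfolding test_fun_def
  by (intro conjI smooth_bump exI[of _ "cbox a b"] compact_cbox) (auto intro: bump_eq_0 simp: box_subset_cbox[THEN subsetD])

lemma bump_prod:
  fixes a b :: "'a::euclidean_space \<times> real"
  shows "bump a b m (x, t) = bump (fst a) (fst b) m x * cutoff (snd a) (snd b) m t"
proof -
  have "bump a b m (x, t) = (\<Prod>i\<in>(\<lambda>u. (u, 0)) ` Basis \<union> (\<lambda>u. (0, u)) ` Basis.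
      cutoff (a \<bullet> i) (b \<bullet> i) m ((x, t) \<bullet> i))"
    by (simp add: bump_def Basis_prod_def)
  also have "\<dots> = (\<Prod>i\<in>(\<lambda>u. (u, 0)) ` Basis. cutoff (a \<bullet> i) (b \<bullet> i) m ((x, t) \<bullet> i)) *
      (\<Prod>i\<in>(\<lambda>u. (0, u)) ` Basis. cutoff (a \<bullet> i) (b \<bullet> i) m ((x, t) \<bullet> i))"
    by (intro prod.union_disjoint) auto
  also have "\<dots> = bump (fst a) (fst b) m x * cutoff (snd a) (snd b) m t"
    by (cases a; cases b) (simp add: prod.reindex inj_on_def bump_def)
  finally show ?thesis .
qed

lemma test_fun_smooth: "test_fun U \<phi> \<Longrightarrow> smooth \<phi>"
  by (simp add: test_fun_def)

lemma test_fun_mono: "test_fun U \<phi> \<Longrightarrow> U \<subseteq> V \<Longrightarrow> test_fun V \<phi>"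
  by (auto simp: test_fun_def)

lemma test_fun_mult_left: "test_fun U f \<Longrightarrow> smooth g \<Longrightarrow> test_fun U (\<lambda>z. g z * f z)"
  unfolding test_fun_def by (auto intro!: smooth_mult)

lemma pd_zero_outside:
  assumes "closed K" "\<And>z. z \<notin> K \<Longrightarrow> f z = 0" "z \<notin> K"
  shows "pd b f z = 0"
proof -
  have "((\<lambda>z. 0) has_derivative (\<lambda>h. 0)) (at z)" by simp
  then have "(f has_derivative (\<lambda>h. 0)) (at z)"
    by (rule has_derivative_transform_within_open[OF _ open_Compl[OF assms(1)]]) (use assms in auto)
  then show ?thesis by (rule pd_eqI)
qed

lemma test_fun_pd: "test_fun U f \<Longrightarrow> b \<in> Basis \<Longrightarrow> test_fun U (pd b f)"
  unfolding test_fun_def using pd_zero_outside[OF compact_imp_closed] smooth_pd by blast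

section \<open>Integration by parts\<close>

lemma pd_line_derivative:
  assumes "f differentiable (at (z + s *\<^sub>R b))"
  shows "((\<lambda>s. f (z + s *\<^sub>R b)) has_real_derivative pd b f (z + s *\<^sub>R b)) (at s)"
proof -
  have "((\<lambda>s. z + s *\<^sub>R b) has_derivative (\<lambda>h. h *\<^sub>R b)) (at s)"
    by (auto intro!: derivative_eq_intros)
  from diff_chain_at[OF this differentiable_has_frechet[OF assms]]
  have *: "((\<lambda>s. f (z + s *\<^sub>R b)) has_derivative (\<lambda>h. frechet_derivative f (at (z + s *\<^sub>R b)) (h *\<^sub>R b))) (at s)"
    by (simp add: o_def)
  have "linear (frechet_derivative f (at (z + s *\<^sub>R b)))"
    by (rule linear_frechet_derivative[OF assms])
  then have "(\<lambda>h. frechet_derivative f (at (z + s *\<^sub>R b)) (h *\<^sub>R b)) = (\<lambda>h. pd b f (z + s *\<^sub>R b) * h)"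
    by (auto simp: linear_cmul pd_def)
  with * show ?thesis by (simp add: has_field_derivative_def)
qed

lemma integrable_compact_support:
  fixes f :: "'b::euclidean_space \<Rightarrow> real"
  assumes "continuous_on UNIV f" "compact K" "\<And>z. z \<notin> K \<Longrightarrow> f z = 0"
  shows "integrable lborel f"
proof -
  have "integrable lborel (\<lambda>z. indicator K z *\<^sub>R f z)"
    using assms by (intro borel_integrable_compact) (auto intro: continuous_on_subset)
  moreover have "(\<lambda>z. indicator K z *\<^sub>R f z) = f"
    using assms(3) by (intro ext) (case_tac "z \<in> K", auto)
  ultimately show ?thesis by simp
qed

lemma bounded_compact_support:
  fixes f :: "'b::euclidean_space \<Rightarrow> real"
  assumes "continuous_on UNIV f" "compact K" "\<And>z. z \<notin> K \<Longrightarrow> f z = 0"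
  obtains M where "0 < M" "\<And>z. \<bar>f z\<bar> \<le> M"
proof -
  have "bounded (f ` K)"
    using assms by (intro compact_imp_bounded compact_continuous_image) (auto intro: continuous_on_subset)
  then obtain M where "0 < M" "\<forall>y\<in>f ` K. norm y \<le> M" using bounded_pos by blast
  then show ?thesis using assms(3) by (intro that[of M]) (force simp: image_iff)+
qed

lemma lborel_integral_translate:
  fixes f :: "'b::euclidean_space \<Rightarrow> real"
  assumes "integrable lborel f"
  shows "integrable lborel (\<lambda>z. f (c + z))" "(\<integral>z. f (c + z) \<partial>lborel) = (\<integral>z. f z \<partial>lborel)"
proof -
  have eq: "lborel = distr lborel borel (\<lambda>z. c + z)"
    using lborel_affine[of 1 c] by (simp add: density_1 one_ennreal_def[symmetric])
  have f: "integrable (distr lborel borel (\<lambda>z. c + z)) f" using assms eq by simp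
  show "integrable lborel (\<lambda>z. f (c + z))"
    using f by (subst (asm) integrable_distr_eq) (use assms in auto)
  have "(\<integral>z. f z \<partial>lborel) = (\<integral>z. f z \<partial>(distr lborel borel (\<lambda>z. c + z)))" using eq by simp
  also have "\<dots> = (\<integral>z. f (c + z) \<partial>lborel)" by (rule integral_distr) (use assms in auto)
  finally show "(\<integral>z. f (c + z) \<partial>lborel) = (\<integral>z. f z \<partial>lborel)" ..
qed

text \<open>Difference quotients of an integrable function have integral zero by translation
  invariance, and dominated convergence carries this over to the derivative.\<close>

lemma integral_pd_eq_0:
  fixes f :: "'b::euclidean_space \<Rightarrow> real"
  assumes f: "smooth f" and b: "b \<in> Basis" and K: "compact K" "\<And>z. z \<notin> K \<Longrightarrow> f z = 0"
  shows "(\<integral>z. pd b f z \<partial>lborel) = 0"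
proof -
  have contf: "continuous_on UNIV f" and contp: "continuous_on UNIV (pd b f)"
    using f smooth_pd[OF f b] by (auto intro: smooth_continuous)
  have K0: "pd b f z = 0" if "z \<notin> K" for z
    using pd_zero_outside[OF compact_imp_closed[OF K(1)]] K(2) that by blast
  obtain M where M: "0 < M" "\<And>z. \<bar>pd b f z\<bar> \<le> M" using bounded_compact_support[OF contp K(1) K0] by blast
  obtain R where R: "\<And>z. z \<in> K \<Longrightarrow> norm z \<le> R" using compact_imp_bounded[OF K(1)] bounded_pos by metis
  define d where "d n z = (f (inverse (real (Suc n)) *\<^sub>R b + z) - f z) * real (Suc n)" for n z
  have int: "integrable lborel f" by (rule integrable_compact_support[OF contf K])
  have d0: "(\<integral>z. d n z \<partial>lborel) = 0" for n
    unfolding d_def using lborel_integral_translate[OF int] int by simp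
  have lim: "(\<lambda>n. \<integral>z. d n z \<partial>lborel) \<longlonglongrightarrow> (\<integral>z. pd b f z \<partial>lborel)"
  proof (rule integral_dominated_convergence)
    show "pd b f \<in> borel_measurable lborel" using contp by (simp add: borel_measurable_continuous_onI)
    have [measurable]: "f \<in> borel_measurable borel" using contf by (simp add: borel_measurable_continuous_onI)
    show "d n \<in> borel_measurable lborel" for n unfolding d_def by measurable
    \<comment> \<open>The steps have length at most 1, so all difference quotients vanish outside
      the ball of radius R + 1; inside it the mean value theorem bounds them by M.\<close>
    show "integrable lborel (\<lambda>z. M * indicator (cball 0 (R + 1)) z)"
      by (intro integrable_mult_right integrable_real_indicator) (use emeasure_bounded_finite[of "cball 0 (R + 1)"] in auto)
    show "AE z in lborel. (\<lambda>n. d n z) \<longlonglongrightarrow> pd b f z"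
    proof (rule AE_I2)
      fix z
      have "((\<lambda>h. (f (z + h *\<^sub>R b) - f z) / h) \<longlongrightarrow> pd b f z) (at 0)"
        using pd_line_derivative[of f z 0 b] smooth_differentiable[OF f] by (simp add: DERIV_def)
      moreover have "filterlim (\<lambda>n. inverse (real (Suc n))) (at 0) sequentially"
        using LIMSEQ_inverse_real_of_nat by (simp add: filterlim_at)
      ultimately have "(\<lambda>n. (f (z + inverse (real (Suc n)) *\<^sub>R b) - f z) / inverse (real (Suc n))) \<longlonglongrightarrow> pd b f z"
        by (rule filterlim_compose)
      then show "(\<lambda>n. d n z) \<longlonglongrightarrow> pd b f z" by (simp add: d_def[abs_def] add.commute divide_inverse)
    qed
    show "AE z in lborel. norm (d n z) \<le> M * indicator (cball 0 (R + 1)) z" for n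
    proof (rule AE_I2)
      fix z
      define h where "h = inverse (real (Suc n))"
      have h: "0 < h" "h \<le> 1" by (auto simp: h_def field_simps)
      show "norm (d n z) \<le> M * indicator (cball 0 (R + 1)) z"
      proof (cases "norm z \<le> R + 1")
        case True
        have "\<exists>s>0. s < h \<and> f (z + h *\<^sub>R b) - f (z + 0 *\<^sub>R b) = (h - 0) * pd b f (z + s *\<^sub>R b)"
          using h(1) pd_line_derivative[OF smooth_differentiable[OF f]] by (intro MVT2) auto
        then obtain s where "f (z + h *\<^sub>R b) - f z = h * pd b f (z + s *\<^sub>R b)" by auto
        then have "d n z = pd b f (z + s *\<^sub>R b)"
          using h by (simp add: d_def h_def[symmetric] add.commute) (simp add: h_def)
        with M True show ?thesis by (auto simp: indicator_def dist_norm)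
      next
        case False
        have "norm (h *\<^sub>R b) \<le> 1" using b h by simp
        then have "norm (h *\<^sub>R b + z) > R" using False norm_diff_ineq[of z "h *\<^sub>R b"] by (simp add: add.commute)
        then have "f (h *\<^sub>R b + z) = 0" using K(2) R by force
        moreover have "f z = 0" using K(2) R False by force
        ultimately show ?thesis using False by (simp add: d_def h_def indicator_def dist_norm)
      qed
    qed
  qed
  then show ?thesis using d0 by (simp add: LIMSEQ_const_iff)
qed

section \<open>The fundamental lemma of the calculus of variations\<close>

text \<open>The sets over which h integrates to zero form a Dynkin system. It contains the boxes,
  which are stable under intersection, hence all Borel sets.\<close>

lemma AE_zero_from_boxes:
  fixes h :: "'b::euclidean_space \<Rightarrow> real"
  assumes h: "integrable lborel h"
    and box0: "\<And>a b. (\<integral>z. indicator (box a b) z * h z \<partial>lborel) = 0"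
  shows "AE z in lborel. h z = 0"
proof -
  have [measurable]: "h \<in> borel_measurable borel" using h by auto
  have int: "integrable lborel (\<lambda>z. indicator A z * h z)" if "A \<in> sets borel" for A
    using integrable_mult_indicator[of A lborel h] that h by simp
  \<comment> \<open>Complements require that the whole space is among these sets; it is exhausted by
    centred boxes.\<close>
  have univ: "(\<integral>z. h z \<partial>lborel) = 0"
  proof -
    have "(\<lambda>n. \<integral>z. indicator (box (- real n *\<^sub>R One) (real n *\<^sub>R One)) z * h z \<partial>lborel) \<longlonglongrightarrow> (\<integral>z. h z \<partial>lborel)"
    proof (rule integral_dominated_convergence[where w="\<lambda>z. \<bar>h z\<bar>"])
      show "AE z in lborel. (\<lambda>n. indicator (box (- real n *\<^sub>R One) (real n *\<^sub>R One)) z * h z) \<longlonglongrightarrow> h z"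
      proof (rule AE_I2)
        fix z :: 'b
        obtain N where N: "norm z < real N" using reals_Archimedean2 by blast
        have "z \<in> box (- real n *\<^sub>R One) (real n *\<^sub>R One)" if "n \<ge> N" for n
          unfolding mem_box
        proof
          fix i :: 'b assume "i \<in> Basis"
          then have "\<bar>z \<bullet> i\<bar> < real n" using Basis_le_norm[of i z] N that by linarith
          with \<open>i \<in> Basis\<close> show "(- real n *\<^sub>R One) \<bullet> i < z \<bullet> i \<and> z \<bullet> i < (real n *\<^sub>R One) \<bullet> i" by auto
        qed
        then have "\<forall>\<^sub>F n in sequentially. h z = indicator (box (- real n *\<^sub>R One) (real n *\<^sub>R One)) z * h z"
          by (intro eventually_sequentiallyI[of N]) simp
        then show "(\<lambda>n. indicator (box (- real n *\<^sub>R One) (real n *\<^sub>R One)) z * h z) \<longlonglongrightarrow> h z"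
          by (rule Lim_transform_eventually[OF tendsto_const])
      qed
    qed (use h in \<open>auto simp: indicator_def\<close>)
    then show ?thesis using box0 by (simp add: LIMSEQ_const_iff)
  qed
  have stable: "Int_stable (range (\<lambda>(a, b). box a b :: 'b set))"
  proof (rule Int_stableI)
    fix A B :: "'b set"
    assume "A \<in> range (\<lambda>(a, b). box a b)" "B \<in> range (\<lambda>(a, b). box a b)"
    then obtain a b c d where "A = box a b" "B = box c d" by auto
    then obtain p q where "A \<inter> B = box p q" using box_Int_box by blast
    then show "A \<inter> B \<in> range (\<lambda>(a, b). box a b)" by (auto intro: range_eqI[of _ _ "(p, q)"])
  qed
  have sb: "sigma_sets UNIV (range (\<lambda>(a, b). box a b :: 'b set)) = sets borel"
    by (subst borel_eq_box) (simp add: sets_measure_of)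
  have "A \<in> sigma_sets UNIV (range (\<lambda>(a, b). box a b)) \<Longrightarrow> (\<integral>z. indicator A z * h z \<partial>lborel) = 0" for A :: "'b set"
  proof (induction rule: sigma_sets_induct_disjoint[rotated 2, consumes 1, case_names basic empty compl union])
    case basic
    then show ?case using box0 by auto
  next
    case empty
    then show ?case by simp
  next
    case (compl A)
    then have A: "A \<in> sets borel" using sb by simp
    have "(\<integral>z. indicator (UNIV - A) z * h z \<partial>lborel) = (\<integral>z. h z - indicator A z * h z \<partial>lborel)"
      by (intro Bochner_Integration.integral_cong) (auto simp: indicator_def)
    then show ?case using univ compl h int[OF A] by simp
  next
    case (union A)
    then have A: "A i \<in> sets borel" for i using sb by auto
    have "(\<lambda>n. \<integral>z. indicator (\<Union>i<n. A i) z * h z \<partial>lborel) \<longlonglongrightarrow> (\<integral>z. indicator (\<Union>i. A i) z * h z \<partial>lborel)"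
    proof (rule integral_dominated_convergence[where w="\<lambda>z. \<bar>h z\<bar>"])
      show "AE z in lborel. (\<lambda>n. indicator (\<Union>i<n. A i) z * h z) \<longlonglongrightarrow> indicator (\<Union>i. A i) z * h z"
        by (intro AE_I2 tendsto_intros LIMSEQ_indicator_UN)
    qed (use h A in \<open>auto simp: indicator_def\<close>)
    moreover have "(\<integral>z. indicator (\<Union>i<n. A i) z * h z \<partial>lborel) = 0" for n
    proof -
      have "(\<integral>z. indicator (\<Union>i<n. A i) z * h z \<partial>lborel) = (\<integral>z. (\<Sum>i<n. indicator (A i) z * h z) \<partial>lborel)"
      proof (intro Bochner_Integration.integral_cong refl)
        fix z
        have "indicator (\<Union>i<n. A i) z = (\<Sum>i<n. indicator (A i) z :: real)"
          using union(1) by (intro indicator_UN_disjoint) (auto simp: disjoint_family_on_def)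
        then show "indicator (\<Union>i<n. A i) z * h z = (\<Sum>i<n. indicator (A i) z * h z)"
          by (simp add: sum_distrib_right)
      qed
      also have "\<dots> = (\<Sum>i<n. \<integral>z. indicator (A i) z * h z \<partial>lborel)"
        by (intro Bochner_Integration.integral_sum int A)
      finally show ?thesis using union by simp
    qed
    ultimately show ?case by (simp add: LIMSEQ_const_iff)
  qed (use stable in auto)
  then have "(\<integral>z. indicator A z * h z \<partial>lborel) = 0" if "A \<in> sets borel" for A
    using that sb by simp
  then have "set_lebesgue_integral lborel A h = set_lebesgue_integral lborel A (\<lambda>z. 0)" if "A \<in> sets lborel" for A
    using that by (simp add: set_lebesgue_integral_def)
  from density_unique_real[OF h integrable_zero this] show ?thesis by simp
qed

section \<open>Functions on an open set as functions on the whole space\<close>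

lemma integral_leb: "open U \<Longrightarrow> (\<integral>z. f z \<partial>leb U) = (\<integral>z. indicator U z * f z \<partial>lborel)"
  for f :: "'b::euclidean_space \<Rightarrow> real"
  by (simp add: integral_restrict_space)

lemma integrable_leb: "open U \<Longrightarrow> integrable (leb U) f \<longleftrightarrow> integrable lborel (\<lambda>z. indicator U z * f z)"
  for f :: "'b::euclidean_space \<Rightarrow> real"
  by (simp add: integrable_restrict_space)

lemma measurable_leb:
  "open U \<Longrightarrow> f \<in> borel_measurable (leb U) \<longleftrightarrow> (\<lambda>z. indicator U z * f z) \<in> borel_measurable borel"
  for f :: "'b::euclidean_space \<Rightarrow> real"
  by (simp add: borel_measurable_restrict_space_iff)

lemma AE_leb: "open U \<Longrightarrow> (AE z in leb U. P z) \<longleftrightarrow> (AE z in lborel. z \<in> U \<longrightarrow> P z)"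
  for U :: "'b::euclidean_space set"
  by (simp add: AE_restrict_space_iff)

lemma indicator_mult_power2: "(indicator U z * f z)\<^sup>2 = indicator U z * (f z)\<^sup>2" for f :: "'b \<Rightarrow> real"
  by (simp add: indicator_def)

lemma L2_leb: "open U \<Longrightarrow> L2 (leb U) f \<longleftrightarrow> L2 lborel (\<lambda>z. indicator U z * f z)"
  for f :: "'b::euclidean_space \<Rightarrow> real"
  by (simp add: L2_def measurable_leb integrable_leb indicator_mult_power2)

lemma L2norm_leb: "open U \<Longrightarrow> L2norm (leb U) f = L2norm lborel (\<lambda>z. indicator U z * f z)"
  for f :: "'b::euclidean_space \<Rightarrow> real"
  unfolding L2norm_def
  by (subst integral_leb) (auto simp: indicator_mult_power2)

lemma L2_indicator:
  assumes "A \<in> sets M" "emeasure M A < \<infinity>"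
  shows "L2 M (indicator A)"
proof -
  have "(\<lambda>z. (indicator A z :: real)\<^sup>2) = indicator A" by (auto simp: indicator_def)
  then show ?thesis using assms by (auto simp: L2_def intro!: integrable_real_indicator)
qed

lemma finite_measure_leb:
  "open U \<Longrightarrow> bounded U \<Longrightarrow> finite_measure (leb U)" for U :: "'b::euclidean_space set"
  using emeasure_bounded_finite[of U]
  by (intro finite_measureI) (simp add: emeasure_restrict_space space_restrict_space)

lemma integrable_leb_continuous_mult:
  fixes u f :: "'b::euclidean_space \<Rightarrow> real"
  assumes "open U" "L2 (leb U) u" "continuous_on UNIV f" "compact K" "\<And>z. z \<notin> K \<Longrightarrow> f z = 0"
  shows "L2 (leb U) f" "integrable (leb U) (\<lambda>z. u z * f z)"
proof -
  have "integrable lborel (\<lambda>z. f z * f z)"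
    using assms by (intro integrable_compact_support[of _ K]) (auto intro: continuous_intros)
  then have "integrable lborel (\<lambda>z. indicator U z *\<^sub>R (f z * f z))"
    using assms by (intro integrable_mult_indicator) auto
  then show f: "L2 (leb U) f"
    using assms borel_measurable_continuous_onI[OF assms(3)]
    by (auto simp: L2_def integrable_leb measurable_leb power2_eq_square)
  show "integrable (leb U) (\<lambda>z. u z * f z)" by (rule L2_mult_integrable[OF assms(2) f])
qed

lemma test_fun_L2: "open V \<Longrightarrow> test_fun U \<phi> \<Longrightarrow> L2 (leb V) \<phi>"
  unfolding test_fun_def using integrable_leb_continuous_mult(1)[OF _ L2_zero smooth_continuous] by blast

text \<open>Bumps converge boundedly to indicators of boxes, so g integrates to zero over every box
  whose closure lies in U. A countable cover of U by closed boxes localizes the problem to sets of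
  finite measure, on which g is integrable and \<open>AE_zero_from_boxes\<close> applies.\<close>

lemma fundamental_lemma:
  fixes g :: "'b::euclidean_space \<Rightarrow> real"
  assumes U: "open U" and g: "L2 (leb U) g"
    and orth: "\<And>a b m. cbox a b \<subseteq> U \<Longrightarrow> (\<integral>z. g z * bump a b m z \<partial>leb U) = 0"
  shows "AE z in leb U. g z = 0"
proof -
  obtain D where D: "countable D" "D \<subseteq> Pow U" "\<And>X. X \<in> D \<Longrightarrow> \<exists>a b. X = cbox a b" "\<Union>D = U"
    using open_countable_Union_open_cbox[OF U] by metis
  have box0: "(\<integral>z. indicator (box a b) z * (indicator U z * g z) \<partial>lborel) = 0"
    if ab: "cbox a b \<subseteq> U" for a b
  proof -
    have gm: "g \<in> borel_measurable (leb U)" using g by (simp add: L2_def)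
    have 1: "L2 (leb U) (indicator (cbox a b))"
      using U ab by (intro L2_indicator)
        (auto simp: sets_restrict_space_iff emeasure_restrict_space emeasure_lborel_cbox_eq)
    from L2_mult_integrable[OF g 1]
    have int: "integrable (leb U) (\<lambda>z. \<bar>g z * indicator (cbox a b) z\<bar>)" by (intro integrable_abs)
    have "(\<lambda>m. \<integral>z. g z * bump a b m z \<partial>leb U) \<longlonglongrightarrow> (\<integral>z. g z * indicator (box a b) z \<partial>leb U)"
    proof (rule integral_dominated_convergence[OF _ _ int])
      show "(\<lambda>z. g z * indicator (box a b) z) \<in> borel_measurable (leb U)"
        using gm U by (intro borel_measurable_times) (auto simp: measurable_leb)
      show "(\<lambda>z. g z * bump a b m z) \<in> borel_measurable (leb U)" for m
        using gm borel_measurable_continuous_onI[OF smooth_continuous[OF smooth_bump[of a b m]]]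
        by (intro borel_measurable_times) (auto intro: measurable_restrict_space1)
      show "AE z in leb U. (\<lambda>m. g z * bump a b m z) \<longlonglongrightarrow> g z * indicator (box a b) z"
        by (intro AE_I2 tendsto_intros bump_tendsto)
      have "\<bar>bump a b m z\<bar> \<le> indicator (cbox a b) z" for m z
        using bump_bounds[of a b m z] bump_eq_0[of z a b m] box_subset_cbox[of a b] by (auto simp: indicator_def)
      then show "AE z in leb U. norm (g z * bump a b m z) \<le> \<bar>g z * indicator (cbox a b) z\<bar>" for m
        by (auto simp: abs_mult intro!: mult_left_mono)
    qed
    with orth[OF ab] have "(\<integral>z. g z * indicator (box a b) z \<partial>leb U) = 0"
      by (simp add: LIMSEQ_const_iff)
    then show ?thesis by (simp add: integral_leb[OF U] algebra_simps)
  qed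
  have loc: "AE z in lborel. z \<in> X \<longrightarrow> g z = 0" if XD: "X \<in> D" for X
  proof -
    obtain a b where X: "X = cbox a b" using D(3)[OF XD] by blast
    have ab: "cbox a b \<subseteq> U" using D(2) XD X by blast
    define h where "h z = indicator (cbox a b) z * (indicator U z * g z)" for z
    have 1: "L2 lborel (indicator (cbox a b))"
      by (intro L2_indicator) (auto simp: emeasure_lborel_cbox_eq)
    \<comment> \<open>The cover consists of closed boxes whereas bumps only detect open ones; the
      faces in between form a null set.\<close>
    have "cbox a b - box a b \<in> null_sets lborel"
      using negligible_frontier_interval[of a b] by (simp add: negligible_iff_null_sets null_sets_completion_iff)
    then have bdry: "AE z in lborel. z \<notin> cbox a b - box a b" by (rule AE_not_in)
    have "integrable lborel h"
      unfolding h_def using L2_mult_integrable[OF 1] g U by (simp add: L2_leb)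
    moreover have "(\<integral>z. indicator (box c d) z * h z \<partial>lborel) = 0" for c d
    proof -
      obtain p q where pq: "box a b \<inter> box c d = box p q" using box_Int_box by blast
      have "(\<integral>z. indicator (box c d) z * h z \<partial>lborel)
          = (\<integral>z. indicator (box p q) z * (indicator U z * g z) \<partial>lborel)"
      proof (rule integral_cong_AE)
        show "AE z in lborel. indicator (box c d) z * h z = indicator (box p q) z * (indicator U z * g z)"
          using bdry
          by eventually_elim (auto simp: h_def pq[symmetric] indicator_def dest: subsetD[OF box_subset_cbox])
      qed (use g U in \<open>auto simp: h_def L2_def measurable_leb\<close>)
      also have "\<dots> = 0"
      \<comment> \<open>The closure of an open box is the corresponding closed box only if the open
        box is nonempty.\<close>
      proof (cases "box p q = {}")
        case False
        then have "cbox p q \<subseteq> cbox a b"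
          using closure_mono[of "box p q" "cbox a b"] pq box_subset_cbox[of a b] by (auto simp: closure_box)
        then show ?thesis using box0[of p q] ab by blast
      qed simp
      finally show ?thesis .
    qed
    ultimately have "AE z in lborel. h z = 0" by (rule AE_zero_from_boxes)
    then show ?thesis
      by eventually_elim (use ab X in \<open>auto simp: h_def indicator_def split: if_splits\<close>)
  qed
  have "AE z in lborel. \<forall>X\<in>D. z \<in> X \<longrightarrow> g z = 0"
    unfolding AE_ball_countable[OF D(1)] using loc by blast
  then show ?thesis unfolding AE_leb[OF U] by (rule eventually_mono) (use D(4) in auto)
qed

section \<open>Weak derivatives\<close>

text \<open>The product of \<phi> and \<eta> inherits the compact support of \<eta>, so its
  derivative integrates to zero; the product rule splits this integral.\<close>

lemma integral_by_parts_test_fun: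
  fixes \<phi> \<eta> :: "'b::euclidean_space \<Rightarrow> real"
  assumes U: "open U" and b: "b \<in> Basis" and \<phi>: "smooth \<phi>" and \<eta>: "test_fun U \<eta>"
  shows "(\<integral>z. \<phi> z * pd b \<eta> z \<partial>leb U) = - (\<integral>z. pd b \<phi> z * \<eta> z \<partial>leb U)"
proof -
  obtain K where K: "compact K" "K \<subseteq> U" "\<And>z. z \<notin> K \<Longrightarrow> \<eta> z = 0" and s\<eta>: "smooth \<eta>"
    using \<eta> by (auto simp: test_fun_def)
  have K': "pd b \<eta> z = 0" if "z \<notin> K" for z
    using pd_zero_outside[OF compact_imp_closed[OF K(1)]] K(3) that by blast
  have "(\<integral>z. pd b (\<lambda>z. \<phi> z * \<eta> z) z \<partial>lborel) = 0"
    by (rule integral_pd_eq_0[OF smooth_mult[OF \<phi> s\<eta>] b K(1)]) (simp add: K(3))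
  moreover have "pd b (\<lambda>z. \<phi> z * \<eta> z) z = \<phi> z * pd b \<eta> z + pd b \<phi> z * \<eta> z" for z
    by (intro pd_mult smooth_differentiable \<phi> s\<eta>)
  moreover have "integrable lborel (\<lambda>z. \<phi> z * pd b \<eta> z)"
    by (rule integrable_compact_support[OF _ K(1)])
      (auto simp: K' intro!: smooth_mult smooth_continuous \<phi> smooth_pd[OF s\<eta> b])
  moreover have "integrable lborel (\<lambda>z. pd b \<phi> z * \<eta> z)"
    by (rule integrable_compact_support[OF _ K(1)])
      (auto simp: K intro!: smooth_mult smooth_continuous s\<eta> smooth_pd[OF \<phi> b])
  ultimately have "(\<integral>z. \<phi> z * pd b \<eta> z \<partial>lborel) + (\<integral>z. pd b \<phi> z * \<eta> z \<partial>lborel) = 0"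
    by simp
  moreover have "(\<integral>z. \<phi> z * pd b \<eta> z \<partial>leb U) = (\<integral>z. \<phi> z * pd b \<eta> z \<partial>lborel)"
    unfolding integral_leb[OF U] using K(2) K'
    by (intro Bochner_Integration.integral_cong) (auto simp: indicator_def)
  moreover have "(\<integral>z. pd b \<phi> z * \<eta> z \<partial>leb U) = (\<integral>z. pd b \<phi> z * \<eta> z \<partial>lborel)"
    unfolding integral_leb[OF U] using K(2,3)
    by (intro Bochner_Integration.integral_cong) (auto simp: indicator_def)
  ultimately show ?thesis by simp
qed

lemma is_wderiv_L2: "is_wderiv U b u g \<Longrightarrow> L2 (leb U) g"
  by (simp add: is_wderiv_def)

lemma is_wderivD:
  "is_wderiv U b u g \<Longrightarrow> test_fun U \<phi> \<Longrightarrow> (\<integral>z. u z * pd b \<phi> z \<partial>leb U) = - (\<integral>z. g z * \<phi> z \<partial>leb U)"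
  by (simp add: is_wderiv_def)

lemma is_wderiv_unique:
  assumes U: "open U" and g: "is_wderiv U b u g" "is_wderiv U b u g'"
  shows "AE z in leb U. g z = g' z"
proof -
  have L: "L2 (leb U) g" "L2 (leb U) g'" using g by (auto simp: is_wderiv_def)
  have "AE z in leb U. g z - g' z = 0"
  proof (rule fundamental_lemma[OF U L2_diff[OF L]])
    fix p q :: 'a and m assume "cbox p q \<subseteq> U"
    then have t: "test_fun U (bump p q m)" by (rule test_fun_bump)
    have B: "L2 (leb U) (bump p q m)" by (rule test_fun_L2[OF U t])
    show "(\<integral>z. (g z - g' z) * bump p q m z \<partial>leb U) = 0"
      using is_wderivD[OF g(1) t] is_wderivD[OF g(2) t] L2_mult_integrable[OF L(1) B] L2_mult_integrable[OF L(2) B]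
      by (simp add: left_diff_distrib)
  qed
  then show ?thesis by simp
qed

lemma is_wderiv_wderiv: "u \<in> H1 U \<Longrightarrow> b \<in> Basis \<Longrightarrow> is_wderiv U b u (wderiv U b u)"
  unfolding wderiv_def H1_def by (auto intro: someI_ex[where P="is_wderiv U b u"])

lemma wderiv_L2: "u \<in> H1 U \<Longrightarrow> b \<in> Basis \<Longrightarrow> L2 (leb U) (wderiv U b u)"
  by (rule is_wderiv_L2[OF is_wderiv_wderiv])

lemma H1_L2: "u \<in> H1 U \<Longrightarrow> L2 (leb U) u"
  by (simp add: H1_def)

text \<open>\<open>wderiv\<close> is an arbitrary choice among the representatives of the weak
  derivative. This is the bridge by which a derivative found explicitly replaces the chosen one, at
  the price of a null set.\<close>

lemma wderiv_AE_eq: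
  assumes "open U" "is_wderiv U b u g"
  shows "AE z in leb U. wderiv U b u z = g z"
proof (rule is_wderiv_unique[OF assms(1) _ assms(2)])
  show "is_wderiv U b u (wderiv U b u)" unfolding wderiv_def using assms(2) by (rule someI[where P="is_wderiv U b u"])
qed

lemma is_wderiv_lincomb:
  assumes U: "open U" and b: "b \<in> Basis" and u: "L2 (leb U) u" "is_wderiv U b u g" and v: "L2 (leb U) v" "is_wderiv U b v h"
  shows "is_wderiv U b (\<lambda>z. a * u z + c * v z) (\<lambda>z. a * g z + c * h z)"
  unfolding is_wderiv_def
proof (intro conjI allI impI)
  show "L2 (leb U) (\<lambda>z. a * g z + c * h z)" using u v by (intro L2_lincomb is_wderiv_L2)
  fix \<phi> assume t: "test_fun U \<phi>"
  have \<phi>: "L2 (leb U) \<phi>" "L2 (leb U) (pd b \<phi>)"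
    using test_fun_L2[OF U t] test_fun_L2[OF U test_fun_pd[OF t b]] .
  show "(\<integral>z. (a * u z + c * v z) * pd b \<phi> z \<partial>leb U) = - (\<integral>z. (a * g z + c * h z) * \<phi> z \<partial>leb U)"
    using is_wderivD[OF u(2) t] is_wderivD[OF v(2) t]
    by (simp add: L2_integral_lincomb_mult[OF u(1) v(1) \<phi>(2)] L2_integral_lincomb_mult[OF is_wderiv_L2[OF u(2)] is_wderiv_L2[OF v(2)] \<phi>(1)])
qed

lemma is_wderiv_AE_cong:
  assumes "is_wderiv U b u g" "AE z in leb U. u z = v z" "AE z in leb U. g z = h z"
    and "v \<in> borel_measurable (leb U)" "u \<in> borel_measurable (leb U)" "h \<in> borel_measurable (leb U)"
    and U: "open U" and b: "b \<in> Basis"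
  shows "is_wderiv U b v h"
  unfolding is_wderiv_def
proof (intro conjI allI impI)
  have g: "L2 (leb U) g" using assms(1) by (rule is_wderiv_L2)
  show "L2 (leb U) h" by (rule L2_AE_cong[OF g assms(3,6)])
  fix \<phi> assume t: "test_fun U \<phi>"
  have m: "\<phi> \<in> borel_measurable (leb U)" "pd b \<phi> \<in> borel_measurable (leb U)"
    using L2_measurable[OF test_fun_L2[OF U t]] L2_measurable[OF test_fun_L2[OF U test_fun_pd[OF t b]]] .
  have "(\<integral>z. v z * pd b \<phi> z \<partial>leb U) = (\<integral>z. u z * pd b \<phi> z \<partial>leb U)"
    using assms m by (intro integral_cong_AE) auto
  also have "\<dots> = - (\<integral>z. g z * \<phi> z \<partial>leb U)" by (rule is_wderivD[OF assms(1) t])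
  also have "(\<integral>z. g z * \<phi> z \<partial>leb U) = (\<integral>z. h z * \<phi> z \<partial>leb U)"
    using assms m L2_measurable[OF g] by (intro integral_cong_AE) auto
  finally show "(\<integral>z. v z * pd b \<phi> z \<partial>leb U) = - (\<integral>z. h z * \<phi> z \<partial>leb U)" .
qed

lemma L2_leb_mono:
  assumes "open U" "open V" "V \<subseteq> U" "L2 (leb U) g"
  shows "L2 (leb V) g" "L2norm (leb V) g \<le> L2norm (leb U) g"
proof -
  have eq: "(\<lambda>z. indicator V z * (indicator U z * g z)) = (\<lambda>z. indicator V z * g z)"
    by (rule ext) (use assms(3) in \<open>auto split: split_indicator\<close>)
  have int: "L2 lborel (\<lambda>z. indicator U z * g z)" using assms by (simp add: L2_leb)
  have "L2 lborel (\<lambda>z. indicator V z * (indicator U z * g z))"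
    by (intro L2_bounded_mult[OF int, where C=1]) (use assms(2) in \<open>auto split: split_indicator\<close>)
  then show V: "L2 (leb V) g" using assms eq by (simp add: L2_leb)
  show "L2norm (leb V) g \<le> L2norm (leb U) g"
    unfolding L2norm_def
  proof (intro real_sqrt_le_mono)
    show "(\<integral>z. (g z)\<^sup>2 \<partial>leb V) \<le> (\<integral>z. (g z)\<^sup>2 \<partial>leb U)"
      unfolding integral_leb[OF assms(1)] integral_leb[OF assms(2)]
      using assms L2_square_integrable[OF V] L2_square_integrable[OF assms(4)]
      by (intro integral_mono) (auto simp: integrable_leb indicator_def)
  qed
qed

text \<open>A test function of V is one of U, and the integrands vanish off its support, so
  integrals over V and over U agree.\<close>

lemma is_wderiv_mono:
  assumes U: "open U" and V: "open V" and VU: "V \<subseteq> U" and b: "b \<in> Basis" and g: "is_wderiv U b u g"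
  shows "is_wderiv V b u g"
  unfolding is_wderiv_def
proof (intro conjI allI impI)
  show "L2 (leb V) g" by (rule L2_leb_mono[OF U V VU is_wderiv_L2[OF g]])
  fix \<phi> assume t: "test_fun V \<phi>"
  obtain K where K: "compact K" "K \<subseteq> V" "\<And>z. z \<notin> K \<Longrightarrow> \<phi> z = 0"
    using t by (auto simp: test_fun_def)
  have K': "pd b \<phi> z = 0" if "z \<notin> K" for z
    using pd_zero_outside[OF compact_imp_closed[OF K(1)]] K(3) that by blast
  have eq: "(\<integral>z. p z * \<psi> z \<partial>leb V) = (\<integral>z. p z * \<psi> z \<partial>leb U)"
    if "\<And>z. z \<notin> K \<Longrightarrow> \<psi> z = 0" for p \<psi> :: "'a \<Rightarrow> real"
    unfolding integral_leb[OF U] integral_leb[OF V] using K(2) VU that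
    by (intro Bochner_Integration.integral_cong) (auto simp: indicator_def)
  show "(\<integral>z. u z * pd b \<phi> z \<partial>leb V) = - (\<integral>z. g z * \<phi> z \<partial>leb V)"
    using is_wderivD[OF g test_fun_mono[OF t VU]] by (simp add: eq K(3) K')
qed

text \<open>Weak differentiation is closed, because both sides of the defining identity are
  continuous in L2 for a fixed test function. Completeness of the energy space and the passage from
  polynomial to continuous weights both rest on this.\<close>

lemma is_wderiv_limit:
  assumes U: "open U" and b: "b \<in> Basis"
    and s: "\<And>n. L2 (leb U) (s n)" "\<And>n. is_wderiv U b (s n) (d n)"
    and u: "L2 (leb U) u" and g: "L2 (leb U) g"
    and lim: "(\<lambda>n. L2norm (leb U) (\<lambda>z. s n z - u z)) \<longlonglongrightarrow> 0"
      "(\<lambda>n. L2norm (leb U) (\<lambda>z. d n z - g z)) \<longlonglongrightarrow> 0"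
  shows "is_wderiv U b u g"
  unfolding is_wderiv_def
proof (intro conjI allI impI g)
  fix \<phi> assume t: "test_fun U \<phi>"
  have "(\<lambda>n. \<integral>z. s n z * pd b \<phi> z \<partial>leb U) \<longlonglongrightarrow> (\<integral>z. u z * pd b \<phi> z \<partial>leb U)"
    by (rule L2_tendsto_integral_mult[OF s(1) u test_fun_L2[OF U test_fun_pd[OF t b]] lim(1)])
  moreover have "(\<lambda>n. \<integral>z. s n z * pd b \<phi> z \<partial>leb U) \<longlonglongrightarrow> - (\<integral>z. g z * \<phi> z \<partial>leb U)"
    unfolding is_wderivD[OF s(2) t]
    by (intro tendsto_minus L2_tendsto_integral_mult[OF is_wderiv_L2[OF s(2)] g test_fun_L2[OF U t] lim(2)])
  ultimately show "(\<integral>z. u z * pd b \<phi> z \<partial>leb U) = - (\<integral>z. g z * \<phi> z \<partial>leb U)"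
    by (rule LIMSEQ_unique)
qed

lemma is_wderiv_smooth:
  assumes "open U" "b \<in> Basis" "smooth \<phi>" "L2 (leb U) (pd b \<phi>)"
  shows "is_wderiv U b \<phi> (pd b \<phi>)"
  unfolding is_wderiv_def using integral_by_parts_test_fun[OF assms(1,2,3)] assms(4) by blast

lemma H1_lincomb:
  assumes "open U" "u \<in> H1 U" "v \<in> H1 U"
  shows "(\<lambda>z. a * u z + c * v z) \<in> H1 U"
  unfolding H1_def using is_wderiv_lincomb[OF assms(1)] is_wderiv_wderiv[OF assms(2)] is_wderiv_wderiv[OF assms(3)]
    L2_lincomb[OF H1_L2[OF assms(2)] H1_L2[OF assms(3)]] H1_L2[OF assms(2)] H1_L2[OF assms(3)] by blast

lemma wderiv_lincomb:
  assumes "open U" "u \<in> H1 U" "v \<in> H1 U" "b \<in> Basis"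
  shows "AE z in leb U. wderiv U b (\<lambda>z. a * u z + c * v z) z = a * wderiv U b u z + c * wderiv U b v z"
  using assms by (intro wderiv_AE_eq is_wderiv_lincomb is_wderiv_wderiv H1_L2)

lemma test_fun_H1:
  assumes V: "open V" and t: "test_fun U \<phi>"
  shows "\<phi> \<in> H1 V" "b \<in> Basis \<Longrightarrow> is_wderiv V b \<phi> (pd b \<phi>)"
proof -
  show "is_wderiv V b \<phi> (pd b \<phi>)" if "b \<in> Basis" for b
    by (rule is_wderiv_smooth[OF V that test_fun_smooth[OF t] test_fun_L2[OF V test_fun_pd[OF t that]]])
  then show "\<phi> \<in> H1 V" using test_fun_L2[OF V t] by (auto simp: H1_def)
qed

section \<open>Integration over half-lines\<close>

lemma integrable_prod_lborel:
  fixes g :: "'a::euclidean_space \<Rightarrow> real" and h :: "'b::euclidean_space \<Rightarrow> real"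
  assumes g: "integrable lborel g" and h: "integrable lborel h"
  shows "integrable (lborel \<Otimes>\<^sub>M lborel) (\<lambda>(t, s). h t * g s)"
proof (rule lborel_pair.Fubini_integrable)
  show "(\<lambda>(t, s). h t * g s) \<in> borel_measurable (lborel \<Otimes>\<^sub>M lborel)"
    using g h by measurable
  show "integrable lborel (\<lambda>t. \<integral>s. norm (case (t, s) of (t, s) \<Rightarrow> h t * g s) \<partial>lborel)"
    using integrable_abs[OF h] by (simp add: abs_mult)
  show "AE t in lborel. integrable lborel (\<lambda>s. case (t, s) of (t, s) \<Rightarrow> h t * g s)"
    using g by simp
qed

text \<open>Fubini over the half-plane s < t. Encoding the limits of integration by a conditional
  keeps every integral over the whole line, so no case distinction on interval end points
  arises.\<close>

lemma half_line_swap: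
  fixes g h :: "real \<Rightarrow> real"
  assumes g: "integrable lborel g" and h: "integrable lborel h"
  shows "(\<integral>t. h t * (\<integral>s. (if s < t then g s else 0) \<partial>lborel) \<partial>lborel)
       = (\<integral>s. g s * (\<integral>t. (if s < t then h t else 0) \<partial>lborel) \<partial>lborel)"
proof -
  have [measurable]: "g \<in> borel_measurable borel" "h \<in> borel_measurable borel" using g h by auto
  have "integrable (lborel \<Otimes>\<^sub>M lborel) (\<lambda>(t, s). if s < t then h t * g s else 0)"
  proof (rule Bochner_Integration.integrable_bound[OF integrable_prod_lborel[OF g h]])
    show "(\<lambda>(t, s). if s < t then h t * g s else 0) \<in> borel_measurable (lborel \<Otimes>\<^sub>M lborel)"
      by measurable
  qed auto
  then have "(\<integral>s. (\<integral>t. (if s < t then h t * g s else 0) \<partial>lborel) \<partial>lborel)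
      = (\<integral>t. (\<integral>s. (if s < t then h t * g s else 0) \<partial>lborel) \<partial>lborel)"
    by (rule lborel_pair.Fubini_integral)
  moreover have "(\<integral>s. (if s < t then h t * g s else 0) \<partial>lborel) = h t * (\<integral>s. (if s < t then g s else 0) \<partial>lborel)" for t
  proof -
    have "(\<integral>s. (if s < t then h t * g s else 0) \<partial>lborel) = (\<integral>s. h t * (if s < t then g s else 0) \<partial>lborel)"
      by (intro Bochner_Integration.integral_cong) auto
    then show ?thesis by simp
  qed
  moreover have "(\<integral>t. (if s < t then h t * g s else 0) \<partial>lborel) = g s * (\<integral>t. (if s < t then h t else 0) \<partial>lborel)" for s
  proof -
    have "(\<integral>t. (if s < t then h t * g s else 0) \<partial>lborel) = (\<integral>t. g s * (if s < t then h t else 0) \<partial>lborel)"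
      by (intro Bochner_Integration.integral_cong) auto
    then show ?thesis by simp
  qed
  ultimately show ?thesis by simp
qed

lemma integrable_if_lborel:
  assumes "integrable lborel g" "Measurable.pred borel P"
  shows "integrable lborel (\<lambda>s. if P s then g s else (0::real))"
proof (rule Bochner_Integration.integrable_bound[OF assms(1)])
  have [measurable]: "g \<in> borel_measurable borel" using assms by auto
  note assms(2)[measurable]
  show "(\<lambda>s. if P s then g s else 0) \<in> borel_measurable lborel" by measurable
qed auto

lemma half_line_measurable:
  assumes "integrable lborel (g :: real \<Rightarrow> real)"
  shows "(\<lambda>t. \<integral>s. (if s < t then g s else 0) \<partial>lborel) \<in> borel_measurable borel"
proof -
  have [measurable]: "g \<in> borel_measurable borel" using assms by auto
  show ?thesis by measurable
qed

lemma half_line_bound: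
  assumes "integrable lborel (g :: real \<Rightarrow> real)" "Measurable.pred borel P"
  shows "\<bar>\<integral>s. (if P s then g s else 0) \<partial>lborel\<bar> \<le> (\<integral>s. \<bar>g s\<bar> \<partial>lborel)"
proof -
  have "\<bar>\<integral>s. (if P s then g s else 0) \<partial>lborel\<bar> \<le> (\<integral>s. \<bar>if P s then g s else 0\<bar> \<partial>lborel)"
    by (rule integral_abs_bound)
  also have "\<dots> \<le> (\<integral>s. \<bar>g s\<bar> \<partial>lborel)"
    using assms by (intro integral_mono integrable_abs integrable_if_lborel) auto
  finally show ?thesis .
qed

lemma half_line_mult_integrable:
  assumes g: "integrable lborel (g :: real \<Rightarrow> real)" and h: "integrable lborel (h :: real \<Rightarrow> real)"
  shows "integrable lborel (\<lambda>t. h t * (\<integral>s. (if s < t then g s else 0) \<partial>lborel))"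
proof (rule Bochner_Integration.integrable_bound)
  show "integrable lborel (\<lambda>t. \<bar>h t\<bar> * (\<integral>s. \<bar>g s\<bar> \<partial>lborel))" using h by auto
  show "(\<lambda>t. h t * (\<integral>s. (if s < t then g s else 0) \<partial>lborel)) \<in> borel_measurable lborel"
    using half_line_measurable[OF g] h by auto
  show "AE t in lborel. norm (h t * (\<integral>s. (if s < t then g s else 0) \<partial>lborel)) \<le> norm (\<bar>h t\<bar> * (\<integral>s. \<bar>g s\<bar> \<partial>lborel))"
  proof (rule AE_I2)
    fix t
    have "\<bar>\<integral>s. (if s < t then g s else 0) \<partial>lborel\<bar> \<le> (\<integral>s. \<bar>g s\<bar> \<partial>lborel)"
      by (rule half_line_bound[OF g]) auto
    from mult_left_mono[OF this, of "\<bar>h t\<bar>"]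
    show "norm (h t * (\<integral>s. (if s < t then g s else 0) \<partial>lborel)) \<le> norm (\<bar>h t\<bar> * (\<integral>s. \<bar>g s\<bar> \<partial>lborel))"
      by (simp add: abs_mult)
  qed
qed

text \<open>The integral of W' W for the running integral W of g, where g is merely integrable and W
  need not be differentiable everywhere. Exchanging the order of integration replaces W by the total
  mass minus W, and adding the two expressions leaves the square of the mass.\<close>

lemma half_line_self:
  assumes g: "integrable lborel (g :: real \<Rightarrow> real)"
  shows "(\<integral>t. g t * (\<integral>s. (if s < t then g s else 0) \<partial>lborel) \<partial>lborel) = (\<integral>t. g t \<partial>lborel)\<^sup>2 / 2"
proof -
  let ?W = "\<lambda>t. \<integral>s. (if s < t then g s else 0) \<partial>lborel"
  let ?M = "\<integral>t. g t \<partial>lborel"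
  have W: "(\<integral>t. (if s < t then g t else 0) \<partial>lborel) = ?M - ?W s" for s
  proof -
    have "(\<integral>t. (if s < t then g t else 0) \<partial>lborel) + ?W s
        = (\<integral>t. (if s < t then g t else 0) + (if t < s then g t else 0) \<partial>lborel)"
      by (intro Bochner_Integration.integral_add[symmetric] integrable_if_lborel g) auto
    also have "\<dots> = ?M"
    proof (rule integral_cong_AE)
      have "AE t in lborel. t \<noteq> s" by (rule AE_lborel_singleton)
      then show "AE t in lborel. (if s < t then g t else 0) + (if t < s then g t else 0) = g t"
        by eventually_elim auto
    qed (use g integrable_if_lborel[OF g] in auto)
    finally show ?thesis by simp
  qed
  have "(\<integral>t. g t * ?W t \<partial>lborel) = (\<integral>s. g s * (?M - ?W s) \<partial>lborel)"
    using half_line_swap[OF g g] by (simp add: W)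
  also have "\<dots> = (\<integral>s. g s * ?M - g s * ?W s \<partial>lborel)"
    by (simp add: right_diff_distrib)
  also have "\<dots> = ?M * ?M - (\<integral>t. g t * ?W t \<partial>lborel)"
    using half_line_mult_integrable[OF g g] g by simp
  finally show ?thesis by (simp add: power2_eq_square)
qed

lemma half_line_self_truncated:
  assumes g: "integrable lborel (g :: real \<Rightarrow> real)"
  shows "(\<integral>t. (if t < r then g t * (\<integral>s. (if s < t then g s else 0) \<partial>lborel) else 0) \<partial>lborel)
    = (\<integral>t. (if t < r then g t else 0) \<partial>lborel)\<^sup>2 / 2"
proof -
  have gr: "integrable lborel (\<lambda>t. if t < r then g t else 0)" by (intro integrable_if_lborel g) auto
  have "(if t < r then g t * (\<integral>s. (if s < t then g s else 0) \<partial>lborel) else 0)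
     = (if t < r then g t else 0) * (\<integral>s. (if s < t then (if s < r then g s else 0) else 0) \<partial>lborel)" for t
    by (auto intro!: arg_cong2[where f="(*)"] Bochner_Integration.integral_cong)
  then show ?thesis using half_line_self[OF gr] by simp
qed

text \<open>Integration by parts for the weight times W' W, done by Fubini: the weight is its value
  at T plus the integral of its negative derivative from t to T, and the truncated identity turns
  the inner integral into half the square of W. The boundary term at T is nonnegative and is
  dropped, hence the inequality.\<close>

lemma weighted_half_line:
  fixes g \<theta> \<theta>' :: "real \<Rightarrow> real"
  assumes g: "integrable lborel g" "\<And>t. t \<notin> {0<..<T} \<Longrightarrow> g t = 0" and T: "0 < T"
    and \<theta>: "\<And>t. 0 \<le> t \<Longrightarrow> t \<le> T \<Longrightarrow> (\<theta> has_real_derivative \<theta>' t) (at t)"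
      "\<And>t. 0 \<le> t \<Longrightarrow> t \<le> T \<Longrightarrow> isCont \<theta>' t" and pos: "0 \<le> \<theta> T"
  shows "(\<integral>t. \<theta> t * (g t * (\<integral>s. (if s < t then g s else 0) \<partial>lborel)) \<partial>lborel)
    \<ge> (\<integral>t. indicator {0..T} t * (- \<theta>' t * (\<integral>s. (if s < t then g s else 0) \<partial>lborel)\<^sup>2) \<partial>lborel) / 2"
proof -
  define W where "W t = (\<integral>s. (if s < t then g s else 0) \<partial>lborel)" for t
  define G where "G t = g t * W t" for t
  define h where "h t = indicator {0..T} t * (- \<theta>' t)" for t
  have G: "integrable lborel G" unfolding G_def W_def by (rule half_line_mult_integrable[OF g(1) g(1)])
  have "integrable lborel (\<lambda>t. indicator {0..T} t *\<^sub>R (- \<theta>' t))"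
    using \<theta>(2) by (intro borel_integrable_compact continuous_at_imp_continuous_on) auto
  then have h: "integrable lborel h" by (simp add: h_def[abs_def])
  \<comment> \<open>The representation holds only where the weight is differentiable; for all other
    t the integrand below vanishes together with g.\<close>
  have \<theta>_eq: "\<theta> t = \<theta> T + (\<integral>s. (if t < s then h s else 0) \<partial>lborel)" if "t \<in> {0<..<T}" for t
  proof -
    have "(\<integral>s. \<theta>' s * indicator {t..T} s \<partial>lborel) = \<theta> T - \<theta> t"
      using that \<theta> by (intro integral_FTC_Icc_real) auto
    moreover have "(\<integral>s. (if t < s then h s else 0) \<partial>lborel) = (\<integral>s. - (\<theta>' s * indicator {t..T} s) \<partial>lborel)"
    proof (rule integral_cong_AE)
      have "AE s in lborel. s \<noteq> t" by (rule AE_lborel_singleton)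
      then show "AE s in lborel. (if t < s then h s else 0) = - (\<theta>' s * indicator {t..T} s)"
        by (rule eventually_mono) (use that in \<open>auto simp: h_def indicator_def\<close>)
      show "(\<lambda>s. if t < s then h s else 0) \<in> borel_measurable lborel"
        using integrable_if_lborel[OF h, of "\<lambda>s. t < s"] by auto
      have "integrable lborel (\<lambda>s. indicator {t..T} s *\<^sub>R \<theta>' s)"
        using that \<theta>(2) by (intro borel_integrable_compact continuous_at_imp_continuous_on) auto
      then show "(\<lambda>s. - (\<theta>' s * indicator {t..T} s)) \<in> borel_measurable lborel"
        by (auto simp: mult.commute)
    qed
    ultimately show ?thesis by simp
  qed
  have mH: "(\<lambda>t. \<integral>s. (if t < s then h s else 0) \<partial>lborel) \<in> borel_measurable borel"
  proof -
    have [measurable]: "h \<in> borel_measurable borel" using h by auto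
    show ?thesis by measurable
  qed
  have Gh: "integrable lborel (\<lambda>t. G t * (\<integral>s. (if t < s then h s else 0) \<partial>lborel))"
  proof (rule Bochner_Integration.integrable_bound)
    show "integrable lborel (\<lambda>t. \<bar>G t\<bar> * (\<integral>s. \<bar>h s\<bar> \<partial>lborel))" using G by auto
    show "(\<lambda>t. G t * (\<integral>s. (if t < s then h s else 0) \<partial>lborel)) \<in> borel_measurable lborel"
      using mH G by auto
    show "AE t in lborel. norm (G t * (\<integral>s. (if t < s then h s else 0) \<partial>lborel)) \<le> norm (\<bar>G t\<bar> * (\<integral>s. \<bar>h s\<bar> \<partial>lborel))"
    proof (rule AE_I2)
      fix t
      have "\<bar>\<integral>s. (if t < s then h s else 0) \<partial>lborel\<bar> \<le> (\<integral>s. \<bar>h s\<bar> \<partial>lborel)"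
        by (rule half_line_bound[OF h]) auto
      from mult_left_mono[OF this, of "\<bar>G t\<bar>"]
      show "norm (G t * (\<integral>s. (if t < s then h s else 0) \<partial>lborel)) \<le> norm (\<bar>G t\<bar> * (\<integral>s. \<bar>h s\<bar> \<partial>lborel))"
        by (simp add: abs_mult)
    qed
  qed
  have "(\<integral>t. \<theta> t * G t \<partial>lborel) = (\<integral>t. \<theta> T * G t + G t * (\<integral>s. (if t < s then h s else 0) \<partial>lborel) \<partial>lborel)"
  proof (rule Bochner_Integration.integral_cong[OF refl])
    fix t show "\<theta> t * G t = \<theta> T * G t + G t * (\<integral>s. (if t < s then h s else 0) \<partial>lborel)"
      using \<theta>_eq[of t] g(2)[of t] by (cases "t \<in> {0<..<T}") (auto simp: G_def algebra_simps)
  qed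
  also have "\<dots> = \<theta> T * (\<integral>t. G t \<partial>lborel) + (\<integral>t. G t * (\<integral>s. (if t < s then h s else 0) \<partial>lborel) \<partial>lborel)"
    using G Gh by simp
  also have "(\<integral>t. G t * (\<integral>s. (if t < s then h s else 0) \<partial>lborel) \<partial>lborel)
      = (\<integral>s. h s * (\<integral>t. (if t < s then G t else 0) \<partial>lborel) \<partial>lborel)"
    using half_line_swap[OF G h] by simp
  also have "\<dots> = (\<integral>s. h s * (W s)\<^sup>2 / 2 \<partial>lborel)"
    unfolding G_def W_def half_line_self_truncated[OF g(1)] by simp
  also have "\<dots> = (\<integral>s. indicator {0..T} s * (- \<theta>' s * (W s)\<^sup>2) \<partial>lborel) / 2"
    by (simp add: h_def algebra_simps)
  finally have "(\<integral>t. \<theta> t * G t \<partial>lborel) = \<theta> T * (\<integral>t. G t \<partial>lborel)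
      + (\<integral>s. indicator {0..T} s * (- \<theta>' s * (W s)\<^sup>2) \<partial>lborel) / 2" .
  moreover have "0 \<le> (\<integral>t. G t \<partial>lborel)"
    unfolding G_def W_def half_line_self[OF g(1)] by simp
  then have "0 \<le> \<theta> T * (\<integral>t. G t \<partial>lborel)" using pos by simp
  ultimately show ?thesis by (simp add: G_def W_def)
qed

section \<open>Time integration on the cylinder\<close>

lemma AE_lborel_fst:
  fixes P :: "'a::euclidean_space \<Rightarrow> bool"
  assumes "AE x in lborel. P x"
  shows "AE z in (lborel :: ('a \<times> 'b::euclidean_space) measure). P (fst z)"
proof -
  obtain N where N: "N \<in> null_sets lborel" "{x. \<not> P x} \<subseteq> N"
    using assms by (auto simp: eventually_ae_filter)
  have "N \<times> (UNIV :: 'b set) \<in> null_sets (lborel \<Otimes>\<^sub>M lborel)"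
    using N(1) by (auto simp: null_sets_def lborel.emeasure_pair_measure_Times)
  then have "N \<times> (UNIV :: 'b set) \<in> null_sets lborel" by (simp add: lborel_prod)
  then show ?thesis by (rule AE_I') (use N(2) in auto)
qed

lemma AE_lborel_sections:
  fixes P :: "'a::euclidean_space \<times> 'b::euclidean_space \<Rightarrow> bool"
  assumes "AE z in lborel. P z"
  shows "AE x in lborel. AE t in lborel. P (x, t)" "AE t in lborel. AE x in lborel. P (x, t)"
proof -
  obtain N where N: "N \<in> null_sets (lborel :: ('a \<times> 'b) measure)" "{z. \<not> P z} \<subseteq> N"
    using assms by (auto simp: eventually_ae_filter)
  have Nb [measurable]: "N \<in> sets (lborel \<Otimes>\<^sub>M lborel)" using N(1) unfolding lborel_prod by (simp add: null_sets_def)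
  have "AE z in lborel \<Otimes>\<^sub>M lborel. z \<notin> N" unfolding lborel_prod by (rule AE_not_in[OF N(1)])
  from lborel_pair.AE_pair[OF this] have 1: "AE x in lborel. AE t in lborel. (x, t) \<notin> N" .
  moreover have "{z \<in> space (lborel \<Otimes>\<^sub>M lborel). (fst z, snd z) \<notin> N} \<in> sets (lborel \<Otimes>\<^sub>M lborel)"
  proof -
    have "{z \<in> space (lborel \<Otimes>\<^sub>M lborel). (fst z, snd z) \<notin> N} = space (lborel \<Otimes>\<^sub>M lborel) - N" by auto
    then show ?thesis using sets.compl_sets[OF Nb] by metis
  qed
  then have "(AE x in lborel. AE t in lborel. (x, t) \<notin> N) \<longleftrightarrow> (AE t in lborel. AE x in lborel. (x, t) \<notin> N)"
    by (intro lborel_pair.AE_commute) simp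
  ultimately have 2: "AE t in lborel. AE x in lborel. (x, t) \<notin> N" by simp
  have imp: "(x, t) \<notin> N \<Longrightarrow> P (x, t)" for x t using N(2) by auto
  show "AE x in lborel. AE t in lborel. P (x, t)"
    using 1 by (rule eventually_mono) (auto elim!: eventually_mono intro: imp)
  show "AE t in lborel. AE x in lborel. P (x, t)"
    using 2 by (rule eventually_mono) (auto elim!: eventually_mono intro: imp)
qed

lemma lborel_integral_sections:
  fixes F :: "'a::euclidean_space \<times> 'b::euclidean_space \<Rightarrow> real"
  assumes "integrable lborel F"
  shows "AE x in lborel. integrable lborel (\<lambda>t. F (x, t))"
    "integrable lborel (\<lambda>x. \<integral>t. F (x, t) \<partial>lborel)"
    "(\<integral>z. F z \<partial>lborel) = (\<integral>x. \<integral>t. F (x, t) \<partial>lborel \<partial>lborel)"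
proof -
  have F: "integrable (lborel \<Otimes>\<^sub>M lborel) F" using assms by (simp add: lborel_prod)
  show "AE x in lborel. integrable lborel (\<lambda>t. F (x, t))"
    "integrable lborel (\<lambda>x. \<integral>t. F (x, t) \<partial>lborel)"
    "(\<integral>z. F z \<partial>lborel) = (\<integral>x. \<integral>t. F (x, t) \<partial>lborel \<partial>lborel)"
    using lborel_pair.AE_integrable_fst'[OF F] lborel_pair.integrable_fst'[OF F] lborel_pair.integral_fst'[OF F]
    by (simp_all add: lborel_prod)
qed

lemma measurable_section:
  fixes F :: "'a::euclidean_space \<times> 'b::euclidean_space \<Rightarrow> real"
  assumes "F \<in> borel_measurable borel"
  shows "(\<lambda>t. F (x, t)) \<in> borel_measurable borel"
  using measurable_compose[OF _ assms, of "\<lambda>t. (x, t)" borel] by (simp add: borel_prod[symmetric])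

lemma L2_sections:
  fixes F :: "'a::euclidean_space \<times> 'b::euclidean_space \<Rightarrow> real"
  assumes "L2 lborel F"
  shows "AE x in lborel. L2 lborel (\<lambda>t. F (x, t))"
proof -
  have "F \<in> borel_measurable borel" using assms by (simp add: L2_def)
  then have "(\<lambda>t. F (x, t)) \<in> borel_measurable borel" for x by (rule measurable_section)
  with lborel_integral_sections(1)[OF L2_square_integrable[OF assms]] show ?thesis
    by (auto simp: L2_def elim!: eventually_mono)
qed

lemma L2_set_integral_bound:
  assumes g: "L2 M g" and S: "S \<in> sets M" "emeasure M S < \<infinity>"
  shows "integrable M (\<lambda>s. indicator S s * g s)"
    "(\<integral>s. indicator S s * g s \<partial>M)\<^sup>2 \<le> measure M S * (\<integral>s. (g s)\<^sup>2 \<partial>M)"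
proof -
  have 1: "L2 M (indicator S)" by (rule L2_indicator[OF S])
  show "integrable M (\<lambda>s. indicator S s * g s)" by (rule L2_mult_integrable[OF 1 g])
  have eq: "(indicator S s)\<^sup>2 = (indicator S s :: real)" for s by (simp add: indicator_def)
  have "\<bar>\<integral>s. indicator S s * g s \<partial>M\<bar>\<^sup>2 \<le> (L2norm M (indicator S) * L2norm M g)\<^sup>2"
    by (intro power_mono L2_Cauchy_Schwarz 1 g) auto
  then show "(\<integral>s. indicator S s * g s \<partial>M)\<^sup>2 \<le> measure M S * (\<integral>s. (g s)\<^sup>2 \<partial>M)"
    using S by (simp add: power_mult_distrib L2norm_power2 eq)
qed

lemma sum_Basis_cylinder:
  "(\<Sum>b\<in>(Basis :: ('a::euclidean_space \<times> real) set). F b) = F (0, 1) + (\<Sum>b\<in>Basis. F (b, 0))"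
proof -
  have "(\<Sum>b\<in>(Basis :: ('a \<times> real) set). F b) = (\<Sum>b\<in>(\<lambda>u. (u, 0)) ` Basis \<union> (\<lambda>u. (0, u)) ` Basis. F b)"
    by (simp add: Basis_prod_def)
  also have "\<dots> = (\<Sum>b\<in>(\<lambda>u. (u, 0)) ` Basis. F b) + (\<Sum>b\<in>(\<lambda>u. (0, u)) ` Basis. F b)"
    by (intro sum.union_disjoint) auto
  finally show ?thesis by (simp add: sum.reindex inj_on_def add.commute)
qed

section \<open>Time reversal\<close>

text \<open>Reversal exchanges forward with backward time integration and initial with terminal
  conditions, so that each one-sided statement needs only one direct proof.\<close>

definition rfl :: "real \<Rightarrow> ('a \<times> real \<Rightarrow> real) \<Rightarrow> 'a \<times> real \<Rightarrow> real" where
  "rfl T u z = u (fst z, T - snd z)"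

lemma rfl_rfl [simp]: "rfl T (rfl T u) = u"
  by (auto simp: rfl_def)

lemma reflection_measurable [measurable]:
  "(\<lambda>z :: 'a::euclidean_space \<times> real. (fst z, T - snd z)) \<in> borel_measurable borel"
  by (intro borel_measurable_continuous_onI continuous_intros)

text \<open>An affine change of variables with coefficient -1 in the time direction and 1 in all
  others; the product of the absolute values is 1.\<close>

lemma lborel_reflection:
  "distr lborel borel (\<lambda>z :: 'a::euclidean_space \<times> real. (fst z, T - snd z)) = lborel"
proof -
  define c :: "'a \<times> real \<Rightarrow> real" where "c j = (if j = (0, 1) then -1 else 1)" for j
  have eq: "(0, T) + (\<Sum>j\<in>Basis. (c j * (z \<bullet> j)) *\<^sub>R j) = (fst z, T - snd z)" for z
  proof -
    have "(\<Sum>j\<in>Basis. (c j * (z \<bullet> j)) *\<^sub>R j) = (c (0, 1) * (z \<bullet> (0, 1))) *\<^sub>R (0, 1) + (\<Sum>b\<in>Basis. (c (b, 0) * (z \<bullet> (b, 0))) *\<^sub>R (b, 0))"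
      by (rule sum_Basis_cylinder)
    also have "(\<Sum>b\<in>Basis. (c (b, 0) * (z \<bullet> (b, 0))) *\<^sub>R (b, 0 :: real)) = (\<Sum>b\<in>Basis. (fst z \<bullet> b) *\<^sub>R (b, 0))"
      by (intro sum.cong) (auto simp: c_def inner_prod_def)
    also have "\<dots> = (fst z, 0)"
      by (rule prod_eqI) (simp_all add: fst_sum snd_sum euclidean_representation)
    finally show ?thesis by (simp add: c_def inner_prod_def)
  qed
  have "(\<Prod>j\<in>Basis. \<bar>c j\<bar>) = 1" by (intro prod.neutral) (auto simp: c_def)
  then have "lborel = density (distr lborel borel (\<lambda>z. (0, T) + (\<Sum>j\<in>Basis. (c j * (z \<bullet> j)) *\<^sub>R j))) (\<lambda>_. 1)"
    using lborel_affine_euclidean[of c "(0, T)"] by (simp add: c_def)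
  then show ?thesis by (simp add: eq density_1)
qed

lemma AE_reflection:
  fixes P :: "'a::euclidean_space \<times> real \<Rightarrow> bool"
  assumes "AE z in lborel. P z"
  shows "AE z in lborel. P (fst z, T - snd z)"
proof (rule AE_distrD[where f="\<lambda>z. (fst z, T - snd z)" and P=P and M'=borel])
  show "(\<lambda>z :: 'a \<times> real. (fst z, T - snd z)) \<in> measurable lborel borel" by simp
  show "AE z in distr lborel borel (\<lambda>z :: 'a \<times> real. (fst z, T - snd z)). P z"
    using assms unfolding lborel_reflection .
qed

section \<open>Forward and backward time integrals on the cylinder\<close>

locale cylinder =
  fixes \<Omega> :: "'a::euclidean_space set" and T :: real
  assumes open_\<Omega>: "open \<Omega>" and bounded_\<Omega>: "bounded \<Omega>" and T_pos: "0 < T"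
begin

abbreviation "M \<equiv> leb (Q \<Omega> T)"

text \<open>Extension by zero turns each integral over Q into one over the whole space, where Fubini
  and changes of variables apply without restrictions on the domain.\<close>

definition ext :: "('a \<times> real \<Rightarrow> real) \<Rightarrow> 'a \<times> real \<Rightarrow> real" where
  "ext u z = indicator (Q \<Omega> T) z * u z"

text \<open>As \<open>ext u\<close> vanishes outside (0,T) in time, this is the integral from 0 to
  t, and \<open>bwd\<close> is the one from t to T. A section that is not integrable yields the
  default value 0; for square-integrable u this concerns only a null set of x.\<close>

definition fwd :: "('a \<times> real \<Rightarrow> real) \<Rightarrow> 'a \<times> real \<Rightarrow> real" where
  "fwd u z = (\<integral>s. (if s < snd z then ext u (fst z, s) else 0) \<partial>lborel)"

definition bwd :: "('a \<times> real \<Rightarrow> real) \<Rightarrow> 'a \<times> real \<Rightarrow> real" where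
  "bwd u z = (\<integral>s. (if snd z < s then ext u (fst z, s) else 0) \<partial>lborel)"

lemma fwd_Pair: "fwd u (x, t) = (\<integral>s. (if s < t then ext u (x, s) else 0) \<partial>lborel)"
  and bwd_Pair: "bwd u (x, t) = (\<integral>s. (if t < s then ext u (x, s) else 0) \<partial>lborel)"
  unfolding fwd_def bwd_def fst_conv snd_conv by (rule refl)+

lemma open_Q: "open (Q \<Omega> T)"
  unfolding Q_def by (intro open_Times open_\<Omega> open_greaterThanLessThan)

lemma bounded_Q: "bounded (Q \<Omega> T)"
  unfolding Q_def by (intro bounded_Times bounded_\<Omega> bounded_Ioo)

lemma finite_M: "finite_measure M"
  by (rule finite_measure_leb[OF open_Q bounded_Q])

lemma Q_sets [measurable]: "Q \<Omega> T \<in> sets borel"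
  using open_Q by simp

lemma ext_L2: "L2 M u \<longleftrightarrow> L2 lborel (ext u)"
  by (simp add: L2_leb[OF open_Q] ext_def[abs_def])

lemma ext_measurable: "u \<in> borel_measurable M \<longleftrightarrow> ext u \<in> borel_measurable borel"
  by (simp add: measurable_leb[OF open_Q] ext_def[abs_def])

lemma ext_integrable: "integrable M u \<longleftrightarrow> integrable lborel (ext u)"
  by (simp add: integrable_leb[OF open_Q] ext_def[abs_def])

lemma ext_integral: "(\<integral>z. u z \<partial>M) = (\<integral>z. ext u z \<partial>lborel)"
  by (simp add: integral_leb[OF open_Q] ext_def[abs_def])

lemma ext_L2norm: "L2norm M u = L2norm lborel (ext u)"
  by (simp add: L2norm_leb[OF open_Q] ext_def[abs_def])

lemma ext_outside: "t \<notin> {0<..<T} \<Longrightarrow> ext u (x, t) = 0"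
  by (auto simp: ext_def Q_def)

lemma integral_M_sections:
  assumes "integrable M u"
  shows "(\<integral>z. u z \<partial>M) = (\<integral>x. \<integral>t. ext u (x, t) \<partial>lborel \<partial>lborel)"
  using lborel_integral_sections(3)[of "ext u"] assms by (simp add: ext_integrable ext_integral)

lemma section_L2: "L2 M u \<Longrightarrow> AE x in lborel. L2 lborel (\<lambda>t. ext u (x, t))"
  by (rule L2_sections) (simp add: ext_L2)

lemma section_integrable:
  assumes "L2 lborel (\<lambda>t. ext u (x, t))"
  shows "integrable lborel (\<lambda>t. ext u (x, t))"
proof -
  have "integrable lborel (\<lambda>t. indicator {0<..<T} t * ext u (x, t))"
    by (rule L2_set_integral_bound(1)[OF assms]) (use emeasure_bounded_finite[of "{0<..<T}"] in auto)
  moreover have "(\<lambda>t. indicator {0<..<T} t * ext u (x, t)) = (\<lambda>t. ext u (x, t))"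
    using ext_outside by (auto simp: fun_eq_iff indicator_def)
  ultimately show ?thesis by simp
qed

lemma fwd_measurable:
  assumes "u \<in> borel_measurable M"
  shows "fwd u \<in> borel_measurable borel"
proof -
  have "ext u \<in> borel_measurable borel" using assms by (simp add: ext_measurable)
  then have [measurable]: "ext u \<in> borel_measurable (borel \<Otimes>\<^sub>M borel)" by (simp add: borel_prod)
  have "(\<lambda>z. fwd u z) \<in> borel_measurable (borel \<Otimes>\<^sub>M borel)" unfolding fwd_def by measurable
  then show "fwd u \<in> borel_measurable borel" by (simp add: borel_prod)
qed

lemma ext_rfl: "ext (rfl T u) z = ext u (fst z, T - snd z)"
  by (cases z) (auto simp: ext_def rfl_def Q_def indicator_def)

lemma AE_M_reflection: "AE z in M. P z \<Longrightarrow> AE z in M. P (fst z, T - snd z)"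
  unfolding AE_leb[OF open_Q]
  by (drule AE_reflection[where T=T]) (auto simp: Q_def elim!: eventually_mono)

lemma rfl_measurable: "u \<in> borel_measurable M \<Longrightarrow> rfl T u \<in> borel_measurable M"
proof -
  assume "u \<in> borel_measurable M"
  then have "ext u \<in> borel_measurable borel" by (simp add: ext_measurable)
  from measurable_compose[OF reflection_measurable this] show ?thesis
    by (simp add: ext_measurable ext_rfl[abs_def])
qed

lemma integral_rfl:
  assumes "u \<in> borel_measurable M"
  shows "(\<integral>z. rfl T u z \<partial>M) = (\<integral>z. u z \<partial>M)"
proof -
  have m: "ext u \<in> borel_measurable borel" using assms by (simp add: ext_measurable)
  have "(\<integral>z. rfl T u z \<partial>M) = (\<integral>z. ext u (fst z, T - snd z) \<partial>lborel)"
    by (simp add: ext_integral ext_rfl)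
  also have "\<dots> = (\<integral>z. ext u z \<partial>distr lborel borel (\<lambda>z. (fst z, T - snd z)))"
    by (rule integral_distr[symmetric]) (use m in auto)
  also have "\<dots> = (\<integral>z. u z \<partial>M)" by (simp add: lborel_reflection ext_integral)
  finally show ?thesis .
qed

lemma rfl_L2:
  assumes "L2 M u"
  shows "L2 M (rfl T u)"
proof -
  have "integrable (distr lborel borel (\<lambda>z. (fst z, T - snd z))) (\<lambda>z. (ext u z)\<^sup>2)"
    using L2_square_integrable[OF assms[unfolded ext_L2]] by (simp add: lborel_reflection)
  then have "integrable lborel (\<lambda>z. (ext u (fst z, T - snd z))\<^sup>2)"
    by (subst (asm) integrable_distr_eq) (use L2_measurable[OF assms[unfolded ext_L2]] in auto)
  then show ?thesis
    using rfl_measurable[OF L2_measurable[OF assms]]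
    unfolding ext_L2 by (simp add: L2_def ext_measurable ext_rfl)
qed

lemma L2norm_rfl:
  assumes "L2 M u"
  shows "L2norm M (rfl T u) = L2norm M u"
  using integral_rfl[of "\<lambda>z. (u z)\<^sup>2"] L2_measurable[OF assms] by (simp add: L2norm_def rfl_def)

text \<open>The substitution of T - s for s in each section.\<close>

lemma bwd_eq_rfl: "bwd u z = rfl T (fwd (rfl T u)) z"
proof (cases z)
  case (Pair x t)
  have "bwd u (x, t) = (\<integral>s. (if t < T + (-1) * s then ext u (x, T + (-1) * s) else 0) \<partial>lborel)"
    unfolding bwd_Pair using lborel_integral_real_affine[of "-1" "\<lambda>s. if t < s then ext u (x, s) else 0" T] by simp
  also have "\<dots> = (\<integral>s. (if s < T - t then ext (rfl T u) (x, s) else 0) \<partial>lborel)"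
    by (intro Bochner_Integration.integral_cong) (auto simp: ext_rfl)
  finally show ?thesis by (simp add: Pair rfl_def fwd_Pair)
qed

lemma bwd_rfl: "bwd (rfl T u) (x, t) = fwd u (x, T - t)"
  by (simp add: bwd_eq_rfl) (simp add: rfl_def)

lemma bwd_measurable:
  assumes "u \<in> borel_measurable M"
  shows "bwd u \<in> borel_measurable borel"
  using measurable_compose[OF reflection_measurable fwd_measurable[OF rfl_measurable[OF assms]]]
  by (simp add: bwd_eq_rfl[abs_def] rfl_def)

text \<open>Cauchy-Schwarz against an indicator, so the constant is the length of the set. Length T
  gives boundedness of the time integrals in L2, length t - r their continuity in time.\<close>

lemma truncated_section_bound:
  assumes g: "L2 lborel (\<lambda>t. ext u (x, t))" and P: "Measurable.pred borel P"
    and m: "measure lborel ({s. P s} \<inter> {0<..<T}) \<le> c"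
  shows "(\<integral>s. (if P s then ext u (x, s) else 0) \<partial>lborel)\<^sup>2 \<le> c * (\<integral>s. (ext u (x, s))\<^sup>2 \<partial>lborel)"
proof -
  let ?S = "{s. P s} \<inter> {0<..<T}"
  have S: "?S \<in> sets lborel" using P by simp
  have fin: "emeasure lborel ?S < \<infinity>"
    by (rule emeasure_bounded_finite) (auto intro: bounded_subset[of "{0<..<T}"])
  have "(\<integral>s. (if P s then ext u (x, s) else 0) \<partial>lborel) = (\<integral>s. indicator ?S s * ext u (x, s) \<partial>lborel)"
    using ext_outside by (intro Bochner_Integration.integral_cong) (auto simp: indicator_def)
  also have "\<dots>\<^sup>2 \<le> measure lborel ?S * (\<integral>s. (ext u (x, s))\<^sup>2 \<partial>lborel)"
    by (rule L2_set_integral_bound(2)[OF g S fin])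
  also have "\<dots> \<le> c * (\<integral>s. (ext u (x, s))\<^sup>2 \<partial>lborel)"
    using m by (intro mult_right_mono) auto
  finally show ?thesis .
qed

lemma section_norm_integral:
  assumes u: "L2 M u"
  shows "integrable lborel (\<lambda>x. \<integral>s. (ext u (x, s))\<^sup>2 \<partial>lborel)"
    "(\<integral>x. \<integral>s. (ext u (x, s))\<^sup>2 \<partial>lborel \<partial>lborel) = (L2norm M u)\<^sup>2"
proof -
  have i: "integrable lborel (\<lambda>z. (ext u z)\<^sup>2)" by (rule L2_square_integrable[OF u[unfolded ext_L2]])
  from lborel_integral_sections(2,3)[OF i]
  show "integrable lborel (\<lambda>x. \<integral>s. (ext u (x, s))\<^sup>2 \<partial>lborel)"
    "(\<integral>x. \<integral>s. (ext u (x, s))\<^sup>2 \<partial>lborel \<partial>lborel) = (L2norm M u)\<^sup>2"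
    by (simp_all add: ext_L2norm L2norm_power2)
qed

text \<open>The pointwise bound carries one factor T and integrating it over (0,T) contributes
  another, so the squared norm is bounded with T^2.\<close>

lemma L2_section_dominated:
  assumes u: "L2 M u" and v: "v \<in> borel_measurable M"
    and bd: "AE x in lborel. \<forall>t\<in>{0<..<T}. (v (x, t))\<^sup>2 \<le> T * (\<integral>s. (ext u (x, s))\<^sup>2 \<partial>lborel)"
  shows "L2 M v" "L2norm M v \<le> T * L2norm M u"
proof -
  define k where "k x = (\<integral>s. (ext u (x, s))\<^sup>2 \<partial>lborel)" for x
  define F where "F = (\<lambda>(x, t). (T * k x) * indicator {0<..<T} t)"
  have k: "integrable lborel k" "(\<integral>x. k x \<partial>lborel) = (L2norm M u)\<^sup>2"
    using section_norm_integral[OF u] unfolding k_def .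
  have k0: "0 \<le> k x" for x by (simp add: k_def)
  have ind: "integrable lborel (indicator {0<..<T} :: real \<Rightarrow> real)" by (intro integrable_real_indicator) (use emeasure_bounded_finite[of "{0<..<T}"] in auto)
  have F: "integrable lborel F"
    using integrable_prod_lborel[OF ind integrable_mult_right[OF k(1)], of T] by (simp add: F_def lborel_prod)
  have intF: "(\<integral>z. F z \<partial>lborel) = (T * L2norm M u)\<^sup>2"
    using lborel_integral_sections(3)[OF F] k T_pos by (simp add: F_def power2_eq_square)
  have vm: "(\<lambda>z. (ext v z)\<^sup>2) \<in> borel_measurable lborel" using v by (simp add: ext_measurable)
  have le: "AE z in lborel. (ext v z)\<^sup>2 \<le> F z"
    using AE_lborel_fst[OF bd, where 'b=real]
  proof (rule eventually_mono)
    fix z :: "'a \<times> real"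
    assume *: "\<forall>t\<in>{0<..<T}. (v (fst z, t))\<^sup>2 \<le> T * (\<integral>s. (ext u (fst z, s))\<^sup>2 \<partial>lborel)"
    obtain x t where z: "z = (x, t)" by (cases z)
    show "(ext v z)\<^sup>2 \<le> F z"
    proof (cases "z \<in> Q \<Omega> T")
      case True
      with * show ?thesis by (auto simp: z ext_def F_def k_def Q_def)
    next
      case False
      have "0 \<le> F z" using T_pos k0 by (auto simp: F_def z)
      with False show ?thesis by (simp add: ext_def)
    qed
  qed
  have int: "integrable lborel (\<lambda>z. (ext v z)\<^sup>2)"
    using F vm by (rule Bochner_Integration.integrable_bound) (use le in \<open>auto elim!: eventually_mono\<close>)
  then show v2: "L2 M v" using v unfolding ext_L2 by (simp add: L2_def ext_measurable)
  have "(L2norm M v)\<^sup>2 \<le> (T * L2norm M u)\<^sup>2"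
    using integral_mono_AE[OF int F le] by (simp add: ext_L2norm L2norm_power2 intF[unfolded ext_L2norm])
  then show "L2norm M v \<le> T * L2norm M u"
    by (rule power2_le_imp_le) (use T_pos in auto)
qed

lemma fwd_L2:
  assumes u: "L2 M u"
  shows "L2 M (fwd u)" "L2norm M (fwd u) \<le> T * L2norm M u"
proof -
  have m: "measure lborel ({s. P s} \<inter> {0<..<T}) \<le> T" if "Measurable.pred borel P" for P
    using measure_mono_fmeasurable[of "{s. P s} \<inter> {0<..<T}" "{0<..<T}" lborel] that T_pos
    emeasure_bounded_finite[of "{0<..<T}"]
    by (auto simp: fmeasurable_def)
  have "AE x in lborel. \<forall>t\<in>{0<..<T}. (fwd u (x, t))\<^sup>2 \<le> T * (\<integral>s. (ext u (x, s))\<^sup>2 \<partial>lborel)"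
    using section_L2[OF u]
    by (rule eventually_mono) (auto simp: fwd_Pair intro!: truncated_section_bound m)
  from L2_section_dominated[OF u _ this]
  show "L2 M (fwd u)" "L2norm M (fwd u) \<le> T * L2norm M u"
    using measurable_restrict_space1[of "fwd u" lborel borel] fwd_measurable[OF L2_measurable[OF u]] by simp_all
qed

lemma bwd_L2:
  assumes u: "L2 M u"
  shows "L2 M (bwd u)" "L2norm M (bwd u) \<le> T * L2norm M u"
proof -
  have eq: "bwd u = rfl T (fwd (rfl T u))" by (rule ext) (rule bwd_eq_rfl)
  note F = fwd_L2[OF rfl_L2[OF u]]
  show "L2 M (bwd u)" unfolding eq by (rule rfl_L2[OF F(1)])
  show "L2norm M (bwd u) \<le> T * L2norm M u"
    unfolding eq L2norm_rfl[OF F(1)] using F(2) by (simp add: L2norm_rfl[OF u])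
qed

lemma ext_lincomb: "ext (\<lambda>z. a * u z + b * v z) z = a * ext u z + b * ext v z"
  by (simp add: ext_def algebra_simps)

lemma AE_M_fst:
  assumes "AE x in lborel. \<forall>t. P (x, t)"
  shows "AE z in M. P z"
  using AE_lborel_fst[OF assms, where 'b=real] unfolding AE_leb[OF open_Q]
  by (auto elim!: eventually_mono)

lemma fwd_lincomb:
  assumes u: "L2 M u" and v: "L2 M v"
  shows "AE z in M. fwd (\<lambda>z. a * u z + b * v z) z = a * fwd u z + b * fwd v z"
proof (rule AE_M_fst)
  show "AE x in lborel. \<forall>t. fwd (\<lambda>z. a * u z + b * v z) (x, t) = a * fwd u (x, t) + b * fwd v (x, t)"
    using section_L2[OF u] section_L2[OF v]
  proof eventually_elim
    case (elim x)
    note i = section_integrable[OF elim(1)] section_integrable[OF elim(2)]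
    show ?case
    proof
      fix t
      have "fwd (\<lambda>z. a * u z + b * v z) (x, t)
        = (\<integral>s. a * (if s < t then ext u (x, s) else 0) + b * (if s < t then ext v (x, s) else 0) \<partial>lborel)"
        unfolding fwd_Pair by (intro Bochner_Integration.integral_cong) (auto simp: ext_lincomb)
      also have "\<dots> = a * fwd u (x, t) + b * fwd v (x, t)"
        using integrable_if_lborel[OF i(1), of "\<lambda>s. s < t"] integrable_if_lborel[OF i(2), of "\<lambda>s. s < t"]
        by (simp add: fwd_Pair)
      finally show "fwd (\<lambda>z. a * u z + b * v z) (x, t) = a * fwd u (x, t) + b * fwd v (x, t)" .
    qed
  qed
qed

lemma bwd_lincomb:
  assumes u: "L2 M u" and v: "L2 M v"
  shows "AE z in M. bwd (\<lambda>z. a * u z + b * v z) z = a * bwd u z + b * bwd v z"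
proof -
  have "rfl T (\<lambda>z. a * u z + b * v z) = (\<lambda>z. a * rfl T u z + b * rfl T v z)"
    by (rule ext) (simp add: rfl_def)
  then show ?thesis
    using AE_M_reflection[OF fwd_lincomb[OF rfl_L2[OF u] rfl_L2[OF v], of a b]]
    by (simp add: bwd_eq_rfl) (simp add: rfl_def)
qed

lemma bwd_diff_bound:
  assumes u: "L2 M u" and v: "L2 M v"
  shows "L2norm M (\<lambda>z. bwd u z - bwd v z) \<le> T * L2norm M (\<lambda>z. u z - v z)"
proof -
  have "L2norm M (\<lambda>z. bwd u z - bwd v z) = L2norm M (bwd (\<lambda>z. u z - v z))"
    using bwd_lincomb[OF u v, of 1 "-1"] bwd_L2(1)[OF L2_diff[OF u v]] L2_diff[OF bwd_L2(1)[OF u] bwd_L2(1)[OF v]]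
    by (intro L2norm_cong_AE) (auto simp: L2_def elim!: eventually_mono)
  then show ?thesis using bwd_L2(2)[OF L2_diff[OF u v]] by simp
qed

text \<open>The norm estimate maps null functions to null functions; no second look at sections is
  necessary.\<close>

lemma bwd_cong_AE:
  assumes u: "L2 M u" and v: "L2 M v" and eq: "AE z in M. u z = v z"
  shows "AE z in M. bwd u z = bwd v z"
proof -
  have "L2norm M (\<lambda>z. u z - v z) = 0"
    using eq L2norm_zero_iff[OF L2_diff[OF u v]] by simp
  then have "L2norm M (\<lambda>z. bwd u z - bwd v z) = 0"
    using bwd_diff_bound[OF u v] L2norm_nonneg by (simp add: order.antisym)
  then show ?thesis using L2norm_zero_iff[OF L2_diff[OF bwd_L2(1)[OF u] bwd_L2(1)[OF v]]] by simp
qed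

text \<open>\<open>half_line_swap\<close> in almost every section. This adjointness is what moves
  initial and terminal conditions from one factor of an integral to the other.\<close>

lemma fwd_bwd_adjoint:
  assumes u: "L2 M u" and v: "L2 M v"
  shows "(\<integral>z. fwd u z * v z \<partial>M) = (\<integral>z. u z * bwd v z \<partial>M)"
proof -
  have i: "integrable M (\<lambda>z. fwd u z * v z)" "integrable M (\<lambda>z. u z * bwd v z)"
    using fwd_L2(1)[OF u] bwd_L2(1)[OF v] u v by (auto intro: L2_mult_integrable)
  have "AE x in lborel. (\<integral>t. ext (\<lambda>z. fwd u z * v z) (x, t) \<partial>lborel) = (\<integral>t. ext (\<lambda>z. u z * bwd v z) (x, t) \<partial>lborel)"
    using section_L2[OF u] section_L2[OF v]
  proof eventually_elim
    case (elim x)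
    have "(\<integral>t. ext (\<lambda>z. fwd u z * v z) (x, t) \<partial>lborel)
        = (\<integral>t. ext v (x, t) * (\<integral>s. (if s < t then ext u (x, s) else 0) \<partial>lborel) \<partial>lborel)"
      by (intro Bochner_Integration.integral_cong) (auto simp: ext_def fwd_Pair)
    also have "\<dots> = (\<integral>s. ext u (x, s) * (\<integral>t. (if s < t then ext v (x, t) else 0) \<partial>lborel) \<partial>lborel)"
      by (rule half_line_swap[OF section_integrable[OF elim(1)] section_integrable[OF elim(2)]])
    also have "\<dots> = (\<integral>t. ext (\<lambda>z. u z * bwd v z) (x, t) \<partial>lborel)"
      by (intro Bochner_Integration.integral_cong) (auto simp: ext_def bwd_Pair)
    finally show ?case .
  qed
  then show ?thesis
    unfolding integral_M_sections[OF i(1)] integral_M_sections[OF i(2)]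
    using lborel_integral_sections(2)[of "ext (\<lambda>z. fwd u z * v z)"] lborel_integral_sections(2)[of "ext (\<lambda>z. u z * bwd v z)"]
      i by (intro integral_cong_AE) (auto simp: ext_integrable)
qed

lemma L2_time_weight:
  assumes u: "L2 M u" and \<theta>: "continuous_on {0..T} \<theta>"
  shows "L2 M (\<lambda>z. \<theta> (snd z) * u z)"
proof -
  obtain C where C': "\<forall>y\<in>\<theta> ` {0..T}. norm y \<le> C"
    using compact_imp_bounded[OF compact_continuous_image[OF \<theta> compact_Icc]] unfolding bounded_iff by blast
  then have C: "\<bar>\<theta> t\<bar> \<le> C" if "t \<in> {0..T}" for t using that by auto
  show ?thesis
  proof (rule L2_bounded_mult[OF u])
    have "continuous_on (Q \<Omega> T) (\<lambda>z. \<theta> (snd z))"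
      by (intro continuous_on_compose2[OF \<theta>] continuous_intros) (auto simp: Q_def)
    then show "(\<lambda>z. \<theta> (snd z)) \<in> borel_measurable M"
      using borel_measurable_continuous_on_restrict measurable_restrict_space2 sets_lborel
      by (metis (no_types, lifting) measurable_cong_sets sets_restrict_space_cong)
    show "\<bar>\<theta> (snd z)\<bar> \<le> C" if "z \<in> space M" for z
      using C[of "snd z"] that by (auto simp: space_restrict_space Q_def)
  qed
qed

text \<open>The energy inequality in time: \<open>weighted_half_line\<close> in almost every
  section, integrated over x. With w = \<open>fwd u\<close>, the left-hand side is the weighted
  integral of w times its time derivative.\<close>

lemma weighted_fwd:
  assumes u: "L2 M u"
    and \<theta>: "\<And>t. 0 \<le> t \<Longrightarrow> t \<le> T \<Longrightarrow> (\<theta> has_real_derivative \<theta>' t) (at t)"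
      "\<And>t. 0 \<le> t \<Longrightarrow> t \<le> T \<Longrightarrow> isCont \<theta>' t" and pos: "0 \<le> \<theta> T"
  shows "(\<integral>z. \<theta> (snd z) * (u z * fwd u z) \<partial>M) \<ge> (\<integral>z. - \<theta>' (snd z) * (fwd u z)\<^sup>2 \<partial>M) / 2"
proof -
  have c: "continuous_on {0..T} \<theta>" "continuous_on {0..T} (\<lambda>t. - \<theta>' t)"
    using DERIV_isCont[OF \<theta>(1)] \<theta>(2) by (auto intro!: continuous_at_imp_continuous_on continuous_intros)
  have i: "integrable M (\<lambda>z. \<theta> (snd z) * (u z * fwd u z))"
    "integrable M (\<lambda>z. - \<theta>' (snd z) * (fwd u z)\<^sup>2)"
    using L2_mult_integrable[OF L2_time_weight[OF u c(1)] fwd_L2(1)[OF u]]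
      L2_mult_integrable[OF L2_time_weight[OF fwd_L2(1)[OF u] c(2)] fwd_L2(1)[OF u]]
    by (simp_all add: power2_eq_square mult.assoc)
  note I = i[unfolded ext_integrable, THEN lborel_integral_sections(2)]
  have "AE x in lborel. (\<integral>t. ext (\<lambda>z. - \<theta>' (snd z) * (fwd u z)\<^sup>2) (x, t) \<partial>lborel) / 2
      \<le> (\<integral>t. ext (\<lambda>z. \<theta> (snd z) * (u z * fwd u z)) (x, t) \<partial>lborel)"
    using section_L2[OF u]
  proof eventually_elim
    case (elim x)
    let ?g = "\<lambda>t. ext u (x, t)"
    have "(\<integral>t. indicator {0..T} t * (- \<theta>' t * (\<integral>s. (if s < t then ?g s else 0) \<partial>lborel)\<^sup>2) \<partial>lborel) / 2
        \<le> (\<integral>t. \<theta> t * (?g t * (\<integral>s. (if s < t then ?g s else 0) \<partial>lborel)) \<partial>lborel)"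
      by (rule weighted_half_line[OF section_integrable[OF elim] ext_outside T_pos \<theta> pos])
    also have "(\<integral>t. \<theta> t * (?g t * (\<integral>s. (if s < t then ?g s else 0) \<partial>lborel)) \<partial>lborel)
        = (\<integral>t. ext (\<lambda>z. \<theta> (snd z) * (u z * fwd u z)) (x, t) \<partial>lborel)"
      by (intro Bochner_Integration.integral_cong) (auto simp: ext_def fwd_Pair)
    also have "(\<integral>t. indicator {0..T} t * (- \<theta>' t * (\<integral>s. (if s < t then ?g s else 0) \<partial>lborel)\<^sup>2) \<partial>lborel)
        = (\<integral>t. ext (\<lambda>z. - \<theta>' (snd z) * (fwd u z)\<^sup>2) (x, t) \<partial>lborel)"
    \<comment> \<open>For x in \<Omega> the closed time interval differs from the open one, on which
      \<open>ext\<close> lives, only in two points; for other x both sides vanish.\<close>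
    proof (cases "x \<in> \<Omega>")
      case True
      have ne: "AE t in lborel. t \<noteq> 0 \<and> t \<noteq> T"
        using AE_lborel_singleton[of 0] AE_lborel_singleton[of T] by (rule AE_conjI)
      have m1: "(\<lambda>t. ext (\<lambda>z. - \<theta>' (snd z) * (fwd u z)\<^sup>2) (x, t)) \<in> borel_measurable borel"
        using borel_measurable_integrable[OF i(2)[unfolded ext_integrable]] by (intro measurable_section) simp
      have "continuous_on {0..T} \<theta>'" using \<theta>(2) by (auto intro!: continuous_at_imp_continuous_on)
      then have [measurable]: "(\<lambda>t. indicator {0..T} t * \<theta>' t) \<in> borel_measurable borel"
        using borel_measurable_continuous_on_indicator[of "{0..T}" \<theta>'] by simp
      have [measurable]: "?g \<in> borel_measurable borel" using elim by (simp add: L2_def)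
      have m2: "(\<lambda>t. (- (indicator {0..T} t * \<theta>' t)) * (\<integral>s. (if s < t then ?g s else 0) \<partial>lborel)\<^sup>2) \<in> borel_measurable borel"
        by measurable
      show ?thesis
      proof (rule integral_cong_AE)
        show "AE t in lborel. indicator {0..T} t * (- \<theta>' t * (\<integral>s. (if s < t then ?g s else 0) \<partial>lborel)\<^sup>2)
            = ext (\<lambda>z. - \<theta>' (snd z) * (fwd u z)\<^sup>2) (x, t)"
          using ne by (rule eventually_mono) (use True in \<open>auto simp: ext_def fwd_Pair Q_def indicator_def\<close>)
      qed (use m1 m2 in \<open>simp_all add: algebra_simps\<close>)
    next
      case False
      then have "ext w (x, s) = 0" for w s by (simp add: ext_def Q_def)
      then show ?thesis by (simp cong: if_cong)
    qed
    finally show ?case .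
  qed
  then have "(\<integral>x. (\<integral>t. ext (\<lambda>z. - \<theta>' (snd z) * (fwd u z)\<^sup>2) (x, t) \<partial>lborel) / 2 \<partial>lborel)
      \<le> (\<integral>x. (\<integral>t. ext (\<lambda>z. \<theta> (snd z) * (u z * fwd u z)) (x, t) \<partial>lborel) \<partial>lborel)"
    using I by (intro integral_mono_AE) auto
  then show ?thesis
    unfolding integral_M_sections[OF i(1)] integral_M_sections[OF i(2)] by simp
qed

text \<open>Time reversal of \<open>weighted_fwd\<close>: reflecting the weight changes the sign of
  its derivative, and the boundary term that is dropped now sits at t = 0.\<close>

lemma weighted_bwd:
  assumes u: "L2 M u"
    and \<theta>: "\<And>t. 0 \<le> t \<Longrightarrow> t \<le> T \<Longrightarrow> (\<theta> has_real_derivative \<theta>' t) (at t)"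
      "\<And>t. 0 \<le> t \<Longrightarrow> t \<le> T \<Longrightarrow> isCont \<theta>' t" and pos: "0 \<le> \<theta> 0"
  shows "(\<integral>z. \<theta> (snd z) * (u z * bwd u z) \<partial>M) \<ge> (\<integral>z. \<theta>' (snd z) * (bwd u z)\<^sup>2 \<partial>M) / 2"
proof -
  have c: "continuous_on {0..T} \<theta>" "continuous_on {0..T} \<theta>'"
    using DERIV_isCont[OF \<theta>(1)] \<theta>(2) by (auto intro!: continuous_at_imp_continuous_on)
  note b = bwd_L2(1)[OF u]
  have m: "(\<lambda>z. \<theta> (snd z) * (u z * bwd u z)) \<in> borel_measurable M"
    "(\<lambda>z. \<theta>' (snd z) * (bwd u z)\<^sup>2) \<in> borel_measurable M"
    using L2_mult_integrable[OF L2_time_weight[OF u c(1)] b] L2_mult_integrable[OF L2_time_weight[OF b c(2)] b]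
    by (simp_all add: power2_eq_square mult.assoc)
  have r: "((\<lambda>t. T - t) has_real_derivative - 1) (at t within UNIV)" for t
    by (auto intro!: derivative_eq_intros)
  have d: "((\<lambda>t. \<theta> (T - t)) has_real_derivative - \<theta>' (T - t)) (at t)" if "0 \<le> t" "t \<le> T" for t
    using DERIV_chain2[OF \<theta>(1)[of "T - t"] r] that by simp
  have cont: "isCont (\<lambda>t. - \<theta>' (T - t)) t" if "0 \<le> t" "t \<le> T" for t
    using isCont_o2[of t "\<lambda>t. T - t" \<theta>'] \<theta>(2)[of "T - t"] that by (simp add: continuous_minus)
  have f: "fwd (rfl T u) z = rfl T (bwd u) z" for z
    by (cases z) (simp add: bwd_eq_rfl rfl_def)
  have "(\<integral>z. - (- \<theta>' (T - snd z)) * (fwd (rfl T u) z)\<^sup>2 \<partial>M) / 2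
      \<le> (\<integral>z. \<theta> (T - snd z) * (rfl T u z * fwd (rfl T u) z) \<partial>M)"
    by (rule weighted_fwd[where \<theta>="\<lambda>t. \<theta> (T - t)" and \<theta>'="\<lambda>t. - \<theta>' (T - t)", OF rfl_L2[OF u]])
      (use d cont pos in auto)
  then show ?thesis
    using integral_rfl[OF m(1)] integral_rfl[OF m(2)] by (simp add: f) (simp add: rfl_def)
qed

end

section \<open>Initial and terminal values\<close>

lemma antiderivative_smooth:
  fixes \<eta> :: "real \<Rightarrow> real"
  assumes \<eta>: "smooth \<eta>" and z: "\<And>t. t \<le> c \<Longrightarrow> \<eta> t = 0"
  shows "\<exists>\<theta>. smooth \<theta> \<and> (\<forall>t. (\<theta> has_real_derivative \<eta> t) (at t)) \<and> (\<forall>t\<le>c. \<theta> t = 0) \<and>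
    (\<forall>t. \<theta> t = (\<integral>s. (if s < t then \<eta> s else 0) \<partial>lborel))"
proof -
  \<comment> \<open>The integrand vanishes up to c, so the base point does not affect the value.
    Taking it one unit to the left makes every t >= c an interior point of the interval, which gives
    a two-sided derivative also at c.\<close>
  define \<theta> where "\<theta> t = integral {c - 1..t} \<eta>" for t
  have cont: "continuous_on S \<eta>" for S using \<eta> by (rule smooth_continuous)
  have zero: "\<theta> t = 0" if "t \<le> c" for t
  proof -
    have "integral {c - 1..t} \<eta> = integral {c - 1..t} (\<lambda>t. 0)"
      using that z by (intro Henstock_Kurzweil_Integration.integral_cong) auto
    then show ?thesis by (simp add: \<theta>_def)
  qed
  have der: "(\<theta> has_real_derivative \<eta> t) (at t)" for t
  proof (cases "t < c")
    case True
    have "((\<lambda>t. 0) has_real_derivative 0) (at t)" by simp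
    then have "(\<theta> has_real_derivative 0) (at t)"
      by (rule has_field_derivative_transform_within_open[where S="{..<c}"]) (use True zero in auto)
    then show ?thesis using True z by simp
  next
    case False
    have "((\<lambda>x. integral {c - 1..x} \<eta>) has_real_derivative \<eta> t) (at t within {c - 1..t + 1})"
      by (rule integral_has_real_derivative[OF cont]) (use False in auto)
    moreover have "at t within {c - 1..t + 1} = at t"
      using False by (intro at_within_interior) auto
    ultimately show ?thesis by (simp add: \<theta>_def[abs_def])
  qed
  have eq: "\<theta> t = (\<integral>s. (if s < t then \<eta> s else 0) \<partial>lborel)" for t
  proof (cases "t \<le> c")
    case True
    have "(\<integral>s. (if s < t then \<eta> s else 0) \<partial>lborel) = (\<integral>s. 0 \<partial>(lborel :: real measure))"
      using True z by (intro Bochner_Integration.integral_cong) auto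
    then show ?thesis using zero[OF True] by simp
  next
    case False
    have "(\<integral>s. \<eta> s * indicator {c..t} s \<partial>lborel) = \<theta> t - \<theta> c"
      using False by (intro integral_FTC_Icc_real der) (use cont[of UNIV] in \<open>auto simp: continuous_on_eq_continuous_at\<close>)
    moreover have "(\<integral>s. (if s < t then \<eta> s else 0) \<partial>lborel) = (\<integral>s. \<eta> s * indicator {c..t} s \<partial>lborel)"
    proof (rule integral_cong_AE)
      have [measurable]: "\<eta> \<in> borel_measurable borel" using cont[of UNIV] by (rule borel_measurable_continuous_onI)
      show "(\<lambda>s. if s < t then \<eta> s else 0) \<in> borel_measurable lborel" by measurable
      show "(\<lambda>s. \<eta> s * indicator {c..t} s) \<in> borel_measurable lborel" by measurable
      have "AE s in lborel. s \<noteq> t" by (rule AE_lborel_singleton)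
      then show "AE s in lborel. (if s < t then \<eta> s else 0) = \<eta> s * indicator {c..t} s"
        by (rule eventually_mono) (use z in \<open>auto simp: indicator_def\<close>)
    qed
    ultimately show ?thesis using zero[of c] by simp
  qed
  show ?thesis using smooth_real_deriv[OF der \<eta>] der zero eq by blast
qed

lemma smooth_snd:
  assumes "smooth (\<theta> :: real \<Rightarrow> real)"
  shows "smooth (\<lambda>z :: 'a::euclidean_space \<times> real. \<theta> (snd z))"
  by (rule smooth_comp_linear[OF bounded_linear_snd assms])

lemma smooth_fst:
  assumes "smooth (\<theta> :: 'a::euclidean_space \<Rightarrow> real)"
  shows "smooth (\<lambda>z :: 'a \<times> real. \<theta> (fst z))"
  by (rule smooth_comp_linear[OF bounded_linear_fst assms])

lemma pd_snd:
  fixes \<theta> :: "real \<Rightarrow> real"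
  assumes "(\<theta> has_real_derivative d) (at (snd z))"
  shows "pd (x, s) (\<lambda>z :: 'a::euclidean_space \<times> real. \<theta> (snd z)) z = s * d"
proof -
  have "(\<theta> has_derivative (\<lambda>h. d * h)) (at (snd z))"
    using assms by (simp add: has_field_derivative_def)
  moreover have "(snd has_derivative snd) (at z)"
    by (rule bounded_linear_imp_has_derivative[OF bounded_linear_snd])
  ultimately have "((\<lambda>z. \<theta> (snd z)) has_derivative (\<lambda>h. d * snd h)) (at z)"
    using diff_chain_at[of snd snd z \<theta>] by (simp add: o_def)
  from pd_eqI[OF this] show ?thesis by simp
qed

lemma pd_fst_time:
  fixes \<theta> :: "'a::euclidean_space \<Rightarrow> real"
  assumes "smooth \<theta>"
  shows "pd (0, s) (\<lambda>z :: 'a \<times> real. \<theta> (fst z)) z = 0"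
proof -
  have "(fst has_derivative fst) (at z)"
    by (rule bounded_linear_imp_has_derivative[OF bounded_linear_fst])
  from diff_chain_at[OF this differentiable_has_frechet[OF smooth_differentiable[OF assms]]]
  have "((\<lambda>z. \<theta> (fst z)) has_derivative (\<lambda>h. frechet_derivative \<theta> (at (fst z)) (fst h))) (at z)"
    by (simp add: o_def)
  from pd_eqI[OF this] show ?thesis
    using linear_0[OF linear_frechet_derivative[OF smooth_differentiable[OF assms]]] by simp
qed

lemma Basis_time: "(0, 1) \<in> (Basis :: ('a::euclidean_space \<times> real) set)"
  and Basis_space: "b \<in> Basis \<Longrightarrow> (b, 0) \<in> (Basis :: ('a::euclidean_space \<times> real) set)"
  by (auto simp: Basis_prod_def)

context cylinder
begin

lemma test_fun_M_L2: "test_fun U \<phi> \<Longrightarrow> L2 M \<phi>"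
  by (rule test_fun_L2[OF open_Q])

text \<open>The weak spatial derivative may be tested with functions that do not vanish at \<open>t = 0\<close>
  and \<open>t = T\<close>: multiply by temporal cut-offs, which commute with \<open>\<partial>\<^sub>x\<close>, and pass to the limit.\<close>

lemma is_wderiv_space_lateral:
  assumes b: "b \<in> Basis" and W: "L2 M W" and G: "is_wderiv (Q \<Omega> T) (b, 0) W G"
    and \<phi>: "test_fun (\<Omega> \<times> UNIV) \<phi>"
  shows "(\<integral>z. W z * pd (b, 0) \<phi> z \<partial>M) = - (\<integral>z. G z * \<phi> z \<partial>M)"
proof -
  note b' = Basis_space[OF b]
  \<comment> \<open>The shift by 1 makes this cut-off vanish within distance 1/(m+1) of t = 0 and t
    = T, so that its product with \<phi> is compactly supported in Q; \<open>Suc m\<close> keeps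
    that distance positive and finite.\<close>
  define \<kappa> where "\<kappa> m t = flat 0 (real (Suc m) * t - 1) * flat 0 (real (Suc m) * (T - t) - 1)" for m t
  have \<kappa>s: "smooth (\<kappa> m)" for m
  proof -
    have "smooth (\<lambda>t. flat 0 (- 1 + real (Suc m) * t) * flat 0 ((real (Suc m) * T - 1) + (- real (Suc m)) * t))"
      by (intro smooth_mult smooth_flat_affine)
    then show ?thesis by (simp add: \<kappa>_def[abs_def] algebra_simps)
  qed
  have \<kappa>b: "0 \<le> \<kappa> m t" "\<kappa> m t \<le> 1" for m t
    by (auto simp: \<kappa>_def flat_0_bounds mult_le_one)
  have \<kappa>lim: "(\<lambda>m. \<kappa> m t) \<longlonglongrightarrow> 1" if "t \<in> {0<..<T}" for t
  proof -
    have "(\<lambda>m. flat 0 (real (Suc m) * t - 1) * flat 0 (real (Suc m) * (T - t) - 1)) \<longlonglongrightarrow> 1 * 1"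
      using that by (intro tendsto_mult LIMSEQ_Suc[OF flat_0_tendsto]) auto
    then show ?thesis by (simp add: \<kappa>_def)
  qed
  define \<delta> where "\<delta> m = inverse (real (Suc m))" for m
  have \<delta>: "0 < \<delta> m" for m by (simp add: \<delta>_def)
  have \<kappa>0: "\<kappa> m t = 0" if "t \<notin> {\<delta> m..T - \<delta> m}" for m t
  proof -
    have "real (Suc m) * t - 1 \<le> 0 \<or> real (Suc m) * (T - t) - 1 \<le> 0"
      using that by (auto simp: \<delta>_def field_simps)
    then show ?thesis by (auto simp: \<kappa>_def flat_0_bounds)
  qed
  define \<psi> where "\<psi> m z = \<kappa> m (snd z) * \<phi> z" for m z
  have s\<phi>: "smooth \<phi>" by (rule test_fun_smooth[OF \<phi>])
  obtain K where K: "compact K" "K \<subseteq> \<Omega> \<times> UNIV" "\<And>z. z \<notin> K \<Longrightarrow> \<phi> z = 0"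
    using \<phi> by (auto simp: test_fun_def)
  have t\<psi>: "test_fun (Q \<Omega> T) (\<psi> m)" for m
    unfolding test_fun_def
  proof (intro conjI exI[of _ "K \<inter> (UNIV \<times> {\<delta> m..T - \<delta> m})"] allI impI)
    show "smooth (\<psi> m)" unfolding \<psi>_def[abs_def] by (intro smooth_mult smooth_snd \<kappa>s s\<phi>)
    show "compact (K \<inter> UNIV \<times> {\<delta> m..T - \<delta> m})"
      by (intro compact_Int_closed K closed_Times) auto
    show "K \<inter> UNIV \<times> {\<delta> m..T - \<delta> m} \<subseteq> Q \<Omega> T"
      using K(2) \<delta>[of m] by (auto simp: Q_def)
    fix z assume "z \<notin> K \<inter> UNIV \<times> {\<delta> m..T - \<delta> m}"
    then show "\<psi> m z = 0" using K(3)[of z] \<kappa>0[of "snd z" m] by (cases z) (auto simp: \<psi>_def)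
  qed
  have pd\<psi>: "pd (b, 0) (\<psi> m) z = \<kappa> m (snd z) * pd (b, 0) \<phi> z" for m z
  proof -
    obtain d where "(\<kappa> m has_real_derivative d) (at (snd z))"
      using smooth_differentiable[OF \<kappa>s, of m "snd z"] real_differentiable_def by blast
    from pd_snd[OF this, of b 0] show ?thesis
      unfolding \<psi>_def[abs_def]
      by (subst pd_mult) (auto intro!: smooth_differentiable smooth_snd \<kappa>s s\<phi>)
  qed
  have L: "L2 M \<phi>" "L2 M (pd (b, 0) \<phi>)" using test_fun_M_L2[OF \<phi>] test_fun_M_L2[OF test_fun_pd[OF \<phi> b']] .
  have lim: "(\<lambda>m. \<integral>z. U z * (\<kappa> m (snd z) * p z) \<partial>M) \<longlonglongrightarrow> (\<integral>z. U z * p z \<partial>M)"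
    if U: "L2 M U" and p: "L2 M p" for U p
  proof (rule integral_dominated_convergence[where w="\<lambda>z. \<bar>U z * p z\<bar>"])
    have m: "(\<lambda>z. \<kappa> m (snd z)) \<in> borel_measurable M" for m
      using borel_measurable_continuous_onI[OF smooth_continuous[OF smooth_snd[OF \<kappa>s]]]
      by (intro measurable_restrict_space1) auto
    show "(\<lambda>z. U z * p z) \<in> borel_measurable M" using U p by (auto simp: L2_def)
    show "(\<lambda>z. U z * (\<kappa> m (snd z) * p z)) \<in> borel_measurable M" for m
      using U p m by (auto simp: L2_def)
    show "integrable M (\<lambda>z. \<bar>U z * p z\<bar>)" by (intro integrable_abs L2_mult_integrable U p)
    show "AE z in M. (\<lambda>m. U z * (\<kappa> m (snd z) * p z)) \<longlonglongrightarrow> U z * p z"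
    proof (rule AE_I2)
      fix z assume "z \<in> space M"
      then have "snd z \<in> {0<..<T}" by (auto simp: space_restrict_space Q_def)
      then have "(\<lambda>m. U z * (\<kappa> m (snd z) * p z)) \<longlonglongrightarrow> U z * (1 * p z)"
        by (intro tendsto_intros \<kappa>lim)
      then show "(\<lambda>m. U z * (\<kappa> m (snd z) * p z)) \<longlonglongrightarrow> U z * p z" by simp
    qed
    show "AE z in M. norm (U z * (\<kappa> m (snd z) * p z)) \<le> \<bar>U z * p z\<bar>" for m
    proof (rule AE_I2)
      fix z
      have "\<bar>\<kappa> m (snd z)\<bar> * \<bar>U z * p z\<bar> \<le> 1 * \<bar>U z * p z\<bar>"
        using \<kappa>b[of m "snd z"] by (intro mult_right_mono) auto
      then show "norm (U z * (\<kappa> m (snd z) * p z)) \<le> \<bar>U z * p z\<bar>" by (simp add: abs_mult mult.left_commute)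
    qed
  qed
  have "(\<lambda>m. \<integral>z. W z * (\<kappa> m (snd z) * pd (b, 0) \<phi> z) \<partial>M) \<longlonglongrightarrow> (\<integral>z. W z * pd (b, 0) \<phi> z \<partial>M)"
    by (rule lim[OF W L(2)])
  moreover have "(\<lambda>m. - (\<integral>z. G z * (\<kappa> m (snd z) * \<phi> z) \<partial>M)) \<longlonglongrightarrow> - (\<integral>z. G z * \<phi> z \<partial>M)"
    by (intro tendsto_minus lim[OF is_wderiv_L2[OF G] L(1)])
  moreover have "(\<integral>z. W z * (\<kappa> m (snd z) * pd (b, 0) \<phi> z) \<partial>M) = - (\<integral>z. G z * (\<kappa> m (snd z) * \<phi> z) \<partial>M)" for m
    using is_wderivD[OF G t\<psi>[of m]] unfolding pd\<psi> by (simp add: \<psi>_def)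
  ultimately show ?thesis using LIMSEQ_unique by simp
qed

text \<open>\<open>bwd u\<close> is its own continuous representative: its time slices at r and t
  differ in L2 by at most sqrt |r - t| times the norm of u, by Cauchy-Schwarz over the times in
  between.\<close>

lemma vanishes_at_terminal_bwd:
  assumes u: "L2 M u"
  shows "vanishes_at \<Omega> T T (bwd u)"
  unfolding vanishes_at_def
proof (intro exI[of _ "bwd u"] conjI ballI)
  define k where "k x = (\<integral>s. (ext u (x, s))\<^sup>2 \<partial>lborel)" for x
  have k: "integrable lborel k" "(\<integral>x. k x \<partial>lborel) = (L2norm M u)\<^sup>2"
    using section_norm_integral[OF u] unfolding k_def .
  have meas: "(\<lambda>x. bwd u (x, t)) \<in> borel_measurable (leb \<Omega>)" for t
  proof -
    have "bwd u \<in> borel_measurable borel" by (rule bwd_measurable[OF L2_measurable[OF u]])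
    from measurable_compose[OF _ this, of "\<lambda>x. (x, t)" borel]
    have "(\<lambda>x. bwd u (x, t)) \<in> borel_measurable borel" by (simp add: borel_prod[symmetric])
    then show ?thesis by (intro measurable_restrict_space1) simp
  qed
  have norm_bound: "L2 (leb \<Omega>) v \<and> L2norm (leb \<Omega>) v \<le> sqrt c * L2norm M u"
    if v: "v \<in> borel_measurable (leb \<Omega>)" and le: "AE x in lborel. (v x)\<^sup>2 \<le> c * k x" and c: "0 \<le> c" for v c
  proof -
    have ck: "integrable lborel (\<lambda>x. c * k x)" using k by simp
    have vm: "(\<lambda>x. indicator \<Omega> x * (v x)\<^sup>2) \<in> borel_measurable lborel"
      using v by (simp add: measurable_leb[OF open_\<Omega>] indicator_mult_power2[symmetric])
    have k0: "0 \<le> k x" for x by (simp add: k_def)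
    have le': "AE x in lborel. indicator \<Omega> x * (v x)\<^sup>2 \<le> c * k x"
      using le by (rule eventually_mono) (use c k0 in \<open>auto simp: indicator_def\<close>)
    have int: "integrable lborel (\<lambda>x. indicator \<Omega> x * (v x)\<^sup>2)"
      using ck vm by (rule Bochner_Integration.integrable_bound) (use le' in \<open>auto elim!: eventually_mono\<close>)
    then have L: "L2 (leb \<Omega>) v" using v by (simp add: L2_def integrable_leb[OF open_\<Omega>])
    have "(L2norm (leb \<Omega>) v)\<^sup>2 \<le> c * (L2norm M u)\<^sup>2"
      using integral_mono_AE[OF int ck le'] k(2) by (simp add: L2norm_power2[of "leb \<Omega>"] integral_leb[OF open_\<Omega>])
    also have "\<dots> = (sqrt c * L2norm M u)\<^sup>2" using c by (simp add: power_mult_distrib)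
    finally have "L2norm (leb \<Omega>) v \<le> sqrt c * L2norm M u"
      by (rule power2_le_imp_le) (use c in auto)
    with L show ?thesis by simp
  qed
  have diff: "AE x in lborel. (bwd u (x, r) - bwd u (x, t))\<^sup>2 \<le> (t - r) * k x" if "r \<le> t" for r t
    using section_L2[OF u]
  proof eventually_elim
    case (elim x)
    note i = section_integrable[OF elim]
    have "bwd u (x, r) - bwd u (x, t)
      = (\<integral>s. (if r < s then ext u (x, s) else 0) - (if t < s then ext u (x, s) else 0) \<partial>lborel)"
      unfolding bwd_Pair using integrable_if_lborel[OF i, of "\<lambda>s. r < s"] integrable_if_lborel[OF i, of "\<lambda>s. t < s"] by simp
    also have "\<dots> = (\<integral>s. (if r < s \<and> s \<le> t then ext u (x, s) else 0) \<partial>lborel)"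
      using that by (intro Bochner_Integration.integral_cong) auto
    also have "\<dots>\<^sup>2 \<le> (t - r) * k x"
      unfolding k_def
    proof (rule truncated_section_bound[OF elim])
      have "measure lborel ({s. r < s \<and> s \<le> t} \<inter> {0<..<T}) \<le> measure lborel {r<..t}"
        using emeasure_bounded_finite[of "{r<..t}"]
        by (intro measure_mono_fmeasurable) (auto simp: fmeasurable_def)
      then show "measure lborel ({s. r < s \<and> s \<le> t} \<inter> {0<..<T}) \<le> t - r" using that by simp
    qed simp
    finally show ?case .
  qed
  have bT: "bwd u (x, T) = 0" for x
  proof -
    have "bwd u (x, T) = (\<integral>s. 0 \<partial>(lborel :: real measure))"
      unfolding bwd_Pair using ext_outside by (intro Bochner_Integration.integral_cong) auto
    then show ?thesis by simp
  qed
  show "AE x in leb \<Omega>. bwd u (x, T) = 0" by (simp add: bT)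
  fix t assume t: "t \<in> {0..T}"
  \<comment> \<open>The slice at t is compared with the slice at T, which is zero.\<close>
  show "L2 (leb \<Omega>) (\<lambda>x. bwd u (x, t))"
    using norm_bound[OF meas, of t "T - t"] diff[of t T] t by (simp add: bT)
  have bd: "L2norm (leb \<Omega>) (\<lambda>x. bwd u (x, r) - bwd u (x, t)) \<le> sqrt \<bar>r - t\<bar> * L2norm M u" for r
  proof (cases "r \<le> t")
    case True
    then show ?thesis using norm_bound[of "\<lambda>x. bwd u (x, r) - bwd u (x, t)" "t - r"] diff[OF True] meas by simp
  next
    case False
    then show ?thesis using norm_bound[of "\<lambda>x. bwd u (x, r) - bwd u (x, t)" "r - t"] diff[of t r] meas
      by (simp add: power2_commute)
  qed
  show "((\<lambda>r. L2norm (leb \<Omega>) (\<lambda>x. bwd u (x, r) - bwd u (x, t))) \<longlongrightarrow> 0) (at t within {0..T})"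
  proof (rule Lim_null_comparison)
    show "\<forall>\<^sub>F r in at t within {0..T}. norm (L2norm (leb \<Omega>) (\<lambda>x. bwd u (x, r) - bwd u (x, t))) \<le> sqrt \<bar>r - t\<bar> * L2norm M u"
      using bd by simp
    have "((\<lambda>r. sqrt \<bar>r - t\<bar> * L2norm M u) \<longlongrightarrow> sqrt \<bar>t - t\<bar> * L2norm M u) (at t within {0..T})"
      by (intro tendsto_intros)
    then show "((\<lambda>r. sqrt \<bar>r - t\<bar> * L2norm M u) \<longlongrightarrow> 0) (at t within {0..T})" by simp
  qed
qed simp

end

lemma lborel_integral_sections_snd:
  fixes F :: "'a::euclidean_space \<times> 'b::euclidean_space \<Rightarrow> real"
  assumes "integrable lborel F"
  shows "integrable lborel (\<lambda>t. \<integral>x. F (x, t) \<partial>lborel)"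
    "(\<integral>z. F z \<partial>lborel) = (\<integral>t. \<integral>x. F (x, t) \<partial>lborel \<partial>lborel)"
proof -
  have F: "integrable (lborel \<Otimes>\<^sub>M lborel) (\<lambda>(x, t). F (x, t))" using assms by (simp add: lborel_prod)
  show "integrable lborel (\<lambda>t. \<integral>x. F (x, t) \<partial>lborel)"
    using lborel_pair.integrable_snd[OF F] .
  show "(\<integral>z. F z \<partial>lborel) = (\<integral>t. \<integral>x. F (x, t) \<partial>lborel \<partial>lborel)"
    using lborel_pair.integral_snd[OF F] by (simp add: lborel_prod)
qed

context cylinder
begin

section \<open>Vanishing at t = T expressed by backward integration\<close>

text \<open>The factor k \<rho>(k (T - t)) has height at most k and lives where 1/k < T - t < 2/k.
  There the slices of v are small in L2, because its continuous representative vanishes at T, and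
  Cauchy-Schwarz in x against \<zeta> gives the decay.\<close>

lemma terminal_layer_tendsto_0:
  assumes v: "L2 M v" and van: "vanishes_at \<Omega> T T v"
    and \<zeta>: "continuous_on UNIV \<zeta>" "compact K" "\<And>x. x \<notin> K \<Longrightarrow> \<zeta> x = 0"
    and \<theta>: "continuous_on UNIV \<theta>"
    and \<rho>: "continuous_on UNIV \<rho>" "\<And>y. 0 \<le> \<rho> y" "\<And>y. \<rho> y \<le> 1" "\<And>y. y \<notin> {1<..<2} \<Longrightarrow> \<rho> y = 0"
  shows "(\<lambda>k. \<integral>z. v z * (\<zeta> (fst z) * (\<theta> (snd z) * (real k * \<rho> (real k * (T - snd z))))) \<partial>M) \<longlonglongrightarrow> 0"
proof -
  obtain V where V: "AE z in M. V z = v z"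
    and VL: "\<And>t. t \<in> {0..T} \<Longrightarrow> L2 (leb \<Omega>) (\<lambda>x. V (x, t))"
    and Vc: "((\<lambda>r. L2norm (leb \<Omega>) (\<lambda>x. V (x, r) - V (x, T))) \<longlongrightarrow> 0) (at T within {0..T})"
    and VT: "AE x in leb \<Omega>. V (x, T) = 0"
    using van T_pos unfolding vanishes_at_def by auto
  have VTm: "(\<lambda>x. V (x, T)) \<in> borel_measurable (leb \<Omega>)" using VL[of T] T_pos by (simp add: L2_def)
  have N: "L2norm (leb \<Omega>) (\<lambda>x. V (x, r) - V (x, T)) = L2norm (leb \<Omega>) (\<lambda>x. V (x, r))" if "r \<in> {0..T}" for r
    using VT VL[OF that] VTm by (intro L2norm_cong_AE) (auto simp: L2_def elim!: eventually_mono)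
  have secm: "(\<lambda>x. v (x, t)) \<in> borel_measurable (leb \<Omega>)" if "t \<in> {0<..<T}" for t
  proof -
    have "ext v \<in> borel_measurable borel" using L2_measurable[OF v] by (simp add: ext_measurable)
    from measurable_compose[OF _ this, of "\<lambda>x. (x, t)" borel]
    have "(\<lambda>x. ext v (x, t)) \<in> borel_measurable borel" by (simp add: borel_prod[symmetric])
    moreover have "(\<lambda>x. ext v (x, t)) = (\<lambda>x. indicator \<Omega> x * v (x, t))"
      using that by (auto simp: ext_def Q_def indicator_def)
    ultimately show ?thesis by (simp add: measurable_leb[OF open_\<Omega>])
  qed
  have "AE z in lborel. z \<in> Q \<Omega> T \<longrightarrow> V z = v z" using V by (simp add: AE_leb[OF open_Q])
  from AE_lborel_sections(2)[OF this]
  have sec: "AE t in lborel. t \<in> {0<..<T} \<longrightarrow> (AE x in leb \<Omega>. V (x, t) = v (x, t))"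
    by (rule eventually_mono) (auto simp: AE_leb[OF open_\<Omega>] Q_def elim!: eventually_mono)
  have \<zeta>L: "L2 (leb \<Omega>) \<zeta>" by (rule integrable_leb_continuous_mult(1)[OF open_\<Omega> L2_zero \<zeta>])
  obtain \<Theta> where \<Theta>': "\<forall>y\<in>\<theta> ` {0..T}. norm y \<le> \<Theta>"
    using compact_imp_bounded[OF compact_continuous_image[OF continuous_on_subset[OF \<theta>] compact_Icc]]
    unfolding bounded_iff by blast
  then have \<Theta>: "\<bar>\<theta> t\<bar> \<le> \<Theta>" if "t \<in> {0..T}" for t using that by auto
  have \<Theta>0: "0 \<le> \<Theta>" using \<Theta>[of 0] T_pos by auto
  define X where "X = L2norm (leb \<Omega>) \<zeta>"
  define F where "F k z = v z * (\<zeta> (fst z) * (\<theta> (snd z) * (real k * \<rho> (real k * (T - snd z)))))" for k z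
  have wL: "L2 M (\<lambda>z. \<zeta> (fst z) * (\<theta> (snd z) * (real k * \<rho> (real k * (T - snd z)))))" for k
  proof -
    have c: "continuous_on UNIV (\<lambda>z :: 'a \<times> real. \<zeta> (fst z) * (\<theta> (snd z) * (real k * \<rho> (real k * (T - snd z)))))"
      by (intro continuous_intros continuous_on_compose2[OF \<zeta>(1)] continuous_on_compose2[OF \<theta>] continuous_on_compose2[OF \<rho>(1)]) auto
    have 1: "L2 M (\<lambda>z. 1)" using finite_measure.integrable_const[OF finite_M, of "1::real"] by (simp add: L2_def)
    obtain C where C: "0 < C" "\<And>x. \<bar>\<zeta> x\<bar> \<le> C" using bounded_compact_support[OF \<zeta>] by metis
    have bd: "\<bar>\<zeta> (fst z) * (\<theta> (snd z) * (real k * \<rho> (real k * (T - snd z))))\<bar> \<le> C * (\<Theta> * (real k * 1))"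
      if "z \<in> space M" for z k
    proof -
      have "snd z \<in> {0..T}" using that by (auto simp: space_restrict_space Q_def)
      then have "\<bar>\<theta> (snd z)\<bar> \<le> \<Theta>" by (rule \<Theta>)
      moreover have "\<bar>\<rho> (real k * (T - snd z))\<bar> \<le> 1" using \<rho>(2,3) by simp
      ultimately show ?thesis
        unfolding abs_mult using C \<Theta>0 by (intro mult_mono) simp_all
    qed
    have m: "(\<lambda>z. \<zeta> (fst z) * (\<theta> (snd z) * (real k * \<rho> (real k * (T - snd z))))) \<in> borel_measurable M"
      by (intro measurable_restrict_space1) (simp add: borel_measurable_continuous_onI[OF c])
    from L2_bounded_mult[OF 1 m bd] show ?thesis by simp
  qed
  have Fi: "integrable M (F k)" for k unfolding F_def by (rule L2_mult_integrable[OF v wL])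
  \<comment> \<open>Each slice contributes at most k \<Theta> X e and the slices concerned fill an
    interval of length 2/k, so k cancels. The condition 2/d <= k keeps this interval within distance
    d of T, where the slices have norm at most e.\<close>
  have main: "\<bar>\<integral>z. F k z \<partial>M\<bar> \<le> 2 * \<Theta> * X * e"
    if e: "0 < e" and d: "0 < d" "\<And>t. t \<in> {0..T} \<Longrightarrow> T - d < t \<Longrightarrow> t < T \<Longrightarrow> L2norm (leb \<Omega>) (\<lambda>x. V (x, t)) \<le> e"
      and k: "2 / d \<le> real k" "0 < k" for e d k
  proof -
    define H where "H z = \<bar>ext (F k) z\<bar>" for z
    have H: "integrable lborel H" unfolding H_def using Fi[of k] by (simp add: ext_integrable)
    define c where "c = real k * \<Theta> * X * e"
    have c0: "0 \<le> c" using \<Theta>0 e by (simp add: c_def X_def)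
    have "\<bar>\<integral>z. F k z \<partial>M\<bar> \<le> (\<integral>z. H z \<partial>lborel)"
      unfolding ext_integral H_def by (rule integral_abs_bound)
    also have "\<dots> = (\<integral>t. \<integral>x. H (x, t) \<partial>lborel \<partial>lborel)" by (rule lborel_integral_sections_snd[OF H])
    also have "\<dots> \<le> (\<integral>t. c * indicator {T - 2 / real k..T} t \<partial>lborel)"
    proof (rule integral_mono_AE)
      show "integrable lborel (\<lambda>t. \<integral>x. H (x, t) \<partial>lborel)" by (rule lborel_integral_sections_snd[OF H])
      show "integrable lborel (\<lambda>t. c * indicator {T - 2 / real k..T} t)"
        by (intro integrable_mult_right integrable_real_indicator) auto
      show "AE t in lborel. (\<integral>x. H (x, t) \<partial>lborel) \<le> c * indicator {T - 2 / real k..T} t"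
        using sec
      proof (rule eventually_mono)
        fix t assume t: "t \<in> {0<..<T} \<longrightarrow> (AE x in leb \<Omega>. V (x, t) = v (x, t))"
        show "(\<integral>x. H (x, t) \<partial>lborel) \<le> c * indicator {T - 2 / real k..T} t"
        proof (cases "t \<in> {0<..<T} \<and> real k * (T - t) \<in> {1<..<2}")
          case False
          then have "H (x, t) = 0" for x
            using \<rho>(4) by (auto simp: H_def ext_def F_def Q_def)
          then show ?thesis using c0 by simp
        next
          case True
          then have tT: "t \<in> {0<..<T}" and tk: "T - 2 / real k < t"
            using k(2) by (auto simp: field_simps)
          have "2 / real k \<le> d" using k d(1) by (simp add: field_simps)
          then have n: "L2norm (leb \<Omega>) (\<lambda>x. V (x, t)) \<le> e" using tT tk by (intro d(2)) auto
          have eq: "AE x in leb \<Omega>. V (x, t) = v (x, t)" using t tT by blast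
          have vL: "L2 (leb \<Omega>) (\<lambda>x. v (x, t))"
            using L2_AE_cong[OF VL eq secm[OF tT]] tT by auto
          have vn: "L2norm (leb \<Omega>) (\<lambda>x. v (x, t)) \<le> e"
            using L2norm_cong_AE[OF eq] VL[of t] secm[OF tT] tT n by (auto simp: L2_def)
          define a where "a = \<bar>\<theta> t * (real k * \<rho> (real k * (T - t)))\<bar>"
          have a: "a \<le> \<Theta> * real k"
            unfolding a_def abs_mult using \<Theta>[of t] tT \<rho>(2,3)[of "real k * (T - t)"] \<Theta>0
              mult_left_le[of "\<rho> (real k * (T - t))" "real k"]
            by (intro mult_mono) auto
          have vabs: "L2 (leb \<Omega>) (\<lambda>x. \<bar>v (x, t)\<bar>)" "L2 (leb \<Omega>) (\<lambda>x. \<bar>\<zeta> x\<bar>)"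
            using vL \<zeta>L by (auto simp: L2_def)
          have "(\<integral>x. H (x, t) \<partial>lborel) = (\<integral>x. indicator \<Omega> x * (a * (\<bar>v (x, t)\<bar> * \<bar>\<zeta> x\<bar>)) \<partial>lborel)"
            using tT by (intro Bochner_Integration.integral_cong)
              (auto simp: H_def ext_def F_def Q_def a_def abs_mult indicator_def)
          also have "\<dots> = a * (\<integral>x. \<bar>v (x, t)\<bar> * \<bar>\<zeta> x\<bar> \<partial>leb \<Omega>)"
            by (simp add: integral_leb[OF open_\<Omega>, symmetric])
          also have "\<dots> \<le> a * (e * X)"
          proof (rule mult_left_mono)
            have "(\<integral>x. \<bar>v (x, t)\<bar> * \<bar>\<zeta> x\<bar> \<partial>leb \<Omega>) \<le> L2norm (leb \<Omega>) (\<lambda>x. v (x, t)) * X"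
              using L2_Cauchy_Schwarz[OF vabs] by (simp add: L2norm_abs X_def)
            also have "\<dots> \<le> e * X" using vn by (intro mult_right_mono) (auto simp: X_def)
            finally show "(\<integral>x. \<bar>v (x, t)\<bar> * \<bar>\<zeta> x\<bar> \<partial>leb \<Omega>) \<le> e * X" .
          qed (simp add: a_def)
          also have "\<dots> \<le> (\<Theta> * real k) * (e * X)"
            using a e by (intro mult_right_mono) (auto simp: X_def)
          finally have "(\<integral>x. H (x, t) \<partial>lborel) \<le> c" by (simp add: c_def mult_ac)
          then show ?thesis using tk tT by simp
        qed
      qed
    qed
    also have "\<dots> = c * (2 / real k)" using k(2) by simp
    also have "\<dots> = 2 * \<Theta> * X * e" using k(2) by (simp add: c_def)
    finally show ?thesis .
  qed
  show ?thesis
    unfolding F_def[symmetric]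
  proof (rule LIMSEQ_I)
    fix r :: real assume r: "0 < r"
    \<comment> \<open>The summand 1 covers the case that \<Theta> X is zero and makes the final
      inequality strict.\<close>
    define e where "e = r / (2 * \<Theta> * X + 1)"
    have den: "0 < 2 * \<Theta> * X + 1" using \<Theta>0 by (simp add: X_def add_nonneg_pos)
    have e: "0 < e" using r den by (simp add: e_def)
    obtain d where d: "0 < d" "\<And>t. t \<in> {0..T} \<Longrightarrow> t \<noteq> T \<Longrightarrow> dist t T < d \<Longrightarrow> L2norm (leb \<Omega>) (\<lambda>x. V (x, t) - V (x, T)) < e"
      using tendstoD[OF Vc e] unfolding eventually_at by (auto simp: dist_real_def)
    have d': "L2norm (leb \<Omega>) (\<lambda>x. V (x, t)) \<le> e" if "t \<in> {0..T}" "T - d < t" "t < T" for t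
      using d(2)[of t] that N[of t] by (auto simp: dist_real_def)
    obtain n where n: "2 / d \<le> real n" using real_arch_simple by blast
    show "\<exists>no. \<forall>k\<ge>no. norm ((\<integral>z. F k z \<partial>M) - 0) < r"
    proof (intro exI allI impI)
      fix k assume k: "max n 1 \<le> k"
      have "\<bar>\<integral>z. F k z \<partial>M\<bar> \<le> 2 * \<Theta> * X * e"
        using k n by (intro main[OF e d(1) d']) auto
      also have "\<dots> < r" using r den by (simp add: e_def field_simps)
      finally show "norm ((\<integral>z. F k z \<partial>M) - 0) < r" by simp
    qed
  qed
qed

lemma fwd_bump:
  assumes sub: "cbox p q \<subseteq> Q \<Omega> T"
  shows "fwd (bump p q m) z = bump (fst p) (fst q) m (fst z) *
    (\<integral>s. (if s < snd z then cutoff (snd p) (snd q) m s else 0) \<partial>lborel)"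
proof (cases z)
  case (Pair x t)
  have "ext (bump p q m) (x, s) = bump (fst p) (fst q) m x * cutoff (snd p) (snd q) m s" for s
    using bump_eq_0[of "(x, s)" p q m] sub box_subset_cbox[of p q]
    by (cases "(x, s) \<in> Q \<Omega> T") (auto simp: ext_def bump_prod[symmetric])
  then have "fwd (bump p q m) (x, t) = (\<integral>s. bump (fst p) (fst q) m x * (if s < t then cutoff (snd p) (snd q) m s else 0) \<partial>lborel)"
    unfolding fwd_Pair by (intro Bochner_Integration.integral_cong) auto
  then show ?thesis by (simp add: Pair)
qed

text \<open>The time antiderivative of a bump would be the natural test function, but it does not
  vanish near t = T. It is multiplied by a cut-off in k (T - t), which moves to T as k grows; the
  derivative of the cut-off leaves a terminal layer, and exactly there the terminal condition on v
  is used.\<close>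

lemma vanishes_at_terminal_orth:
  assumes v: "L2 M v" and g: "is_wderiv (Q \<Omega> T) (0, 1) v g" and van: "vanishes_at \<Omega> T T v"
    and sub: "cbox p q \<subseteq> Q \<Omega> T" and ne: "cbox p q \<noteq> {}"
  shows "(\<integral>z. v z * bump p q m z \<partial>M) = - (\<integral>z. g z * fwd (bump p q m) z \<partial>M)"
proof -
  define \<zeta> where "\<zeta> = bump (fst p) (fst q) m"
  define \<eta> where "\<eta> = cutoff (snd p) (snd q) m"
  define \<rho> where "\<rho> = cutoff 1 2 1"
  have gL: "L2 M g" by (rule is_wderiv_L2[OF g])
  have box: "cbox p q = cbox (fst p) (fst q) \<times> {snd p..snd q}"
    using cbox_Pair_eq[of "fst p" "snd p" "fst q" "snd q"] by simp
  have "cbox (fst p) (fst q) \<subseteq> \<Omega> \<and> {snd p..snd q} \<subseteq> {0<..<T}" "snd p \<le> snd q"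
    using sub ne unfolding box Q_def times_subset_iff by auto
  then have p0: "0 < snd p" and sub\<Omega>: "cbox (fst p) (fst q) \<subseteq> \<Omega>" by auto
  have \<zeta>: "smooth \<zeta>" "\<And>x. x \<notin> cbox (fst p) (fst q) \<Longrightarrow> \<zeta> x = 0"
    unfolding \<zeta>_def using bump_eq_0[of _ "fst p" "fst q" m] box_subset_cbox[of "fst p" "fst q"]
    by (auto intro: smooth_bump)
  have \<eta>: "smooth \<eta>" "\<And>t. t \<le> snd p \<Longrightarrow> \<eta> t = 0"
    unfolding \<eta>_def by (auto intro: smooth_cutoff cutoff_eq_0)
  obtain \<theta> where \<theta>: "smooth \<theta>" "\<And>t. (\<theta> has_real_derivative \<eta> t) (at t)" "\<And>t. t \<le> snd p \<Longrightarrow> \<theta> t = 0"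
    "\<And>t. \<theta> t = (\<integral>s. (if s < t then \<eta> s else 0) \<partial>lborel)"
    using antiderivative_smooth[of \<eta> "snd p", OF \<eta>(1)] \<eta>(2) by meson
  have \<rho>: "smooth \<rho>" "\<And>t. t \<le> 1 \<Longrightarrow> \<rho> t = 0" "\<And>t. t \<notin> {1<..<2} \<Longrightarrow> \<rho> t = 0" "\<And>t. 0 \<le> \<rho> t" "\<And>t. \<rho> t \<le> 1"
    unfolding \<rho>_def by (auto intro: smooth_cutoff cutoff_eq_0 cutoff_bounds)
  obtain \<kappa> where \<kappa>: "smooth \<kappa>" "\<And>t. (\<kappa> has_real_derivative \<rho> t) (at t)" "\<And>t. t \<le> 1 \<Longrightarrow> \<kappa> t = 0"
    "\<And>t. \<kappa> t = (\<integral>s. (if s < t then \<rho> s else 0) \<partial>lborel)"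
    using antiderivative_smooth[of \<rho> 1, OF \<rho>(1)] \<rho>(2) by meson
  \<comment> \<open>The cut-off is not normalized: c is its plateau value, the total mass of \<rho>.
    Both limits carry the factor c, which is cancelled at the end.\<close>
  define c where "c = \<kappa> 2"
  have mono: "\<kappa> s \<le> \<kappa> t" if "s \<le> t" for s t
    by (rule DERIV_nonneg_imp_nondecreasing[OF that]) (use \<kappa>(2) \<rho>(4) in blast)
  have const: "\<kappa> t = c" if "2 \<le> t" for t
  proof -
    have "\<kappa> t = (\<integral>s. \<rho> s \<partial>lborel)" "\<kappa> 2 = (\<integral>s. \<rho> s \<partial>lborel)"
      unfolding \<kappa>(4) by (intro Bochner_Integration.integral_cong; use that \<rho>(3) in auto)+
    then show ?thesis by (simp add: c_def)
  qed
  have cpos: "0 < c"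
  proof -
    have "\<exists>z>1. z < 2 \<and> \<kappa> 2 - \<kappa> 1 = (2 - 1) * \<rho> z" by (rule MVT2) (simp_all add: \<kappa>(2))
    then obtain z where z: "1 < z" "z < 2" "\<kappa> 2 - \<kappa> 1 = (2 - 1) * \<rho> z" by blast
    have "0 < \<rho> z" using z flat_0_pos by (simp add: \<rho>_def cutoff_def)
    then show ?thesis using z \<kappa>(3)[of 1] by (simp add: c_def)
  qed
  have \<kappa>b: "\<bar>\<kappa> t\<bar> \<le> c" for t
  proof -
    have "0 \<le> \<kappa> t" using mono[of "min 1 t" t] \<kappa>(3)[of "min 1 t"] by simp
    moreover have "\<kappa> t \<le> c" using mono[of t "max t 2"] const[of "max t 2"] by simp
    ultimately show ?thesis by simp
  qed
  define \<psi> where "\<psi> k z = \<zeta> (fst z) * (\<theta> (snd z) * \<kappa> (real k * (T - snd z)))" for k z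
  have \<kappa>s: "smooth (\<lambda>t. \<kappa> (real k * (T - t)))" for k
  proof -
    have "smooth (\<lambda>t. \<kappa> (real k * T + (- real k) * t))"
      by (rule smooth_affine[OF bounded_linear_mult_right \<kappa>(1)])
    then show ?thesis by (simp add: algebra_simps)
  qed
  have \<kappa>d: "((\<lambda>t. \<kappa> (real k * (T - t))) has_real_derivative - (real k * \<rho> (real k * (T - t)))) (at t)" for k t
  proof -
    have "((\<lambda>t. real k * (T - t)) has_real_derivative - real k) (at t within UNIV)"
      by (auto intro!: derivative_eq_intros)
    from DERIV_chain2[OF \<kappa>(2) this] show ?thesis by (simp add: mult.commute)
  qed
  have t\<psi>: "test_fun (Q \<Omega> T) (\<psi> k)" if k: "0 < k" for k
    unfolding test_fun_def
  proof (intro conjI exI[of _ "cbox (fst p) (fst q) \<times> {snd p..T - 1 / real k}"] allI impI)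
    show "smooth (\<psi> k)" unfolding \<psi>_def[abs_def]
      by (intro smooth_mult smooth_fst \<zeta> smooth_snd[OF \<theta>(1)] smooth_snd[OF \<kappa>s])
    show "compact (cbox (fst p) (fst q) \<times> {snd p..T - 1 / real k})" by (intro compact_Times) auto
    have "0 < 1 / real k" using k by simp
    then show "cbox (fst p) (fst q) \<times> {snd p..T - 1 / real k} \<subseteq> Q \<Omega> T"
      using sub\<Omega> p0 unfolding Q_def by (intro Sigma_mono) (simp_all only: atLeastAtMost_iff greaterThanLessThan_iff subset_iff, linarith)
    fix z assume z: "z \<notin> cbox (fst p) (fst q) \<times> {snd p..T - 1 / real k}"
    have "real k * (T - snd z) \<le> 1" if "\<not> snd z \<le> T - 1 / real k" using that k by (simp add: field_simps)
    then show "\<psi> k z = 0" using z \<zeta>(2)[of "fst z"] \<theta>(3)[of "snd z"] \<kappa>(3)[of "real k * (T - snd z)"]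
      by (cases z) (force simp: \<psi>_def)
  qed
  \<comment> \<open>The first summand tends to c times the bump; the second is the terminal layer
    handled by \<open>terminal_layer_tendsto_0\<close>.\<close>
  have pd\<psi>: "pd (0, 1) (\<psi> k) z = \<zeta> (fst z) * (\<eta> (snd z) * \<kappa> (real k * (T - snd z)))
     - \<zeta> (fst z) * (\<theta> (snd z) * (real k * \<rho> (real k * (T - snd z))))" for k z
  proof -
    have "((\<lambda>t. \<theta> t * \<kappa> (real k * (T - t))) has_real_derivative
        \<theta> (snd z) * - (real k * \<rho> (real k * (T - snd z))) + \<eta> (snd z) * \<kappa> (real k * (T - snd z))) (at (snd z))"
      using DERIV_mult'[OF \<theta>(2) \<kappa>d] by simp
    note pd1 = pd_snd[OF this, of 0 1]
    have s1: "smooth (\<lambda>z :: 'a \<times> real. \<theta> (snd z) * \<kappa> (real k * (T - snd z)))"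
      by (intro smooth_mult smooth_snd[OF \<theta>(1)] smooth_snd[OF \<kappa>s])
    have s2: "smooth (\<lambda>z :: 'a \<times> real. \<zeta> (fst z))" by (rule smooth_fst[OF \<zeta>(1)])
    show ?thesis
      unfolding \<psi>_def[abs_def] pd_mult[OF smooth_differentiable[OF s2] smooth_differentiable[OF s1]] pd1 pd_fst_time[OF \<zeta>(1)]
      by (simp add: distrib_left right_diff_distrib)
  qed
  have bump: "\<zeta> (fst z) * \<eta> (snd z) = bump p q m z" for z
    by (cases z) (simp add: bump_prod \<zeta>_def \<eta>_def)
  have fwd: "\<zeta> (fst z) * \<theta> (snd z) = fwd (bump p q m) z" for z
    unfolding fwd_bump[OF sub] \<theta>(4) \<zeta>_def \<eta>_def by (rule refl)
  have bL: "L2 M (bump p q m)" by (rule test_fun_L2[OF open_Q test_fun_bump[OF sub]])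
  have I1: "integrable M (\<lambda>z. v z * bump p q m z)" by (rule L2_mult_integrable[OF v bL])
  have I2: "integrable M (\<lambda>z. g z * fwd (bump p q m) z)" by (rule L2_mult_integrable[OF gL fwd_L2(1)[OF bL]])
  have \<kappa>m: "(\<lambda>z. \<kappa> (real k * (T - snd z))) \<in> borel_measurable M" for k
    using borel_measurable_continuous_onI[OF smooth_continuous[OF smooth_snd[OF \<kappa>s]]]
    by (intro measurable_restrict_space1) auto
  have Iw: "integrable M (\<lambda>z. w z * \<kappa> (real k * (T - snd z)))" if "integrable M w" for w k
  proof (rule Bochner_Integration.integrable_bound[OF integrable_mult_left[OF that, of c]])
    show "(\<lambda>z. w z * \<kappa> (real k * (T - snd z))) \<in> borel_measurable M" using that \<kappa>m by auto
    show "AE z in M. norm (w z * \<kappa> (real k * (T - snd z))) \<le> norm (w z * c)"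
      using \<kappa>b cpos by (auto simp: abs_mult intro!: mult_left_mono)
  qed
  have lim: "(\<lambda>k. \<integral>z. w z * \<kappa> (real k * (T - snd z)) \<partial>M) \<longlonglongrightarrow> (\<integral>z. w z * c \<partial>M)" if w: "integrable M w" for w
  proof (rule integral_dominated_convergence[where w="\<lambda>z. \<bar>w z * c\<bar>"])
    show "AE z in M. (\<lambda>k. w z * \<kappa> (real k * (T - snd z))) \<longlonglongrightarrow> w z * c"
    proof (rule AE_I2)
      fix z assume "z \<in> space M"
      then have pos: "0 < T - snd z" by (auto simp: space_restrict_space Q_def)
      obtain n where n: "2 / (T - snd z) \<le> real n" using real_arch_simple by blast
      have "2 \<le> real k * (T - snd z)" if "n \<le> k" for k
      proof -
        have "2 \<le> real n * (T - snd z)" using n pos by (simp add: divide_le_eq)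
        also have "\<dots> \<le> real k * (T - snd z)" using that pos by (intro mult_right_mono) auto
        finally show ?thesis .
      qed
      then have "\<forall>\<^sub>F k in sequentially. w z * c = w z * \<kappa> (real k * (T - snd z))"
        using const by (intro eventually_sequentiallyI[of n]) simp
      then show "(\<lambda>k. w z * \<kappa> (real k * (T - snd z))) \<longlonglongrightarrow> w z * c"
        by (rule Lim_transform_eventually[OF tendsto_const])
    qed
    show "AE z in M. norm (w z * \<kappa> (real k * (T - snd z))) \<le> \<bar>w z * c\<bar>" for k
      using \<kappa>b cpos by (auto simp: abs_mult intro!: mult_left_mono)
    show "(\<lambda>z. w z * \<kappa> (real k * (T - snd z))) \<in> borel_measurable M" for k using w \<kappa>m by auto
  qed (use w in auto)
  define B where "B k = (\<integral>z. v z * (\<zeta> (fst z) * (\<theta> (snd z) * (real k * \<rho> (real k * (T - snd z))))) \<partial>M)" for k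
  have B: "B \<longlonglongrightarrow> 0"
    unfolding B_def
    by (rule terminal_layer_tendsto_0[OF v van smooth_continuous[OF \<zeta>(1)] compact_cbox \<zeta>(2)
          smooth_continuous[OF \<theta>(1)] smooth_continuous[OF \<rho>(1)] \<rho>(4,5,3)])
  have eq: "(\<integral>z. (v z * bump p q m z) * \<kappa> (real k * (T - snd z)) \<partial>M) - B k
      = - (\<integral>z. (g z * fwd (bump p q m) z) * \<kappa> (real k * (T - snd z)) \<partial>M)" if k: "0 < k" for k
  proof -
    have i1: "integrable M (\<lambda>z. v z * pd (0, 1) (\<psi> k) z)"
      by (rule L2_mult_integrable[OF v test_fun_M_L2[OF test_fun_pd[OF t\<psi>[OF k] Basis_time]]])
    have "B k = (\<integral>z. (v z * bump p q m z) * \<kappa> (real k * (T - snd z)) - v z * pd (0, 1) (\<psi> k) z \<partial>M)"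
      unfolding B_def pd\<psi> bump[symmetric]
      by (intro Bochner_Integration.integral_cong) (auto simp: algebra_simps)
    also have "\<dots> = (\<integral>z. (v z * bump p q m z) * \<kappa> (real k * (T - snd z)) \<partial>M) - (\<integral>z. v z * pd (0, 1) (\<psi> k) z \<partial>M)"
      by (intro Bochner_Integration.integral_diff Iw I1 i1)
    also have "(\<integral>z. v z * pd (0, 1) (\<psi> k) z \<partial>M) = - (\<integral>z. g z * \<psi> k z \<partial>M)"
      by (rule is_wderivD[OF g t\<psi>[OF k]])
    finally show ?thesis by (simp add: \<psi>_def fwd[symmetric] mult.assoc)
  qed
  have "(\<lambda>k. (\<integral>z. (v z * bump p q m z) * \<kappa> (real k * (T - snd z)) \<partial>M) - B k) \<longlonglongrightarrow> (\<integral>z. (v z * bump p q m z) * c \<partial>M) - 0"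
    by (intro tendsto_diff lim I1 B)
  moreover have "(\<lambda>k. (\<integral>z. (v z * bump p q m z) * \<kappa> (real k * (T - snd z)) \<partial>M) - B k) \<longlonglongrightarrow> - (\<integral>z. (g z * fwd (bump p q m) z) * c \<partial>M)"
  proof (rule Lim_transform_eventually)
    show "(\<lambda>k. - (\<integral>z. (g z * fwd (bump p q m) z) * \<kappa> (real k * (T - snd z)) \<partial>M)) \<longlonglongrightarrow> - (\<integral>z. (g z * fwd (bump p q m) z) * c \<partial>M)"
      by (intro tendsto_minus lim I2)
    show "\<forall>\<^sub>F k in sequentially. - (\<integral>z. (g z * fwd (bump p q m) z) * \<kappa> (real k * (T - snd z)) \<partial>M)
       = (\<integral>z. (v z * bump p q m z) * \<kappa> (real k * (T - snd z)) \<partial>M) - B k"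
      using eq by (intro eventually_sequentiallyI[of 1]) simp
  qed
  ultimately have "(\<integral>z. (v z * bump p q m z) * c \<partial>M) - 0 = - (\<integral>z. (g z * fwd (bump p q m) z) * c \<partial>M)"
    by (rule LIMSEQ_unique)
  then have "c * (\<integral>z. v z * bump p q m z \<partial>M) = c * - (\<integral>z. g z * fwd (bump p q m) z \<partial>M)"
    by (simp add: mult.commute)
  then show ?thesis using cpos by (simp only: mult_cancel_left) simp
qed

text \<open>Adjointness turns the previous identity into the statement that v + \<open>bwd g\<close>
  is orthogonal to all bumps.\<close>

lemma vanishes_at_terminal_imp:
  assumes v: "L2 M v" and g: "is_wderiv (Q \<Omega> T) (0, 1) v g" and van: "vanishes_at \<Omega> T T v"
  shows "AE z in M. v z = - bwd g z"
proof -
  have gL: "L2 M g" by (rule is_wderiv_L2[OF g])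
  have bL: "L2 M (bwd g)" by (rule bwd_L2(1)[OF gL])
  have "AE z in M. v z + bwd g z = 0"
  proof (rule fundamental_lemma[OF open_Q L2_add[OF v bL]])
    fix p q :: "'a \<times> real" and m assume sub: "cbox p q \<subseteq> Q \<Omega> T"
    have B: "L2 M (bump p q m)" by (rule test_fun_L2[OF open_Q test_fun_bump[OF sub]])
    show "(\<integral>z. (v z + bwd g z) * bump p q m z \<partial>M) = 0"
    proof (cases "cbox p q = {}")
      case True
      then have "bump p q m z = 0" for z using bump_eq_0[of z p q m] box_subset_cbox[of p q] by auto
      then show ?thesis by simp
    next
      case False
      have "(\<integral>z. (v z + bwd g z) * bump p q m z \<partial>M)
          = (\<integral>z. v z * bump p q m z \<partial>M) + (\<integral>z. bwd g z * bump p q m z \<partial>M)"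
        using L2_mult_integrable[OF v B] L2_mult_integrable[OF bL B] by (simp add: distrib_right)
      also have "(\<integral>z. bwd g z * bump p q m z \<partial>M) = (\<integral>z. g z * fwd (bump p q m) z \<partial>M)"
        using fwd_bwd_adjoint[OF B gL] by (simp add: mult.commute)
      finally show ?thesis using vanishes_at_terminal_orth[OF v g van sub False, of m] by simp
    qed
  qed
  then show ?thesis by (rule eventually_mono) simp
qed

end

section \<open>Time reversal\<close>

lemma pd_affine_direction:
  fixes f :: "'c::euclidean_space \<Rightarrow> real"
  assumes "f differentiable (at (p + l z))" "bounded_linear l"
  shows "pd d (\<lambda>z. f (p + l z)) z = pd (l d) f (p + l z)"
  using pd_affine[OF assms, of d] frechet_derivative_eq_sum_pd[OF assms(1), of "l d"] by (simp add: pd_def)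

lemma pd_minus:
  assumes "f differentiable (at z)"
  shows "pd (- d) f z = - pd d f z"
  using linear_neg[OF linear_frechet_derivative[OF assms]] by (simp add: pd_def)

lemma reflection_affine:
  "(\<lambda>z :: 'a::euclidean_space \<times> real. (fst z, T - snd z)) = (\<lambda>z. (0, T) + (fst z, - snd z))"
  "bounded_linear (\<lambda>z :: 'a::euclidean_space \<times> real. (fst z, - snd z))"
  by (auto intro!: bounded_linear_Pair bounded_linear_fst bounded_linear_minus bounded_linear_snd)

lemma smooth_rfl: "smooth \<phi> \<Longrightarrow> smooth (rfl T \<phi>)" for \<phi> :: "'a::euclidean_space \<times> real \<Rightarrow> real"
  using smooth_affine[OF reflection_affine(2), of \<phi> "(0, T)"] by (simp add: rfl_def[abs_def])

lemma pd_rfl: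
  fixes \<phi> :: "'a::euclidean_space \<times> real \<Rightarrow> real"
  assumes "smooth \<phi>"
  shows "pd (b, 0) (rfl T \<phi>) z = rfl T (pd (b, 0) \<phi>) z" "pd (0, 1) (rfl T \<phi>) z = - rfl T (pd (0, 1) \<phi>) z"
proof -
  have "pd d (rfl T \<phi>) z = pd (fst d, - snd d) \<phi> (fst z, T - snd z)" for d
    using pd_affine_direction[OF smooth_differentiable[OF assms] reflection_affine(2), of d "(0, T)" z]
    by (simp add: rfl_def[abs_def])
  moreover have "pd (0, -1) \<phi> z = - pd (0, 1) \<phi> z" for z
    using pd_minus[OF smooth_differentiable[OF assms], of "(0, 1)" z] by simp
  ultimately show "pd (b, 0) (rfl T \<phi>) z = rfl T (pd (b, 0) \<phi>) z"
    "pd (0, 1) (rfl T \<phi>) z = - rfl T (pd (0, 1) \<phi>) z"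
    by (simp_all add: rfl_def)
qed

context cylinder
begin

lemma test_fun_rfl:
  assumes "test_fun (Q \<Omega> T) \<phi>"
  shows "test_fun (Q \<Omega> T) (rfl T \<phi>)"
proof -
  obtain K where K: "compact K" "K \<subseteq> Q \<Omega> T" "\<And>z. z \<notin> K \<Longrightarrow> \<phi> z = 0"
    using assms by (auto simp: test_fun_def)
  let ?r = "\<lambda>z :: 'a \<times> real. (fst z, T - snd z)"
  have inv: "?r (?r z) = z" for z by simp
  show ?thesis
    unfolding test_fun_def
  proof (intro conjI exI[of _ "?r ` K"] allI impI)
    show "smooth (rfl T \<phi>)" by (intro smooth_rfl test_fun_smooth[OF assms])
    show "compact (?r ` K)" by (intro compact_continuous_image[OF _ K(1)] continuous_intros)
    show "?r ` K \<subseteq> Q \<Omega> T"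
    proof
      fix z assume "z \<in> ?r ` K"
      then obtain y where "y \<in> K" "z = ?r y" by blast
      with K(2) show "z \<in> Q \<Omega> T" by (cases y) (auto simp: Q_def)
    qed
    fix z assume "z \<notin> ?r ` K"
    then have "?r z \<notin> K" using imageI[of "?r z" K ?r] by (cases z) auto
    then show "rfl T \<phi> z = 0" using K(3) by (simp add: rfl_def)
  qed
qed

lemma is_wderiv_rfl:
  assumes u: "L2 M u"
  shows "b \<in> Basis \<Longrightarrow> is_wderiv (Q \<Omega> T) (b, 0) u g \<Longrightarrow> is_wderiv (Q \<Omega> T) (b, 0) (rfl T u) (rfl T g)"
    "is_wderiv (Q \<Omega> T) (0, 1) u g \<Longrightarrow> is_wderiv (Q \<Omega> T) (0, 1) (rfl T u) (\<lambda>z. - rfl T g z)"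
proof -
  have sw: "(\<integral>z. rfl T p z * q z \<partial>M) = (\<integral>z. p z * rfl T q z \<partial>M)" if "L2 M p" "L2 M q" for p q
  proof -
    have "(\<lambda>z. rfl T p z * q z) = rfl T (\<lambda>z. p z * rfl T q z)" by (auto simp: rfl_def)
    then show ?thesis
      using integral_rfl[OF borel_measurable_times[OF L2_measurable[OF that(1)] L2_measurable[OF rfl_L2[OF that(2)]]]] by simp
  qed
  {
    assume b: "b \<in> Basis" and g: "is_wderiv (Q \<Omega> T) (b, 0) u g"
    note gL = is_wderiv_L2[OF g]
    show "is_wderiv (Q \<Omega> T) (b, 0) (rfl T u) (rfl T g)"
      unfolding is_wderiv_def
    proof (intro conjI allI impI rfl_L2[OF gL])
      fix \<phi> assume t: "test_fun (Q \<Omega> T) \<phi>"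
      have e: "rfl T (pd (b, 0) \<phi>) = pd (b, 0) (rfl T \<phi>)"
        by (rule ext) (simp add: pd_rfl(1)[OF test_fun_smooth[OF t]])
      show "(\<integral>z. rfl T u z * pd (b, 0) \<phi> z \<partial>M) = - (\<integral>z. rfl T g z * \<phi> z \<partial>M)"
        using is_wderivD[OF g test_fun_rfl[OF t]]
        by (simp add: sw[OF u test_fun_M_L2[OF test_fun_pd[OF t Basis_space[OF b]]]] sw[OF gL test_fun_M_L2[OF t]] e)
    qed
  }
  {
    assume g: "is_wderiv (Q \<Omega> T) (0, 1) u g"
    note gL = is_wderiv_L2[OF g]
    show "is_wderiv (Q \<Omega> T) (0, 1) (rfl T u) (\<lambda>z. - rfl T g z)"
      unfolding is_wderiv_def
    proof (intro conjI allI impI L2_minus rfl_L2[OF gL])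
      fix \<phi> assume t: "test_fun (Q \<Omega> T) \<phi>"
      have e: "rfl T (pd (0, 1) \<phi>) = (\<lambda>z. - pd (0, 1) (rfl T \<phi>) z)"
        by (rule ext) (simp add: pd_rfl(2)[OF test_fun_smooth[OF t]])
      show "(\<integral>z. rfl T u z * pd (0, 1) \<phi> z \<partial>M) = - (\<integral>z. - rfl T g z * \<phi> z \<partial>M)"
        using is_wderivD[OF g test_fun_rfl[OF t]]
        by (simp add: sw[OF u test_fun_M_L2[OF test_fun_pd[OF t Basis_time]]] sw[OF gL test_fun_M_L2[OF t]] e)
    qed
  }
qed

lemma vanishes_at_rfl:
  assumes "vanishes_at \<Omega> T s v"
  shows "vanishes_at \<Omega> T (T - s) (rfl T v)"
proof -
  obtain V where V: "AE z in M. V z = v z"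
    "\<And>t. t \<in> {0..T} \<Longrightarrow> L2 (leb \<Omega>) (\<lambda>x. V (x, t))"
    "\<And>t. t \<in> {0..T} \<Longrightarrow> ((\<lambda>r. L2norm (leb \<Omega>) (\<lambda>x. V (x, r) - V (x, t))) \<longlongrightarrow> 0) (at t within {0..T})"
    "AE x in leb \<Omega>. V (x, s) = 0"
    using assms unfolding vanishes_at_def by blast
  show ?thesis
    unfolding vanishes_at_def
  proof (intro exI[of _ "rfl T V"] conjI ballI)
    show "AE z in M. rfl T V z = rfl T v z"
      using AE_M_reflection[OF V(1)] by (simp add: rfl_def)
    show "AE x in leb \<Omega>. rfl T V (x, T - s) = 0" using V(4) by (simp add: rfl_def)
    fix t assume t: "t \<in> {0..T}"
    then have t': "T - t \<in> {0..T}" by auto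
    show "L2 (leb \<Omega>) (\<lambda>x. rfl T V (x, t))" using V(2)[OF t'] by (simp add: rfl_def)
    have "filterlim (\<lambda>r. T - r) (at (T - t) within {0..T}) (at t within {0..T})"
      unfolding filterlim_at by (auto intro!: tendsto_intros simp: eventually_at_filter)
    from filterlim_compose[OF V(3)[OF t'] this]
    show "((\<lambda>r. L2norm (leb \<Omega>) (\<lambda>x. rfl T V (x, r) - rfl T V (x, t))) \<longlongrightarrow> 0) (at t within {0..T})"
      by (simp add: rfl_def)
  qed
qed

lemma vanishes_at_cong_AE:
  assumes "vanishes_at \<Omega> T s v" "AE z in M. v z = w z"
  shows "vanishes_at \<Omega> T s w"
proof -
  obtain V where V: "AE z in M. V z = v z"
    "\<forall>t\<in>{0..T}. L2 (leb \<Omega>) (\<lambda>x. V (x, t))"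
    "\<forall>t\<in>{0..T}. ((\<lambda>r. L2norm (leb \<Omega>) (\<lambda>x. V (x, r) - V (x, t))) \<longlongrightarrow> 0) (at t within {0..T})"
    "AE x in leb \<Omega>. V (x, s) = 0"
    using assms(1) unfolding vanishes_at_def by blast
  moreover have "AE z in M. V z = w z" using V(1) assms(2) by eventually_elim simp
  ultimately show ?thesis unfolding vanishes_at_def by blast
qed

lemma vanishes_at_terminal_iff:
  assumes v: "L2 M v" and g: "is_wderiv (Q \<Omega> T) (0, 1) v g"
  shows "vanishes_at \<Omega> T T v \<longleftrightarrow> (AE z in M. v z = - bwd g z)"
proof
  assume "vanishes_at \<Omega> T T v"
  then show "AE z in M. v z = - bwd g z" by (rule vanishes_at_terminal_imp[OF v g])
next
  assume eq: "AE z in M. v z = - bwd g z"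
  note gL = is_wderiv_L2[OF g]
  have "AE z in M. bwd (\<lambda>z. (-1) * g z + 0 * g z) z = (-1) * bwd g z + 0 * bwd g z"
    by (rule bwd_lincomb[OF gL gL])
  with eq have "AE z in M. bwd (\<lambda>z. - g z) z = v z" by eventually_elim simp
  with vanishes_at_terminal_bwd[OF L2_minus[OF gL]] show "vanishes_at \<Omega> T T v"
    by (rule vanishes_at_cong_AE)
qed

text \<open>Time reversal of the terminal case. The sign from reversing the time derivative cancels
  the sign in front of \<open>bwd\<close>.\<close>

lemma vanishes_at_initial_iff:
  assumes v: "L2 M v" and g: "is_wderiv (Q \<Omega> T) (0, 1) v g"
  shows "vanishes_at \<Omega> T 0 v \<longleftrightarrow> (AE z in M. v z = fwd g z)"
proof -
  note gL = is_wderiv_L2[OF g]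
  have "vanishes_at \<Omega> T 0 v \<longleftrightarrow> vanishes_at \<Omega> T T (rfl T v)"
    using vanishes_at_rfl[of 0 v] vanishes_at_rfl[of T "rfl T v"] by auto
  also have "\<dots> \<longleftrightarrow> (AE z in M. rfl T v z = - bwd (\<lambda>z. - rfl T g z) z)"
    by (rule vanishes_at_terminal_iff[OF rfl_L2[OF v] is_wderiv_rfl(2)[OF v g]])
  also have "\<dots> \<longleftrightarrow> (AE z in M. rfl T v z = rfl T (fwd g) z)"
  proof -
    have R: "L2 M (rfl T g)" by (rule rfl_L2[OF gL])
    have "AE z in M. bwd (\<lambda>z. (-1) * rfl T g z + 0 * rfl T g z) z = (-1) * bwd (rfl T g) z + 0 * bwd (rfl T g) z"
      by (rule bwd_lincomb[OF R R])
    then have e: "AE z in M. - bwd (\<lambda>z. - rfl T g z) z = rfl T (fwd g) z"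
      by (rule eventually_mono) (auto simp: bwd_rfl rfl_def)
    show ?thesis
    proof
      assume "AE z in M. rfl T v z = - bwd (\<lambda>z. - rfl T g z) z"
      with e show "AE z in M. rfl T v z = rfl T (fwd g) z" by eventually_elim simp
    next
      assume "AE z in M. rfl T v z = rfl T (fwd g) z"
      with e show "AE z in M. rfl T v z = - bwd (\<lambda>z. - rfl T g z) z" by eventually_elim simp
    qed
  qed
  also have "\<dots> \<longleftrightarrow> (AE z in M. v z = fwd g z)"
  proof
    assume "AE z in M. rfl T v z = rfl T (fwd g) z"
    from AE_M_reflection[OF this] show "AE z in M. v z = fwd g z" by (simp add: rfl_def)
  next
    assume "AE z in M. v z = fwd g z"
    from AE_M_reflection[OF this] show "AE z in M. rfl T v z = rfl T (fwd g) z" by (simp add: rfl_def)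
  qed
  finally show ?thesis .
qed

text \<open>The form of the terminal condition used from here on: unlike a continuous
  representative, an identity almost everywhere passes directly to linear combinations and to L2
  limits.\<close>

lemma H11_term_iff:
  "v \<in> H11_term \<Omega> T \<longleftrightarrow> v \<in> H1 (Q \<Omega> T) \<and> (AE z in M. v z = - bwd (dt \<Omega> T v) z)"
  unfolding H11_term_def H11_def
  using vanishes_at_terminal_iff[OF H1_L2 is_wderiv_wderiv[OF _ Basis_time]] by blast

lemma H11_init_iff:
  "v \<in> H11_init \<Omega> T \<longleftrightarrow> v \<in> H1 (Q \<Omega> T) \<and> (AE z in M. v z = fwd (dt \<Omega> T v) z)"
  unfolding H11_init_def H11_def
  using vanishes_at_initial_iff[OF H1_L2 is_wderiv_wderiv[OF _ Basis_time]] by blast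

lemma H1_rfl: "v \<in> H1 (Q \<Omega> T) \<Longrightarrow> rfl T v \<in> H1 (Q \<Omega> T)"
  unfolding H1_def Basis_prod_def
  using is_wderiv_rfl[of v] rfl_L2[of v] by (auto; blast)

lemma wderiv_rfl:
  assumes v: "v \<in> H1 (Q \<Omega> T)"
  shows "b \<in> Basis \<Longrightarrow> AE z in M. dx \<Omega> T b (rfl T v) z = rfl T (dx \<Omega> T b v) z"
    "AE z in M. dt \<Omega> T (rfl T v) z = - rfl T (dt \<Omega> T v) z"
  using wderiv_AE_eq[OF open_Q is_wderiv_rfl(1)[OF H1_L2[OF v] _ is_wderiv_wderiv[OF v Basis_space]]]
    wderiv_AE_eq[OF open_Q is_wderiv_rfl(2)[OF H1_L2[OF v] is_wderiv_wderiv[OF v Basis_time]]] by auto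

lemma H11_term_rfl: "v \<in> H11_init \<Omega> T \<Longrightarrow> rfl T v \<in> H11_term \<Omega> T"
  and H11_init_rfl: "v \<in> H11_term \<Omega> T \<Longrightarrow> rfl T v \<in> H11_init \<Omega> T"
  using vanishes_at_rfl[of 0 v] vanishes_at_rfl[of T v] H1_rfl[of v]
  by (auto simp: H11_init_def H11_term_def H11_def)

lemma integral_rfl_mult:
  assumes "L2 M p" "L2 M q"
  shows "(\<integral>z. rfl T p z * rfl T q z \<partial>M) = (\<integral>z. p z * q z \<partial>M)"
  using integral_rfl[OF borel_measurable_times[OF L2_measurable[OF assms(1)] L2_measurable[OF assms(2)]]] by (simp add: rfl_def)

lemma integral_mult_cong_AE:
  assumes "AE z in M. p z = p' z" "AE z in M. q z = q' z" "L2 M p" "L2 M p'" "L2 M q" "L2 M q'"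
  shows "(\<integral>z. p z * q z \<partial>M) = (\<integral>z. p' z * q' z \<partial>M)"
  using assms by (intro integral_cong_AE) (auto simp: L2_def)

text \<open>Reversal changes the sign of both time derivatives, and the signs cancel. As reversal
  also exchanges the two function spaces, the adjoint problem is the original one run
  backwards.\<close>

lemma wave_form_rfl:
  assumes u: "u \<in> H1 (Q \<Omega> T)" and v: "v \<in> H1 (Q \<Omega> T)"
  shows "wave_form \<Omega> T (rfl T u) (rfl T v) = wave_form \<Omega> T u v"
proof -
  note Lu = wderiv_L2[OF u] and Lv = wderiv_L2[OF v]
  note Ru = wderiv_L2[OF H1_rfl[OF u]] and Rv = wderiv_L2[OF H1_rfl[OF v]]
  have "(\<integral>z. dt \<Omega> T (rfl T u) z * dt \<Omega> T (rfl T v) z \<partial>M) = (\<integral>z. - rfl T (dt \<Omega> T u) z * - rfl T (dt \<Omega> T v) z \<partial>M)"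
    using wderiv_rfl(2)[OF u] wderiv_rfl(2)[OF v]
    by (intro integral_mult_cong_AE Ru Rv Basis_time L2_minus rfl_L2 Lu Lv) auto
  also have "\<dots> = (\<integral>z. dt \<Omega> T u z * dt \<Omega> T v z \<partial>M)"
    using integral_rfl_mult[OF Lu[OF Basis_time] Lv[OF Basis_time]] by simp
  moreover have "(\<integral>z. dx \<Omega> T b (rfl T u) z * dx \<Omega> T b (rfl T v) z \<partial>M) = (\<integral>z. dx \<Omega> T b u z * dx \<Omega> T b v z \<partial>M)" if b: "b \<in> Basis" for b
  proof -
    note b' = Basis_space[OF b]
    have "(\<integral>z. dx \<Omega> T b (rfl T u) z * dx \<Omega> T b (rfl T v) z \<partial>M) = (\<integral>z. rfl T (dx \<Omega> T b u) z * rfl T (dx \<Omega> T b v) z \<partial>M)"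
      using wderiv_rfl(1)[OF u b] wderiv_rfl(1)[OF v b]
      by (intro integral_mult_cong_AE Ru Rv b' rfl_L2 Lu Lv) auto
    then show ?thesis using integral_rfl_mult[OF Lu[OF b'] Lv[OF b']] by simp
  qed
  ultimately show ?thesis by (simp add: wave_form_def)
qed

lemma wave_form_commute: "wave_form \<Omega> T u v = wave_form \<Omega> T v u"
  by (simp add: wave_form_def mult.commute)

end

section \<open>Weak derivatives of time integrals\<close>

lemma pd_snd_mult:
  fixes \<phi> :: "'a::euclidean_space \<times> real \<Rightarrow> real"
  assumes "smooth p" "smooth \<phi>"
  shows "pd (b, 0) (\<lambda>z. p (snd z) * \<phi> z) z = p (snd z) * pd (b, 0) \<phi> z"
proof -
  obtain d where "(p has_real_derivative d) (at (snd z))"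
    using smooth_differentiable[OF assms(1), of "snd z"] real_differentiable_def by blast
  from pd_snd[OF this, of b 0] show ?thesis
    using pd_mult[OF smooth_differentiable[OF smooth_snd[OF assms(1)]] smooth_differentiable[OF assms(2)], of "(b, 0)" z]
    by simp
qed

lemma has_derivative_time_section:
  fixes \<phi> :: "'a::euclidean_space \<times> real \<Rightarrow> real"
  assumes "smooth \<phi>"
  shows "((\<lambda>s. \<phi> (x, s)) has_real_derivative pd (0, 1) \<phi> (x, t)) (at t)"
proof -
  have "((\<lambda>s. \<phi> ((x, 0) + s *\<^sub>R (0, 1))) has_real_derivative pd (0, 1) \<phi> ((x, 0) + t *\<^sub>R (0, 1))) (at t)"
    by (rule pd_line_derivative[OF smooth_differentiable[OF assms]])
  then show ?thesis by simp
qed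

lemma test_fun_outside: "test_fun U \<phi> \<Longrightarrow> z \<notin> U \<Longrightarrow> \<phi> z = 0"
  unfolding test_fun_def by blast

context cylinder
begin

lemma ext_test_fun: "test_fun (Q \<Omega> T) \<phi> \<Longrightarrow> ext \<phi> z = \<phi> z"
  by (auto simp: ext_def indicator_def dest: test_fun_outside)

lemma fwd_pd_time:
  assumes t: "test_fun (Q \<Omega> T) \<phi>" and z: "z \<in> Q \<Omega> T"
  shows "fwd (pd (0, 1) \<phi>) z = \<phi> z"
proof -
  obtain x r where zx: "z = (x, r)" by (cases z)
  have r: "0 < r" using z by (simp add: zx Q_def)
  have t': "test_fun (Q \<Omega> T) (pd (0, 1) \<phi>)" by (rule test_fun_pd[OF t Basis_time])
  have s: "smooth \<phi>" by (rule test_fun_smooth[OF t])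
  have cont: "isCont (\<lambda>s. pd (0, 1) \<phi> (x, s)) u" for u
  proof -
    have "continuous_on UNIV (\<lambda>s. pd (0, 1) \<phi> (x, s))"
      by (intro continuous_on_compose2[OF smooth_continuous[OF test_fun_smooth[OF t'], of UNIV]] continuous_intros) auto
    then show ?thesis by (simp add: continuous_on_eq_continuous_at)
  qed
  have "(\<integral>s. pd (0, 1) \<phi> (x, s) * indicator {0..r} s \<partial>lborel) = \<phi> (x, r) - \<phi> (x, 0)"
    using r by (intro integral_FTC_Icc_real has_derivative_time_section s cont) auto
  moreover have "\<phi> (x, 0) = 0"
    by (rule test_fun_outside[OF t]) (simp add: Q_def)
  moreover have "fwd (pd (0, 1) \<phi>) (x, r) = (\<integral>s. pd (0, 1) \<phi> (x, s) * indicator {0..r} s \<partial>lborel)"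
    unfolding fwd_Pair ext_test_fun[OF t']
  proof (rule integral_cong_AE)
    have m: "(\<lambda>s. pd (0, 1) \<phi> (x, s)) \<in> borel_measurable borel"
      using cont by (intro borel_measurable_continuous_onI) (simp add: continuous_on_eq_continuous_at)
    note m[measurable]
    show "(\<lambda>s. if s < r then pd (0, 1) \<phi> (x, s) else 0) \<in> borel_measurable lborel" by measurable
    show "(\<lambda>s. pd (0, 1) \<phi> (x, s) * indicator {0..r} s) \<in> borel_measurable lborel" by measurable
    have neg: "pd (0, 1) \<phi> (x, s) = 0" if "s \<le> 0" for s
      by (rule test_fun_outside[OF t']) (use that in \<open>simp add: Q_def\<close>)
    have "AE s in lborel. s \<noteq> r" by (rule AE_lborel_singleton)
    then show "AE s in lborel. (if s < r then pd (0, 1) \<phi> (x, s) else 0) = pd (0, 1) \<phi> (x, s) * indicator {0..r} s"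
      by (rule eventually_mono) (use neg in \<open>auto simp: indicator_def\<close>)
  qed
  ultimately show ?thesis by (simp add: zx)
qed

text \<open>By adjointness the backward integral becomes the forward integral of the time derivative
  of a test function, which is the test function itself.\<close>

lemma is_wderiv_time_bwd:
  assumes u: "L2 M u"
  shows "is_wderiv (Q \<Omega> T) (0, 1) (bwd u) (\<lambda>z. - u z)"
  unfolding is_wderiv_def
proof (intro conjI allI impI L2_minus u)
  fix \<phi> assume t: "test_fun (Q \<Omega> T) \<phi>"
  have L: "L2 M (pd (0, 1) \<phi>)" by (rule test_fun_M_L2[OF test_fun_pd[OF t Basis_time]])
  have "(\<integral>z. bwd u z * pd (0, 1) \<phi> z \<partial>M) = (\<integral>z. fwd (pd (0, 1) \<phi>) z * u z \<partial>M)"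
    using fwd_bwd_adjoint[OF L u] by (simp add: mult.commute)
  also have "\<dots> = (\<integral>z. \<phi> z * u z \<partial>M)"
    by (intro Bochner_Integration.integral_cong) (auto simp: fwd_pd_time[OF t] space_restrict_space)
  finally show "(\<integral>z. bwd u z * pd (0, 1) \<phi> z \<partial>M) = - (\<integral>z. - u z * \<phi> z \<partial>M)"
    by (simp add: mult.commute)
qed

text \<open>Time integration of a test function is an average of its translates, which moves the
  spatial derivative onto the translates without differentiating under the integral sign.\<close>

lemma integral_fwd_translates:
  assumes U: "L2 M U" and c: "continuous_on UNIV \<xi>" "compact K" "K \<subseteq> Q \<Omega> T" "\<And>z. z \<notin> K \<Longrightarrow> \<xi> z = 0"
  shows "(\<integral>z. U z * fwd \<xi> z \<partial>M)
    = (\<integral>\<tau>. indicator {0<..<T} \<tau> * (\<integral>z. U z * \<xi> (fst z, snd z - \<tau>) \<partial>M) \<partial>lborel)"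
proof -
  obtain C where C: "0 < C" "\<And>z. \<bar>\<xi> z\<bar> \<le> C" using bounded_compact_support[OF c(1,2,4)] by metis
  define F where "F = (\<lambda>(z, \<tau>). ext U z * (indicator {0<..<T} \<tau> * \<xi> (fst z, snd z - \<tau>)))"
  have Ui: "integrable lborel (ext U)"
    using L2_imp_integrable[OF finite_M U] by (simp add: ext_integrable)
  have ind: "integrable lborel (\<lambda>\<tau>::real. C * indicator {0<..<T} \<tau>)"
    by (intro integrable_mult_right integrable_real_indicator) (use emeasure_bounded_finite[of "{0<..<T}"] in auto)
  have Fi: "integrable (lborel \<Otimes>\<^sub>M lborel) F"
  proof (rule Bochner_Integration.integrable_bound[OF integrable_prod_lborel[OF ind Ui]])
    have [measurable]: "ext U \<in> borel_measurable borel" using Ui by auto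
    have "(\<lambda>y :: ('a \<times> real) \<times> real. \<xi> (fst (fst y), snd (fst y) - snd y)) \<in> borel_measurable borel"
      by (intro borel_measurable_continuous_onI continuous_on_compose2[OF c(1)] continuous_intros) auto
    then have [measurable]: "(\<lambda>y. \<xi> (fst (fst y), snd (fst y) - snd y)) \<in> borel_measurable ((borel :: ('a \<times> real) measure) \<Otimes>\<^sub>M (borel :: real measure))"
      unfolding borel_prod .
    show "F \<in> borel_measurable (lborel \<Otimes>\<^sub>M lborel)"
      unfolding F_def case_prod_beta by measurable
    have "norm (F y) \<le> norm (case y of (z, \<tau>) \<Rightarrow> ext U z * (C * indicator {0<..<T} \<tau>))" for y
      using C by (cases y) (auto simp: F_def abs_mult indicator_def intro!: mult_left_mono)
    then show "AE y in lborel \<Otimes>\<^sub>M lborel. norm (F y) \<le> norm (case y of (z, \<tau>) \<Rightarrow> ext U z * (C * indicator {0<..<T} \<tau>))"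
      by simp
  qed
  have \<xi>Q: "ext \<xi> z = \<xi> z" for z
    using c(4)[of z] subsetD[OF c(3), of z] by (cases "z \<in> K") (auto simp: ext_def)
  have fw: "ext U z * fwd \<xi> z = (\<integral>\<tau>. F (z, \<tau>) \<partial>lborel)" for z
  proof (cases "z \<in> Q \<Omega> T")
    case True
    obtain x t where z: "z = (x, t)" by (cases z)
    have "fwd \<xi> z = (\<integral>\<tau>. (if t + (-1) * \<tau> < t then \<xi> (x, t + (-1) * \<tau>) else 0) \<partial>lborel)"
      unfolding z fwd_Pair \<xi>Q
      using lborel_integral_real_affine[of "-1" "\<lambda>s. if s < t then \<xi> (x, s) else 0" t] by simp
    also have "\<dots> = (\<integral>\<tau>. indicator {0<..<T} \<tau> * \<xi> (fst z, snd z - \<tau>) \<partial>lborel)"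
    proof (intro Bochner_Integration.integral_cong refl)
      fix \<tau>
      \<comment> \<open>Since t < T, such a shift leads to a negative time. One averaging window
        (0,T) therefore works for all t, which is what permits exchanging the integrals.\<close>
      have "\<xi> (x, t - \<tau>) = 0" if "T \<le> \<tau>"
        using that True by (intro c(4) notI) (auto simp: z Q_def dest!: subsetD[OF c(3)])
      then show "(if t + (-1) * \<tau> < t then \<xi> (x, t + (-1) * \<tau>) else 0) = indicator {0<..<T} \<tau> * \<xi> (fst z, snd z - \<tau>)"
        by (auto simp: z indicator_def)
    qed
    finally show ?thesis by (simp add: F_def)
  qed (simp add: ext_def F_def)
  have inner: "(\<integral>z. F (z, \<tau>) \<partial>lborel) = indicator {0<..<T} \<tau> * (\<integral>z. U z * \<xi> (fst z, snd z - \<tau>) \<partial>M)" for \<tau>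
  proof -
    have "(\<integral>z. F (z, \<tau>) \<partial>lborel) = (\<integral>z. indicator {0<..<T} \<tau> * ext (\<lambda>z. U z * \<xi> (fst z, snd z - \<tau>)) z \<partial>lborel)"
      by (intro Bochner_Integration.integral_cong) (auto simp: F_def ext_def)
    then show ?thesis by (simp add: ext_integral)
  qed
  have "(\<integral>z. U z * fwd \<xi> z \<partial>M) = (\<integral>z. ext U z * fwd \<xi> z \<partial>lborel)"
    by (simp add: ext_integral ext_def mult.assoc)
  also have "\<dots> = (\<integral>z. \<integral>\<tau>. F (z, \<tau>) \<partial>lborel \<partial>lborel)" by (simp add: fw)
  also have "\<dots> = (\<integral>\<tau>. \<integral>z. F (z, \<tau>) \<partial>lborel \<partial>lborel)"
    using lborel_pair.Fubini_integral[of "\<lambda>z \<tau>. F (z, \<tau>)"] Fi by simp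
  also have "\<dots> = (\<integral>\<tau>. indicator {0<..<T} \<tau> * (\<integral>z. U z * \<xi> (fst z, snd z - \<tau>) \<partial>M) \<partial>lborel)"
    by (simp add: inner)
  finally show ?thesis .
qed

text \<open>Time integration is moved to the test function by adjointness and written as an average
  of translates forward in time. The support of a translate may reach t = T and beyond, so each
  translate is tested by means of \<open>is_wderiv_space_lateral\<close>.\<close>

lemma is_wderiv_space_bwd:
  assumes b: "b \<in> Basis" and W: "L2 M W" and G: "is_wderiv (Q \<Omega> T) (b, 0) W G"
  shows "is_wderiv (Q \<Omega> T) (b, 0) (bwd W) (bwd G)"
  unfolding is_wderiv_def
proof (intro conjI allI impI)
  note GL = is_wderiv_L2[OF G]
  show "L2 M (bwd G)" by (rule bwd_L2(1)[OF GL])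
  fix \<phi> assume t: "test_fun (Q \<Omega> T) \<phi>"
  have t': "test_fun (Q \<Omega> T) (pd (b, 0) \<phi>)" by (rule test_fun_pd[OF t Basis_space[OF b]])
  have s: "smooth \<phi>" by (rule test_fun_smooth[OF t])
  have tr: "(\<integral>z. U z * fwd \<xi> z \<partial>M)
    = (\<integral>\<tau>. indicator {0<..<T} \<tau> * (\<integral>z. U z * \<xi> (fst z, snd z - \<tau>) \<partial>M) \<partial>lborel)"
    if U: "L2 M U" and \<xi>: "test_fun (Q \<Omega> T) \<xi>" for U \<xi>
  proof -
    obtain K where "compact K" "K \<subseteq> Q \<Omega> T" "\<And>z. z \<notin> K \<Longrightarrow> \<xi> z = 0"
      using \<xi> by (auto simp: test_fun_def)
    then show ?thesis by (intro integral_fwd_translates[OF U smooth_continuous[OF test_fun_smooth[OF \<xi>]]]) auto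
  qed
  have step: "(\<integral>z. W z * pd (b, 0) \<phi> (fst z, snd z - \<tau>) \<partial>M) = - (\<integral>z. G z * \<phi> (fst z, snd z - \<tau>) \<partial>M)" for \<tau>
  proof -
    define \<phi>' where "\<phi>' z = \<phi> ((0, - \<tau>) + z)" for z
    obtain K where K: "compact K" "K \<subseteq> Q \<Omega> T" "\<And>z. z \<notin> K \<Longrightarrow> \<phi> z = 0"
      using t by (auto simp: test_fun_def)
    have bl: "bounded_linear (\<lambda>z :: 'a \<times> real. z)" by (rule bounded_linear_ident)
    have "test_fun (\<Omega> \<times> UNIV) \<phi>'"
      unfolding test_fun_def
    proof (intro conjI exI[of _ "(+) (0, \<tau>) ` K"] allI impI)
      show "smooth \<phi>'" unfolding \<phi>'_def[abs_def] by (rule smooth_affine[OF bl s])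
      show "compact ((+) (0, \<tau>) ` K)" by (rule compact_translation[OF K(1)])
      show "(+) (0, \<tau>) ` K \<subseteq> \<Omega> \<times> UNIV"
      proof
        fix z assume "z \<in> (+) (0, \<tau>) ` K"
        then obtain y where "y \<in> K" "z = (0, \<tau>) + y" by blast
        with K(2) show "z \<in> \<Omega> \<times> UNIV" by (cases y) (auto simp: Q_def)
      qed
      fix z assume z: "z \<notin> (+) (0, \<tau>) ` K"
      have "(0, - \<tau>) + z \<notin> K"
      proof
        assume "(0, - \<tau>) + z \<in> K"
        from imageI[OF this, of "(+) (0, \<tau>)"] z show False by (cases z) simp
      qed
      then show "\<phi>' z = 0" using K(3) by (simp add: \<phi>'_def)
    qed
    from is_wderiv_space_lateral[OF b W G this]
    have "(\<integral>z. W z * pd (b, 0) \<phi>' z \<partial>M) = - (\<integral>z. G z * \<phi>' z \<partial>M)" .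
    moreover have "pd (b, 0) \<phi>' z = pd (b, 0) \<phi> (fst z, snd z - \<tau>)" for z
      using pd_affine_direction[OF smooth_differentiable[OF s] bl, of "(b, 0)" "(0, - \<tau>)" z]
      by (cases z) (simp add: \<phi>'_def[abs_def])
    moreover have "\<phi>' z = \<phi> (fst z, snd z - \<tau>)" for z by (cases z) (simp add: \<phi>'_def)
    ultimately show ?thesis by simp
  qed
  have "(\<integral>z. bwd W z * pd (b, 0) \<phi> z \<partial>M) = (\<integral>z. W z * fwd (pd (b, 0) \<phi>) z \<partial>M)"
    using fwd_bwd_adjoint[OF test_fun_M_L2[OF t'] W] by (simp add: mult.commute)
  also have "\<dots> = - (\<integral>z. G z * fwd \<phi> z \<partial>M)"
    by (simp add: tr[OF W t'] tr[OF GL t] step)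
  also have "(\<integral>z. G z * fwd \<phi> z \<partial>M) = (\<integral>z. bwd G z * \<phi> z \<partial>M)"
    using fwd_bwd_adjoint[OF test_fun_M_L2[OF t] GL] by (simp add: mult.commute)
  finally show "(\<integral>z. bwd W z * pd (b, 0) \<phi> z \<partial>M) = - (\<integral>z. bwd G z * \<phi> z \<partial>M)" .
qed

lemma is_wderiv_space_smooth_weight:
  assumes b: "b \<in> Basis" and W: "L2 M W" and G: "is_wderiv (Q \<Omega> T) (b, 0) W G" and p: "smooth p"
  shows "is_wderiv (Q \<Omega> T) (b, 0) (\<lambda>z. p (snd z) * W z) (\<lambda>z. p (snd z) * G z)"
  unfolding is_wderiv_def
proof (intro conjI allI impI)
  show "L2 M (\<lambda>z. p (snd z) * G z)" by (rule L2_time_weight[OF is_wderiv_L2[OF G] smooth_continuous[OF p]])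
  fix \<phi> assume t: "test_fun (Q \<Omega> T) \<phi>"
  have "(\<integral>z. W z * pd (b, 0) (\<lambda>z. p (snd z) * \<phi> z) z \<partial>M) = - (\<integral>z. G z * (p (snd z) * \<phi> z) \<partial>M)"
    by (rule is_wderivD[OF G test_fun_mult_left[OF t smooth_snd[OF p]]])
  then show "(\<integral>z. p (snd z) * W z * pd (b, 0) \<phi> z \<partial>M) = - (\<integral>z. p (snd z) * G z * \<phi> z \<partial>M)"
    unfolding pd_snd_mult[OF p test_fun_smooth[OF t]] by (simp add: mult.assoc mult.left_commute)
qed

text \<open>The weight needed later, a tangent, is regular only near [0,T] and cannot serve as a
  globally smooth factor of a test function. Polynomials can, and they approximate the weight
  uniformly on [0,T] by Weierstrass; closedness of the weak derivative gives the limit.\<close>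

lemma is_wderiv_space_weight:
  assumes b: "b \<in> Basis" and W: "L2 M W" and G: "is_wderiv (Q \<Omega> T) (b, 0) W G" and \<psi>: "continuous_on {0..T} \<psi>"
  shows "is_wderiv (Q \<Omega> T) (b, 0) (\<lambda>z. \<psi> (snd z) * W z) (\<lambda>z. \<psi> (snd z) * G z)"
proof -
  have "\<exists>p. real_polynomial_function p \<and> (\<forall>t\<in>{0..T}. \<bar>\<psi> t - p t\<bar> < inverse (real (Suc n)))" for n
  proof -
    have pos: "0 < inverse (real (Suc n))" by simp
    show ?thesis by (rule Stone_Weierstrass_real_polynomial_function[OF compact_Icc \<psi> pos]) blast
  qed
  then obtain p where p: "\<And>n. real_polynomial_function (p n)" "\<And>n t. t \<in> {0..T} \<Longrightarrow> \<bar>\<psi> t - p n t\<bar> < inverse (real (Suc n))"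
    by metis
  have ps: "smooth (p n)" for n by (rule smooth_real_polynomial[OF p(1)])
  note GL = is_wderiv_L2[OF G]
  have lim: "(\<lambda>n. L2norm M (\<lambda>z. p n (snd z) * U z - \<psi> (snd z) * U z)) \<longlonglongrightarrow> 0" if U: "L2 M U" for U
  proof (rule Lim_null_comparison)
    show "(\<lambda>n. inverse (real (Suc n)) * L2norm M U) \<longlonglongrightarrow> 0"
      by (rule tendsto_mult_left_zero[OF LIMSEQ_inverse_real_of_nat])
    have "L2norm M (\<lambda>z. p n (snd z) * U z - \<psi> (snd z) * U z) \<le> inverse (real (Suc n)) * L2norm M U" for n
    proof -
      have L: "L2 M (\<lambda>z. p n (snd z) * U z - \<psi> (snd z) * U z)"
        by (rule L2_diff[OF L2_time_weight[OF U smooth_continuous[OF ps]] L2_time_weight[OF U \<psi>]])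
      have "(L2norm M (\<lambda>z. p n (snd z) * U z - \<psi> (snd z) * U z))\<^sup>2 \<le> (\<integral>z. (inverse (real (Suc n)))\<^sup>2 * (U z)\<^sup>2 \<partial>M)"
        unfolding L2norm_power2
      proof (rule integral_mono)
        show "integrable M (\<lambda>z. (p n (snd z) * U z - \<psi> (snd z) * U z)\<^sup>2)" by (rule L2_square_integrable[OF L])
        show "integrable M (\<lambda>z. (inverse (real (Suc n)))\<^sup>2 * (U z)\<^sup>2)" using L2_square_integrable[OF U] by simp
        fix z assume "z \<in> space M"
        then have "\<bar>\<psi> (snd z) - p n (snd z)\<bar> \<le> inverse (real (Suc n))"
          using p(2)[of "snd z" n] by (auto simp: space_restrict_space Q_def)
        then have "(\<psi> (snd z) - p n (snd z))\<^sup>2 \<le> (inverse (real (Suc n)))\<^sup>2"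
          using power_mono[of "\<bar>\<psi> (snd z) - p n (snd z)\<bar>" "inverse (real (Suc n))" 2] by simp
        then have "(\<psi> (snd z) - p n (snd z))\<^sup>2 * (U z)\<^sup>2 \<le> (inverse (real (Suc n)))\<^sup>2 * (U z)\<^sup>2"
          by (rule mult_right_mono) simp
        then show "(p n (snd z) * U z - \<psi> (snd z) * U z)\<^sup>2 \<le> (inverse (real (Suc n)))\<^sup>2 * (U z)\<^sup>2"
          by (simp add: left_diff_distrib[symmetric] power_mult_distrib power2_commute)
      qed
      also have "\<dots> = (inverse (real (Suc n)) * L2norm M U)\<^sup>2"
        by (simp add: power_mult_distrib L2norm_power2)
      finally show ?thesis by (rule power2_le_imp_le) simp
    qed
    then show "\<forall>\<^sub>F n in sequentially. norm (L2norm M (\<lambda>z. p n (snd z) * U z - \<psi> (snd z) * U z)) \<le> inverse (real (Suc n)) * L2norm M U"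
      by simp
  qed
  show ?thesis
    by (rule is_wderiv_limit[OF open_Q Basis_space[OF b] L2_time_weight[OF W smooth_continuous[OF ps]]
          is_wderiv_space_smooth_weight[OF b W G ps] L2_time_weight[OF W \<psi>] L2_time_weight[OF GL \<psi>] lim[OF W] lim[OF GL]])
qed

end

section \<open>The inf-sup inequality\<close>

context cylinder
begin

lemma norm11_power2: "(norm11 \<Omega> T v)\<^sup>2 = (L2norm M (dt \<Omega> T v))\<^sup>2 + (\<Sum>b\<in>Basis. (L2norm M (dx \<Omega> T b v))\<^sup>2)"
  unfolding norm11_def by (rule real_sqrt_pow2) (intro add_nonneg_nonneg sum_nonneg; simp)

text \<open>The weight \<open>\<psi>\<close> solves \<open>\<psi>' = - \<alpha> (1 + \<psi>\<^sup>2)\<close>, so that \<open>\<integral> - \<psi>' w\<^sup>2\<close> is \<open>\<alpha>\<close> times the squared norms of \<open>w\<close> and of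
  \<open>\<psi> w = - \<partial>\<^sub>t v\<close>, while the spatial terms carry the weight \<open>(1/\<psi>)' \<ge> \<alpha>\<close>.  As \<open>\<alpha> T = sqrt 2 < \<pi>/2\<close>, this
  tangent is finite on \<open>[0,T]\<close>; the shift \<open>1/20\<close> keeps it positive at \<open>t = T\<close>.\<close>

lemma wave_form_inf_sup:
  assumes w: "w \<in> H11_init \<Omega> T"
  shows "\<exists>v\<in>H11_term \<Omega> T. (L2norm M w)\<^sup>2 + (norm11 \<Omega> T v)\<^sup>2 \<le> 2 * (T / sqrt 2) * wave_form \<Omega> T w v"
proof -
  have wH: "w \<in> H1 (Q \<Omega> T)" and weq: "AE z in M. w z = fwd (dt \<Omega> T w) z"
    using w by (auto simp: H11_init_iff)
  \<comment> \<open>The estimate below comes out with factor \<alpha>/2, and this is the value for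
    which dividing by it gives 2 (T / sqrt 2).\<close>
  define \<alpha> where "\<alpha> = sqrt 2 / T"
  have \<alpha>0: "0 < \<alpha>" using T_pos by (simp add: \<alpha>_def)
  have \<alpha>C: "2 * (T / sqrt 2) * (\<alpha> / 2) = 1" using T_pos by (simp add: \<alpha>_def)
  define r where "r t = 1/20 + (T - t) * \<alpha>" for t
  have r: "0 < r t" "r t < pi / 2" if "0 \<le> t" "t \<le> T" for t
  proof -
    show "0 < r t" using that \<alpha>0 by (simp add: r_def add_pos_nonneg)
    have "(T - t) * \<alpha> \<le> T * \<alpha>" using that \<alpha>0 by (intro mult_right_mono) auto
    also have "T * \<alpha> = sqrt 2" using T_pos by (simp add: \<alpha>_def)
    \<comment> \<open>1.45 plus the shift 1/20 is 1.5, which is below \<pi>/2 because \<pi> >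
      3.\<close>
    also have "sqrt 2 \<le> 1.45" by (rule real_le_lsqrt) (auto simp: power2_eq_square)
    finally show "r t < pi / 2" using pi_gt3 by (simp add: r_def)
  qed
  define \<psi> where "\<psi> t = tan (r t)" for t
  define \<psi>' where "\<psi>' t = - \<alpha> * (1 + (\<psi> t)\<^sup>2)" for t
  have cos: "cos (r t) \<noteq> 0" if "0 \<le> t" "t \<le> T" for t
    using cos_gt_zero_pi[of "r t"] r[OF that] by auto
  have \<psi>pos: "0 < \<psi> t" if "0 \<le> t" "t \<le> T" for t
    using tan_gt_zero r[OF that] by (simp add: \<psi>_def)
  have \<psi>d: "(\<psi> has_real_derivative \<psi>' t) (at t)" if "0 \<le> t" "t \<le> T" for t
  proof -
    have "(r has_real_derivative - \<alpha>) (at t within UNIV)"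
      unfolding r_def[abs_def] by (auto intro!: derivative_eq_intros)
    from DERIV_chain2[OF DERIV_tan[OF cos[OF that]] this]
    have "(\<psi> has_real_derivative inverse ((cos (r t))\<^sup>2) * - \<alpha>) (at t)" by (simp add: \<psi>_def[abs_def])
    moreover have "inverse ((cos (r t))\<^sup>2) = 1 + (\<psi> t)\<^sup>2"
      using cos[OF that] sin_cos_squared_add[of "r t"] by (simp add: \<psi>_def tan_def power_divide field_simps)
    ultimately show ?thesis by (simp add: \<psi>'_def algebra_simps)
  qed
  have \<psi>c: "isCont \<psi> t" if "0 \<le> t" "t \<le> T" for t using DERIV_isCont[OF \<psi>d[OF that]] .
  have \<psi>'c: "isCont \<psi>' t" if "0 \<le> t" "t \<le> T" for t
    unfolding \<psi>'_def[abs_def] by (intro continuous_intros \<psi>c[OF that])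
  have \<psi>on: "continuous_on {0..T} \<psi>" using \<psi>c by (auto intro!: continuous_at_imp_continuous_on)
  \<comment> \<open>In the spatial terms \<open>dx v\<close> is the backward integral of
    \<open>h b\<close> = \<psi> \<open>g b\<close>, with \<open>g b\<close> = \<open>dx w\<close>.
    Writing \<open>g b\<close> as \<theta> times \<open>h b\<close> gives the pairing the shape
    required by \<open>weighted_bwd\<close>.\<close>
  define \<theta> where "\<theta> t = inverse (\<psi> t)" for t
  define \<theta>' where "\<theta>' t = - (inverse (\<psi> t) * \<psi>' t * inverse (\<psi> t))" for t
  have \<theta>d: "(\<theta> has_real_derivative \<theta>' t) (at t)" if "0 \<le> t" "t \<le> T" for t
    unfolding \<theta>_def[abs_def] \<theta>'_def using \<psi>pos[OF that] by (intro DERIV_inverse' \<psi>d that) auto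
  have \<theta>'c: "isCont \<theta>' t" if "0 \<le> t" "t \<le> T" for t
    unfolding \<theta>'_def[abs_def] using \<psi>pos[OF that] by (intro continuous_intros \<psi>c[OF that] \<psi>'c[OF that]) auto
  have \<theta>'on: "continuous_on {0..T} \<theta>'" using \<theta>'c by (auto intro!: continuous_at_imp_continuous_on)
  have \<theta>'ge: "\<alpha> \<le> \<theta>' t" if "0 \<le> t" "t \<le> T" for t
  proof -
    have "\<theta>' t = \<alpha> + \<alpha> * (inverse (\<psi> t))\<^sup>2"
      using \<psi>pos[OF that] by (simp add: \<theta>'_def \<psi>'_def field_simps power2_eq_square)
    then show ?thesis using \<alpha>0 by simp
  qed
  define u where "u = dt \<Omega> T w"
  have uL: "L2 M u" unfolding u_def by (rule wderiv_L2[OF wH Basis_time])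
  have wL: "L2 M w" by (rule H1_L2[OF wH])
  have ww: "AE z in M. w z = fwd u z" using weq by (simp add: u_def)
  \<comment> \<open>With v = \<open>bwd U\<close> the time derivative of v is -U, so the time part
    of the wave form becomes the integral of \<open>dt w\<close> times \<psi> w.\<close>
  define U where "U z = \<psi> (snd z) * w z" for z
  have UL: "L2 M U" unfolding U_def[abs_def] by (rule L2_time_weight[OF wL \<psi>on])
  define v where "v = bwd U"
  define g where "g b = dx \<Omega> T b w" for b
  define h where "h b z = \<psi> (snd z) * g b z" for b z
  have gL: "L2 M (g b)" if "b \<in> Basis" for b unfolding g_def by (rule wderiv_L2[OF wH Basis_space[OF that]])
  have hL: "L2 M (h b)" if "b \<in> Basis" for b unfolding h_def[abs_def] by (rule L2_time_weight[OF gL[OF that] \<psi>on])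
  have vL: "L2 M v" unfolding v_def by (rule bwd_L2(1)[OF UL])
  have vt: "is_wderiv (Q \<Omega> T) (0, 1) v (\<lambda>z. - U z)" unfolding v_def by (rule is_wderiv_time_bwd[OF UL])
  have vx: "is_wderiv (Q \<Omega> T) (b, 0) v (bwd (h b))" if b: "b \<in> Basis" for b
    unfolding v_def
  proof (rule is_wderiv_space_bwd[OF b UL])
    show "is_wderiv (Q \<Omega> T) (b, 0) U (h b)"
      unfolding U_def[abs_def] h_def[abs_def] g_def
      by (rule is_wderiv_space_weight[OF b wL is_wderiv_wderiv[OF wH Basis_space[OF b]] \<psi>on])
  qed
  have vH: "v \<in> H1 (Q \<Omega> T)"
    unfolding H1_def Basis_prod_def using vL vt vx by auto
  have dtv: "AE z in M. dt \<Omega> T v z = - U z" by (rule wderiv_AE_eq[OF open_Q vt])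
  have dxv: "AE z in M. dx \<Omega> T b v z = bwd (h b) z" if "b \<in> Basis" for b
    by (rule wderiv_AE_eq[OF open_Q vx[OF that]])
  have dtvL: "L2 M (dt \<Omega> T v)" by (rule wderiv_L2[OF vH Basis_time])
  have dxvL: "L2 M (dx \<Omega> T b v)" if "b \<in> Basis" for b by (rule wderiv_L2[OF vH Basis_space[OF that]])
  have vterm: "v \<in> H11_term \<Omega> T"
    using vanishes_at_terminal_bwd[OF UL] vH by (simp add: H11_term_def H11_def v_def)
  \<comment> \<open>By the Riccati equation -\<psi>' w^2 equals \<alpha> (w^2 + U^2), and U has the
    norm of the time derivative of v. The energy inequality applies with weight \<psi>, which is
    positive at T.\<close>
  have time: "(\<alpha> / 2) * ((L2norm M w)\<^sup>2 + (L2norm M (dt \<Omega> T v))\<^sup>2) \<le> - (\<integral>z. dt \<Omega> T w z * dt \<Omega> T v z \<partial>M)"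
  proof -
    have "(L2norm M (dt \<Omega> T v))\<^sup>2 = (L2norm M U)\<^sup>2"
      using L2norm_cong_AE[OF dtv L2_measurable[OF dtvL] L2_measurable[OF L2_minus[OF UL]]]
      by (simp add: L2norm_def)
    then have "(\<alpha> / 2) * ((L2norm M w)\<^sup>2 + (L2norm M (dt \<Omega> T v))\<^sup>2) = (\<alpha> / 2) * (\<integral>z. (w z)\<^sup>2 + (U z)\<^sup>2 \<partial>M)"
      using L2_square_integrable[OF wL] L2_square_integrable[OF UL] by (simp add: L2norm_power2)
    also have "\<dots> = (\<integral>z. - \<psi>' (snd z) * (w z)\<^sup>2 \<partial>M) / 2"
    proof -
      have "- \<psi>' (snd z) * (w z)\<^sup>2 = \<alpha> * ((w z)\<^sup>2 + (U z)\<^sup>2)" for z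
        by (simp add: \<psi>'_def U_def power_mult_distrib algebra_simps)
      then show ?thesis by simp
    qed
    also have "(\<integral>z. - \<psi>' (snd z) * (w z)\<^sup>2 \<partial>M) = (\<integral>z. - \<psi>' (snd z) * (fwd u z)\<^sup>2 \<partial>M)"
    proof (rule integral_cong_AE)
      have c: "continuous_on {0..T} (\<lambda>t. - \<psi>' t)"
        using \<psi>'c by (auto intro!: continuous_at_imp_continuous_on continuous_intros)
      show "(\<lambda>z. - \<psi>' (snd z) * (w z)\<^sup>2) \<in> borel_measurable M"
        using L2_mult_integrable[OF L2_time_weight[OF wL c] wL] by (simp add: power2_eq_square mult.assoc)
      show "(\<lambda>z. - \<psi>' (snd z) * (fwd u z)\<^sup>2) \<in> borel_measurable M"
        using L2_mult_integrable[OF L2_time_weight[OF fwd_L2(1)[OF uL] c] fwd_L2(1)[OF uL]]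
        by (simp add: power2_eq_square mult.assoc)
      show "AE z in M. - \<psi>' (snd z) * (w z)\<^sup>2 = - \<psi>' (snd z) * (fwd u z)\<^sup>2"
        using ww by (rule eventually_mono) simp
    qed
    also have "\<dots> / 2 \<le> (\<integral>z. \<psi> (snd z) * (u z * fwd u z) \<partial>M)"
      by (rule weighted_fwd[OF uL]) (use \<psi>d \<psi>'c \<psi>pos[of T] T_pos in auto)
    also have "\<dots> = (\<integral>z. u z * U z \<partial>M)"
    proof (rule integral_cong_AE)
      show "(\<lambda>z. \<psi> (snd z) * (u z * fwd u z)) \<in> borel_measurable M"
        using L2_mult_integrable[OF L2_time_weight[OF uL \<psi>on] fwd_L2(1)[OF uL]] by (simp add: mult.assoc)
      show "(\<lambda>z. u z * U z) \<in> borel_measurable M" using L2_mult_integrable[OF uL UL] by simp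
      show "AE z in M. \<psi> (snd z) * (u z * fwd u z) = u z * U z"
        using ww by (rule eventually_mono) (simp add: U_def)
    qed
    also have "\<dots> = - (\<integral>z. u z * - U z \<partial>M)" by simp
    also have "(\<integral>z. u z * - U z \<partial>M) = (\<integral>z. dt \<Omega> T w z * dt \<Omega> T v z \<partial>M)"
      using dtv by (intro integral_mult_cong_AE uL dtvL L2_minus UL) (auto simp: u_def uL[unfolded u_def] elim!: eventually_mono)
    finally show ?thesis .
  qed
  \<comment> \<open>The derivative of \<theta> is at least \<alpha> and its value at 0 is positive,
    which are the two conditions under which \<open>weighted_bwd\<close> bounds the pairing from
    below.\<close>
  have space: "(\<alpha> / 2) * (L2norm M (dx \<Omega> T b v))\<^sup>2 \<le> (\<integral>z. dx \<Omega> T b w z * dx \<Omega> T b v z \<partial>M)" if b: "b \<in> Basis" for b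
  proof -
    note B = bwd_L2(1)[OF hL[OF b]]
    have "(\<alpha> / 2) * (L2norm M (dx \<Omega> T b v))\<^sup>2 = (\<integral>z. \<alpha> * (bwd (h b) z)\<^sup>2 \<partial>M) / 2"
      using L2norm_cong_AE[OF dxv[OF b] L2_measurable[OF dxvL[OF b]] L2_measurable[OF B]]
      by (simp add: L2norm_power2)
    also have "(\<integral>z. \<alpha> * (bwd (h b) z)\<^sup>2 \<partial>M) \<le> (\<integral>z. \<theta>' (snd z) * (bwd (h b) z)\<^sup>2 \<partial>M)"
    proof (rule integral_mono)
      show "integrable M (\<lambda>z. \<alpha> * (bwd (h b) z)\<^sup>2)" using L2_square_integrable[OF B] by simp
      show "integrable M (\<lambda>z. \<theta>' (snd z) * (bwd (h b) z)\<^sup>2)"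
        using L2_mult_integrable[OF L2_time_weight[OF B \<theta>'on] B] by (simp add: power2_eq_square mult.assoc)
      fix z assume "z \<in> space M"
      then have "\<alpha> \<le> \<theta>' (snd z)" by (intro \<theta>'ge) (auto simp: space_restrict_space Q_def)
      then show "\<alpha> * (bwd (h b) z)\<^sup>2 \<le> \<theta>' (snd z) * (bwd (h b) z)\<^sup>2" by (rule mult_right_mono) simp
    qed
    also have "(\<integral>z. \<theta>' (snd z) * (bwd (h b) z)\<^sup>2 \<partial>M) / 2 \<le> (\<integral>z. \<theta> (snd z) * (h b z * bwd (h b) z) \<partial>M)"
    proof (rule weighted_bwd[OF hL[OF b]])
      show "0 \<le> \<theta> 0" using \<psi>pos[of 0] T_pos by (simp add: \<theta>_def)
    qed (use \<theta>d \<theta>'c in auto)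
    also have "\<dots> = (\<integral>z. g b z * bwd (h b) z \<partial>M)"
    proof (rule Bochner_Integration.integral_cong[OF refl])
      fix z assume "z \<in> space M"
      then have "0 < \<psi> (snd z)" by (intro \<psi>pos) (auto simp: space_restrict_space Q_def)
      then show "\<theta> (snd z) * (h b z * bwd (h b) z) = g b z * bwd (h b) z"
        by (simp add: \<theta>_def h_def)
    qed
    also have "\<dots> = (\<integral>z. dx \<Omega> T b w z * dx \<Omega> T b v z \<partial>M)"
      using dxv[OF b] by (intro integral_mult_cong_AE gL[OF b] dxvL[OF b] B) (auto simp: g_def gL[OF b, unfolded g_def] elim!: eventually_mono)
    finally show ?thesis by simp
  qed
  have "(\<alpha> / 2) * ((L2norm M w)\<^sup>2 + (norm11 \<Omega> T v)\<^sup>2) \<le> wave_form \<Omega> T w v"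
    using time sum_mono[OF space, of Basis "\<lambda>b. b"]
    by (simp add: wave_form_def norm11_power2 distrib_left sum_distrib_left)
  from mult_left_mono[OF this, of "2 * (T / sqrt 2)"] T_pos
  have "(2 * (T / sqrt 2) * (\<alpha> / 2)) * ((L2norm M w)\<^sup>2 + (norm11 \<Omega> T v)\<^sup>2) \<le> 2 * (T / sqrt 2) * wave_form \<Omega> T w v"
    by (simp only: mult.assoc) simp
  then have "(L2norm M w)\<^sup>2 + (norm11 \<Omega> T v)\<^sup>2 \<le> 2 * (T / sqrt 2) * wave_form \<Omega> T w v"
    unfolding \<alpha>C by simp
  with vterm show ?thesis by blast
qed

end

section \<open>Hilbert space arguments\<close>

text \<open>Elements are functions identified up to \<open>ip\<close>-null vectors, so \<open>ip\<close> is only semidefinite and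
  limits are not unique.\<close>

locale hilbert_functions =
  fixes X :: "('z \<Rightarrow> real) set" and ip :: "('z \<Rightarrow> real) \<Rightarrow> ('z \<Rightarrow> real) \<Rightarrow> real"
  assumes lincomb: "u \<in> X \<Longrightarrow> v \<in> X \<Longrightarrow> (\<lambda>z. a * u z + b * v z) \<in> X"
    and ip_lincomb: "u \<in> X \<Longrightarrow> v \<in> X \<Longrightarrow> w \<in> X \<Longrightarrow> ip (\<lambda>z. a * u z + b * v z) w = a * ip u w + b * ip v w"
    and ip_commute: "u \<in> X \<Longrightarrow> v \<in> X \<Longrightarrow> ip u v = ip v u"
    and ip_nonneg: "u \<in> X \<Longrightarrow> 0 \<le> ip u u"
    and complete: "(\<And>n. s n \<in> X) \<Longrightarrow>
      (\<And>e. 0 < e \<Longrightarrow> \<exists>N. \<forall>m\<ge>N. \<forall>n\<ge>N. ip (\<lambda>z. s m z - s n z) (\<lambda>z. s m z - s n z) < e) \<Longrightarrow>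
      \<exists>x\<in>X. (\<lambda>n. ip (\<lambda>z. s n z - x z) (\<lambda>z. s n z - x z)) \<longlonglongrightarrow> 0"
begin

lemma diff_mem: "u \<in> X \<Longrightarrow> v \<in> X \<Longrightarrow> (\<lambda>z. u z - v z) \<in> X"
  using lincomb[of u v 1 "-1"] by simp

lemma ip_diff: "u \<in> X \<Longrightarrow> v \<in> X \<Longrightarrow> w \<in> X \<Longrightarrow> ip (\<lambda>z. u z - v z) w = ip u w - ip v w"
  using ip_lincomb[of u v w 1 "-1"] by simp

lemma ip_lincomb_self:
  assumes "u \<in> X" "v \<in> X"
  shows "ip (\<lambda>z. a * u z + b * v z) (\<lambda>z. a * u z + b * v z) = a\<^sup>2 * ip u u + 2 * a * b * ip u v + b\<^sup>2 * ip v v"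
  using assms lincomb[OF assms, of a b] ip_lincomb[OF assms, of "\<lambda>z. a * u z + b * v z" a b]
    ip_commute[of u "\<lambda>z. a * u z + b * v z"] ip_commute[of v "\<lambda>z. a * u z + b * v z"]
    ip_lincomb[of u v u a b] ip_lincomb[of u v v a b] ip_commute[of v u]
  by (simp add: power2_eq_square algebra_simps)

lemma Cauchy_Schwarz:
  assumes "u \<in> X" "v \<in> X"
  shows "\<bar>ip u v\<bar> \<le> sqrt (ip u u) * sqrt (ip v v)"
proof -
  have "(ip u v)\<^sup>2 \<le> ip u u * ip v v"
  proof (rule discriminant_le)
    show "0 \<le> ip u u + 2 * s * ip u v + s\<^sup>2 * ip v v" for s
      using ip_lincomb_self[OF assms, of 1 s] ip_nonneg[OF lincomb[OF assms, of 1 s]] by simp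
  qed (rule ip_nonneg[OF assms(2)])
  then have "sqrt ((ip u v)\<^sup>2) \<le> sqrt (ip u u * ip v v)" by (rule real_sqrt_le_mono)
  then show ?thesis by (simp add: real_sqrt_mult)
qed

lemma ip_tendsto:
  assumes s: "\<And>n. s n \<in> X" and x: "x \<in> X" and y: "y \<in> X"
    and lim: "(\<lambda>n. ip (\<lambda>z. s n z - x z) (\<lambda>z. s n z - x z)) \<longlonglongrightarrow> 0"
  shows "(\<lambda>n. ip (s n) y) \<longlonglongrightarrow> ip x y"
proof (rule Lim_null_comparison[THEN LIM_zero_cancel])
  have "(\<lambda>n. sqrt (ip (\<lambda>z. s n z - x z) (\<lambda>z. s n z - x z)) * sqrt (ip y y)) \<longlonglongrightarrow> sqrt 0 * sqrt (ip y y)"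
    by (intro tendsto_intros lim)
  then show "(\<lambda>n. sqrt (ip (\<lambda>z. s n z - x z) (\<lambda>z. s n z - x z)) * sqrt (ip y y)) \<longlonglongrightarrow> 0" by simp
  show "\<forall>\<^sub>F n in sequentially. norm (ip (s n) y - ip x y) \<le> sqrt (ip (\<lambda>z. s n z - x z) (\<lambda>z. s n z - x z)) * sqrt (ip y y)"
    using Cauchy_Schwarz[OF diff_mem[OF s x] y] by (simp add: ip_diff[OF s x y])
qed

text \<open>\<open>G\<close> is the graph of a linear functional on a subspace of \<open>X\<close>; its representing vector in the closure
  of the subspace is the limit of a minimizing sequence of \<open>ip y y - 2 c\<close>.\<close>

lemma representation:
  assumes GX: "\<And>y c. (y, c) \<in> G \<Longrightarrow> y \<in> X" and ne: "G \<noteq> {}"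
    and Glin: "\<And>y c y' c' a b. (y, c) \<in> G \<Longrightarrow> (y', c') \<in> G \<Longrightarrow> (\<lambda>z. a * y z + b * y' z, a * c + b * c') \<in> G"
    and bound: "\<And>y c. (y, c) \<in> G \<Longrightarrow> \<bar>c\<bar> \<le> K * sqrt (ip y y)"
  shows "\<exists>x\<in>X. (\<exists>s. (\<forall>n. \<exists>c. (s n, c) \<in> G) \<and> (\<lambda>n. ip (\<lambda>z. s n z - x z) (\<lambda>z. s n z - x z)) \<longlonglongrightarrow> 0) \<and>
    (\<forall>(y, c)\<in>G. ip x y = c)"
proof -
  \<comment> \<open>If c is the inner product of y with a vector x, then J is |y - x|^2 - |x|^2;
    thus minimizing J over G approximates the representing vector.\<close>
  define J where "J = (\<lambda>(y, c). ip y y - 2 * c)"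
  have lower: "- K\<^sup>2 \<le> J p" if p: "p \<in> G" for p
  proof -
    obtain y c where yc: "p = (y, c)" by (cases p)
    have "0 \<le> (sqrt (ip y y) - K)\<^sup>2" by simp
    then have "- K\<^sup>2 \<le> ip y y - 2 * (K * sqrt (ip y y))"
      using ip_nonneg[OF GX[of y c]] p yc by (simp add: power2_diff mult_ac)
    also have "\<dots> \<le> J p" using bound[of y c] p yc by (simp add: J_def)
    finally show ?thesis .
  qed
  define d where "d = Inf (J ` G)"
  have bdd: "bdd_below (J ` G)" by (rule bdd_belowI2) (rule lower)
  have dle: "d \<le> J p" if "p \<in> G" for p unfolding d_def using that bdd by (auto intro: cInf_lower)
  have "\<exists>p\<in>G. J p < d + inverse (real (Suc n))" for n
    using cInf_lessD[of "J ` G" "d + inverse (real (Suc n))"] ne by (auto simp: d_def)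
  then obtain p where p: "\<And>n. p n \<in> G" "\<And>n. J (p n) < d + inverse (real (Suc n))" by metis
  define s where "s n = fst (p n)" for n
  define c where "c n = snd (p n)" for n
  have sc: "(s n, c n) \<in> G" for n using p(1)[of n] by (simp add: s_def c_def)
  have sX: "s n \<in> X" for n by (rule GX[OF sc])
  have Jn: "ip (s n) (s n) - 2 * c n < d + inverse (real (Suc n))" for n
    using p(2)[of n] by (simp add: J_def s_def c_def case_prod_beta)
  have para: "ip (\<lambda>z. s m z - s n z) (\<lambda>z. s m z - s n z) \<le> 2 * (inverse (real (Suc m)) + inverse (real (Suc n)))" for m n
  proof -
    \<comment> \<open>The midpoint lies in G again; comparing its value with the infimum d and using
      the parallelogram law makes the minimizing sequence Cauchy.\<close>
    have "d \<le> J (\<lambda>z. 1/2 * s m z + 1/2 * s n z, 1/2 * c m + 1/2 * c n)" by (intro dle Glin sc)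
    then have "4 * d \<le> ip (s m) (s m) + 2 * ip (s m) (s n) + ip (s n) (s n) - 4 * c m - 4 * c n"
      using ip_lincomb_self[OF sX sX, of "1/2" m "1/2" n] by (simp add: J_def power2_eq_square)
    moreover have "ip (\<lambda>z. s m z - s n z) (\<lambda>z. s m z - s n z) = ip (s m) (s m) - 2 * ip (s m) (s n) + ip (s n) (s n)"
      using ip_lincomb_self[OF sX sX, of 1 m "-1" n] by simp
    moreover have "\<lbrakk>4 * d \<le> a + 2 * b + a' - 4 * c - 4 * c'; e = a - 2 * b + a'; a - 2 * c < d + r; a' - 2 * c' < d + r'\<rbrakk>
        \<Longrightarrow> e \<le> 2 * (r + r')" for a b a' c c' e r r' :: real
      by argo
    ultimately show ?thesis using Jn[of m] Jn[of n] by blast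
  qed
  have "\<exists>x\<in>X. (\<lambda>n. ip (\<lambda>z. s n z - x z) (\<lambda>z. s n z - x z)) \<longlonglongrightarrow> 0"
  proof (rule complete[OF sX])
    fix e :: real assume "0 < e"
    then obtain N where N: "inverse (real (Suc N)) < e / 4" using reals_Archimedean[of "e/4"] by auto
    have small: "inverse (real (Suc m)) < e / 4" if "N \<le> m" for m
    proof (rule le_less_trans[OF _ N])
      show "inverse (real (Suc m)) \<le> inverse (real (Suc N))" using that by (intro le_imp_inverse_le) auto
    qed
    show "\<exists>N. \<forall>m\<ge>N. \<forall>n\<ge>N. ip (\<lambda>z. s m z - s n z) (\<lambda>z. s m z - s n z) < e"
    proof (intro exI[of _ N] allI impI)
      fix m n assume mn: "N \<le> m" "N \<le> n"
      show "ip (\<lambda>z. s m z - s n z) (\<lambda>z. s m z - s n z) < e"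
        using para[of m n] small[OF mn(1)] small[OF mn(2)] by argo
    qed
  qed
  then obtain x where x: "x \<in> X" and lim: "(\<lambda>n. ip (\<lambda>z. s n z - x z) (\<lambda>z. s n z - x z)) \<longlonglongrightarrow> 0" by blast
  have "ip x y = b" if yb: "(y, b) \<in> G" for y b
  proof -
    have yX: "y \<in> X" by (rule GX[OF yb])
    \<comment> \<open>Moving the minimizing sequence by \<tau> in the direction y cannot push J
      below d. In the limit this is a quadratic in \<tau> without constant term that is never
      negative, so its linear coefficient vanishes.\<close>
    have var: "0 \<le> 2 * \<tau> * (ip x y - b) + \<tau>\<^sup>2 * ip y y" for \<tau>
    proof (rule LIMSEQ_le_const)
      show "(\<lambda>n. inverse (real (Suc n)) + (2 * \<tau> * (ip (s n) y - b) + \<tau>\<^sup>2 * ip y y)) \<longlonglongrightarrow> 2 * \<tau> * (ip x y - b) + \<tau>\<^sup>2 * ip y y"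
      proof -
        have "(\<lambda>n. inverse (real (Suc n)) + (2 * \<tau> * (ip (s n) y - b) + \<tau>\<^sup>2 * ip y y))
            \<longlonglongrightarrow> 0 + (2 * \<tau> * (ip x y - b) + \<tau>\<^sup>2 * ip y y)"
          by (intro tendsto_add LIMSEQ_inverse_real_of_nat tendsto_mult tendsto_diff tendsto_const ip_tendsto[OF sX x yX lim])
        then show ?thesis by simp
      qed
      have "0 \<le> inverse (real (Suc n)) + (2 * \<tau> * (ip (s n) y - b) + \<tau>\<^sup>2 * ip y y)" for n
      proof -
        have "d \<le> J (\<lambda>z. 1 * s n z + \<tau> * y z, 1 * c n + \<tau> * b)" by (intro dle Glin sc yb)
        then show ?thesis using ip_lincomb_self[OF sX[of n] yX, of 1 \<tau>] Jn[of n] by (simp add: J_def algebra_simps)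
      qed
      then show "\<exists>N. \<forall>n\<ge>N. 0 \<le> inverse (real (Suc n)) + (2 * \<tau> * (ip (s n) y - b) + \<tau>\<^sup>2 * ip y y)" by blast
    qed
    have "(ip x y - b)\<^sup>2 \<le> 0 * ip y y"
      by (rule discriminant_le) (use var ip_nonneg[OF yX] in \<open>simp_all add: mult.assoc\<close>)
    then show ?thesis by simp
  qed
  then show ?thesis using x lim sc by blast
qed

lemma Riesz:
  assumes lin: "\<And>u v a b. u \<in> X \<Longrightarrow> v \<in> X \<Longrightarrow> F (\<lambda>z. a * u z + b * v z) = a * F u + b * F v"
    and bound: "\<And>u. u \<in> X \<Longrightarrow> \<bar>F u\<bar> \<le> K * sqrt (ip u u)" and ne: "X \<noteq> {}"
  shows "\<exists>r\<in>X. \<forall>v\<in>X. ip r v = F v"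
proof -
  define G where "G = (\<lambda>v. (v, F v)) ` X"
  have G: "(y, c) \<in> G \<longleftrightarrow> y \<in> X \<and> c = F y" for y c by (auto simp: G_def)
  have "\<exists>x\<in>X. (\<exists>s. (\<forall>n. \<exists>c. (s n, c) \<in> G) \<and> (\<lambda>n. ip (\<lambda>z. s n z - x z) (\<lambda>z. s n z - x z)) \<longlonglongrightarrow> 0) \<and>
    (\<forall>(y, c)\<in>G. ip x y = c)"
  proof (rule representation)
    show "G \<noteq> {}" using ne by (simp add: G_def)
    show "(\<lambda>z. a * y z + b * y' z, a * c + b * c') \<in> G" if "(y, c) \<in> G" "(y', c') \<in> G" for y c y' c' a b
      using that lin lincomb by (simp add: G)
    show "\<bar>c\<bar> \<le> K * sqrt (ip y y)" if "(y, c) \<in> G" for y c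
      using that bound by (simp add: G)
  qed (simp add: G)
  then obtain r where "r \<in> X" "\<forall>(y, c)\<in>G. ip r y = c" by blast
  then show ?thesis by (intro bexI[of _ r] ballI) (auto simp: G_def)
qed

end

lemma integral_self_mult: "(\<integral>z. u z * u z \<partial>M) = (L2norm M u)\<^sup>2"
  by (simp only: L2norm_power2) (simp only: power2_eq_square)

section \<open>The energy space of test functions and the range of the wave form\<close>

context cylinder
begin

text \<open>The positive counterpart of \<open>wave_form\<close>, with the same integrals and no
  sign change in time. Summing over the whole space-time basis allows linearity, bounds and limits
  to be shown for one direction at a time.\<close>

definition ip11 :: "('a \<times> real \<Rightarrow> real) \<Rightarrow> ('a \<times> real \<Rightarrow> real) \<Rightarrow> real" where
  "ip11 u v = (\<Sum>b\<in>Basis. \<integral>z. wderiv (Q \<Omega> T) b u z * wderiv (Q \<Omega> T) b v z \<partial>M)"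

lemma norm11_sqrt_ip11: "norm11 \<Omega> T v = sqrt (ip11 v v)"
  by (simp add: norm11_def ip11_def sum_Basis_cylinder integral_self_mult)

lemma norm11_nonneg [simp]: "0 \<le> norm11 \<Omega> T v"
  unfolding norm11_sqrt_ip11 ip11_def by (intro real_sqrt_ge_zero sum_nonneg) (simp add: power2_eq_square[symmetric])

lemma L2norm_wderiv_le_norm11:
  assumes "b \<in> Basis"
  shows "L2norm M (wderiv (Q \<Omega> T) b v) \<le> norm11 \<Omega> T v"
proof (rule power2_le_imp_le)
  have "(L2norm M (wderiv (Q \<Omega> T) b v))\<^sup>2 \<le> (\<Sum>b\<in>Basis. (L2norm M (wderiv (Q \<Omega> T) b v))\<^sup>2)"
    using assms by (intro member_le_sum) auto
  also have "\<dots> = (norm11 \<Omega> T v)\<^sup>2"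
    by (simp add: norm11_power2 sum_Basis_cylinder)
  finally show "(L2norm M (wderiv (Q \<Omega> T) b v))\<^sup>2 \<le> (norm11 \<Omega> T v)\<^sup>2" .
qed simp

lemma H11_term_H1: "v \<in> H11_term \<Omega> T \<Longrightarrow> v \<in> H1 (Q \<Omega> T)"
  and H11_init_H1: "v \<in> H11_init \<Omega> T \<Longrightarrow> v \<in> H1 (Q \<Omega> T)"
  by (simp_all add: H11_term_iff H11_init_iff)

lemma H11_term_lincomb:
  assumes u: "u \<in> H11_term \<Omega> T" and v: "v \<in> H11_term \<Omega> T"
  shows "(\<lambda>z. a * u z + b * v z) \<in> H11_term \<Omega> T"
  unfolding H11_term_iff
proof
  have uH: "u \<in> H1 (Q \<Omega> T)" and ue: "AE z in M. u z = - bwd (dt \<Omega> T u) z"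
    and vH: "v \<in> H1 (Q \<Omega> T)" and ve: "AE z in M. v z = - bwd (dt \<Omega> T v) z"
    using u v by (auto simp: H11_term_iff)
  show sH: "(\<lambda>z. a * u z + b * v z) \<in> H1 (Q \<Omega> T)" by (rule H1_lincomb[OF open_Q uH vH])
  note L = wderiv_L2[OF uH Basis_time] wderiv_L2[OF vH Basis_time]
  have "AE z in M. bwd (dt \<Omega> T (\<lambda>z. a * u z + b * v z)) z = bwd (\<lambda>z. a * dt \<Omega> T u z + b * dt \<Omega> T v z) z"
    by (rule bwd_cong_AE[OF wderiv_L2[OF sH Basis_time] L2_lincomb[OF L] wderiv_lincomb[OF open_Q uH vH Basis_time]])
  with bwd_lincomb[OF L, of a b] ue ve
  show "AE z in M. a * u z + b * v z = - bwd (dt \<Omega> T (\<lambda>z. a * u z + b * v z)) z"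
    by eventually_elim (simp add: algebra_simps)
qed

lemma H11_init_lincomb:
  assumes u: "u \<in> H11_init \<Omega> T" and v: "v \<in> H11_init \<Omega> T"
  shows "(\<lambda>z. a * u z + b * v z) \<in> H11_init \<Omega> T"
proof -
  have "rfl T (\<lambda>z. a * rfl T u z + b * rfl T v z) \<in> H11_init \<Omega> T"
    by (intro H11_init_rfl H11_term_lincomb H11_term_rfl u v)
  moreover have "rfl T (\<lambda>z. a * rfl T u z + b * rfl T v z) = (\<lambda>z. a * u z + b * v z)"
    by (auto simp: rfl_def)
  ultimately show ?thesis by simp
qed

lemma integral_wderiv_lincomb:
  assumes u: "u \<in> H1 (Q \<Omega> T)" and v: "v \<in> H1 (Q \<Omega> T)" and w: "w \<in> H1 (Q \<Omega> T)" and b: "b \<in> Basis"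
  shows "(\<integral>z. wderiv (Q \<Omega> T) b (\<lambda>z. a * u z + c * v z) z * wderiv (Q \<Omega> T) b w z \<partial>M)
    = a * (\<integral>z. wderiv (Q \<Omega> T) b u z * wderiv (Q \<Omega> T) b w z \<partial>M) + c * (\<integral>z. wderiv (Q \<Omega> T) b v z * wderiv (Q \<Omega> T) b w z \<partial>M)"
proof -
  note L = wderiv_L2[OF u b] wderiv_L2[OF v b] wderiv_L2[OF w b]
  have "(\<integral>z. wderiv (Q \<Omega> T) b (\<lambda>z. a * u z + c * v z) z * wderiv (Q \<Omega> T) b w z \<partial>M)
    = (\<integral>z. (a * wderiv (Q \<Omega> T) b u z + c * wderiv (Q \<Omega> T) b v z) * wderiv (Q \<Omega> T) b w z \<partial>M)"
    by (rule integral_mult_cong_AE[OF wderiv_lincomb[OF open_Q u v b] _ wderiv_L2[OF H1_lincomb[OF open_Q u v] b] L2_lincomb[OF L(1,2)] L(3) L(3)])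
      simp
  then show ?thesis by (simp add: L2_integral_lincomb_mult[OF L])
qed

lemma ip11_lincomb:
  assumes "u \<in> H1 (Q \<Omega> T)" "v \<in> H1 (Q \<Omega> T)" "w \<in> H1 (Q \<Omega> T)"
  shows "ip11 (\<lambda>z. a * u z + b * v z) w = a * ip11 u w + b * ip11 v w"
  unfolding ip11_def using integral_wderiv_lincomb[OF assms]
  by (simp add: sum.distrib sum_distrib_left)

lemma wave_form_lincomb:
  assumes "u \<in> H1 (Q \<Omega> T)" "v \<in> H1 (Q \<Omega> T)" "w \<in> H1 (Q \<Omega> T)"
  shows "wave_form \<Omega> T (\<lambda>z. a * u z + b * v z) w = a * wave_form \<Omega> T u w + b * wave_form \<Omega> T v w"
  unfolding wave_form_def using integral_wderiv_lincomb[OF assms Basis_time, of a b] integral_wderiv_lincomb[OF assms Basis_space, of _ a b]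
  by (simp add: sum.distrib sum_distrib_left algebra_simps)

lemma wave_form_lincomb_right:
  assumes "u \<in> H1 (Q \<Omega> T)" "v \<in> H1 (Q \<Omega> T)" "w \<in> H1 (Q \<Omega> T)"
  shows "wave_form \<Omega> T w (\<lambda>z. a * u z + b * v z) = a * wave_form \<Omega> T w u + b * wave_form \<Omega> T w v"
  using wave_form_lincomb[OF assms] by (simp add: wave_form_commute)

lemma wave_form_bounded:
  assumes w: "w \<in> H1 (Q \<Omega> T)"
  shows "\<exists>K\<ge>0. \<forall>v\<in>H1 (Q \<Omega> T). \<bar>wave_form \<Omega> T w v\<bar> \<le> K * norm11 \<Omega> T v"
proof (intro exI conjI ballI)
  let ?K = "\<Sum>b\<in>Basis. L2norm M (wderiv (Q \<Omega> T) b w)"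
  show "0 \<le> ?K" by (intro sum_nonneg) simp
  fix v assume v: "v \<in> H1 (Q \<Omega> T)"
  have bd: "\<bar>\<integral>z. wderiv (Q \<Omega> T) b w z * wderiv (Q \<Omega> T) b v z \<partial>M\<bar> \<le> L2norm M (wderiv (Q \<Omega> T) b w) * norm11 \<Omega> T v"
    if "b \<in> Basis" for b
    using L2_Cauchy_Schwarz[OF wderiv_L2[OF w that] wderiv_L2[OF v that]]
      mult_left_mono[OF L2norm_wderiv_le_norm11[OF that, of v], of "L2norm M (wderiv (Q \<Omega> T) b w)"]
    by simp
  have "\<bar>wave_form \<Omega> T w v\<bar> \<le> \<bar>\<integral>z. dt \<Omega> T w z * dt \<Omega> T v z \<partial>M\<bar> + (\<Sum>b\<in>Basis. \<bar>\<integral>z. dx \<Omega> T b w z * dx \<Omega> T b v z \<partial>M\<bar>)"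
    unfolding wave_form_def
    by (rule order_trans[OF abs_triangle_ineq]) (use sum_abs in \<open>auto intro: add_mono\<close>)
  also have "\<dots> = (\<Sum>b\<in>Basis. \<bar>\<integral>z. wderiv (Q \<Omega> T) b w z * wderiv (Q \<Omega> T) b v z \<partial>M\<bar>)"
    by (simp add: sum_Basis_cylinder)
  also have "\<dots> \<le> (\<Sum>b\<in>Basis. L2norm M (wderiv (Q \<Omega> T) b w) * norm11 \<Omega> T v)"
    by (intro sum_mono bd)
  finally show "\<bar>wave_form \<Omega> T w v\<bar> \<le> ?K * norm11 \<Omega> T v" by (simp add: sum_distrib_right)
qed

lemma H11_term_zero: "(\<lambda>z. 0) \<in> H11_term \<Omega> T"
proof -
  have "is_wderiv (Q \<Omega> T) b (\<lambda>z. 0) (\<lambda>z. 0)" for b by (simp add: is_wderiv_def)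
  then have "(\<lambda>z. 0) \<in> H1 (Q \<Omega> T)" by (auto simp: H1_def)
  moreover have "vanishes_at \<Omega> T T (\<lambda>z. 0)"
    unfolding vanishes_at_def by (intro exI[of _ "\<lambda>z. 0"]) (simp add: L2norm_def)
  ultimately show ?thesis by (simp add: H11_term_def H11_def)
qed

lemma H11_init_zero: "(\<lambda>z. 0) \<in> H11_init \<Omega> T"
  using H11_init_rfl[OF H11_term_zero] by (simp add: rfl_def[abs_def])

lemma ip11_self_eq:
  assumes v: "v \<in> H1 (Q \<Omega> T)" and d: "\<And>b. b \<in> Basis \<Longrightarrow> is_wderiv (Q \<Omega> T) b v (d b)"
  shows "ip11 v v = (\<Sum>b\<in>Basis. (L2norm M (d b))\<^sup>2)"
  unfolding ip11_def
proof (rule sum.cong[OF refl])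
  fix b :: "'a \<times> real" assume b: "b \<in> Basis"
  have "(\<integral>z. wderiv (Q \<Omega> T) b v z * wderiv (Q \<Omega> T) b v z \<partial>M) = (\<integral>z. d b z * d b z \<partial>M)"
    using wderiv_AE_eq[OF open_Q d[OF b]] wderiv_L2[OF v b] is_wderiv_L2[OF d[OF b]]
    by (intro integral_mult_cong_AE)
  then show "(\<integral>z. wderiv (Q \<Omega> T) b v z * wderiv (Q \<Omega> T) b v z \<partial>M) = (L2norm M (d b))\<^sup>2"
    by (simp add: integral_self_mult)
qed

text \<open>Of a Cauchy sequence in the energy norm only the derivatives converge at first. The
  terminal condition recovers the functions: each is minus the backward integral of its time
  derivative, and that operator is bounded in L2. Closedness of the weak derivatives then identifies
  all derivatives of the limit.\<close>

lemma hilbert_H11_term: "hilbert_functions (H11_term \<Omega> T) ip11"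
proof
  show "(\<lambda>z. a * u z + b * v z) \<in> H11_term \<Omega> T" if "u \<in> H11_term \<Omega> T" "v \<in> H11_term \<Omega> T" for u v a b
    by (rule H11_term_lincomb[OF that])
  show "ip11 (\<lambda>z. a * u z + b * v z) w = a * ip11 u w + b * ip11 v w"
    if "u \<in> H11_term \<Omega> T" "v \<in> H11_term \<Omega> T" "w \<in> H11_term \<Omega> T" for u v w a b
    by (rule ip11_lincomb) (intro H11_term_H1 that)+
  show "ip11 u v = ip11 v u" for u v by (simp add: ip11_def mult.commute)
  show "0 \<le> ip11 u u" for u unfolding ip11_def by (intro sum_nonneg) (simp add: power2_eq_square[symmetric])
  fix s :: "nat \<Rightarrow> 'a \<times> real \<Rightarrow> real"
  assume s: "\<And>n. s n \<in> H11_term \<Omega> T"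
    and C: "\<And>e. 0 < e \<Longrightarrow> \<exists>N. \<forall>m\<ge>N. \<forall>n\<ge>N. ip11 (\<lambda>z. s m z - s n z) (\<lambda>z. s m z - s n z) < e"
  let ?d = "wderiv (Q \<Omega> T)"
  have sH: "s n \<in> H1 (Q \<Omega> T)" for n by (rule H11_term_H1[OF s])
  have sdiff: "is_wderiv (Q \<Omega> T) b (\<lambda>z. s m z - s n z) (\<lambda>z. ?d b (s m) z - ?d b (s n) z)" if "b \<in> Basis" for b m n
    using is_wderiv_lincomb[OF open_Q that H1_L2[OF sH] is_wderiv_wderiv[OF sH that] H1_L2[OF sH] is_wderiv_wderiv[OF sH that], of 1 m "-1" n]
    by simp
  have sdH: "(\<lambda>z. s m z - s n z) \<in> H1 (Q \<Omega> T)" for m n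
    using H1_lincomb[OF open_Q sH sH, of 1 m "-1" n] by simp
  have "\<exists>g. L2 M g \<and> (\<lambda>n. L2norm M (\<lambda>z. ?d b (s n) z - g z)) \<longlonglongrightarrow> 0" if b: "b \<in> Basis" for b
  proof (rule L2_complete[OF finite_M wderiv_L2[OF sH b]])
    fix e :: real assume "0 < e"
    then obtain N where N: "\<And>m n. m \<ge> N \<Longrightarrow> n \<ge> N \<Longrightarrow> ip11 (\<lambda>z. s m z - s n z) (\<lambda>z. s m z - s n z) < e\<^sup>2"
      using C[of "e\<^sup>2"] by (meson zero_less_power)
    have "L2norm M (\<lambda>z. ?d b (s m) z - ?d b (s n) z) < e" if "m \<ge> N" "n \<ge> N" for m n
    proof (rule power2_less_imp_less)
      have "(L2norm M (\<lambda>z. ?d b (s m) z - ?d b (s n) z))\<^sup>2 \<le> (\<Sum>b\<in>Basis. (L2norm M (\<lambda>z. ?d b (s m) z - ?d b (s n) z))\<^sup>2)"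
        using b by (intro member_le_sum) auto
      also have "\<dots> < e\<^sup>2" using N[OF that] ip11_self_eq[OF sdH[of m n] sdiff[of _ m n]] by metis
      finally show "(L2norm M (\<lambda>z. ?d b (s m) z - ?d b (s n) z))\<^sup>2 < e\<^sup>2" .
    qed (use \<open>0 < e\<close> in simp)
    then show "\<exists>N. \<forall>m\<ge>N. \<forall>n\<ge>N. L2norm M (\<lambda>z. ?d b (s m) z - ?d b (s n) z) < e" by blast
  qed
  then have "\<forall>b\<in>Basis. \<exists>g. L2 M g \<and> (\<lambda>n. L2norm M (\<lambda>z. ?d b (s n) z - g z)) \<longlonglongrightarrow> 0" by blast
  from bchoice[OF this] obtain g where
    g: "\<forall>b\<in>Basis. L2 M (g b) \<and> (\<lambda>n. L2norm M (\<lambda>z. ?d b (s n) z - g b z)) \<longlonglongrightarrow> 0" by blast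
  have gL: "L2 M (g b)" and glim: "(\<lambda>n. L2norm M (\<lambda>z. ?d b (s n) z - g b z)) \<longlonglongrightarrow> 0" if "b \<in> Basis" for b
    using g that by auto
  \<comment> \<open>Integrating the limit of the time derivatives backward gives a limit function
    whose terminal value is zero by construction.\<close>
  define v where "v z = - bwd (g (0, 1)) z" for z
  note gt = gL[OF Basis_time]
  have vL: "L2 M v" unfolding v_def[abs_def] by (rule L2_minus[OF bwd_L2(1)[OF gt]])
  have slim: "(\<lambda>n. L2norm M (\<lambda>z. s n z - v z)) \<longlonglongrightarrow> 0"
  proof (rule Lim_null_comparison)
    show "(\<lambda>n. T * L2norm M (\<lambda>z. ?d (0, 1) (s n) z - g (0, 1) z)) \<longlonglongrightarrow> 0"
      by (rule tendsto_mult_right_zero[OF glim[OF Basis_time]])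
    have "L2norm M (\<lambda>z. s n z - v z) \<le> T * L2norm M (\<lambda>z. ?d (0, 1) (s n) z - g (0, 1) z)" for n
    proof -
      have e: "AE z in M. s n z = - bwd (?d (0, 1) (s n)) z" using s[of n] by (simp add: H11_term_iff)
      note Lt = wderiv_L2[OF sH[of n] Basis_time]
      have "L2norm M (\<lambda>z. s n z - v z) = L2norm M (\<lambda>z. bwd (g (0, 1)) z - bwd (?d (0, 1) (s n)) z)"
        using e L2_measurable[OF L2_diff[OF H1_L2[OF sH[of n]] vL]] L2_measurable[OF L2_diff[OF bwd_L2(1)[OF gt] bwd_L2(1)[OF Lt]]]
        by (intro L2norm_cong_AE) (auto simp: v_def elim!: eventually_mono)
      also have "\<dots> \<le> T * L2norm M (\<lambda>z. g (0, 1) z - ?d (0, 1) (s n) z)" by (rule bwd_diff_bound[OF gt Lt])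
      finally show ?thesis by (simp add: L2norm_minus)
    qed
    then show "\<forall>\<^sub>F n in sequentially. norm (L2norm M (\<lambda>z. s n z - v z)) \<le> T * L2norm M (\<lambda>z. ?d (0, 1) (s n) z - g (0, 1) z)"
      by simp
  qed
  have vd: "is_wderiv (Q \<Omega> T) b v (g b)" if b: "b \<in> Basis" for b
    by (rule is_wderiv_limit[OF open_Q b H1_L2[OF sH] is_wderiv_wderiv[OF sH b] vL gL[OF b] slim glim[OF b]])
  have vH: "v \<in> H1 (Q \<Omega> T)" using vL vd by (auto simp: H1_def)
  have vterm: "v \<in> H11_term \<Omega> T"
    unfolding H11_term_def H11_def using vH vanishes_at_terminal_iff[OF vL vd[OF Basis_time]] by (simp add: v_def)
  have "(\<lambda>n. ip11 (\<lambda>z. s n z - v z) (\<lambda>z. s n z - v z)) \<longlonglongrightarrow> 0"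
  proof -
    have "ip11 (\<lambda>z. s n z - v z) (\<lambda>z. s n z - v z) = (\<Sum>b\<in>Basis. (L2norm M (\<lambda>z. ?d b (s n) z - g b z))\<^sup>2)" for n
    proof (rule ip11_self_eq)
      show "(\<lambda>z. s n z - v z) \<in> H1 (Q \<Omega> T)" using H1_lincomb[OF open_Q sH[of n] vH, of 1 "-1"] by simp
      show "is_wderiv (Q \<Omega> T) b (\<lambda>z. s n z - v z) (\<lambda>z. ?d b (s n) z - g b z)" if "b \<in> Basis" for b
        using is_wderiv_lincomb[OF open_Q that H1_L2[OF sH[of n]] is_wderiv_wderiv[OF sH that] vL vd[OF that], of 1 "-1"]
        by simp
    qed
    moreover have "(\<lambda>n. \<Sum>b\<in>Basis. (L2norm M (\<lambda>z. ?d b (s n) z - g b z))\<^sup>2) \<longlonglongrightarrow> (\<Sum>b\<in>(Basis :: ('a \<times> real) set). 0\<^sup>2)"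
      by (intro tendsto_sum tendsto_power glim)
    ultimately show ?thesis by simp
  qed
  with vterm show "\<exists>x\<in>H11_term \<Omega> T. (\<lambda>n. ip11 (\<lambda>z. s n z - x z) (\<lambda>z. s n z - x z)) \<longlonglongrightarrow> 0" by blast
qed

text \<open>With C = T / sqrt 2, the term 2 C K |v| is at most (C K)^2 + |v|^2. The norm of v in
  \<open>wave_form_inf_sup\<close> thus absorbs the unknown test function completely.\<close>

lemma inf_sup_bound:
  assumes w: "w \<in> H11_init \<Omega> T" and K: "0 \<le> K" "\<And>v. v \<in> H11_term \<Omega> T \<Longrightarrow> \<bar>wave_form \<Omega> T w v\<bar> \<le> K * norm11 \<Omega> T v"
  shows "L2norm M w \<le> T / sqrt 2 * K"
proof -
  define C where "C = T / sqrt 2"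
  have C: "0 < C" using T_pos by (simp add: C_def)
  obtain v where v: "v \<in> H11_term \<Omega> T" "(L2norm M w)\<^sup>2 + (norm11 \<Omega> T v)\<^sup>2 \<le> 2 * C * wave_form \<Omega> T w v"
    using wave_form_inf_sup[OF w] unfolding C_def by blast
  have "2 * C * wave_form \<Omega> T w v \<le> 2 * C * (K * norm11 \<Omega> T v)"
    using K(2)[OF v(1)] C by (intro mult_left_mono) auto
  moreover have "0 \<le> (C * K - norm11 \<Omega> T v)\<^sup>2" by simp
  ultimately have "(L2norm M w)\<^sup>2 \<le> (C * K)\<^sup>2"
    using v(2) by (simp add: power2_diff mult_ac)
  then show ?thesis unfolding C_def[symmetric] by (rule power2_le_imp_le) (use C K(1) in simp)
qed

text \<open>Reversed in time, v becomes an admissible w whose functional is zero, so the estimate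
  with K = 0 makes it vanish almost everywhere. Its weak derivatives, and with them its energy norm,
  are then zero.\<close>

lemma adjoint_unique:
  assumes v: "v \<in> H11_term \<Omega> T" and orth: "\<And>w. w \<in> H11_init \<Omega> T \<Longrightarrow> wave_form \<Omega> T w v = 0"
  shows "norm11 \<Omega> T v = 0"
proof -
  have vH: "v \<in> H1 (Q \<Omega> T)" by (rule H11_term_H1[OF v])
  have "L2norm M (rfl T v) \<le> T / sqrt 2 * 0"
  proof (rule inf_sup_bound[OF H11_init_rfl[OF v]])
    fix u assume u: "u \<in> H11_term \<Omega> T"
    have "wave_form \<Omega> T (rfl T v) u = wave_form \<Omega> T (rfl T v) (rfl T (rfl T u))" by simp
    also have "\<dots> = wave_form \<Omega> T (rfl T u) v"
      using wave_form_rfl[OF vH H1_rfl[OF H11_term_H1[OF u]]] by (simp add: wave_form_commute)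
    also have "\<dots> = 0" by (rule orth[OF H11_init_rfl[OF u]])
    finally show "\<bar>wave_form \<Omega> T (rfl T v) u\<bar> \<le> 0 * norm11 \<Omega> T u" by simp
  qed simp
  then have "L2norm M (rfl T v) = 0" by (simp add: order.antisym)
  then have "AE z in M. rfl T v z = 0" using L2norm_zero_iff[OF rfl_L2[OF H1_L2[OF vH]]] by simp
  from AE_M_reflection[OF this] have v0: "AE z in M. v z = 0" by (simp add: rfl_def)
  have "is_wderiv (Q \<Omega> T) b v (\<lambda>z. 0)" if b: "b \<in> Basis" for b
  proof (rule is_wderiv_AE_cong[of _ _ "\<lambda>z. 0" "\<lambda>z. 0"])
    show "is_wderiv (Q \<Omega> T) b (\<lambda>z. 0) (\<lambda>z. 0)" by (simp add: is_wderiv_def)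
    show "AE z in M. 0 = v z" using v0 by (rule eventually_mono) simp
  qed (use b open_Q L2_measurable[OF H1_L2[OF vH]] in auto)
  from ip11_self_eq[OF vH this] show ?thesis
    by (simp add: norm11_sqrt_ip11 L2norm_def)
qed

lemma wave_form_representer:
  assumes w: "w \<in> H1 (Q \<Omega> T)"
  shows "\<exists>x\<in>H11_term \<Omega> T. \<forall>v\<in>H11_term \<Omega> T. ip11 x v = wave_form \<Omega> T w v"
proof -
  interpret X: hilbert_functions "H11_term \<Omega> T" ip11 by (rule hilbert_H11_term)
  obtain K where K: "\<And>v. v \<in> H1 (Q \<Omega> T) \<Longrightarrow> \<bar>wave_form \<Omega> T w v\<bar> \<le> K * norm11 \<Omega> T v"
    using wave_form_bounded[OF w] by blast
  show ?thesis
  proof (rule X.Riesz)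
    show "wave_form \<Omega> T w (\<lambda>z. a * u z + b * v z) = a * wave_form \<Omega> T w u + b * wave_form \<Omega> T w v"
      if "u \<in> H11_term \<Omega> T" "v \<in> H11_term \<Omega> T" for u v a b
      by (intro wave_form_lincomb_right H11_term_H1 that w)
    show "\<bar>wave_form \<Omega> T w u\<bar> \<le> K * sqrt (ip11 u u)" if "u \<in> H11_term \<Omega> T" for u
      using K[OF H11_term_H1[OF that]] by (simp add: norm11_sqrt_ip11)
    show "H11_term \<Omega> T \<noteq> {}" using H11_term_zero by blast
  qed
qed

text \<open>Pairs \<open>(x, c)\<close> in which \<open>x\<close> represents the functional \<open>wave_form w\<close> for some \<open>w\<close> with zero initial value
  related to \<open>c\<close> by \<open>P\<close>.  Quantifying over all representers avoids choosing one, which would not be linear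
  on the nose.\<close>

definition wave_graph :: "(('a \<times> real \<Rightarrow> real) \<Rightarrow> ('a \<times> real \<Rightarrow> real) \<Rightarrow> real \<Rightarrow> bool) \<Rightarrow> (('a \<times> real \<Rightarrow> real) \<times> real) set" where
  "wave_graph P = {(x, c). x \<in> H11_term \<Omega> T \<and>
    (\<exists>w\<in>H11_init \<Omega> T. (\<forall>v\<in>H11_term \<Omega> T. ip11 x v = wave_form \<Omega> T w v) \<and> P x w c)}"

text \<open>Shared by two applications: c may be prescribed through w, which leads to solutions of
  the adjoint problem, or through x, which leads to a projection onto the closure of the
  range.\<close>

lemma representation_wave_graph:
  assumes lin: "\<And>x w c x' w' c' a b. \<lbrakk>x \<in> H11_term \<Omega> T; w \<in> H11_init \<Omega> T; x' \<in> H11_term \<Omega> T; w' \<in> H11_init \<Omega> T; P x w c; P x' w' c'\<rbrakk>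
      \<Longrightarrow> P (\<lambda>z. a * x z + b * x' z) (\<lambda>z. a * w z + b * w' z) (a * c + b * c')"
    and zero: "P (\<lambda>z. 0) (\<lambda>z. 0) 0"
    and bound: "\<And>x c. (x, c) \<in> wave_graph P \<Longrightarrow> \<bar>c\<bar> \<le> K * norm11 \<Omega> T x"
  shows "\<exists>x\<in>H11_term \<Omega> T. (\<exists>s. (\<forall>n. \<exists>c. (s n, c) \<in> wave_graph P) \<and> (\<lambda>n. ip11 (\<lambda>z. s n z - x z) (\<lambda>z. s n z - x z)) \<longlonglongrightarrow> 0) \<and>
    (\<forall>(y, c)\<in>wave_graph P. ip11 x y = c)"
proof -
  interpret X: hilbert_functions "H11_term \<Omega> T" ip11 by (rule hilbert_H11_term)
  show ?thesis
  proof (rule X.representation)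
    show "y \<in> H11_term \<Omega> T" if "(y, c) \<in> wave_graph P" for y c using that by (simp add: wave_graph_def)
    have "ip11 (\<lambda>z. 0) v = wave_form \<Omega> T (\<lambda>z. 0) v" if "v \<in> H11_term \<Omega> T" for v
      using ip11_lincomb[OF H11_term_H1[OF H11_term_zero] H11_term_H1[OF H11_term_zero] H11_term_H1[OF that], of 0 0]
        wave_form_lincomb[OF H11_term_H1[OF H11_term_zero] H11_term_H1[OF H11_term_zero] H11_term_H1[OF that], of 0 0] by simp
    then have "(\<lambda>z. 0, 0) \<in> wave_graph P"
      using H11_term_zero H11_init_zero zero by (auto simp: wave_graph_def)
    then show "wave_graph P \<noteq> {}" by blast
    show "\<bar>c\<bar> \<le> K * sqrt (ip11 y y)" if "(y, c) \<in> wave_graph P" for y c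
      using bound[OF that] by (simp add: norm11_sqrt_ip11)
    fix y c y' c' a b assume "(y, c) \<in> wave_graph P" "(y', c') \<in> wave_graph P"
    then obtain w w' where *: "y \<in> H11_term \<Omega> T" "y' \<in> H11_term \<Omega> T" "w \<in> H11_init \<Omega> T" "w' \<in> H11_init \<Omega> T"
      "P y w c" "P y' w' c'"
      "\<And>v. v \<in> H11_term \<Omega> T \<Longrightarrow> ip11 y v = wave_form \<Omega> T w v" "\<And>v. v \<in> H11_term \<Omega> T \<Longrightarrow> ip11 y' v = wave_form \<Omega> T w' v"
      by (auto simp: wave_graph_def)
    have "ip11 (\<lambda>z. a * y z + b * y' z) v = wave_form \<Omega> T (\<lambda>z. a * w z + b * w' z) v" if "v \<in> H11_term \<Omega> T" for v
      using * that by (simp add: ip11_lincomb wave_form_lincomb H11_term_H1 H11_init_H1)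
    moreover have "P (\<lambda>z. a * y z + b * y' z) (\<lambda>z. a * w z + b * w' z) (a * c + b * c')"
      by (rule lin) (use * in auto)
    ultimately show "(\<lambda>z. a * y z + b * y' z, a * c + b * c') \<in> wave_graph P"
      using H11_term_lincomb[OF *(1,2), of a b] H11_init_lincomb[OF *(3,4), of a b]
      unfolding wave_graph_def by blast
  qed
qed

text \<open>Sending the representer x of the functional of w to the integral of w g is bounded,
  because the estimate controls the norm of w by that of x. The vector representing this map solves
  the adjoint problem with right-hand side g.\<close>

lemma adjoint_solution:
  assumes g: "L2 M g"
  shows "\<exists>v\<in>H11_term \<Omega> T. \<forall>w\<in>H11_init \<Omega> T. wave_form \<Omega> T w v = (\<integral>z. w z * g z \<partial>M)"
proof -
  interpret X: hilbert_functions "H11_term \<Omega> T" ip11 by (rule hilbert_H11_term)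
  define P where "P = (\<lambda>(x :: 'a \<times> real \<Rightarrow> real) w c. c = (\<integral>z. w z * g z \<partial>M))"
  have "\<exists>x\<in>H11_term \<Omega> T. (\<exists>s. (\<forall>n. \<exists>c. (s n, c) \<in> wave_graph P) \<and> (\<lambda>n. ip11 (\<lambda>z. s n z - x z) (\<lambda>z. s n z - x z)) \<longlonglongrightarrow> 0) \<and>
    (\<forall>(y, c)\<in>wave_graph P. ip11 x y = c)"
  proof (rule representation_wave_graph)
    show "P (\<lambda>z. a * x z + b * x' z) (\<lambda>z. a * w z + b * w' z) (a * c + b * c')"
      if "w \<in> H11_init \<Omega> T" "w' \<in> H11_init \<Omega> T" "P x w c" "P x' w' c'" for x w c x' w' c' a b
      using that L2_integral_lincomb_mult[OF H1_L2[OF H11_init_H1[OF that(1)]] H1_L2[OF H11_init_H1[OF that(2)]] g, of a b]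
      by (simp add: P_def)
    show "P (\<lambda>z. 0) (\<lambda>z. 0) 0" by (simp add: P_def)
    fix x c assume "(x, c) \<in> wave_graph P"
    then obtain w where w: "x \<in> H11_term \<Omega> T" "w \<in> H11_init \<Omega> T" "c = (\<integral>z. w z * g z \<partial>M)"
      "\<And>v. v \<in> H11_term \<Omega> T \<Longrightarrow> ip11 x v = wave_form \<Omega> T w v"
      by (auto simp: wave_graph_def P_def)
    have "\<bar>c\<bar> \<le> L2norm M w * L2norm M g"
      unfolding w(3) by (rule L2_Cauchy_Schwarz[OF H1_L2[OF H11_init_H1[OF w(2)]] g])
    also have "\<dots> \<le> (T / sqrt 2 * norm11 \<Omega> T x) * L2norm M g"
    proof (intro mult_right_mono inf_sup_bound[OF w(2)])
      fix v assume "v \<in> H11_term \<Omega> T"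
      then show "\<bar>wave_form \<Omega> T w v\<bar> \<le> norm11 \<Omega> T x * norm11 \<Omega> T v"
        using X.Cauchy_Schwarz[OF w(1)] w(4) by (simp add: norm11_sqrt_ip11)
    qed simp_all
    finally show "\<bar>c\<bar> \<le> (T / sqrt 2 * L2norm M g) * norm11 \<Omega> T x" by (simp add: mult_ac)
  qed
  then obtain x where x1: "x \<in> H11_term \<Omega> T" and x2: "\<forall>(y, c)\<in>wave_graph P. ip11 x y = c" by blast
  have x: "x \<in> H11_term \<Omega> T" "\<And>y c. (y, c) \<in> wave_graph P \<Longrightarrow> ip11 x y = c" using x1 x2 by auto
  show ?thesis
  proof (rule bexI[OF _ x(1)], rule ballI)
    fix w assume w: "w \<in> H11_init \<Omega> T"
    obtain y where y: "y \<in> H11_term \<Omega> T" "\<forall>v\<in>H11_term \<Omega> T. ip11 y v = wave_form \<Omega> T w v"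
      using wave_form_representer[OF H11_init_H1[OF w]] by blast
    have "(y, \<integral>z. w z * g z \<partial>M) \<in> wave_graph P" using y w by (auto simp: wave_graph_def P_def)
    from x(2)[OF this] show "wave_form \<Omega> T w x = (\<integral>z. w z * g z \<partial>M)"
      using y x(1) X.ip_commute[OF x(1) y(1)] by simp
  qed
qed

text \<open>The representer r of F is projected onto the closure of the representers of wave
  functionals. The remainder is annihilated by every wave functional, so it is null by
  \<open>adjoint_unique\<close>; the sequence approximating the projection then approximates F in
  the dual norm, with error e.\<close>

lemma dense_range:
  assumes F: "F \<in> dual (H11_term \<Omega> T) (norm11 \<Omega> T)"
  shows "\<exists>U e. (\<forall>n. U n \<in> H11_init \<Omega> T) \<and> e \<longlonglongrightarrow> 0 \<and> (\<forall>n::nat. 0 \<le> e n) \<and>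
    (\<forall>n. \<forall>v\<in>H11_term \<Omega> T. \<bar>wave_form \<Omega> T (U n) v - F v\<bar> \<le> e n * norm11 \<Omega> T v)"
proof -
  interpret X: hilbert_functions "H11_term \<Omega> T" ip11 by (rule hilbert_H11_term)
  obtain K where Flin: "\<And>u v a b. u \<in> H11_term \<Omega> T \<Longrightarrow> v \<in> H11_term \<Omega> T \<Longrightarrow> F (\<lambda>z. a * u z + b * v z) = a * F u + b * F v"
    and K: "\<And>v. v \<in> H11_term \<Omega> T \<Longrightarrow> \<bar>F v\<bar> \<le> K * norm11 \<Omega> T v"
    using F unfolding dual_def by blast
  have "\<exists>r\<in>H11_term \<Omega> T. \<forall>v\<in>H11_term \<Omega> T. ip11 r v = F v"
    by (rule X.Riesz[OF Flin]) (use K H11_term_zero in \<open>auto simp: norm11_sqrt_ip11\<close>)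
  then obtain r where r: "r \<in> H11_term \<Omega> T" "\<And>v. v \<in> H11_term \<Omega> T \<Longrightarrow> ip11 r v = F v" by blast
  \<comment> \<open>With c the inner product of x with r, the vector produced by
    \<open>representation_wave_graph\<close> is the orthogonal projection of r onto the closure of
    the subspace.\<close>
  define P where "P = (\<lambda>x (w :: 'a \<times> real \<Rightarrow> real) c. c = ip11 r x)"
  have "\<exists>x\<in>H11_term \<Omega> T. (\<exists>s. (\<forall>n. \<exists>c. (s n, c) \<in> wave_graph P) \<and> (\<lambda>n. ip11 (\<lambda>z. s n z - x z) (\<lambda>z. s n z - x z)) \<longlonglongrightarrow> 0) \<and>
    (\<forall>(y, c)\<in>wave_graph P. ip11 x y = c)"
  proof (rule representation_wave_graph)
    show "P (\<lambda>z. a * x z + b * x' z) (\<lambda>z. a * w z + b * w' z) (a * c + b * c')"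
      if "x \<in> H11_term \<Omega> T" "x' \<in> H11_term \<Omega> T" "P x w c" "P x' w' c'" for x w c x' w' c' a b
      using that Flin[OF that(1,2), of a b] r(2) H11_term_lincomb[OF that(1,2), of a b] by (simp add: P_def)
    show "P (\<lambda>z. 0) (\<lambda>z. 0) 0"
      using r(2)[OF H11_term_zero] K[OF H11_term_zero] Flin[OF H11_term_zero H11_term_zero, of 0 0] by (simp add: P_def)
    fix x c assume "(x, c) \<in> wave_graph P"
    then show "\<bar>c\<bar> \<le> K * norm11 \<Omega> T x" using r(2) K by (auto simp: wave_graph_def P_def)
  qed
  then obtain x s where x1: "x \<in> H11_term \<Omega> T" and x2: "\<forall>(y, c)\<in>wave_graph P. ip11 x y = c"
    and s: "\<And>n. \<exists>c. (s n, c) \<in> wave_graph P"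
    and lim: "(\<lambda>n. ip11 (\<lambda>z. s n z - x z) (\<lambda>z. s n z - x z)) \<longlonglongrightarrow> 0" by blast
  have x: "x \<in> H11_term \<Omega> T" "\<And>y c. (y, c) \<in> wave_graph P \<Longrightarrow> ip11 x y = c" using x1 x2 by auto
  have rx: "(\<lambda>z. r z - x z) \<in> H11_term \<Omega> T" by (rule X.diff_mem[OF r(1) x(1)])
  have "norm11 \<Omega> T (\<lambda>z. r z - x z) = 0"
  proof (rule adjoint_unique[OF rx])
    fix w assume w: "w \<in> H11_init \<Omega> T"
    obtain y where y: "y \<in> H11_term \<Omega> T" "\<forall>v\<in>H11_term \<Omega> T. ip11 y v = wave_form \<Omega> T w v"
      using wave_form_representer[OF H11_init_H1[OF w]] by blast
    have "(y, ip11 r y) \<in> wave_graph P" using y w by (auto simp: wave_graph_def P_def)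
    then have "ip11 (\<lambda>z. r z - x z) y = 0" using x(2) X.ip_diff[OF r(1) x(1) y(1)] by simp
    then show "wave_form \<Omega> T w (\<lambda>z. r z - x z) = 0" using y rx X.ip_commute[OF rx y(1)] by simp
  qed
  then have rx0: "ip11 (\<lambda>z. r z - x z) (\<lambda>z. r z - x z) = 0"
    using X.ip_nonneg[OF rx] by (simp add: norm11_sqrt_ip11)
  have "\<forall>n. \<exists>w. w \<in> H11_init \<Omega> T \<and> s n \<in> H11_term \<Omega> T \<and> (\<forall>v\<in>H11_term \<Omega> T. ip11 (s n) v = wave_form \<Omega> T w v)"
    using s by (fastforce simp: wave_graph_def)
  then obtain U where U: "\<And>n. U n \<in> H11_init \<Omega> T" "\<And>n. s n \<in> H11_term \<Omega> T"
    "\<And>n v. v \<in> H11_term \<Omega> T \<Longrightarrow> ip11 (s n) v = wave_form \<Omega> T (U n) v" by metis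
  define e where "e n = sqrt (ip11 (\<lambda>z. s n z - x z) (\<lambda>z. s n z - x z))" for n
  have "e \<longlonglongrightarrow> sqrt 0" unfolding e_def[abs_def] by (intro tendsto_real_sqrt lim)
  then have elim: "e \<longlonglongrightarrow> 0" by simp
  have e0: "0 \<le> e n" for n unfolding e_def by (intro real_sqrt_ge_zero X.ip_nonneg X.diff_mem U x(1))
  have "\<bar>wave_form \<Omega> T (U n) v - F v\<bar> \<le> e n * norm11 \<Omega> T v" if v: "v \<in> H11_term \<Omega> T" for n v
  proof -
    have "\<bar>ip11 (\<lambda>z. r z - x z) v\<bar> \<le> 0" using X.Cauchy_Schwarz[OF rx v] rx0 by simp
    then have "ip11 r v = ip11 x v" using X.ip_diff[OF r(1) x(1) v] by simp
    then have "wave_form \<Omega> T (U n) v - F v = ip11 (\<lambda>z. s n z - x z) v"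
      using U(3)[OF v] r(2)[OF v] X.ip_diff[OF U(2) x(1) v] by simp
    then show ?thesis using X.Cauchy_Schwarz[OF X.diff_mem[OF U(2) x(1)] v] by (simp add: e_def norm11_sqrt_ip11)
  qed
  with U(1) elim e0 show ?thesis by blast
qed

end

section \<open>The wave operator on the extended cylinder\<close>

text \<open>Boundedness of f makes the supremum a genuine one, and the given element of S provides
  the nonempty set without which its value would be unspecified.\<close>

lemma dual_bound:
  assumes f: "f \<in> dual S nrm" and v: "v \<in> S" and nn: "\<And>v. v \<in> S \<Longrightarrow> 0 \<le> nrm v"
  shows "\<bar>f v\<bar> \<le> dual_norm S nrm f * nrm v" "0 \<le> dual_norm S nrm f"
proof -
  obtain C where C: "\<And>v. v \<in> S \<Longrightarrow> \<bar>f v\<bar> \<le> C * nrm v" using f unfolding dual_def by blast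
  have bdd: "bdd_above {\<bar>f v\<bar> / nrm v | v. v \<in> S}"
  proof (rule bdd_aboveI)
    fix x assume "x \<in> {\<bar>f v\<bar> / nrm v | v. v \<in> S}"
    then obtain v where v: "v \<in> S" "x = \<bar>f v\<bar> / nrm v" by blast
    show "x \<le> \<bar>C\<bar>"
    proof (cases "nrm v = 0")
      case False
      then have "0 < nrm v" using nn[OF v(1)] by simp
      then have "x \<le> C" using C[OF v(1)] by (simp add: v(2) divide_le_eq)
      then show ?thesis by simp
    qed (simp add: v(2))
  qed
  have le: "\<bar>f v\<bar> / nrm v \<le> dual_norm S nrm f"
    unfolding dual_norm_def by (rule cSup_upper[OF _ bdd]) (use v in blast)
  have "0 \<le> \<bar>f v\<bar> / nrm v" using nn[OF v] by simp
  with le show "0 \<le> dual_norm S nrm f" by simp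
  show "\<bar>f v\<bar> \<le> dual_norm S nrm f * nrm v"
  \<comment> \<open>The quotient is then 0/0 = 0 and carries no information on f v; boundedness of f
    forces f v = 0.\<close>
  proof (cases "nrm v = 0")
    case True
    then show ?thesis using C[OF v] by simp
  next
    case False
    then have "0 < nrm v" using nn[OF v] by simp
    then show ?thesis using le by (simp add: divide_le_eq)
  qed
qed

context cylinder
begin

lemma open_Qminus: "open (Qminus \<Omega> T)"
  unfolding Qminus_def by (intro open_Times open_\<Omega> open_greaterThanLessThan)

lemma Q_subset_Qminus: "Q \<Omega> T \<subseteq> Qminus \<Omega> T"
  using T_pos by (auto simp: Q_def Qminus_def)

lemma test_fun_Qminus_lateral: "test_fun (Qminus \<Omega> T) \<phi> \<Longrightarrow> test_fun (\<Omega> \<times> UNIV) \<phi>"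
  by (rule test_fun_mono) (auto simp: Qminus_def)

text \<open>A test function on the extended cylinder vanishes at t = T but in general not at t = 0,
  so it is the backward integral that recovers it.\<close>

lemma bwd_pd_time:
  assumes t: "test_fun (Qminus \<Omega> T) \<phi>" and z: "z \<in> Q \<Omega> T"
  shows "bwd (pd (0, 1) \<phi>) z = - \<phi> z"
proof -
  obtain x r where zx: "z = (x, r)" by (cases z)
  have r: "0 < r" "r < T" "x \<in> \<Omega>" using z by (auto simp: zx Q_def)
  have t': "test_fun (Qminus \<Omega> T) (pd (0, 1) \<phi>)" by (rule test_fun_pd[OF t Basis_time])
  have s: "smooth \<phi>" by (rule test_fun_smooth[OF t])
  have contU: "continuous_on UNIV (\<lambda>s. pd (0, 1) \<phi> (x, s))"
    by (intro continuous_on_compose2[OF smooth_continuous[OF test_fun_smooth[OF t'], of UNIV]] continuous_intros) auto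
  then have cont: "isCont (\<lambda>s. pd (0, 1) \<phi> (x, s)) u" for u by (simp add: continuous_on_eq_continuous_at)
  have "(\<integral>s. pd (0, 1) \<phi> (x, s) * indicator {r..T} s \<partial>lborel) = \<phi> (x, T) - \<phi> (x, r)"
    using r by (intro integral_FTC_Icc_real has_derivative_time_section s cont) auto
  moreover have "\<phi> (x, T) = 0"
    by (rule test_fun_outside[OF t]) (simp add: Qminus_def)
  moreover have "bwd (pd (0, 1) \<phi>) (x, r) = (\<integral>s. pd (0, 1) \<phi> (x, s) * indicator {r..T} s \<partial>lborel)"
    unfolding bwd_Pair
  proof (rule integral_cong_AE)
    have m: "(\<lambda>s. pd (0, 1) \<phi> (x, s)) \<in> borel_measurable borel" by (rule borel_measurable_continuous_onI[OF contU])
    note m[measurable]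
    have "(\<lambda>s. ext (pd (0, 1) \<phi>) (x, s)) = (\<lambda>s. indicator {0<..<T} s * pd (0, 1) \<phi> (x, s))"
      using r(3) by (auto simp: ext_def Q_def indicator_def)
    then have [measurable]: "(\<lambda>s. ext (pd (0, 1) \<phi>) (x, s)) \<in> borel_measurable borel" by simp
    show "(\<lambda>s. if r < s then ext (pd (0, 1) \<phi>) (x, s) else 0) \<in> borel_measurable lborel" by measurable
    show "(\<lambda>s. pd (0, 1) \<phi> (x, s) * indicator {r..T} s) \<in> borel_measurable lborel" by measurable
    have "AE s in lborel. s \<noteq> r \<and> s \<noteq> T"
      using AE_lborel_singleton[of r] AE_lborel_singleton[of T] by (rule AE_conjI)
    then show "AE s in lborel. (if r < s then ext (pd (0, 1) \<phi>) (x, s) else 0) = pd (0, 1) \<phi> (x, s) * indicator {r..T} s"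
      by (rule eventually_mono) (use r in \<open>auto simp: ext_def Q_def indicator_def\<close>)
  qed
  ultimately show ?thesis by (simp add: zx)
qed

lemma test_fun_wderiv:
  assumes "test_fun (Qminus \<Omega> T) \<phi>" "b \<in> Basis"
  shows "AE z in M. wderiv (Q \<Omega> T) b \<phi> z = pd b \<phi> z"
  by (rule wderiv_AE_eq[OF open_Q test_fun_H1(2)[OF open_Q assms]])

lemma test_fun_H11_term:
  assumes t: "test_fun (Qminus \<Omega> T) \<phi>"
  shows "\<phi> \<in> H11_term \<Omega> T"
  unfolding H11_term_iff
proof
  show H: "\<phi> \<in> H1 (Q \<Omega> T)" by (rule test_fun_H1(1)[OF open_Q t])
  have "AE z in M. bwd (dt \<Omega> T \<phi>) z = bwd (pd (0, 1) \<phi>) z"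
    by (rule bwd_cong_AE[OF wderiv_L2[OF H Basis_time] test_fun_M_L2[OF test_fun_pd[OF t Basis_time]] test_fun_wderiv[OF t Basis_time]])
  moreover have "AE z in M. bwd (pd (0, 1) \<phi>) z = - \<phi> z"
    by (rule AE_I2) (simp add: bwd_pd_time[OF t] space_restrict_space)
  ultimately show "AE z in M. \<phi> z = - bwd (dt \<Omega> T \<phi>) z" by eventually_elim simp
qed

lemma box_dist_M: "box_dist \<Omega> T u \<phi> = (\<integral>z. u z * Box \<phi> z \<partial>M)"
  unfolding box_dist_def integral_leb[OF open_Qminus] integral_leb[OF open_Q]
  using Q_subset_Qminus by (intro Bochner_Integration.integral_cong) (auto simp: ext0_def indicator_def)

lemma Box_L2:
  assumes t: "test_fun (Qminus \<Omega> T) \<phi>"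
  shows "L2 M (Box \<phi>)"
proof -
  have sum: "L2 M (\<lambda>z. \<Sum>b\<in>B. p b z)" if "finite B" "\<And>b. b \<in> B \<Longrightarrow> L2 M (p b)" for B :: "'a set" and p
    using that by (induction B rule: finite_induct) (auto intro: L2_add)
  show ?thesis
    unfolding Box_def
    by (intro L2_diff sum finite_Basis test_fun_M_L2[where U="Qminus \<Omega> T"] test_fun_pd t Basis_time Basis_space)
qed

text \<open>In time, U is the forward integral of its derivative, and adjointness shifts one
  derivative without a term at t = 0; this is where the initial condition enters. In space, \<phi>
  need not vanish at t = 0, so the lateral form of the weak derivative is used.\<close>

lemma box_dist_init:
  assumes U: "U \<in> H11_init \<Omega> T" and t: "test_fun (Qminus \<Omega> T) \<phi>"
  shows "box_dist \<Omega> T U \<phi> = wave_form \<Omega> T U \<phi>"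
proof -
  have UH: "U \<in> H1 (Q \<Omega> T)" and Ue: "AE z in M. U z = fwd (dt \<Omega> T U) z"
    using U by (auto simp: H11_init_iff)
  have UL: "L2 M U" by (rule H1_L2[OF UH])
  have \<phi>H: "\<phi> \<in> H1 (Q \<Omega> T)" by (rule test_fun_H1(1)[OF open_Q t])
  have pt: "test_fun (Qminus \<Omega> T) (pd (0, 1) \<phi>)" by (rule test_fun_pd[OF t Basis_time])
  have ptt: "test_fun (Qminus \<Omega> T) (pd (0, 1) (pd (0, 1) \<phi>))" by (rule test_fun_pd[OF pt Basis_time])
  have px: "test_fun (Qminus \<Omega> T) (pd (b, 0) \<phi>)" if "b \<in> Basis" for b by (rule test_fun_pd[OF t Basis_space[OF that]])
  have pxx: "test_fun (Qminus \<Omega> T) (pd (b, 0) (pd (b, 0) \<phi>))" if "b \<in> Basis" for b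
    by (rule test_fun_pd[OF px[OF that] Basis_space[OF that]])
  have cong: "(\<integral>z. wderiv (Q \<Omega> T) b U z * pd b \<phi> z \<partial>M) = (\<integral>z. wderiv (Q \<Omega> T) b U z * wderiv (Q \<Omega> T) b \<phi> z \<partial>M)"
    if b: "b \<in> Basis" for b
    using test_fun_wderiv[OF t b]
    by (intro integral_mult_cong_AE wderiv_L2[OF UH b] wderiv_L2[OF \<phi>H b] test_fun_M_L2[OF test_fun_pd[OF t b]])
      (auto elim!: eventually_mono)
  have time: "(\<integral>z. U z * pd (0, 1) (pd (0, 1) \<phi>) z \<partial>M) = - (\<integral>z. dt \<Omega> T U z * pd (0, 1) \<phi> z \<partial>M)"
  proof -
    note DL = wderiv_L2[OF UH Basis_time]
    have "(\<integral>z. U z * pd (0, 1) (pd (0, 1) \<phi>) z \<partial>M) = (\<integral>z. fwd (dt \<Omega> T U) z * pd (0, 1) (pd (0, 1) \<phi>) z \<partial>M)"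
      by (rule integral_mult_cong_AE[OF Ue _ UL fwd_L2(1)[OF DL] test_fun_M_L2[OF ptt] test_fun_M_L2[OF ptt]]) simp
    also have "\<dots> = (\<integral>z. dt \<Omega> T U z * bwd (pd (0, 1) (pd (0, 1) \<phi>)) z \<partial>M)"
      by (rule fwd_bwd_adjoint[OF DL test_fun_M_L2[OF ptt]])
    also have "\<dots> = (\<integral>z. - (dt \<Omega> T U z * pd (0, 1) \<phi> z) \<partial>M)"
      by (intro Bochner_Integration.integral_cong) (auto simp: bwd_pd_time[OF pt] space_restrict_space)
    finally show ?thesis by simp
  qed
  have space: "(\<integral>z. U z * pd (b, 0) (pd (b, 0) \<phi>) z \<partial>M) = - (\<integral>z. dx \<Omega> T b U z * pd (b, 0) \<phi> z \<partial>M)" if b: "b \<in> Basis" for b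
    by (rule is_wderiv_space_lateral[OF b UL is_wderiv_wderiv[OF UH Basis_space[OF b]] test_fun_Qminus_lateral[OF px[OF b]]])
  have int: "integrable M (\<lambda>z. U z * pd (b, 0) (pd (b, 0) \<phi>) z)" if "b \<in> Basis" for b
    by (rule L2_mult_integrable[OF UL test_fun_M_L2[OF pxx[OF that]]])
  have "box_dist \<Omega> T U \<phi> = (\<integral>z. U z * pd (0, 1) (pd (0, 1) \<phi>) z - (\<Sum>b\<in>Basis. U z * pd (b, 0) (pd (b, 0) \<phi>) z) \<partial>M)"
    unfolding box_dist_M Box_def by (simp add: right_diff_distrib sum_distrib_left)
  also have "\<dots> = (\<integral>z. U z * pd (0, 1) (pd (0, 1) \<phi>) z \<partial>M) - (\<Sum>b\<in>Basis. \<integral>z. U z * pd (b, 0) (pd (b, 0) \<phi>) z \<partial>M)"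
    using int L2_mult_integrable[OF UL test_fun_M_L2[OF ptt]] by simp
  also have "\<dots> = wave_form \<Omega> T U \<phi>"
    unfolding wave_form_def time using space cong[OF Basis_time] cong[OF Basis_space] by (simp add: sum_negf)
  finally show ?thesis .
qed

text \<open>The chosen derivatives of u and w may differ as functions, but those of w are weak
  derivatives of u as well.\<close>

lemma norm11_cong_AE:
  assumes u: "u \<in> H1 (Q \<Omega> T)" and w: "w \<in> H1 (Q \<Omega> T)" and eq: "AE z in M. u z = w z"
  shows "norm11 \<Omega> T u = norm11 \<Omega> T w"
proof -
  have "is_wderiv (Q \<Omega> T) b u (wderiv (Q \<Omega> T) b w)" if b: "b \<in> Basis" for b
  proof (rule is_wderiv_AE_cong[OF is_wderiv_wderiv[OF w b]])
    show "AE z in M. w z = u z" using eq by (rule eventually_mono) simp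
  qed (use b open_Q H1_L2[OF u] H1_L2[OF w] wderiv_L2[OF w b] in \<open>auto simp: L2_def\<close>)
  from ip11_self_eq[OF u this] ip11_self_eq[OF w is_wderiv_wderiv[OF w]]
  show ?thesis by (simp add: norm11_sqrt_ip11)
qed

lemma norm11_le_H1norm:
  assumes W: "W \<in> H1 (Qminus \<Omega> T)"
  shows "W \<in> H1 (Q \<Omega> T)" "norm11 \<Omega> T W \<le> H1norm (Qminus \<Omega> T) W"
proof -
  have d: "is_wderiv (Q \<Omega> T) b W (wderiv (Qminus \<Omega> T) b W)" if "b \<in> Basis" for b
    by (rule is_wderiv_mono[OF open_Qminus open_Q Q_subset_Qminus that is_wderiv_wderiv[OF W that]])
  show WH: "W \<in> H1 (Q \<Omega> T)"
    using d L2_leb_mono(1)[OF open_Qminus open_Q Q_subset_Qminus H1_L2[OF W]] by (auto simp: H1_def)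
  have "ip11 W W = (\<Sum>b\<in>Basis. (L2norm M (wderiv (Qminus \<Omega> T) b W))\<^sup>2)" by (rule ip11_self_eq[OF WH d])
  also have "\<dots> \<le> (\<Sum>b\<in>Basis. (L2norm (leb (Qminus \<Omega> T)) (wderiv (Qminus \<Omega> T) b W))\<^sup>2)"
    by (intro sum_mono power_mono L2_leb_mono(2)[OF open_Qminus open_Q Q_subset_Qminus] wderiv_L2[OF W]) auto
  also have "\<dots> \<le> (L2norm (leb (Qminus \<Omega> T)) W)\<^sup>2 + (\<Sum>b\<in>Basis. (L2norm (leb (Qminus \<Omega> T)) (wderiv (Qminus \<Omega> T) b W))\<^sup>2)"
    by simp
  finally show "norm11 \<Omega> T W \<le> H1norm (Qminus \<Omega> T) W"
    unfolding norm11_sqrt_ip11 H1norm_def by (rule real_sqrt_le_mono)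
qed

lemma H11_zero_term_subset: "v \<in> H11_zero_term \<Omega> T \<Longrightarrow> v \<in> H11_term \<Omega> T"
  by (simp add: H11_zero_term_def)

text \<open>Makes the supremum in \<open>box_norm\<close> one over a nonempty set.\<close>

lemma H11_zero_term_zero: "(\<lambda>z. 0) \<in> H11_zero_term \<Omega> T"
proof -
  have w: "is_wderiv (Q \<Omega> T) b (\<lambda>z. 0) (\<lambda>z. 0)" for b by (simp add: is_wderiv_def)
  have H: "(\<lambda>z. 0) \<in> H1 (Q \<Omega> T)" by (rule H11_term_H1[OF H11_term_zero])
  have z: "L2norm N (\<lambda>z. 0) = 0" for N by (simp add: L2norm_def)
  have "L2norm M (wderiv (Q \<Omega> T) b (\<lambda>z. 0)) = 0" if "b \<in> Basis" for b
    using L2norm_zero_iff[OF wderiv_L2[OF H that]] wderiv_AE_eq[OF open_Q w] by simp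
  then have "H1norm (Q \<Omega> T) (\<lambda>z. 0) = 0" by (simp add: H1norm_def z)
  then have "(\<lambda>_. 0) \<in> lateral_trace \<Omega> T (\<lambda>z. 0)"
    unfolding lateral_trace_def by (auto simp: z intro!: exI[of _ "\<lambda>m z. 0"])
  then show ?thesis using H11_term_zero by (simp add: H11_zero_term_def)
qed

text \<open>Test functions converging to \<open>E v\<close> in the extended cylinder converge to v
  on Q in the energy norm, in which F is continuous. The pairing thus depends only on v and no
  longer on the extension.\<close>

lemma box_pair_eq:
  assumes E: "extension_operator \<Omega> T E" and F: "F \<in> dual (H11_term \<Omega> T) (norm11 \<Omega> T)"
    and box: "\<And>\<phi>. test_fun (Qminus \<Omega> T) \<phi> \<Longrightarrow> box_dist \<Omega> T u \<phi> = F \<phi>"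
    and v: "v \<in> H11_zero_term \<Omega> T"
  shows "box_pair \<Omega> T u (E v) = F v"
proof -
  have EH: "E v \<in> H10 (Qminus \<Omega> T)" and Ev: "AE z in M. E v z = v z"
    using E v by (auto simp: extension_operator_def)
  have E1: "E v \<in> H1 (Qminus \<Omega> T)" using EH by (simp add: H10_def)
  have vt: "v \<in> H11_term \<Omega> T" by (rule H11_zero_term_subset[OF v])
  obtain C where Flin: "\<And>u v a b. u \<in> H11_term \<Omega> T \<Longrightarrow> v \<in> H11_term \<Omega> T \<Longrightarrow> F (\<lambda>z. a * u z + b * v z) = a * F u + b * F v"
    and C: "\<And>v. v \<in> H11_term \<Omega> T \<Longrightarrow> \<bar>F v\<bar> \<le> C * norm11 \<Omega> T v"
    using F unfolding dual_def by blast
  have lim: "(\<lambda>m. box_dist \<Omega> T u (\<phi> m)) \<longlonglongrightarrow> F v"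
    if t: "\<And>m. test_fun (Qminus \<Omega> T) (\<phi> m)" and c: "(\<lambda>m. H1norm (Qminus \<Omega> T) (\<lambda>z. \<phi> m z - E v z)) \<longlonglongrightarrow> 0" for \<phi>
  proof (rule Lim_null_comparison[THEN LIM_zero_cancel])
    show "(\<lambda>m. \<bar>C\<bar> * H1norm (Qminus \<Omega> T) (\<lambda>z. \<phi> m z - E v z)) \<longlonglongrightarrow> 0"
      by (rule tendsto_mult_right_zero[OF c])
    have "\<bar>box_dist \<Omega> T u (\<phi> m) - F v\<bar> \<le> \<bar>C\<bar> * H1norm (Qminus \<Omega> T) (\<lambda>z. \<phi> m z - E v z)" for m
    proof -
      note \<phi>t = test_fun_H11_term[OF t[of m]]
      have dt': "(\<lambda>z. \<phi> m z - v z) \<in> H11_term \<Omega> T" using H11_term_lincomb[OF \<phi>t vt, of 1 "-1"] by simp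
      have dE: "(\<lambda>z. \<phi> m z - E v z) \<in> H1 (Qminus \<Omega> T)"
        using H1_lincomb[OF open_Qminus test_fun_H1(1)[OF open_Qminus t[of m]] E1, of 1 "-1"] by simp
      have "box_dist \<Omega> T u (\<phi> m) - F v = F (\<lambda>z. \<phi> m z - v z)"
        using Flin[OF \<phi>t vt, of 1 "-1"] box[OF t] by simp
      then have "\<bar>box_dist \<Omega> T u (\<phi> m) - F v\<bar> \<le> C * norm11 \<Omega> T (\<lambda>z. \<phi> m z - v z)" using C[OF dt'] by simp
      also have "\<dots> \<le> \<bar>C\<bar> * norm11 \<Omega> T (\<lambda>z. \<phi> m z - v z)" by (intro mult_right_mono) auto
      also have "norm11 \<Omega> T (\<lambda>z. \<phi> m z - v z) = norm11 \<Omega> T (\<lambda>z. \<phi> m z - E v z)"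
        by (rule norm11_cong_AE[OF H11_term_H1[OF dt'] norm11_le_H1norm(1)[OF dE]])
          (use Ev in \<open>auto elim!: eventually_mono\<close>)
      also have "\<bar>C\<bar> * norm11 \<Omega> T (\<lambda>z. \<phi> m z - E v z) \<le> \<bar>C\<bar> * H1norm (Qminus \<Omega> T) (\<lambda>z. \<phi> m z - E v z)"
        by (intro mult_left_mono norm11_le_H1norm(2)[OF dE]) auto
      finally show ?thesis .
    qed
    then show "\<forall>\<^sub>F m in sequentially. norm (box_dist \<Omega> T u (\<phi> m) - F v) \<le> \<bar>C\<bar> * H1norm (Qminus \<Omega> T) (\<lambda>z. \<phi> m z - E v z)"
      by simp
  qed
  \<comment> \<open>Membership in \<open>H10\<close> supplies at least one approximating sequence;
    without one the description of l would hold for every number.\<close>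
  obtain \<phi>0 where \<phi>0: "\<And>m. test_fun (Qminus \<Omega> T) (\<phi>0 m)" "(\<lambda>m. H1norm (Qminus \<Omega> T) (\<lambda>z. \<phi>0 m z - E v z)) \<longlonglongrightarrow> 0"
    using EH unfolding H10_def by blast
  show ?thesis
    unfolding box_pair_def
  proof (rule the_equality)
    show "\<forall>\<phi>. (\<forall>m. test_fun (Qminus \<Omega> T) (\<phi> m)) \<and> (\<lambda>m. H1norm (Qminus \<Omega> T) (\<lambda>z. \<phi> m z - E v z)) \<longlonglongrightarrow> 0 \<longrightarrow>
        (\<lambda>m. box_dist \<Omega> T u (\<phi> m)) \<longlonglongrightarrow> F v"
      using lim by blast
    fix l assume "\<forall>\<phi>. (\<forall>m. test_fun (Qminus \<Omega> T) (\<phi> m)) \<and> (\<lambda>m. H1norm (Qminus \<Omega> T) (\<lambda>z. \<phi> m z - E v z)) \<longlonglongrightarrow> 0 \<longrightarrow>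
        (\<lambda>m. box_dist \<Omega> T u (\<phi> m)) \<longlonglongrightarrow> l"
    then have "(\<lambda>m. box_dist \<Omega> T u (\<phi>0 m)) \<longlonglongrightarrow> l" using \<phi>0 by blast
    then show "l = F v" using lim[OF \<phi>0] LIMSEQ_unique by blast
  qed
qed

text \<open>\<open>box_norm\<close> is the norm of F restricted to the functions of zero trace, so
  every bound for F on the larger space bounds it.\<close>

lemma box_norm_bounds:
  assumes E: "extension_operator \<Omega> T E" and F: "F \<in> dual (H11_term \<Omega> T) (norm11 \<Omega> T)"
    and box: "\<And>\<phi>. test_fun (Qminus \<Omega> T) \<phi> \<Longrightarrow> box_dist \<Omega> T u \<phi> = F \<phi>"
    and K: "0 \<le> K" "\<And>v. v \<in> H11_term \<Omega> T \<Longrightarrow> \<bar>F v\<bar> \<le> K * norm11 \<Omega> T v"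
  shows "0 \<le> box_norm \<Omega> T E u" "box_norm \<Omega> T E u \<le> K"
proof -
  let ?S = "{\<bar>box_pair \<Omega> T u (E v)\<bar> / norm11 \<Omega> T v | v. v \<in> H11_zero_term \<Omega> T}"
  have le: "x \<le> K" if x: "x \<in> ?S" for x
  proof -
    obtain v where v: "v \<in> H11_zero_term \<Omega> T" "x = \<bar>box_pair \<Omega> T u (E v)\<bar> / norm11 \<Omega> T v" using x by blast
    have "x = \<bar>F v\<bar> / norm11 \<Omega> T v" using v box_pair_eq[OF E F box v(1)] by simp
    also have "\<dots> \<le> K"
    proof (cases "norm11 \<Omega> T v = 0")
      case False
      then have "0 < norm11 \<Omega> T v" using norm11_nonneg[of v] by linarith
      then show ?thesis using K(2)[OF H11_zero_term_subset[OF v(1)]] by (simp add: divide_le_eq)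
    qed (use K in simp)
    finally show ?thesis .
  qed
  have ne: "\<bar>box_pair \<Omega> T u (E (\<lambda>z. 0))\<bar> / norm11 \<Omega> T (\<lambda>z. 0) \<in> ?S" using H11_zero_term_zero by blast
  show "box_norm \<Omega> T E u \<le> K"
    unfolding box_norm_def dual_norm_def by (rule cSup_least) (use ne le in auto)
  have "0 \<le> \<bar>box_pair \<Omega> T u (E (\<lambda>z. 0))\<bar> / norm11 \<Omega> T (\<lambda>z. 0)" by simp
  also have "\<dots> \<le> box_norm \<Omega> T E u"
    unfolding box_norm_def dual_norm_def by (rule cSup_upper[OF ne]) (use le in \<open>auto simp: bdd_above_def\<close>)
  finally show "0 \<le> box_norm \<Omega> T E u" .
qed

section \<open>Existence with the bound, and uniqueness\<close>

lemma L2norm_le_HQ_norm: "L2norm M u \<le> HQ_norm \<Omega> T E u"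
  unfolding HQ_norm_def by (rule real_le_rsqrt) simp

text \<open>The functional belonging to the difference of an approximation and the solution; its
  norm measures the error in \<open>box_norm\<close>.\<close>

lemma wave_form_dual:
  assumes "U \<in> H1 (Q \<Omega> T)" "F \<in> dual (H11_term \<Omega> T) (norm11 \<Omega> T)"
  shows "(\<lambda>v. wave_form \<Omega> T U v - F v) \<in> dual (H11_term \<Omega> T) (norm11 \<Omega> T)"
proof -
  obtain C where Flin: "\<And>u v a b. u \<in> H11_term \<Omega> T \<Longrightarrow> v \<in> H11_term \<Omega> T \<Longrightarrow> F (\<lambda>z. a * u z + b * v z) = a * F u + b * F v"
    and C: "\<And>v. v \<in> H11_term \<Omega> T \<Longrightarrow> \<bar>F v\<bar> \<le> C * norm11 \<Omega> T v"
    using assms(2) unfolding dual_def by blast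
  obtain K where K: "\<And>v. v \<in> H1 (Q \<Omega> T) \<Longrightarrow> \<bar>wave_form \<Omega> T U v\<bar> \<le> K * norm11 \<Omega> T v"
    using wave_form_bounded[OF assms(1)] by blast
  show ?thesis
    unfolding dual_def
  proof (intro CollectI conjI ballI allI exI)
    fix u v a b assume "u \<in> H11_term \<Omega> T" "v \<in> H11_term \<Omega> T"
    then show "wave_form \<Omega> T U (\<lambda>z. a * u z + b * v z) - F (\<lambda>z. a * u z + b * v z)
        = a * (wave_form \<Omega> T U u - F u) + b * (wave_form \<Omega> T U v - F v)"
      using assms(1) by (simp add: wave_form_lincomb_right H11_term_H1 Flin algebra_simps)
  next
    fix v assume v: "v \<in> H11_term \<Omega> T"
    show "\<bar>wave_form \<Omega> T U v - F v\<bar> \<le> (K + C) * norm11 \<Omega> T v"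
      using K[OF H11_term_H1[OF v]] C[OF v] by (simp add: distrib_right)
  qed
qed

text \<open>Convergence of the functionals in the dual norm is used twice: through the inf-sup
  estimate it makes the approximations Cauchy in L2, and it bounds the distributional norm of the
  error directly. Together these give convergence in \<open>HQ\<close>, as membership in
  \<open>HQ_init\<close> requires.\<close>

lemma generalized_solution:
  assumes E: "extension_operator \<Omega> T E" and F: "F \<in> dual (H11_term \<Omega> T) (norm11 \<Omega> T)"
    and K: "0 \<le> K" "\<And>v. v \<in> H11_term \<Omega> T \<Longrightarrow> \<bar>F v\<bar> \<le> K * norm11 \<Omega> T v"
  shows "\<exists>u. u \<in> HQ_init \<Omega> T E \<and> is_ftilde \<Omega> T E u F \<and> HQ_norm \<Omega> T E u \<le> 1 / sqrt 2 * sqrt (2 + T\<^sup>2) * K"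
proof -
  obtain U e where U: "\<And>n. U n \<in> H11_init \<Omega> T" and e: "e \<longlonglongrightarrow> 0" "\<And>n::nat. 0 \<le> e n"
    and Ue: "\<And>n v. v \<in> H11_term \<Omega> T \<Longrightarrow> \<bar>wave_form \<Omega> T (U n) v - F v\<bar> \<le> e n * norm11 \<Omega> T v"
    using dense_range[OF F] by blast
  define C where "C = T / sqrt 2"
  have C: "0 < C" using T_pos by (simp add: C_def)
  have UH: "U n \<in> H1 (Q \<Omega> T)" for n by (rule H11_init_H1[OF U])
  have UL: "L2 M (U n)" for n by (rule H1_L2[OF UH])
  \<comment> \<open>The difference again has zero initial value, and F cancels from its functional,
    which leaves the bound e m + e n.\<close>
  have Cauchy: "L2norm M (\<lambda>z. U m z - U n z) \<le> C * (e m + e n)" for m n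
    unfolding C_def
  proof (rule inf_sup_bound)
    show "(\<lambda>z. U m z - U n z) \<in> H11_init \<Omega> T" using H11_init_lincomb[OF U[of m] U[of n], of 1 "-1"] by simp
    fix v assume v: "v \<in> H11_term \<Omega> T"
    have "wave_form \<Omega> T (\<lambda>z. U m z - U n z) v = wave_form \<Omega> T (U m) v - wave_form \<Omega> T (U n) v"
      using wave_form_lincomb[OF UH[of m] UH[of n] H11_term_H1[OF v], of 1 "-1"] by simp
    then show "\<bar>wave_form \<Omega> T (\<lambda>z. U m z - U n z) v\<bar> \<le> (e m + e n) * norm11 \<Omega> T v"
      using Ue[OF v, of m] Ue[OF v, of n] by (simp add: distrib_right)
  qed (use e(2) in simp)
  have "\<exists>u. L2 M u \<and> (\<lambda>n. L2norm M (\<lambda>z. U n z - u z)) \<longlonglongrightarrow> 0"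
  proof (rule L2_complete[OF finite_M UL])
    fix r :: real assume "0 < r"
    then have "0 < r / (2 * C)" using C by simp
    from LIMSEQ_D[OF e(1) this] obtain N where N: "\<And>n. n \<ge> N \<Longrightarrow> e n < r / (2 * C)" using e(2) by force
    show "\<exists>N. \<forall>m\<ge>N. \<forall>n\<ge>N. L2norm M (\<lambda>z. U m z - U n z) < r"
    proof (intro exI allI impI)
      fix m n assume mn: "m \<ge> N" "n \<ge> N"
      have "C * (e m + e n) < C * (r / (2 * C) + r / (2 * C))"
        using N[OF mn(1)] N[OF mn(2)] C by (intro mult_strict_left_mono add_strict_mono)
      also have "\<dots> = r" using C by simp
      finally show "L2norm M (\<lambda>z. U m z - U n z) < r" using Cauchy[of m n] by linarith
    qed
  qed
  then obtain u where u: "L2 M u" "(\<lambda>n. L2norm M (\<lambda>z. U n z - u z)) \<longlonglongrightarrow> 0" by blast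
  have conv: "(\<lambda>n. wave_form \<Omega> T (U n) v) \<longlonglongrightarrow> F v" if v: "v \<in> H11_term \<Omega> T" for v
  proof (rule Lim_null_comparison[THEN LIM_zero_cancel])
    show "(\<lambda>n. e n * norm11 \<Omega> T v) \<longlonglongrightarrow> 0" by (rule tendsto_mult_left_zero[OF e(1)])
    show "\<forall>\<^sub>F n in sequentially. norm (wave_form \<Omega> T (U n) v - F v) \<le> e n * norm11 \<Omega> T v"
      using Ue[OF v] by simp
  qed
  \<comment> \<open>The two limits come from different sources: L2 convergence on the distributional
    side, convergence of the functionals on the variational side.\<close>
  have box: "box_dist \<Omega> T u \<phi> = F \<phi>" if t: "test_fun (Qminus \<Omega> T) \<phi>" for \<phi>
  proof (rule LIMSEQ_unique)
    show "(\<lambda>n. box_dist \<Omega> T (U n) \<phi>) \<longlonglongrightarrow> box_dist \<Omega> T u \<phi>"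
      unfolding box_dist_M by (rule L2_tendsto_integral_mult[OF UL u(1) Box_L2[OF t] u(2)])
    show "(\<lambda>n. box_dist \<Omega> T (U n) \<phi>) \<longlonglongrightarrow> F \<phi>"
      unfolding box_dist_init[OF U t] by (rule conv[OF test_fun_H11_term[OF t]])
  qed
  have boxn: "box_dist \<Omega> T (\<lambda>z. U n z - u z) \<phi> = wave_form \<Omega> T (U n) \<phi> - F \<phi>" if t: "test_fun (Qminus \<Omega> T) \<phi>" for \<phi> n
    using box_dist_init[OF U t] box[OF t] L2_mult_integrable[OF UL Box_L2[OF t]] L2_mult_integrable[OF u(1) Box_L2[OF t]]
    by (simp add: box_dist_M left_diff_distrib)
  have bn: "0 \<le> box_norm \<Omega> T E (\<lambda>z. U n z - u z)" "box_norm \<Omega> T E (\<lambda>z. U n z - u z) \<le> e n" for n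
    using box_norm_bounds[OF E wave_form_dual[OF UH F] boxn e(2) Ue] by auto
  have approx: "approximates \<Omega> T E U u"
    unfolding approximates_def
  proof (intro conjI allI U)
    have "(\<lambda>n. box_norm \<Omega> T E (\<lambda>z. U n z - u z)) \<longlonglongrightarrow> 0"
      by (rule tendsto_sandwich[OF _ _ tendsto_const e(1)]) (use bn in auto)
    then have "(\<lambda>n. sqrt ((L2norm M (\<lambda>z. U n z - u z))\<^sup>2 + (box_norm \<Omega> T E (\<lambda>z. U n z - u z))\<^sup>2)) \<longlonglongrightarrow> sqrt (0\<^sup>2 + 0\<^sup>2)"
      by (intro tendsto_intros u(2))
    then show "(\<lambda>n. HQ_norm \<Omega> T E (\<lambda>z. U n z - u z)) \<longlonglongrightarrow> 0" by (simp add: HQ_norm_def)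
  qed
  have "u \<in> HQ \<Omega> T"
    unfolding HQ_def
  proof (intro CollectI conjI u exI allI impI)
    fix \<phi> assume t: "test_fun (Qminus \<Omega> T) \<phi>"
    have "\<bar>box_dist \<Omega> T u \<phi>\<bar> \<le> K * norm11 \<Omega> T \<phi>" unfolding box[OF t] by (rule K(2)[OF test_fun_H11_term[OF t]])
    also have "\<dots> \<le> K * H1norm (Qminus \<Omega> T) \<phi>"
      by (intro mult_left_mono norm11_le_H1norm test_fun_H1(1)[OF open_Qminus t] K(1))
    finally show "\<bar>box_dist \<Omega> T u \<phi>\<bar> \<le> K * H1norm (Qminus \<Omega> T) \<phi>" .
  qed
  then have init: "u \<in> HQ_init \<Omega> T E" using approx by (auto simp: HQ_init_def)
  have ft: "is_ftilde \<Omega> T E u F"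
    unfolding is_ftilde_def using F box_pair_eq[OF E F box] approx conv by auto
  \<comment> \<open>The functional of \<open>U n\<close> is bounded by K + e n; the estimate for
    \<open>U n\<close> passes to the limit.\<close>
  have uK: "L2norm M u \<le> C * K"
  proof (rule LIMSEQ_le[OF L2norm_tendsto[OF UL u]])
    have "(\<lambda>n. C * (K + e n)) \<longlonglongrightarrow> C * (K + 0)" by (intro tendsto_intros e(1))
    then show "(\<lambda>n. C * (K + e n)) \<longlonglongrightarrow> C * K" by simp
    have "L2norm M (U n) \<le> C * (K + e n)" for n
      unfolding C_def
    proof (rule inf_sup_bound[OF U])
      fix v assume v: "v \<in> H11_term \<Omega> T"
      show "\<bar>wave_form \<Omega> T (U n) v\<bar> \<le> (K + e n) * norm11 \<Omega> T v"
        using Ue[OF v, of n] K(2)[OF v] by (simp add: distrib_right)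
    qed (use K(1) e(2) in simp)
    then show "\<exists>N. \<forall>n\<ge>N. L2norm M (U n) \<le> C * (K + e n)" by blast
  qed
  have bK: "0 \<le> box_norm \<Omega> T E u" "box_norm \<Omega> T E u \<le> K" using box_norm_bounds[OF E F box K] by auto
  have "(L2norm M u)\<^sup>2 + (box_norm \<Omega> T E u)\<^sup>2 \<le> (C * K)\<^sup>2 + K\<^sup>2"
    using uK bK by (intro add_mono power_mono) auto
  \<comment> \<open>C^2 + 1 = (2 + T^2) / 2 for C = T / sqrt 2.\<close>
  also have "\<dots> = (1 / sqrt 2 * sqrt (2 + T\<^sup>2) * K)\<^sup>2"
    by (simp add: C_def power_mult_distrib power_divide field_simps)
  finally have "HQ_norm \<Omega> T E u \<le> 1 / sqrt 2 * sqrt (2 + T\<^sup>2) * K"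
    unfolding HQ_norm_def by (intro real_le_lsqrt) (use K(1) in auto)
  with init ft show ?thesis by blast
qed

text \<open>The approximating sequences only make the functionals converge weakly; testing with an
  exact adjoint solution is what identifies the \<open>L\<^sup>2\<close> limits.\<close>

lemma generalized_solution_unique:
  assumes u: "u \<in> HQ_init \<Omega> T E" "is_ftilde \<Omega> T E u F" and w: "w \<in> HQ_init \<Omega> T E" "is_ftilde \<Omega> T E w G"
    and eq: "\<And>v. v \<in> H11_term \<Omega> T \<Longrightarrow> F v = G v"
  shows "AE z in M. w z = u z"
proof -
  obtain U where U: "approximates \<Omega> T E U u" "\<And>v. v \<in> H11_term \<Omega> T \<Longrightarrow> (\<lambda>m. wave_form \<Omega> T (U m) v) \<longlonglongrightarrow> F v"
    using u(2) unfolding is_ftilde_def by blast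
  obtain W where W: "approximates \<Omega> T E W w" "\<And>v. v \<in> H11_term \<Omega> T \<Longrightarrow> (\<lambda>m. wave_form \<Omega> T (W m) v) \<longlonglongrightarrow> G v"
    using w(2) unfolding is_ftilde_def by blast
  have uL: "L2 M u" and wL: "L2 M w" using u(1) w(1) by (auto simp: HQ_init_def HQ_def)
  have Ui: "U m \<in> H11_init \<Omega> T" and Wi: "W m \<in> H11_init \<Omega> T" for m using U(1) W(1) by (auto simp: approximates_def)
  have lim: "(\<lambda>m. \<integral>z. p m z * r z \<partial>M) \<longlonglongrightarrow> (\<integral>z. q z * r z \<partial>M)"
    if p: "approximates \<Omega> T E p q" and q: "L2 M q" and r: "L2 M r" for p q r
  proof (rule L2_tendsto_integral_mult[OF _ q r])
    show "L2 M (p m)" for m using p by (auto simp: approximates_def intro: H1_L2 H11_init_H1)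
    show "(\<lambda>m. L2norm M (\<lambda>z. p m z - q z)) \<longlonglongrightarrow> 0"
    proof (rule Lim_null_comparison)
      show "(\<lambda>m. HQ_norm \<Omega> T E (\<lambda>z. p m z - q z)) \<longlonglongrightarrow> 0" using p by (simp add: approximates_def)
      show "\<forall>\<^sub>F m in sequentially. norm (L2norm M (\<lambda>z. p m z - q z)) \<le> HQ_norm \<Omega> T E (\<lambda>z. p m z - q z)"
        using L2norm_le_HQ_norm by simp
    qed
  qed
  define g where "g z = w z - u z" for z
  have gL: "L2 M g" unfolding g_def[abs_def] by (rule L2_diff[OF wL uL])
  \<comment> \<open>The difference g = w - u itself is the right-hand side of the adjoint problem.
    Testing with its solution v evaluates the integrals of u g and w g as F v and G v, which agree,
    so g is orthogonal to itself.\<close>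
  obtain v where v: "v \<in> H11_term \<Omega> T" "\<And>y. y \<in> H11_init \<Omega> T \<Longrightarrow> wave_form \<Omega> T y v = (\<integral>z. y z * g z \<partial>M)"
    using adjoint_solution[OF gL] by blast
  have "(\<integral>z. u z * g z \<partial>M) = F v"
    using lim[OF U(1) uL gL] U(2)[OF v(1)] LIMSEQ_unique unfolding v(2)[OF Ui] by blast
  moreover have "(\<integral>z. w z * g z \<partial>M) = G v"
    using lim[OF W(1) wL gL] W(2)[OF v(1)] LIMSEQ_unique unfolding v(2)[OF Wi] by blast
  moreover have "(\<integral>z. g z * g z \<partial>M) = (\<integral>z. w z * g z \<partial>M) - (\<integral>z. u z * g z \<partial>M)"
    using L2_mult_integrable[OF wL gL] L2_mult_integrable[OF uL gL] by (subst (1) g_def) (simp add: left_diff_distrib)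
  ultimately have "(L2norm M g)\<^sup>2 = 0" using eq[OF v(1)] by (simp add: integral_self_mult)
  then have "AE z in M. g z = 0" using L2norm_zero_iff[OF gL] by simp
  then show ?thesis by (rule eventually_mono) (simp add: g_def)
qed

end

lemma admissible_domain_open_bounded: "admissible_domain \<Omega> \<Longrightarrow> open \<Omega> \<and> bounded \<Omega>"
  by (auto simp: admissible_domain_def bounded_lipschitz_domain_def open_box bounded_box)

theorem mainTheorem7:
  fixes \<Omega> :: "'a::euclidean_space set" and T :: real
    and E :: "('a \<times> real \<Rightarrow> real) \<Rightarrow> 'a \<times> real \<Rightarrow> real"
    and f :: "('a \<times> real \<Rightarrow> real) \<Rightarrow> real"
    and l :: "('a \<times> real \<Rightarrow> real) set \<Rightarrow> real"
  assumes "admissible_domain \<Omega>" and "0 < T"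
    and "extension_operator \<Omega> T E"
    and "f \<in> dual (H11_term \<Omega> T) (norm11 \<Omega> T)"
    and "l \<in> trace_dual \<Omega> T"
  shows "\<exists>u. solves_neumann \<Omega> T E f l u \<and>
    (\<forall>w. solves_neumann \<Omega> T E f l w \<longrightarrow> (AE z in leb (Q \<Omega> T). w z = u z)) \<and>
    HSigma_norm \<Omega> T E (trace_ext \<Omega> T E u) \<le> HQ_norm \<Omega> T E u \<and>
    HQ_norm \<Omega> T E u \<le> 1 / sqrt 2 * sqrt (2 + T\<^sup>2) *
      (dual_norm (H11_term \<Omega> T) (norm11 \<Omega> T) f + trace_dual_norm \<Omega> T l)"
proof -
  interpret cylinder \<Omega> T
    using admissible_domain_open_bounded[OF assms(1)] assms(2) by unfold_locales auto
  \<comment> \<open>The boundary datum becomes a functional on the test space, so that volume and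
    boundary data act as a single F whose norm is at most the sum of theirs.\<close>
  define \<mu> where "\<mu> v = l (lateral_trace \<Omega> T v)" for v
  have \<mu>: "\<mu> \<in> dual (H11_term \<Omega> T) (norm11 \<Omega> T)"
    using assms(5) by (simp add: trace_dual_def \<mu>_def[abs_def])
  define F where "F v = f v + \<mu> v" for v
  define K where "K = dual_norm (H11_term \<Omega> T) (norm11 \<Omega> T) f + dual_norm (H11_term \<Omega> T) (norm11 \<Omega> T) \<mu>"
  have K: "K = dual_norm (H11_term \<Omega> T) (norm11 \<Omega> T) f + trace_dual_norm \<Omega> T l"
    by (simp add: K_def trace_dual_norm_def \<mu>_def[abs_def])
  have K0: "0 \<le> K"
    unfolding K_def by (intro add_nonneg_nonneg dual_bound(2)[OF assms(4) H11_term_zero] dual_bound(2)[OF \<mu> H11_term_zero]) auto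
  have FK: "\<bar>F v\<bar> \<le> K * norm11 \<Omega> T v" if v: "v \<in> H11_term \<Omega> T" for v
    using dual_bound(1)[OF assms(4) v] dual_bound(1)[OF \<mu> v] by (simp add: F_def K_def distrib_right)
  have flin: "f (\<lambda>z. a * v z + b * w z) = a * f v + b * f w" and \<mu>lin: "\<mu> (\<lambda>z. a * v z + b * w z) = a * \<mu> v + b * \<mu> w"
    if "v \<in> H11_term \<Omega> T" "w \<in> H11_term \<Omega> T" for v w a b
    using assms(4) \<mu> that unfolding dual_def by blast+
  have F: "F \<in> dual (H11_term \<Omega> T) (norm11 \<Omega> T)"
    unfolding dual_def
  proof (intro CollectI conjI ballI allI exI)
    show "F (\<lambda>z. a * v z + b * w z) = a * F v + b * F w" if "v \<in> H11_term \<Omega> T" "w \<in> H11_term \<Omega> T" for v w a b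
      using flin[OF that] \<mu>lin[OF that] by (simp add: F_def algebra_simps)
    show "\<bar>F v\<bar> \<le> K * norm11 \<Omega> T v" if "v \<in> H11_term \<Omega> T" for v by (rule FK[OF that])
  qed
  obtain u where u: "u \<in> HQ_init \<Omega> T E" "is_ftilde \<Omega> T E u F"
    and bound: "HQ_norm \<Omega> T E u \<le> 1 / sqrt 2 * sqrt (2 + T\<^sup>2) * K"
    using generalized_solution[OF assms(3) F K0 FK] by blast
  show ?thesis
  proof (intro exI[of _ u] conjI allI impI)
    show "solves_neumann \<Omega> T E f l u"
      unfolding solves_neumann_def using u by (auto simp: F_def \<mu>_def)
    show "AE z in leb (Q \<Omega> T). w z = u z" if sol: "solves_neumann \<Omega> T E f l w" for w
    proof -
      obtain G where G: "w \<in> HQ_init \<Omega> T E" "is_ftilde \<Omega> T E w G" "\<And>v. v \<in> H11_term \<Omega> T \<Longrightarrow> G v = f v + l (lateral_trace \<Omega> T v)"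
        using sol unfolding solves_neumann_def by blast
      show ?thesis by (rule generalized_solution_unique[OF u G(1,2)]) (simp add: G(3) F_def \<mu>_def)
    qed
    \<comment> \<open>The solution u is itself a competitor in the infimum that defines the norm of
      its trace; all competitors have nonnegative norm, so the infimum is a lower bound.\<close>
    show "HSigma_norm \<Omega> T E (trace_ext \<Omega> T E u) \<le> HQ_norm \<Omega> T E u"
      unfolding HSigma_norm_def
    proof (rule cInf_lower)
      show "HQ_norm \<Omega> T E u \<in> {HQ_norm \<Omega> T E V |V. V \<in> HQ_init \<Omega> T E \<and> trace_ext \<Omega> T E V = trace_ext \<Omega> T E u}"
        using u(1) by blast
      show "bdd_below {HQ_norm \<Omega> T E V |V. V \<in> HQ_init \<Omega> T E \<and> trace_ext \<Omega> T E V = trace_ext \<Omega> T E u}"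
        by (rule bdd_belowI[of _ 0]) (auto simp: HQ_norm_def)
    qed
    show "HQ_norm \<Omega> T E u \<le> 1 / sqrt 2 * sqrt (2 + T\<^sup>2) *
      (dual_norm (H11_term \<Omega> T) (norm11 \<Omega> T) f + trace_dual_norm \<Omega> T l)"
      using bound unfolding K .
  qed
qed

end
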